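(* Consider the Schwarzschild exterior of mass $m>0$ with the foliation $\Sigma_\tau=\{t^*=\tau\}$ and the timelike vector field $N=-(dt^* )^\sharp$ described in the context, and let $\gamma:[0,\infty)\to\mathcal{D}(\Sigma_0)$ be the affinely parametrised null geodesic on the photon sphere $\{r=3m\}$ given in $(t,r,\theta,\varphi)$ coordinates by $$\gamma(s)=\Big(s-2m\log m,\;3m,\;\tfrac\pi2,\;(27m^2)^{-\frac12}(s-2m\log m)\Big).$$ Then, given any open neighbourhood $\mathcal{T}$ of $\mathrm{Im}(\gamma)$ in $\mathcal{D}(\Sigma_0)$, there is no function $P:[0,\infty)\to(0,\infty)$ with $P(\tau)\to0$ for $\tau\to\infty$ such that $$E^N_{\tau,\mathcal{T}\cap\Sigma_\tau}(u)\le P(\tau)\,E^N_0(u)$$ holds for all solutions $u$ of the wave equation $\Box_gu=0$ and for all $\tau\ge0$.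
   Context: Schwarzschild exterior: $M=\mathbb{R}\times(2m,\infty)\times\mathbb{S}^2$ with coordinates $(t,r,\theta,\varphi)$ and $g=-(1-\frac{2m}r)dt^2+(1-\frac{2m}r)^{-1}dr^2+r^2d\theta^2+r^2\sin^2\theta\,d\varphi^2$. $t^*=t+2m\log(r-2m)$, $\Sigma_\tau=\{t^*=\tau\}$ (spacelike), $N=-(dt^* )^\sharp$ is timelike and defines the future direction. $\mathcal{D}(\Sigma_0)$ is the domain of dependence of $\Sigma_0$ in $(M,g)$; the wave equation is considered on $\mathcal{D}(\Sigma_0)$, with smooth solutions. Energy. $n_{\Sigma_\tau}$ is the future directed unit normal, $\bar g_\tau$ the induced metric; $\mathbb{T}(u)=\frac12\overline{du}\otimes du+\frac12du\otimes\overline{du}-\frac12g\,g^{-1}(du,\overline{du})$, $J^N(u)=[\mathbb{T}(u)(N,\cdot)]^\sharp$; for $A\subseteq\Sigma_\tau$, $E^N_{\tau,A}(u)=\int_Ag(J^N(u),n_{\Sigma_\tau})\,\mathrm{vol}_{\bar g_\tau}$ and $E^N_\tau(u)=E^N_{\tau,\Sigma_\tau}(u)$. *)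

theory Defs
  imports "HOL-Analysis.Analysis"
begin

section \<open>Smooth functions on open subsets of Euclidean space\<close>

primrec differentiable_times_on ::
  "nat \<Rightarrow> 'a::real_normed_vector set \<Rightarrow> ('a \<Rightarrow> 'b::real_normed_vector) \<Rightarrow> bool" where
  "differentiable_times_on 0 S f \<longleftrightarrow> continuous_on S f"
| "differentiable_times_on (Suc k) S f \<longleftrightarrow>
     (\<forall>x\<in>S. f differentiable (at x)) \<and>
     (\<forall>v. differentiable_times_on k S (\<lambda>x. frechet_derivative f (at x) v))"

definition smooth_on ::
  "'a::real_normed_vector set \<Rightarrow> ('a \<Rightarrow> 'b::real_normed_vector) \<Rightarrow> bool" where
  "smooth_on S f \<longleftrightarrow> (\<forall>k. differentiable_times_on k S f)"

definition pd :: "'n::finite \<Rightarrow> (real^'n \<Rightarrow> 'a::real_normed_vector) \<Rightarrow> real^'n \<Rightarrow> 'a" where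
  "pd i f p = frechet_derivative f (at p) (axis i 1)"

definition differential :: "(real^'n::finite \<Rightarrow> 'a::real_normed_vector) \<Rightarrow> real^'n \<Rightarrow> 'a^'n" where
  "differential f p = (\<chi> i. pd i f p)"


section \<open>Lorentzian geometry in a global chart\<close>

text \<open>
  The manifold is an open subset of \<open>real^'n\<close>, all of whose tangent and cotangent spaces are
  identified with \<open>real^'n\<close>; a metric is the field of its component matrices.
\<close>

type_synonym 'n metric = "real^'n \<Rightarrow> real^'n^'n"

definition ip :: "'n::finite metric \<Rightarrow> real^'n \<Rightarrow> real^'n \<Rightarrow> real^'n \<Rightarrow> real" where
  "ip g p X Y = (\<Sum>i\<in>UNIV. \<Sum>j\<in>UNIV. g p $ i $ j * X $ i * Y $ j)"

definition inverse_metric :: "'n::finite metric \<Rightarrow> 'n metric" where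
  "inverse_metric g p = matrix_inv (g p)"

definition sharp :: "'n::finite metric \<Rightarrow> real^'n \<Rightarrow> real^'n \<Rightarrow> real^'n" where
  "sharp g p \<omega> = inverse_metric g p *v \<omega>"

definition christoffel :: "'n::finite metric \<Rightarrow> 'n \<Rightarrow> 'n \<Rightarrow> 'n \<Rightarrow> real^'n \<Rightarrow> real" where
  "christoffel g k i j p = (\<Sum>l\<in>UNIV. inverse_metric g p $ k $ l *
     (pd i (\<lambda>q. g q $ j $ l) p + pd j (\<lambda>q. g q $ i $ l) p - pd l (\<lambda>q. g q $ i $ j) p)) / 2"

text \<open>The wave operator as the metric trace of the Hessian of the Levi-Civita connection.\<close>

definition wave_op :: "'n::finite metric \<Rightarrow> (real^'n \<Rightarrow> complex) \<Rightarrow> real^'n \<Rightarrow> complex" where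
  "wave_op g u p = (\<Sum>i\<in>UNIV. \<Sum>j\<in>UNIV. inverse_metric g p $ i $ j *\<^sub>R
     (pd i (pd j u) p - (\<Sum>k\<in>UNIV. christoffel g k i j p *\<^sub>R pd k u p)))"

text \<open>
  The time orientation is given by a timelike vector field \<open>N\<close>; the signature is
  \<open>(-,+,\<dots>,+)\<close>.
\<close>

definition future_causal ::
  "'n::finite metric \<Rightarrow> (real^'n \<Rightarrow> real^'n) \<Rightarrow> real^'n \<Rightarrow> real^'n \<Rightarrow> bool" where
  "future_causal g N p X \<longleftrightarrow> X \<noteq> 0 \<and> ip g p X X \<le> 0 \<and> ip g p (N p) X < 0"

text \<open>
  Piecewise \<open>C\<^sup>1\<close> curves starting at \<open>p\<close>, defined on a half-open interval which is reparametrised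
  to \<open>[0,\<infty>)\<close>. The sequence \<open>a\<close> contains the break points, and the derivative on each closed
  piece (one-sided at its ends) is causal and, depending on \<open>\<sigma> = 1\<close> or \<open>\<sigma> = -1\<close>, future or
  past directed. Inextendible means that the curve has no end point in \<open>M\<close>.
\<close>

definition inextendible_causal_curve_from ::
  "(real^'n::finite) set \<Rightarrow> 'n metric \<Rightarrow> (real^'n \<Rightarrow> real^'n) \<Rightarrow> real \<Rightarrow>
   real^'n \<Rightarrow> (real \<Rightarrow> real^'n) \<Rightarrow> bool" where
  "inextendible_causal_curve_from M g N \<sigma> p c \<longleftrightarrow>
     c 0 = p \<and> c ` {0..} \<subseteq> M \<and>
     (\<exists>a :: nat \<Rightarrow> real. a 0 = 0 \<and> strict_mono a \<and> filterlim a at_top sequentially \<and>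
        (\<forall>k. \<exists>c'. continuous_on {a k..a (Suc k)} c' \<and>
           (\<forall>s\<in>{a k..a (Suc k)}.
              (c has_vector_derivative c' s) (at s within {a k..a (Suc k)}) \<and>
              future_causal g N (c s) (\<sigma> *\<^sub>R c' s)))) \<and>
     \<not> (\<exists>q\<in>M. (c \<longlongrightarrow> q) at_top)"

definition future_domain_of_dependence ::
  "(real^'n::finite) set \<Rightarrow> 'n metric \<Rightarrow> (real^'n \<Rightarrow> real^'n) \<Rightarrow> (real^'n) set \<Rightarrow> (real^'n) set" where
  "future_domain_of_dependence M g N S =
     {p \<in> M. \<forall>c. inextendible_causal_curve_from M g N (-1) p c \<longrightarrow> c ` {0..} \<inter> S \<noteq> {}}"

definition past_domain_of_dependence ::
  "(real^'n::finite) set \<Rightarrow> 'n metric \<Rightarrow> (real^'n \<Rightarrow> real^'n) \<Rightarrow> (real^'n) set \<Rightarrow> (real^'n) set" where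
  "past_domain_of_dependence M g N S =
     {p \<in> M. \<forall>c. inextendible_causal_curve_from M g N 1 p c \<longrightarrow> c ` {0..} \<inter> S \<noteq> {}}"

definition domain_of_dependence ::
  "(real^'n::finite) set \<Rightarrow> 'n metric \<Rightarrow> (real^'n \<Rightarrow> real^'n) \<Rightarrow> (real^'n) set \<Rightarrow> (real^'n) set" where
  "domain_of_dependence M g N S =
     future_domain_of_dependence M g N S \<union> past_domain_of_dependence M g N S"

text \<open>The future directed unit normal to the spacelike level set of \<open>f\<close> through \<open>p\<close>.\<close>

definition is_unit_normal ::
  "'n::finite metric \<Rightarrow> (real^'n \<Rightarrow> real^'n) \<Rightarrow> (real^'n \<Rightarrow> real) \<Rightarrow> real^'n \<Rightarrow> real^'n \<Rightarrow> bool" where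
  "is_unit_normal g N f p n \<longleftrightarrow>
     (\<forall>X. frechet_derivative f (at p) X = 0 \<longrightarrow> ip g p n X = 0) \<and>
     ip g p n n = -1 \<and> future_causal g N p n"

definition unit_normal ::
  "'n::finite metric \<Rightarrow> (real^'n \<Rightarrow> real^'n) \<Rightarrow> (real^'n \<Rightarrow> real) \<Rightarrow> real^'n \<Rightarrow> real^'n" where
  "unit_normal g N f p = (THE n. is_unit_normal g N f p n)"

definition stress_energy_complex ::
  "'n::finite metric \<Rightarrow> (real^'n \<Rightarrow> complex) \<Rightarrow> real^'n \<Rightarrow> real^'n \<Rightarrow> real^'n \<Rightarrow> complex" where
  "stress_energy_complex g u p X Y =
     (let du = frechet_derivative u (at p) in
        1/2 * cnj (du X) * du Y + 1/2 * du X * cnj (du Y)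
        - 1/2 * of_real (ip g p X Y) *
            (\<Sum>i\<in>UNIV. \<Sum>j\<in>UNIV. of_real (inverse_metric g p $ i $ j) * pd i u p * cnj (pd j u p)))"

text \<open>The complex expression is real if the metric is symmetric and invertible
  (\<open>stress_energy_eq\<close> below).\<close>

definition stress_energy ::
  "'n::finite metric \<Rightarrow> (real^'n \<Rightarrow> complex) \<Rightarrow> real^'n \<Rightarrow> real^'n \<Rightarrow> real^'n \<Rightarrow> real" where
  "stress_energy g u p X Y = Re (stress_energy_complex g u p X Y)"

definition current ::
  "'n::finite metric \<Rightarrow> (real^'n \<Rightarrow> real^'n) \<Rightarrow> (real^'n \<Rightarrow> complex) \<Rightarrow> real^'n \<Rightarrow> real^'n" where
  "current g N u p = sharp g p (\<chi> i. stress_energy g u p (N p) (axis i 1))"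

definition induced_metric :: "'n::finite metric \<Rightarrow> (real^'k::finite \<Rightarrow> real^'n) \<Rightarrow> 'k metric" where
  "induced_metric g \<psi> x = (\<chi> i j. ip g (\<psi> x) (pd i \<psi> x) (pd j \<psi> x))"


section \<open>The Schwarzschild exterior\<close>

text \<open>
  \<open>\<real> \<times> (2m,\<infty>) \<times> S\<^sup>2\<close> is identified with the open set of all \<open>(t,x,y,z)\<close> with
  \<open>|(x,y,z)| > 2m\<close>, via \<open>(t,r,\<omega>) \<mapsto> (t, r \<omega>)\<close>. This avoids the degeneracy of spherical
  coordinates on the axis.
\<close>

definition spherical :: "real \<Rightarrow> real \<Rightarrow> real \<Rightarrow> real \<Rightarrow> real^4" where
  "spherical t r \<theta> \<phi> = vector [t, r * sin \<theta> * cos \<phi>, r * sin \<theta> * sin \<phi>, r * cos \<theta>]"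

definition radius :: "real^4 \<Rightarrow> real" where
  "radius p = sqrt ((p$2)\<^sup>2 + (p$3)\<^sup>2 + (p$4)\<^sup>2)"

definition exterior :: "real \<Rightarrow> (real^4) set" where
  "exterior m = {p. radius p > 2 * m}"

definition dt :: "real^4" where
  "dt = axis 1 1"

definition dr :: "real^4 \<Rightarrow> real^4" where
  "dr p = (\<chi> i. if i = 1 then 0 else p $ i / radius p)"

text \<open>The components of \<open>r\<^sup>2 g\<^bsub>S\<^sup>2\<^esub> = dx\<^sup>2 + dy\<^sup>2 + dz\<^sup>2 - dr\<^sup>2\<close>.\<close>

definition sphere_part :: "real^4 \<Rightarrow> real^4^4" where
  "sphere_part p = (\<chi> i j. (if i = j \<and> i \<noteq> 1 then 1 else 0) - dr p $ i * dr p $ j)"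

definition schwarzschild :: "real \<Rightarrow> 4 metric" where
  "schwarzschild m p = (\<chi> i j.
      - (1 - 2 * m / radius p) * dt $ i * dt $ j
      + inverse (1 - 2 * m / radius p) * dr p $ i * dr p $ j
      + sphere_part p $ i $ j)"

definition tstar :: "real \<Rightarrow> real^4 \<Rightarrow> real" where
  "tstar m p = p $ 1 + 2 * m * ln (radius p - 2 * m)"

definition Sigma_slice :: "real \<Rightarrow> real \<Rightarrow> (real^4) set" where
  "Sigma_slice m \<tau> = {p \<in> exterior m. tstar m p = \<tau>}"

definition N_field :: "real \<Rightarrow> real^4 \<Rightarrow> real^4" where
  "N_field m p = - sharp (schwarzschild m) p (differential (tstar m) p)"

definition DoD :: "real \<Rightarrow> (real^4) set" where
  "DoD m = domain_of_dependence (exterior m) (schwarzschild m) (N_field m) (Sigma_slice m 0)"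

definition wave_solution :: "real \<Rightarrow> (real^4 \<Rightarrow> complex) \<Rightarrow> bool" where
  "wave_solution m u \<longleftrightarrow> smooth_on (DoD m) u \<and> (\<forall>p\<in>DoD m. wave_op (schwarzschild m) u p = 0)"

text \<open>Global parametrisation of \<open>\<Sigma>\<^sub>\<tau>\<close> by \<open>{x \<in> \<real>\<^sup>3. |x| > 2m}\<close>.\<close>

definition slice_chart :: "real \<Rightarrow> real \<Rightarrow> real^3 \<Rightarrow> real^4" where
  "slice_chart m \<tau> x = vector [\<tau> - 2 * m * ln (norm x - 2 * m), x$1, x$2, x$3]"

text \<open>
  \<open>E\<^sup>N\<^bsub>\<tau>,A\<^esub>(u)\<close> for \<open>A \<subseteq> \<Sigma>\<^sub>\<tau>\<close>, with value \<open>\<infty>\<close> allowed. The integrand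
  \<open>g(J\<^sup>N, n) = T(u)(N, n)\<close> is nonnegative, because \<open>N\<close> and \<open>n\<close> are both future directed and
  timelike, so that the coercion to \<open>ennreal\<close> loses nothing.
\<close>

definition energy :: "real \<Rightarrow> real \<Rightarrow> (real^4) set \<Rightarrow> (real^4 \<Rightarrow> complex) \<Rightarrow> ennreal" where
  "energy m \<tau> A u =
     (\<integral>\<^sup>+ x \<in> {x. norm x > 2 * m \<and> slice_chart m \<tau> x \<in> A}.
        ennreal (let p = slice_chart m \<tau> x in
          ip (schwarzschild m) p (current (schwarzschild m) (N_field m) u p)
             (unit_normal (schwarzschild m) (N_field m) (tstar m) p)
          * sqrt (det (induced_metric (schwarzschild m) (slice_chart m \<tau>) x))) \<partial>lborel)"

definition photon_geodesic :: "real \<Rightarrow> real \<Rightarrow> real^4" where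
  "photon_geodesic m s =
     spherical (s - 2 * m * ln m) (3 * m) (pi / 2)
       ((27 * m\<^sup>2) powr (-1/2) * (s - 2 * m * ln m))"


section \<open>Consistency of the definitions\<close>

lemma inverse_metric_inverts:
  assumes "invertible (g p)"
  shows "g p ** inverse_metric g p = mat 1" "inverse_metric g p ** g p = mat 1"
  using someI_ex[OF assms[unfolded invertible_def]]
  by (auto simp: inverse_metric_def matrix_inv_def)

lemma stress_energy_eq:
  assumes "transpose (g p) = g p" "invertible (g p)"
  shows "stress_energy_complex g u p X Y = of_real (stress_energy g u p X Y)"
proof -
  let ?h = "inverse_metric g p"
  have inv: "g p ** ?h = mat 1" "?h ** g p = mat 1"
    using inverse_metric_inverts[of g p, OF assms(2)] by simp_all
  have "transpose ?h ** g p = mat 1"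
    using arg_cong[OF inv(1), of transpose] by (simp add: matrix_transpose_mul assms(1) transpose_mat)
  then have "transpose ?h ** (g p ** ?h) = ?h"
    by (simp only: matrix_mul_assoc matrix_mul_lid)
  then have "transpose ?h = ?h"
    by (simp only: inv(1) matrix_mul_rid)
  then have sym: "?h $ i $ j = ?h $ j $ i" for i j
    by (simp add: transpose_def vec_eq_iff)
  define Q where "Q = (\<Sum>i\<in>UNIV. \<Sum>j\<in>UNIV. complex_of_real (?h $ i $ j) * pd i u p * cnj (pd j u p))"
  have "cnj Q = (\<Sum>i\<in>UNIV. \<Sum>j\<in>UNIV. complex_of_real (?h $ j $ i) * pd j u p * cnj (pd i u p))"
    unfolding Q_def cnj_sum by (intro sum.cong refl) (simp add: sym ac_simps)
  also have "\<dots> = Q"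
    unfolding Q_def by (rule sum.swap)
  finally have "Im Q = 0"
    by (simp add: complex_eq_iff)
  moreover have "Im (1/2 * cnj a * b + 1/2 * a * cnj b - 1/2 * of_real x * q) = 0"
    if "Im q = 0" for a b q x
    using that by (simp add: field_simps)
  ultimately have "Im (stress_energy_complex g u p X Y) = 0"
    unfolding stress_energy_complex_def Let_def Q_def[symmetric] by blast
  then show ?thesis
    by (simp add: stress_energy_def complex_eq_iff)
qed

lemma vector_4:
  "(vector [a, b, c, d] :: 'a::zero^4) $ 1 = a"
  "(vector [a, b, c, d] :: 'a::zero^4) $ 2 = b"
  "(vector [a, b, c, d] :: 'a::zero^4) $ 3 = c"
  "(vector [a, b, c, d] :: 'a::zero^4) $ 4 = d"
  unfolding vector_def by simp_all

lemma radius_spherical: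
  assumes "r \<ge> 0" shows "radius (spherical t r \<theta> \<phi>) = r"
proof -
  have "(r * sin \<theta> * cos \<phi>)\<^sup>2 + (r * sin \<theta> * sin \<phi>)\<^sup>2 + (r * cos \<theta>)\<^sup>2
      = r\<^sup>2"
    by (simp add: power_mult_distrib sin_squared_eq algebra_simps)
  then show ?thesis
    using assms by (simp add: radius_def spherical_def vector_4)
qed

text \<open>In spherical coordinates, the metric is
  \<open>-(1 - 2m/r) dt\<^sup>2 + (1 - 2m/r)\<^sup>-\<^sup>1 dr\<^sup>2 + r\<^sup>2 d\<theta>\<^sup>2 + r\<^sup>2 sin\<^sup>2\<theta> d\<phi>\<^sup>2\<close>.\<close>

lemma line_element:
  fixes t r \<theta> \<phi> :: "real \<Rightarrow> real"
  assumes "m > 0" "r s > 2 * m"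
    and "(t has_real_derivative t') (at s)" "(r has_real_derivative r') (at s)"
    and "(\<theta> has_real_derivative \<theta>') (at s)" "(\<phi> has_real_derivative \<phi>') (at s)"
  defines "V \<equiv> vector [t',
      r' * sin (\<theta> s) * cos (\<phi> s) + r s * cos (\<theta> s) * \<theta>' * cos (\<phi> s) - r s * sin (\<theta> s) * sin (\<phi> s) * \<phi>',
      r' * sin (\<theta> s) * sin (\<phi> s) + r s * cos (\<theta> s) * \<theta>' * sin (\<phi> s) + r s * sin (\<theta> s) * cos (\<phi> s) * \<phi>',
      r' * cos (\<theta> s) - r s * sin (\<theta> s) * \<theta>'] :: real^4"
  shows "((\<lambda>s. spherical (t s) (r s) (\<theta> s) (\<phi> s)) has_vector_derivative V) (at s)"
    and "ip (schwarzschild m) (spherical (t s) (r s) (\<theta> s) (\<phi> s)) V V =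
      - (1 - 2 * m / r s) * t'\<^sup>2 + inverse (1 - 2 * m / r s) * r'\<^sup>2
      + (r s)\<^sup>2 * \<theta>'\<^sup>2 + (r s)\<^sup>2 * (sin (\<theta> s))\<^sup>2 * \<phi>'\<^sup>2"
proof -
  have *: "((\<lambda>s. spherical (t s) (r s) (\<theta> s) (\<phi> s) $ i) has_real_derivative V $ i) (at s)" for i
    using exhaust_4[of i]
    by (elim disjE)
       (auto simp: spherical_def V_def vector_4 algebra_simps
         intro!: derivative_eq_intros assms(3-6))
  have "((\<lambda>s. \<Sum>i\<in>UNIV. spherical (t s) (r s) (\<theta> s) (\<phi> s) $ i *\<^sub>R (axis i 1 :: real^4))
      has_vector_derivative (\<Sum>i\<in>UNIV. V $ i *\<^sub>R axis i 1)) (at s)"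
  proof (intro has_vector_derivative_sum)
    fix i :: 4
    show "((\<lambda>s. spherical (t s) (r s) (\<theta> s) (\<phi> s) $ i *\<^sub>R (axis i 1 :: real^4))
        has_vector_derivative V $ i *\<^sub>R axis i 1) (at s)"
      using has_vector_derivative_scaleR[OF *[of i] has_vector_derivative_const[of "axis i 1"]]
      by simp
  qed
  then show "((\<lambda>s. spherical (t s) (r s) (\<theta> s) (\<phi> s)) has_vector_derivative V) (at s)"
    by (simp add: basis_expansion flip: scalar_mult_eq_scaleR)
  define p where "p = spherical (t s) (r s) (\<theta> s) (\<phi> s)"
  define S C a b where "S = sin (\<theta> s)" and "C = cos (\<theta> s)" and "a = sin (\<phi> s)" and "b = cos (\<phi> s)"
  define R where "R = r s"
  have S2: "S\<^sup>2 = 1 - C\<^sup>2" and a2: "a\<^sup>2 = 1 - b\<^sup>2"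
    by (simp_all add: S_def C_def a_def b_def sin_squared_eq)
  have rad: "radius p = R" "R \<noteq> 0"
    using assms by (simp_all add: radius_spherical p_def R_def)
  have drp: "dr p $ 1 = 0" "dr p $ 2 = S * b" "dr p $ 3 = S * a" "dr p $ 4 = C"
    using rad by (simp_all add: dr_def p_def spherical_def vector_4 S_def C_def a_def b_def R_def)
  have dt: "dt $ 1 = 1" "dt $ 2 = 0" "dt $ 3 = 0" "dt $ 4 = 0"
    by (simp_all add: dt_def axis_def)
  define W where "W = S * b * V $ 2 + S * a * V $ 3 + C * V $ 4"
  have V: "V $ 1 = t'" "V $ 2 = r' * S * b + R * C * \<theta>' * b - R * S * a * \<phi>'"
     "V $ 3 = r' * S * a + R * C * \<theta>' * a + R * S * b * \<phi>'" "V $ 4 = r' * C - R * S * \<theta>'"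
    by (simp_all add: V_def vector_4 S_def C_def a_def b_def R_def)
  have "ip (schwarzschild m) p V V = - (1 - 2 * m / R) * (V$1)\<^sup>2 + inverse (1 - 2 * m / R) * W\<^sup>2
      + ((V$2)\<^sup>2 + (V$3)\<^sup>2 + (V$4)\<^sup>2 - W\<^sup>2)"
    by (simp add: ip_def sum_4 schwarzschild_def sphere_part_def rad drp dt W_def
        algebra_simps power2_eq_square)
  moreover have "W = r'"
  proof -
    have "W = r' * (S\<^sup>2 * (b\<^sup>2 + a\<^sup>2) + C\<^sup>2) + R * C * \<theta>' * S * (b\<^sup>2 + a\<^sup>2 - 1)"
      unfolding W_def V by (simp add: algebra_simps power2_eq_square)
    then show ?thesis by (simp add: S2 a2)
  qed
  moreover have "(V$2)\<^sup>2 + (V$3)\<^sup>2 + (V$4)\<^sup>2 = r'\<^sup>2 + R\<^sup>2 * \<theta>'\<^sup>2 + R\<^sup>2 * S\<^sup>2 * \<phi>'\<^sup>2"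
  proof -
    have "(V$2)\<^sup>2 + (V$3)\<^sup>2 + (V$4)\<^sup>2 =
       (r' * S + R * C * \<theta>')\<^sup>2 * (b\<^sup>2 + a\<^sup>2) + R\<^sup>2 * S\<^sup>2 * \<phi>'\<^sup>2 * (b\<^sup>2 + a\<^sup>2) + (r' * C - R * S * \<theta>')\<^sup>2"
      unfolding V by (simp add: algebra_simps power2_eq_square)
    also have "\<dots> = r'\<^sup>2 * (S\<^sup>2 + C\<^sup>2) + R\<^sup>2 * \<theta>'\<^sup>2 * (S\<^sup>2 + C\<^sup>2) + R\<^sup>2 * S\<^sup>2 * \<phi>'\<^sup>2"
      unfolding a2 by (simp add: algebra_simps power2_eq_square)
    finally show ?thesis by (simp add: S2)
  qed
  ultimately show "ip (schwarzschild m) (spherical (t s) (r s) (\<theta> s) (\<phi> s)) V V =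
      - (1 - 2 * m / r s) * t'\<^sup>2 + inverse (1 - 2 * m / r s) * r'\<^sup>2
      + (r s)\<^sup>2 * \<theta>'\<^sup>2 + (r s)\<^sup>2 * (sin (\<theta> s))\<^sup>2 * \<phi>'\<^sup>2"
    by (simp add: V(1) p_def R_def S_def)
qed

lemma transpose_schwarzschild: "transpose (schwarzschild m p) = schwarzschild m p"
  by (simp add: vec_eq_iff transpose_def schwarzschild_def sphere_part_def ac_simps)

lemma invertible_schwarzschild:
  assumes "m > 0" "p \<in> exterior m"
  shows "invertible (schwarzschild m p)"
proof -
  define f where "f = 1 - 2 * m / radius p"
  define B where "B = (\<chi> i j. - inverse f * dt $ i * dt $ j + f * dr p $ i * dr p $ j
      + sphere_part p $ i $ j)"
  have r: "radius p > 2 * m" using assms by (simp add: exterior_def)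
  then have f: "f \<noteq> 0" using assms by (simp add: f_def)
  define a b c where "a = dr p $ 2" and "b = dr p $ 3" and "c = dr p $ 4"
  have r2: "(radius p)\<^sup>2 = (p$2)\<^sup>2 + (p$3)\<^sup>2 + (p$4)\<^sup>2" by (simp add: radius_def)
  have "a\<^sup>2 + b\<^sup>2 + c\<^sup>2 = ((p$2)\<^sup>2 + (p$3)\<^sup>2 + (p$4)\<^sup>2) / (radius p)\<^sup>2"
    by (simp add: a_def b_def c_def dr_def power_divide add_divide_distrib)
  then have n: "a * a + b * b + c * c = 1"
    using r assms(1) by (simp add: r2[symmetric] power2_eq_square[symmetric])
  have d: "dt $ 1 = 1" "dt $ 2 = 0" "dt $ 3 = 0" "dt $ 4 = 0" "dr p $ 1 = 0"
    by (simp_all add: dt_def dr_def axis_def)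
  have dt0: "i \<noteq> 1 \<Longrightarrow> dt $ i = 0" for i by (simp add: dt_def axis_def)
  have dr: "(\<Sum>k\<in>UNIV. dr p $ k * dr p $ k) = 1"
    using n by (simp add: sum_4 d a_def b_def c_def)
  have split: "(x * dt $ i * dt $ k + y * dr p $ i * dr p $ k + sphere_part p $ i $ k) *
      (x' * dt $ k * dt $ j + y' * dr p $ k * dr p $ j + sphere_part p $ k $ j) =
      x * x' * dt $ i * dt $ j * (dt $ k * dt $ k)
      + (y - 1) * (y' - 1) * dr p $ i * dr p $ j * (dr p $ k * dr p $ k)
      + (if k = i \<and> i \<noteq> 1 then (y' - 1) * dr p $ i * dr p $ j else 0)
      + (if k = j \<and> j \<noteq> 1 then (y - 1) * dr p $ i * dr p $ j else 0)
      + (if k = i \<and> i = j \<and> i \<noteq> 1 then 1 else 0)" for x y x' y' i j k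
    by (cases "i = 1"; cases "j = 1"; cases "k = 1"; cases "k = i"; cases "k = j"; cases "i = j")
       (simp_all add: sphere_part_def d dt0 algebra_simps)
  have prod: "(\<Sum>k\<in>UNIV. (x * dt $ i * dt $ k + y * dr p $ i * dr p $ k + sphere_part p $ i $ k) *
      (x' * dt $ k * dt $ j + y' * dr p $ k * dr p $ j + sphere_part p $ k $ j)) = mat 1 $ i $ j"
    if "x * x' = 1" "y * y' = 1" for x y x' y' i j
  proof -
    have dd: "(\<Sum>k\<in>UNIV. dt $ k * dt $ k) = 1" by (simp add: sum_4 d)
    have yy: "(y - 1) * (y' - 1) + (y' - 1) + (y - 1) = 0"
      using that(2) by (simp add: algebra_simps)
    have "(\<Sum>k\<in>UNIV. (x * dt $ i * dt $ k + y * dr p $ i * dr p $ k + sphere_part p $ i $ k) *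
      (x' * dt $ k * dt $ j + y' * dr p $ k * dr p $ j + sphere_part p $ k $ j)) =
      dt $ i * dt $ j + (y - 1) * (y' - 1) * dr p $ i * dr p $ j
      + (if i \<noteq> 1 then (y' - 1) * dr p $ i * dr p $ j else 0)
      + (if j \<noteq> 1 then (y - 1) * dr p $ i * dr p $ j else 0)
      + (if i = j \<and> i \<noteq> 1 then 1 else 0)"
      unfolding split sum.distrib sum_distrib_left[symmetric] dr dd that(1)
      by (cases "i = 1"; cases "j = 1"; cases "i = j") simp_all
    also have "\<dots> = dt $ i * dt $ j + ((y - 1) * (y' - 1) + (y' - 1) + (y - 1)) * (dr p $ i * dr p $ j)
      + (if i = j \<and> i \<noteq> 1 then 1 else 0)"
      by (auto simp: d algebra_simps)
    also have "\<dots> = mat 1 $ i $ j"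
      unfolding yy by (auto simp: mat_def dt_def axis_def)
    finally show ?thesis .
  qed
  have "schwarzschild m p ** B = mat 1" "B ** schwarzschild m p = mat 1"
    unfolding vec_eq_iff matrix_matrix_mult_def
    using prod[of "- f" "- inverse f" "inverse f" f] prod[of "- inverse f" "- f" f "inverse f"] f
    by (simp_all add: schwarzschild_def B_def f_def[symmetric])
  then show ?thesis by (auto simp: invertible_def)
qed

lemma bij_betw_slice_chart: "bij_betw (slice_chart m \<tau>) {x. norm x > 2 * m} (Sigma_slice m \<tau>)"
proof -
  have rad: "radius (slice_chart m \<tau> x) = norm x" for x
    by (simp add: radius_def slice_chart_def vector_4 norm_vec_def L2_set_def sum_3)
  show ?thesis
  proof (rule bij_betw_byWitness[where f' = "\<lambda>p. vector [p$2, p$3, p$4] :: real^3"])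
    show "\<forall>x\<in>{x. norm x > 2 * m}. vector [slice_chart m \<tau> x $ 2, slice_chart m \<tau> x $ 3, slice_chart m \<tau> x $ 4] = x"
      by (simp add: slice_chart_def vector_4 vec_eq_iff forall_3)
    have norm3: "norm (vector [p$2, p$3, p$4] :: real^3) = radius p" for p
      by (simp add: radius_def norm_vec_def L2_set_def sum_3)
    show "\<forall>p\<in>Sigma_slice m \<tau>. slice_chart m \<tau> (vector [p$2, p$3, p$4]) = p"
      by (auto simp: Sigma_slice_def tstar_def slice_chart_def norm3 vector_4 vec_eq_iff forall_4)
    show "slice_chart m \<tau> ` {x. norm x > 2 * m} \<subseteq> Sigma_slice m \<tau>"
      by (auto simp: Sigma_slice_def exterior_def tstar_def rad) (simp add: slice_chart_def vector_4)
    show "(\<lambda>p. vector [p$2, p$3, p$4] :: real^3) ` Sigma_slice m \<tau> \<subseteq> {x. norm x > 2 * m}"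
      by (auto simp: Sigma_slice_def exterior_def norm3)
  qed
qed

lemma photon_geodesic_in_slice:
  assumes "m > 0" shows "photon_geodesic m s \<in> Sigma_slice m s"
  using assms
  by (simp add: Sigma_slice_def exterior_def tstar_def photon_geodesic_def radius_spherical)
     (simp add: spherical_def vector_4)

lemma is_unit_normal_iff:
  assumes "transpose (g p) = g p" "invertible (g p)" "f differentiable (at p)"
    and N: "N p = - sharp g p (differential f p)" and timelike: "ip g p (N p) (N p) < 0"
  shows "is_unit_normal g N f p n \<longleftrightarrow> n = (1 / sqrt (- ip g p (N p) (N p))) *\<^sub>R N p"
proof -
  let ?a = "ip g p (N p) (N p)"
  define df where "df = frechet_derivative f (at p)"
  have lin: "linear df"
    using assms(3) unfolding df_def by (rule linear_frechet_derivative)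
  have ip_eq: "ip g p X Y = X \<bullet> (g p *v Y)" for X Y
    by (simp add: ip_def inner_vec_def matrix_vector_mult_def sum_distrib_left ac_simps)
  have ip_sym: "ip g p X Y = ip g p Y X" for X Y
    by (metis assms(1) dot_lmul_matrix inner_commute ip_eq transpose_matrix_vector)
  have ip_scale: "ip g p (c *\<^sub>R X) Y = c * ip g p X Y" for c X Y
    by (simp add: ip_eq)
  have ip_diff: "ip g p (X - Z) Y = ip g p X Y - ip g p Z Y" for X Y Z
    by (simp add: ip_eq inner_diff_left)
  have gN: "g p *v N p = - differential f p"
    using inverse_metric_inverts(1)[of g p, OF assms(2)]
    by (simp add: N sharp_def linear_neg[OF matrix_vector_mul_linear] matrix_vector_mul_assoc)
  have df_eq: "df X = differential f p \<bullet> X" for X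
  proof -
    have "df X = df (\<Sum>i\<in>UNIV. X $ i *\<^sub>R axis i 1)"
      by (simp add: basis_expansion flip: scalar_mult_eq_scaleR)
    also have "\<dots> = (\<Sum>i\<in>UNIV. X $ i * df (axis i 1))"
      by (simp add: linear_sum[OF lin] linear_cmul[OF lin])
    finally show ?thesis
      by (simp add: inner_vec_def differential_def pd_def df_def ac_simps)
  qed
  have NX: "ip g p (N p) X = - df X" for X
    by (metis df_eq gN inner_commute inner_minus_left ip_eq ip_sym)
  have c2: "(1 / sqrt (- ?a)) * (1 / sqrt (- ?a)) * ?a = -1"
    using timelike by (simp add: field_simps)
  show ?thesis
  proof
    assume n: "n = (1 / sqrt (- ?a)) *\<^sub>R N p"
    have nn: "ip g p n n = -1"
      using c2 by (simp add: n ip_scale ip_sym[of "N p" "_ *\<^sub>R _"])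
    then have "n \<noteq> 0" by (auto simp: ip_def)
    moreover have "ip g p (N p) n < 0"
      using timelike by (simp add: n ip_scale ip_sym[of "N p" "_ *\<^sub>R _"] divide_neg_pos)
    ultimately show "is_unit_normal g N f p n"
      using nn by (simp add: is_unit_normal_def future_causal_def)
        (simp add: n ip_scale NX flip: df_def)
  next
    assume A: "is_unit_normal g N f p n"
    define c where "c = ip g p n (N p) / ?a"
    define X where "X = n - c *\<^sub>R N p"
    have XN: "ip g p X (N p) = 0"
      using timelike by (simp add: X_def ip_diff ip_scale c_def)
    have XY: "ip g p X Y = 0" for Y
    proof -
      define Z where "Z = Y - (df Y / df (N p)) *\<^sub>R N p"
      have "df (N p) \<noteq> 0" using timelike NX[of "N p"] by simp
      then have dZ: "df Z = 0"
        by (simp add: Z_def linear_diff[OF lin] linear_cmul[OF lin])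
      then have "ip g p n Z = 0"
        using A by (simp add: is_unit_normal_def df_def)
      then have "ip g p X Z = 0"
        by (simp add: X_def ip_diff ip_scale NX dZ)
      then show ?thesis
        using XN by (simp add: ip_sym[of X] Z_def ip_diff ip_scale)
    qed
    have "g p *v X = 0"
      by (metis XY inner_eq_zero_iff ip_eq ip_sym)
    then have "X = 0"
      by (metis assms(2) inverse_metric_inverts(2) matrix_vector_mul_assoc matrix_vector_mul_lid
          matrix_vector_mult_0_right)
    then have n: "n = c *\<^sub>R N p" by (simp add: X_def)
    have "c * (c * ?a) = -1" "c * ?a < 0"
      using A by (simp_all add: is_unit_normal_def future_causal_def n ip_scale ip_sym[of "N p" "_ *\<^sub>R _"])
    then have c: "c > 0" "c\<^sup>2 * (- ?a) = 1"
      using timelike by (simp_all add: mult_less_0_iff power2_eq_square)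
    have "c * sqrt (- ?a) = sqrt (c\<^sup>2 * (- ?a))"
      using c(1) by (simp only: real_sqrt_mult real_sqrt_abs abs_of_pos)
    also have "\<dots> = 1"
      by (simp only: c(2) real_sqrt_one)
    finally have "c = 1 / sqrt (- ?a)"
      using timelike by (simp add: field_simps)
    then show "n = (1 / sqrt (- ?a)) *\<^sub>R N p" using n by simp
  qed
qed

end

theory Submission
  imports Defs "HOL-Real_Asymp.Real_Asymp"
begin

text \<open>
  The functions \<open>Z\<^sup>l v\<^sub>l(t,x)/r\<close> with \<open>Z = sin \<theta> e\<^sup>i\<^sup>\<phi>\<close> solve the wave equation if \<open>v\<^sub>l\<close> solves a wave equation with potential in
  \<open>t\<close> and the tortoise coordinate \<open>x\<close>. For the critical impact parameter the eikonal and transport equations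
  have global smooth solutions, in which the amplitude is a bump of width \<open>\<delta>\<close> transported by the linear
  flow \<open>z \<mapsto> exp (\<omega> t) z\<close> in a suitable radial coordinate \<open>z\<close>. The error of this approximation is bounded
  uniformly in \<open>l\<close>, so that the corrected, exact mode has the same energy of order \<open>l\<^sup>2\<close> up to a bounded term.
  The sum of the modes \<open>l = L + k\<close> with weights \<open>(K choose k)/2\<^sup>K\<close> is localised at the geodesic, since
  its leading part contains the factor \<open>((1 + Z e\<^sup>i\<^sup>S)/2)\<^sup>K\<close>. The area of the amplitude profile on \<open>\<Sigma>\<^sub>\<tau>\<close>
  is comparable to the one on \<open>\<Sigma>\<^sub>0\<close> independently of \<open>\<tau>\<close>, \<open>\<delta>\<close> and \<open>K\<close>. For \<open>L \<rightarrow> \<infinity>\<close> the fraction of the energy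
  which remains in the neighbourhood is therefore bounded below by a constant which is independent of \<open>\<tau>\<close>.
\<close>

section \<open>Smooth functions\<close>

text \<open>The surviving fraction must be fixed before \<tau>, while the neighbourhood may shrink
  around the geodesic at any rate in \<tau>. The parameters K and \<delta> adapt to the
  neighbourhood and enter the error constants; L does not, and is chosen last to beat them. Two
  facts make this possible: amplitude and phase solve the transport and eikonal equations exactly,
  so no power of l is left in the residual, and the energy estimate for the correction uses the sign
  of the potential instead of its size l^2. At the critical impact parameter the square of the
  radial momentum has a double zero at r = 3m, so its root passes smoothly through the photon sphere
  with a change of sign. The critical rays approach r = 3m in the future: the bump narrows like exp
  (- \<omega> \<tau>), its squared height grows like exp (\<omega> \<tau>). Separation reduces
  existence to one space dimension, where Picard iteration is enough. The modes live on the whole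
  exterior, so causality enters through one fact: points with \<open>tstar\<close> \<ge> 0 belong to
  the domain of dependence.\<close>

abbreviation "Cdiff \<equiv> differentiable_times_on"

lemma Cdiff_subset: "Cdiff k T f \<Longrightarrow> S \<subseteq> T \<Longrightarrow> Cdiff k S f"
proof (induction k arbitrary: f)
  case 0
  then show ?case by (simp add: continuous_on_subset[of T f S])
next
  case (Suc k)
  then show ?case by (simp add: subset_iff)
qed

lemma Cdiff_SucD: "Cdiff (Suc k) S f \<Longrightarrow> Cdiff k S f"
proof (induction k arbitrary: f)
  case 0
  then show ?case
    by (auto intro!: continuous_at_imp_continuous_on differentiable_imp_continuous_within)
next
  case (Suc k)
  then show ?case by (metis differentiable_times_on.simps(2))
qed

lemma Cdiff_imp_continuous_on: "Cdiff k S f \<Longrightarrow> continuous_on S f"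
proof (induction k)
  case (Suc k)
  then show ?case by (blast dest: Cdiff_SucD)
qed simp

lemma Cdiff_has_derivative:
  "Cdiff (Suc k) S f \<Longrightarrow> x \<in> S \<Longrightarrow> (f has_derivative frechet_derivative f (at x)) (at x)"
  by (simp add: frechet_derivative_works)

lemma Cdiff_cong:
  assumes "open S" "\<And>x. x \<in> S \<Longrightarrow> f x = g x" "Cdiff k S f"
  shows "Cdiff k S g"
  using assms(2,3)
proof (induction k arbitrary: f g)
  case 0
  then show ?case using continuous_on_eq[of S f g] by (metis differentiable_times_on.simps(1))
next
  case (Suc k)
  have d: "(g has_derivative frechet_derivative f (at x)) (at x)" if "x \<in> S" for x
    by (rule has_derivative_transform_within_open[OF Cdiff_has_derivative[OF Suc.prems(2) that] assms(1) that])
      (rule Suc.prems(1))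
  have "frechet_derivative f (at x) = frechet_derivative g (at x)" if "x \<in> S" for x
    by (rule frechet_derivative_at[OF d[OF that]])
  then have "Cdiff k S (\<lambda>x. frechet_derivative g (at x) v)" for v
    using Suc.prems(2) by (rule_tac Suc.IH[of "\<lambda>x. frechet_derivative f (at x) v" "\<lambda>x. frechet_derivative g (at x) v"]) simp_all
  then show ?case
    using differentiableI[OF d] by simp
qed

lemma Cdiff_SucI:
  assumes "open S" "\<And>x. x \<in> S \<Longrightarrow> (f has_derivative f' x) (at x)" "\<And>v. Cdiff k S (\<lambda>x. f' x v)"
  shows "Cdiff (Suc k) S f"
proof -
  have "frechet_derivative f (at x) = f' x" if "x \<in> S" for x
    by (rule frechet_derivative_at[OF assms(2)[OF that], symmetric])
  then have "Cdiff k S (\<lambda>x. frechet_derivative f (at x) v)" for v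
    by (rule_tac Cdiff_cong[OF assms(1) _ assms(3)]) simp
  then show ?thesis
    using differentiableI[OF assms(2)] by simp
qed

lemma Cdiff_const [simp]: "Cdiff k S (\<lambda>_. c)"
  by (induction k arbitrary: c) simp_all

lemma Cdiff_bounded_linear:
  assumes "open S" "bounded_linear h" shows "Cdiff k S h"
proof (cases k)
  case 0
  then show ?thesis
    by (simp add: assms linear_continuous_on)
next
  case (Suc n)
  show ?thesis unfolding Suc
    by (rule Cdiff_SucI[OF assms(1), of _ "\<lambda>_. h"]) (simp_all add: assms bounded_linear_imp_has_derivative)
qed

lemma Cdiff_linear_compose:
  assumes "open S" "bounded_linear h"
  shows "Cdiff k S f \<Longrightarrow> Cdiff k S (\<lambda>x. h (f x))"
proof (induction k arbitrary: f)
  case 0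
  then show ?case
    by (simp add: bounded_linear.continuous_on[OF assms(2)])
next
  case (Suc k)
  show ?case
  proof (rule Cdiff_SucI[OF assms(1)])
    show "((\<lambda>x. h (f x)) has_derivative (\<lambda>v. h (frechet_derivative f (at x) v))) (at x)"
      if "x \<in> S" for x
      by (rule bounded_linear.has_derivative[OF assms(2) Cdiff_has_derivative[OF Suc.prems that]])
    show "Cdiff k S (\<lambda>x. h (frechet_derivative f (at x) v))" for v
      using Suc by simp
  qed
qed

lemma Cdiff_add:
  assumes "open S"
  shows "Cdiff k S f \<Longrightarrow> Cdiff k S g \<Longrightarrow> Cdiff k S (\<lambda>x. f x + g x)"
proof (induction k arbitrary: f g)
  case 0
  then show ?case by (simp add: continuous_on_add)
next
  case (Suc k)
  show ?case
  proof (rule Cdiff_SucI[OF assms])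
    show "((\<lambda>x. f x + g x) has_derivative
        (\<lambda>v. frechet_derivative f (at x) v + frechet_derivative g (at x) v)) (at x)"
      if "x \<in> S" for x
      by (intro has_derivative_add Cdiff_has_derivative[OF Suc.prems(1) that] Cdiff_has_derivative[OF Suc.prems(2) that])
    show "Cdiff k S (\<lambda>x. frechet_derivative f (at x) v + frechet_derivative g (at x) v)" for v
      using Suc by simp
  qed
qed

lemma Cdiff_bilinear:
  assumes "open S" "bounded_bilinear bil"
  shows "Cdiff k S f \<Longrightarrow> Cdiff k S g \<Longrightarrow> Cdiff k S (\<lambda>x. bil (f x) (g x))"
proof (induction k arbitrary: f g)
  case 0
  then show ?case by (simp add: bounded_bilinear.continuous_on[OF assms(2)])
next
  case (Suc k)
  show ?case
  proof (rule Cdiff_SucI[OF assms(1)])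
    show "((\<lambda>x. bil (f x) (g x)) has_derivative
        (\<lambda>v. bil (f x) (frechet_derivative g (at x) v) + bil (frechet_derivative f (at x) v) (g x))) (at x)"
      if "x \<in> S" for x
      by (intro bounded_bilinear.FDERIV[OF assms(2)] Cdiff_has_derivative[OF Suc.prems(1) that]
          Cdiff_has_derivative[OF Suc.prems(2) that])
    show "Cdiff k S (\<lambda>x. bil (f x) (frechet_derivative g (at x) v) + bil (frechet_derivative f (at x) v) (g x))" for v
    proof -
      have "Cdiff k S (\<lambda>x. frechet_derivative f (at x) v)" "Cdiff k S (\<lambda>x. frechet_derivative g (at x) v)"
        using Suc.prems by simp_all
      with Cdiff_SucD[OF Suc.prems(1)] Cdiff_SucD[OF Suc.prems(2)] show ?thesis
        by (intro Cdiff_add[OF assms(1)] Suc.IH)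
    qed
  qed
qed

lemmas Cdiff_scaleR = Cdiff_bilinear[OF _ bounded_bilinear_scaleR]
lemmas Cdiff_mult = Cdiff_bilinear[OF _ bounded_bilinear_mult]
lemmas Cdiff_minus = Cdiff_linear_compose[OF _ bounded_linear_minus[OF bounded_linear_ident]]
lemmas Cdiff_of_real = Cdiff_linear_compose[OF _ bounded_linear_of_real]

lemma Cdiff_diff:
  assumes "open S" "Cdiff k S f" "Cdiff k S g"
  shows "Cdiff k S (\<lambda>x. f x - g x)"
  using Cdiff_add[OF assms(1,2) Cdiff_minus[OF assms(1,3)]] by simp

lemma Cdiff_sum:
  assumes "open S" "\<And>i. i \<in> I \<Longrightarrow> Cdiff k S (f i)"
  shows "Cdiff k S (\<lambda>x. \<Sum>i\<in>I. f i x)"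
  using assms(2)
proof (induction I rule: infinite_finite_induct)
  case (insert i I)
  then show ?case using Cdiff_add[OF assms(1), of k "f i" "\<lambda>x. \<Sum>i\<in>I. f i x"] by simp
qed simp_all

lemma Cdiff_power:
  fixes f :: "'a::real_normed_vector \<Rightarrow> 'b::real_normed_algebra_1"
  assumes "open S" "Cdiff k S f"
  shows "Cdiff k S (\<lambda>x. f x ^ n)"
proof (induction n)
  case (Suc n)
  show ?case using Cdiff_mult[OF assms(1,2) Suc.IH] by simp
qed simp

lemma Cdiff_Pair:
  assumes "open S" "Cdiff k S f" "Cdiff k S g"
  shows "Cdiff k S (\<lambda>x. (f x, g x))"
proof -
  have "Cdiff k S (\<lambda>x. (f x, 0) + (0, g x))"
    using Cdiff_linear_compose[OF assms(1) bounded_linear_Pair[OF bounded_linear_ident bounded_linear_zero] assms(2)]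
      Cdiff_linear_compose[OF assms(1) bounded_linear_Pair[OF bounded_linear_zero bounded_linear_ident] assms(3)]
    by (rule Cdiff_add[OF assms(1)])
  then show ?thesis by simp
qed

text \<open>The derivative of the composition is Df (g x) applied to Dg x v, a direction that varies
  with x, whereas \<open>differentiable_times_on\<close> iterates derivatives along a fixed v.
  Expanding Dg x v in a basis leaves scalar coefficients times derivatives in fixed directions, to
  which the induction hypothesis applies; hence the Euclidean middle space.\<close>

lemma Cdiff_compose:
  fixes g :: "'a::real_normed_vector \<Rightarrow> 'b::euclidean_space"
  assumes "open S" "open T" "g ` S \<subseteq> T"
  shows "Cdiff k T f \<Longrightarrow> Cdiff k S g \<Longrightarrow> Cdiff k S (\<lambda>x. f (g x))"
proof (induction k arbitrary: f)
  case 0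
  then show ?case using assms(3) by (auto intro: continuous_on_compose2)
next
  case (Suc k)
  let ?Df = "\<lambda>y. frechet_derivative f (at y)" and ?Dg = "\<lambda>x. frechet_derivative g (at x)"
  have gd: "(g has_derivative ?Dg x) (at x)" and fd: "(f has_derivative ?Df (g x)) (at (g x))"
    if "x \<in> S" for x
    using Cdiff_has_derivative[OF Suc.prems(2) that] Cdiff_has_derivative[OF Suc.prems(1)] assms(3) that
    by auto
  show ?case
  proof (rule Cdiff_SucI[OF assms(1)])
    show "((\<lambda>x. f (g x)) has_derivative (\<lambda>v. \<Sum>b\<in>Basis. (?Dg x v \<bullet> b) *\<^sub>R ?Df (g x) b)) (at x)"
      if x: "x \<in> S" for x
    proof -
      have lin: "linear (?Df (g x))"
        using fd[OF x] has_derivative_linear by blast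
      have "?Df (g x) (?Dg x v) = (\<Sum>b\<in>Basis. (?Dg x v \<bullet> b) *\<^sub>R ?Df (g x) b)" for v
      proof -
        have "?Df (g x) (?Dg x v) = ?Df (g x) (\<Sum>b\<in>Basis. (?Dg x v \<bullet> b) *\<^sub>R b)"
          by (simp add: euclidean_representation)
        then show ?thesis by (simp add: linear_sum[OF lin] linear_cmul[OF lin])
      qed
      then show ?thesis
        using diff_chain_at[OF gd[OF x] fd[OF x]] by (simp add: o_def)
    qed
    show "Cdiff k S (\<lambda>x. \<Sum>b\<in>Basis. (?Dg x v \<bullet> b) *\<^sub>R ?Df (g x) b)" for v
    proof (rule Cdiff_sum[OF assms(1)])
      fix b :: 'b
      have "Cdiff k S (\<lambda>x. ?Dg x v \<bullet> b)"
        using Suc.prems(2) by (intro Cdiff_linear_compose[OF assms(1) bounded_linear_inner_left]) simp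
      moreover have "Cdiff k S (\<lambda>x. ?Df (g x) b)"
        using Suc.prems(1) Cdiff_SucD[OF Suc.prems(2)] by (intro Suc.IH[of "\<lambda>y. ?Df y b"]) simp_all
      ultimately show "Cdiff k S (\<lambda>x. (?Dg x v \<bullet> b) *\<^sub>R ?Df (g x) b)"
        by (rule Cdiff_scaleR[OF assms(1)])
    qed
  qed
qed

section \<open>Elementary functions, parameter integrals and a smooth cutoff\<close>

lemma Cdiff_vector_derivative:
  fixes f :: "real \<Rightarrow> 'b::real_normed_vector"
  assumes "open S" "\<And>x. x \<in> S \<Longrightarrow> (f has_vector_derivative f' x) (at x)" "Cdiff k S f'"
  shows "Cdiff (Suc k) S f"
  by (rule Cdiff_SucI[OF assms(1) assms(2)[unfolded has_vector_derivative_def]])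
    (assumption, intro Cdiff_scaleR assms Cdiff_const)

lemma Cdiff_real_derivative:
  assumes "open S" "\<And>x. x \<in> S \<Longrightarrow> (f has_real_derivative f' x) (at x)" "Cdiff k S f'"
  shows "Cdiff (Suc k) S f"
  by (rule Cdiff_vector_derivative[OF assms(1) _ assms(3)])
    (simp add: assms(2) flip: has_real_derivative_iff_has_vector_derivative)

lemma Cdiff_inverse: "Cdiff k {x::real. x \<noteq> 0} inverse"
proof (induction k)
  case 0
  then show ?case by (auto intro!: continuous_intros)
next
  case (Suc k)
  have o: "open {x::real. x \<noteq> 0}" by (simp add: open_Collect_neq)
  show ?case
  proof (rule Cdiff_real_derivative[OF o])
    show "(inverse has_real_derivative - (inverse x * inverse x)) (at x)" if "x \<in> {x. x \<noteq> 0}" for x :: real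
      using that by (auto intro!: derivative_eq_intros)
    show "Cdiff k {x::real. x \<noteq> 0} (\<lambda>x. - (inverse x * inverse x))"
      by (intro Cdiff_minus Cdiff_mult Suc o)
  qed
qed

lemma Cdiff_exp: "Cdiff k UNIV (exp :: real \<Rightarrow> real)"
proof (induction k)
  case 0
  then show ?case by (auto intro!: continuous_intros)
next
  case (Suc k)
  show ?case
    by (rule Cdiff_real_derivative[OF open_UNIV DERIV_exp Suc])
qed

lemma Cdiff_cis: "Cdiff k UNIV (\<lambda>x. cis x)"
proof (induction k)
  case 0
  then show ?case by (auto intro!: continuous_intros)
next
  case (Suc k)
  show ?case
  proof (rule Cdiff_vector_derivative[where f' = "\<lambda>x. \<i> * cis x"])
    have "((\<lambda>x. exp (\<i> * of_real x)) has_vector_derivative \<i> * exp (\<i> * of_real x)) (at x)" for x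
    proof -
      have "((\<lambda>z. exp (\<i> * z)) has_field_derivative \<i> * exp (\<i> * of_real x)) (at (of_real x))"
        by (auto intro!: derivative_eq_intros)
      from has_vector_derivative_real_field[OF this] show ?thesis by simp
    qed
    then show "(cis has_vector_derivative \<i> * cis x) (at x)" for x
      unfolding cis_conv_exp[abs_def] .
  qed (intro Cdiff_mult Suc Cdiff_const open_UNIV)+
qed

lemma Cdiff_ln: "Cdiff k {x::real. x > 0} ln"
proof (cases k)
  case 0
  then show ?thesis by (auto intro!: continuous_intros)
next
  case (Suc n)
  have o: "open {x::real. x > 0}" by (simp add: open_Collect_less)
  show ?thesis unfolding Suc
    by (rule Cdiff_real_derivative[OF o, where f' = inverse])
      (auto simp: DERIV_ln intro!: Cdiff_subset[OF Cdiff_inverse])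
qed

lemma Cdiff_sqrt: "Cdiff k {x::real. x > 0} sqrt"
proof (induction k)
  case 0
  then show ?case by (auto intro!: continuous_intros)
next
  case (Suc k)
  have o: "open {x::real. x > 0}" "open {x::real. x \<noteq> 0}"
    by (simp_all add: open_Collect_less open_Collect_neq)
  show ?case
  proof (rule Cdiff_real_derivative[OF o(1)])
    show "(sqrt has_real_derivative inverse (sqrt x) * (1/2)) (at x)" if "x \<in> {x. x > 0}" for x :: real
      using that by (auto intro!: derivative_eq_intros)
    show "Cdiff k {x::real. x > 0} (\<lambda>x. inverse (sqrt x) * (1/2))"
      by (intro Cdiff_mult Cdiff_compose[OF o _ Cdiff_inverse] Suc o Cdiff_const) auto
  qed
qed

lemma Cdiff_inverse_compose:
  fixes f :: "'a::real_normed_vector \<Rightarrow> real"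
  assumes "open S" "Cdiff k S f" "\<And>x. x \<in> S \<Longrightarrow> f x \<noteq> 0"
  shows "Cdiff k S (\<lambda>x. inverse (f x))"
  by (rule Cdiff_compose[OF assms(1) _ _ Cdiff_inverse assms(2)])
    (use assms in \<open>auto simp: open_Collect_neq\<close>)

lemma Cdiff_divide:
  fixes f :: "'a::real_normed_vector \<Rightarrow> real"
  assumes "open S" "Cdiff k S g" "Cdiff k S f" "\<And>x. x \<in> S \<Longrightarrow> f x \<noteq> 0"
  shows "Cdiff k S (\<lambda>x. g x / f x)"
  unfolding divide_inverse by (intro Cdiff_mult Cdiff_inverse_compose assms)

lemma Cdiff_sqrt_compose:
  assumes "open S" "Cdiff k S f" "\<And>x. x \<in> S \<Longrightarrow> f x > 0"
  shows "Cdiff k S (\<lambda>x. sqrt (f x))"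
  by (rule Cdiff_compose[OF assms(1) _ _ Cdiff_sqrt assms(2)])
    (use assms in \<open>auto simp: open_Collect_less\<close>)

lemma Cdiff_ln_compose:
  assumes "open S" "Cdiff k S f" "\<And>x. x \<in> S \<Longrightarrow> f x > 0"
  shows "Cdiff k S (\<lambda>x. ln (f x) :: real)"
  by (rule Cdiff_compose[OF assms(1) _ _ Cdiff_ln assms(2)])
    (use assms in \<open>auto simp: open_Collect_less\<close>)

lemmas Cdiff_exp_compose = Cdiff_compose[OF _ open_UNIV subset_UNIV Cdiff_exp]
lemmas Cdiff_cis_compose = Cdiff_compose[OF _ open_UNIV subset_UNIV Cdiff_cis]
lemmas Cdiff_fst = Cdiff_bounded_linear[OF _ bounded_linear_fst]
lemmas Cdiff_snd = Cdiff_bounded_linear[OF _ bounded_linear_snd]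
lemmas Cdiff_nth = Cdiff_bounded_linear[OF _ bounded_linear_vec_nth]
lemmas Cdiff_ident = Cdiff_bounded_linear[OF _ bounded_linear_ident]

text \<open>Differentiation under the integral yields a parameter integral of the same shape, with
  \<open>H\<close> replaced by its derivative in a direction \<open>(v, 0)\<close>; hence the
  induction with \<open>H\<close> arbitrary.\<close>

lemma Cdiff_integral:
  fixes H :: "'a::euclidean_space \<times> real \<Rightarrow> 'b::banach"
  shows "Cdiff k UNIV H \<Longrightarrow> Cdiff k UNIV (\<lambda>p. integral {0..1} (\<lambda>\<theta>. H (p, \<theta>)))"
proof (induction k arbitrary: H)
  case 0
  have "continuous_on (UNIV \<times> cbox 0 1) (\<lambda>(p, \<theta>). H (p, \<theta>))"
    using 0 by (auto intro: continuous_on_subset)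
  from integral_continuous_on_param[OF this] show ?case by simp
next
  case (Suc k)
  let ?DH = "\<lambda>p \<theta> v. frechet_derivative H (at (p, \<theta>)) (v, 0)"
  have Hd: "(H has_derivative frechet_derivative H (at y)) (at y)" for y
    using Cdiff_has_derivative[OF Suc.prems] by simp
  have d1: "((\<lambda>p. H (p, \<theta>)) has_derivative ?DH p \<theta>) (at p)" for p \<theta>
    using diff_chain_at[OF has_derivative_Pair[OF has_derivative_ident has_derivative_const] Hd]
    by (simp add: o_def)
  have bl: "bounded_linear (?DH p \<theta>)" for p \<theta>
    using d1 has_derivative_bounded_linear by blast
  have DHk: "Cdiff k UNIV (\<lambda>y. frechet_derivative H (at y) (v, 0))" for v
    using Suc.prems by simp
  have DHc: "continuous_on A (\<lambda>y. frechet_derivative H (at y) (v, 0))" for v A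
    using Cdiff_imp_continuous_on[OF DHk] continuous_on_subset by blast
  have Hc: "continuous_on A H" for A
    using Cdiff_imp_continuous_on[OF Suc.prems] continuous_on_subset by blast
  \<comment> \<open>The Leibniz rule asks for continuity of the derivative as a bounded linear map;
    in finite dimension this reduces to continuity of each directional derivative.\<close>
  have bcont: "continuous_on A (\<lambda>y. Blinfun (\<lambda>v. frechet_derivative H (at y) (v, 0)))" for A
    by (rule continuous_on_blinfun_componentwise)
      (use bl DHc in \<open>auto simp: bounded_linear_Blinfun_apply split_paired_all cong: continuous_on_cong\<close>)
  have int: "(\<lambda>\<theta>. Blinfun (?DH p \<theta>)) integrable_on {0..1}" for p
    by (rule integrable_continuous_real) (intro continuous_on_compose2[OF bcont[of UNIV]] continuous_intros subset_UNIV)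
  have main: "((\<lambda>p. integral {0..1} (\<lambda>\<theta>. H (p, \<theta>))) has_derivative (\<lambda>v. integral {0..1} (\<lambda>\<theta>. ?DH p \<theta> v))) (at p)" for p
  proof -
    have "((\<lambda>p. integral (cbox 0 1) (\<lambda>\<theta>. H (p, \<theta>))) has_derivative
        blinfun_apply (integral (cbox 0 1) (\<lambda>\<theta>. Blinfun (?DH p \<theta>)))) (at p within UNIV)"
    proof (rule leibniz_rule[where f="\<lambda>p \<theta>. H (p, \<theta>)"])
      show "continuous_on (UNIV \<times> cbox 0 1) (\<lambda>(x, t). Blinfun (?DH x t))"
        using bcont by (simp add: split_beta)
      show "(\<lambda>\<theta>. H (x, \<theta>)) integrable_on cbox 0 1" for x
        by (rule integrable_continuous) (intro continuous_on_compose2[OF Hc[of UNIV]] continuous_intros subset_UNIV)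
    qed (use d1 bl in \<open>auto simp: bounded_linear_Blinfun_apply\<close>)
    moreover have eq: "blinfun_apply (integral {0..1} (\<lambda>\<theta>. Blinfun (?DH p \<theta>))) v = integral {0..1} (\<lambda>\<theta>. ?DH p \<theta> v)" for v
    proof -
      have "integral {0..1} ((\<lambda>B. blinfun_apply B v) \<circ> (\<lambda>\<theta>. Blinfun (?DH p \<theta>)))
          = blinfun_apply (integral {0..1} (\<lambda>\<theta>. Blinfun (?DH p \<theta>))) v"
        by (rule integral_linear[OF int]) (rule blinfun.bounded_linear_left)
      then show ?thesis
        by (simp add: o_def bounded_linear_Blinfun_apply bl)
    qed
    ultimately show ?thesis by (simp add: ext[OF eq])
  qed
  show ?case
    by (rule Cdiff_SucI[OF open_UNIV main]) (rule Suc.IH[OF DHk])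
qed

lemma Cdiff_antiderivative:
  fixes f :: "real \<Rightarrow> real"
  assumes "Cdiff k UNIV f"
  shows "\<exists>g. g 0 = 0 \<and> (\<forall>x. (g has_real_derivative f x) (at x)) \<and> Cdiff (Suc k) UNIV g"
proof -
  have c: "continuous_on UNIV f" using assms by (rule Cdiff_imp_continuous_on)
  obtain F where F: "\<And>x. (F has_real_derivative f x) (at x)"
    using c einterval_antiderivative[of "-\<infinity>" "\<infinity>" f]
    by (auto simp: continuous_on_eq_continuous_at has_real_derivative_iff_has_vector_derivative)
  have d: "((\<lambda>x. F x - F 0) has_real_derivative f x) (at x)" for x
    by (auto intro!: derivative_eq_intros F)
  then show ?thesis
    using Cdiff_real_derivative[OF open_UNIV d assms]
    by (intro exI[of _ "\<lambda>x. F x - F 0"]) auto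
qed

text \<open>\<open>flat 0\<close> is the classical function exp (- 1/x), continued by 0. The powers
  of 1/x are carried along because the family is closed under differentiation, which makes
  smoothness an induction over all \<open>n\<close> at once.\<close>

definition flat :: "nat \<Rightarrow> real \<Rightarrow> real" where
  "flat n x = (if x > 0 then exp (- inverse x) * inverse x ^ n else 0)"

text \<open>This is the difference quotient at 0, the one point where the calculus rules do not give
  the derivative.\<close>

lemma flat_tendsto: "((\<lambda>x. flat n x / x) \<longlongrightarrow> 0) (at 0)"
proof -
  have "((\<lambda>x::real. exp (- inverse x) * inverse x ^ n / x) \<longlongrightarrow> 0) (at_right 0)"
    by real_asymp
  then have "((\<lambda>x. flat n x / x) \<longlongrightarrow> 0) (at_right 0)"
    by (rule Lim_transform_eventually) (auto simp: flat_def eventually_at_filter)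
  moreover have "((\<lambda>x. flat n x / x) \<longlongrightarrow> 0) (at_left 0)"
    by (rule Lim_transform_eventually[OF tendsto_const]) (auto simp: flat_def eventually_at_filter)
  ultimately show ?thesis by (simp add: filterlim_split_at)
qed

lemma flat_derivative: "(flat n has_real_derivative flat (n + 2) x - real n * flat (n + 1) x) (at x)"
proof -
  consider "x > 0" | "x < 0" | "x = 0" by linarith
  then show ?thesis
  proof cases
    case 1
    have "((\<lambda>x. exp (- inverse x) * inverse x ^ n) has_real_derivative flat (n + 2) x - real n * flat (n + 1) x) (at x)"
    proof -
      have "((\<lambda>x. exp (- inverse x) * inverse x ^ n) has_real_derivative
          exp (- inverse x) * (inverse x * inverse x) * inverse x ^ n
          + exp (- inverse x) * (real n * inverse x ^ (n - 1) * (- (inverse x * inverse x)))) (at x)"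
        using 1 by (auto intro!: derivative_eq_intros)
      moreover have "exp (- inverse x) * (inverse x * inverse x) * inverse x ^ n
          + exp (- inverse x) * (real n * inverse x ^ (n - 1) * (- (inverse x * inverse x)))
          = flat (n + 2) x - real n * flat (n + 1) x"
        using 1 by (cases n) (simp_all add: flat_def algebra_simps del: of_nat_Suc)
      ultimately show ?thesis by simp
    qed
    then show ?thesis
      by (rule has_field_derivative_transform_within_open[where S="{0<..}"]) (use 1 in \<open>auto simp: flat_def\<close>)
  next
    case 2
    have "((\<lambda>x. 0) has_real_derivative flat (n + 2) x - real n * flat (n + 1) x) (at x)"
      using 2 by (auto simp: flat_def)
    then show ?thesis
      by (rule has_field_derivative_transform_within_open[where S="{..<0}"]) (use 2 in \<open>auto simp: flat_def\<close>)
  next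
    case 3
    then show ?thesis
      using flat_tendsto[of n] by (simp add: has_field_derivative_iff flat_def)
  qed
qed

lemma Cdiff_flat: "Cdiff k UNIV (flat n)"
proof (induction k arbitrary: n)
  case 0
  then show ?case
    using DERIV_continuous_on[OF flat_derivative] by (simp add: continuous_on_subset)
next
  case (Suc k)
  show ?case
    by (rule Cdiff_real_derivative[OF open_UNIV flat_derivative]) (intro Cdiff_diff Cdiff_mult Cdiff_const Suc open_UNIV)
qed

section \<open>Integration over the sphere\<close>

text \<open>Surface measure of the unit sphere, up to the factor 3: the cone measure.\<close>

definition sphere_measure :: "(real^3) measure" where
  "sphere_measure = distr (restrict_space lborel (cball 0 1)) borel (\<lambda>y. y /\<^sub>R norm y)"

lemma sets_sphere_measure [measurable_cong, simp]: "sets sphere_measure = sets borel"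
  by (simp add: sphere_measure_def)

lemma space_sphere_measure [simp]: "space sphere_measure = UNIV"
  by (simp add: sphere_measure_def)

lemma cball_sets_borel [measurable]: "cball a (r::real) \<in> sets borel"
  by (simp add: borel_closed)

lemma nn_integral_sphere:
  fixes H :: "real^3 \<Rightarrow> ennreal"
  assumes [measurable]: "H \<in> borel_measurable borel"
  shows "(\<integral>\<^sup>+\<omega>. H \<omega> \<partial>sphere_measure) = (\<integral>\<^sup>+y. H (y /\<^sub>R norm y) * indicator (cball 0 1) y \<partial>lborel)"
  unfolding sphere_measure_def
  by (subst nn_integral_distr) (auto simp: nn_integral_restrict_space intro!: measurable_restrict_space1)

interpretation sphere_measure: finite_measure sphere_measure
proof
  have "emeasure sphere_measure UNIV = (\<integral>\<^sup>+\<omega>. 1 \<partial>sphere_measure)" by simp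
  also have "\<dots> = emeasure lborel (cball 0 1 :: (real^3) set)"
    by (subst nn_integral_sphere) auto
  also have "\<dots> < \<infinity>" by (rule emeasure_lborel_cball_finite)
  finally show "emeasure sphere_measure (space sphere_measure) \<noteq> \<infinity>" by simp
qed

lemma AE_sphere_measure: "AE \<omega> in sphere_measure. norm \<omega> = 1"
proof -
  have "AE y in lborel. y \<noteq> (0::real^3)" by (rule AE_lborel_singleton)
  then have "AE y in restrict_space lborel (cball 0 1). norm (y /\<^sub>R norm y :: real^3) = 1"
    by (auto simp: AE_restrict_space_iff elim!: AE_mp)
  then show ?thesis
    unfolding sphere_measure_def by (subst AE_distr_iff) (auto intro!: measurable_restrict_space1)
qed

lemma nn_integral_lborel_scale:
  fixes f :: "'a::euclidean_space \<Rightarrow> ennreal"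
  assumes [measurable]: "f \<in> borel_measurable borel" and "c > 0"
  shows "(\<integral>\<^sup>+x. f x \<partial>lborel) = ennreal (c ^ DIM('a)) * (\<integral>\<^sup>+x. f (c *\<^sub>R x) \<partial>lborel)"
proof -
  have "(\<integral>\<^sup>+x. f x \<partial>lborel) = (\<integral>\<^sup>+x. f x \<partial>density (distr lborel borel (\<lambda>x. 0 + c *\<^sub>R x)) (\<lambda>_. ennreal (\<bar>c\<bar> ^ DIM('a))))"
    using lborel_affine[of c "0::'a"] assms(2) by simp
  also have "\<dots> = (\<integral>\<^sup>+x. ennreal (c ^ DIM('a)) * f (c *\<^sub>R x) \<partial>lborel)"
    using assms(2) by (subst nn_integral_density) (auto simp: nn_integral_distr)
  finally show ?thesis by (simp add: nn_integral_cmult)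
qed

lemma nn_integral_inverse_fourth:
  assumes "a > 0"
  shows "(\<integral>\<^sup>+t. ennreal (3 / t ^ 4) * indicator {a..} t \<partial>lborel) = ennreal (1 / a ^ 3)"
proof -
  have "(\<integral>\<^sup>+t. ennreal (3 / t ^ 4) * indicator {a..} t \<partial>lborel) = ennreal (0 - (- (1 / a ^ 3)))"
  proof (rule nn_integral_FTC_atLeast)
    show "((\<lambda>t. - (1 / t ^ 3)) has_real_derivative 3 / t ^ 4) (at t)" if "a \<le> t" for t
      using that assms by (auto intro!: derivative_eq_intros simp: field_simps power4_eq_xxxx power3_eq_cube power2_eq_square)
    show "((\<lambda>t::real. - (1 / t ^ 3)) \<longlongrightarrow> 0) at_top" by real_asymp
  qed (use assms in auto)
  then show ?thesis by simp
qed

lemma mult_regroup: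
  fixes a :: "'a::comm_monoid_mult"
  assumes "a * c = d" shows "a * (g * c * i) = g * d * i"
  unfolding assms[symmetric] by (simp only: mult_ac)

text \<open>Three scalings replace a Jacobian. The right hand side is an integral over s and over y
  in the unit ball. For fixed y, s = t |y| turns G (s y/|y|) 3 s^2 into G (t y) 3 t^2 |y|^3; for
  fixed t, x = t y gives G x |x|^3 3/t^4 on |x| \<le> t. The integral of 3/t^4 over t \<ge> |x| is
  1/|x|^3 and cancels the remaining factor. The 3 makes up for the normalisation of the cone
  measure.\<close>

theorem nn_integral_polar:
  fixes G :: "real^3 \<Rightarrow> ennreal"
  assumes [measurable]: "G \<in> borel_measurable borel"
  shows "(\<integral>\<^sup>+x. G x \<partial>lborel)
     = (\<integral>\<^sup>+s. (\<integral>\<^sup>+\<omega>. G (s *\<^sub>R \<omega>) \<partial>sphere_measure) * ennreal (3 * s\<^sup>2) * indicator {0<..} s \<partial>lborel)"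
proof -
  have inner: "(\<integral>\<^sup>+s. G (s *\<^sub>R (y /\<^sub>R norm y)) * ennreal (3 * s\<^sup>2) * indicator {0<..} s \<partial>lborel)
      = (\<integral>\<^sup>+t. G (t *\<^sub>R y) * ennreal (3 * t\<^sup>2 * norm y ^ 3) * indicator {0<..} t \<partial>lborel)" if y: "y \<noteq> 0" for y :: "real^3"
  proof -
    have "(\<integral>\<^sup>+s. G (s *\<^sub>R (y /\<^sub>R norm y)) * ennreal (3 * s\<^sup>2) * indicator {0<..} s \<partial>lborel)
        = ennreal (norm y ^ 1) * (\<integral>\<^sup>+t. G ((norm y *\<^sub>R t) *\<^sub>R (y /\<^sub>R norm y)) * ennreal (3 * (norm y *\<^sub>R t)\<^sup>2) * indicator {0<..} (norm y *\<^sub>R t) \<partial>lborel)"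
      using nn_integral_lborel_scale[of "\<lambda>s. G (s *\<^sub>R (y /\<^sub>R norm y)) * ennreal (3 * s\<^sup>2) * indicator {0<..} s" "norm y"] y
      by simp
    also have "\<dots> = (\<integral>\<^sup>+t. G (t *\<^sub>R y) * ennreal (3 * t\<^sup>2 * norm y ^ 3) * indicator {0<..} t \<partial>lborel)"
    proof (subst nn_integral_cmult[symmetric])
      show "(\<integral>\<^sup>+t. ennreal (norm y ^ 1) * (G ((norm y *\<^sub>R t) *\<^sub>R (y /\<^sub>R norm y)) * ennreal (3 * (norm y *\<^sub>R t)\<^sup>2) * indicator {0<..} (norm y *\<^sub>R t)) \<partial>lborel)
          = (\<integral>\<^sup>+t. G (t *\<^sub>R y) * ennreal (3 * t\<^sup>2 * norm y ^ 3) * indicator {0<..} t \<partial>lborel)"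
      proof (rule nn_integral_cong)
        fix t :: real
        have "norm y ^ 1 * (3 * (norm y *\<^sub>R t)\<^sup>2) = 3 * t\<^sup>2 * norm y ^ 3"
          by (simp add: power_mult_distrib power3_eq_cube power2_eq_square)
        then have "ennreal (norm y ^ 1) * ennreal (3 * (norm y *\<^sub>R t)\<^sup>2) = ennreal (3 * t\<^sup>2 * norm y ^ 3)"
          by (simp add: ennreal_mult'[symmetric])
        moreover have "indicator {0<..} (norm y *\<^sub>R t) = (indicator {0<..} t :: ennreal)"
          using y by (simp add: indicator_def zero_less_mult_iff)
        moreover have "(norm y *\<^sub>R t) *\<^sub>R (y /\<^sub>R norm y) = t *\<^sub>R y" using y by simp
        ultimately show "ennreal (norm y ^ 1) * (G ((norm y *\<^sub>R t) *\<^sub>R (y /\<^sub>R norm y)) * ennreal (3 * (norm y *\<^sub>R t)\<^sup>2) * indicator {0<..} (norm y *\<^sub>R t))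
            = G (t *\<^sub>R y) * ennreal (3 * t\<^sup>2 * norm y ^ 3) * indicator {0<..} t"
          by (simp only: mult_regroup)
      qed
    qed measurable
    finally show ?thesis .
  qed
  have "(\<integral>\<^sup>+s. (\<integral>\<^sup>+\<omega>. G (s *\<^sub>R \<omega>) \<partial>sphere_measure) * ennreal (3 * s\<^sup>2) * indicator {0<..} s \<partial>lborel)
      = (\<integral>\<^sup>+s. \<integral>\<^sup>+y. G (s *\<^sub>R (y /\<^sub>R norm y)) * ennreal (3 * s\<^sup>2) * indicator {0<..} s * indicator (cball 0 1) y \<partial>lborel \<partial>lborel)"
  proof (rule nn_integral_cong)
    fix s :: real
    have "(\<integral>\<^sup>+\<omega>. G (s *\<^sub>R \<omega>) \<partial>sphere_measure) * ennreal (3 * s\<^sup>2) * indicator {0<..} s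
       = (\<integral>\<^sup>+y. (G (s *\<^sub>R (y /\<^sub>R norm y)) * indicator (cball 0 1) y) * (ennreal (3 * s\<^sup>2) * indicator {0<..} s) \<partial>lborel)"
    proof -
      have m0: "(\<lambda>\<omega>. G (s *\<^sub>R \<omega>)) \<in> borel_measurable borel" by measurable
      have m1: "(\<lambda>y. G (s *\<^sub>R (y /\<^sub>R norm y)) * indicator (cball 0 1) y) \<in> borel_measurable lborel" by measurable
      show ?thesis unfolding nn_integral_sphere[OF m0] nn_integral_multc[OF m1] by (rule mult.assoc)
    qed
    then show "(\<integral>\<^sup>+\<omega>. G (s *\<^sub>R \<omega>) \<partial>sphere_measure) * ennreal (3 * s\<^sup>2) * indicator {0<..} s
       = (\<integral>\<^sup>+y. G (s *\<^sub>R (y /\<^sub>R norm y)) * ennreal (3 * s\<^sup>2) * indicator {0<..} s * indicator (cball 0 1) y \<partial>lborel)"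
      by (simp only: mult_ac)
  qed
  also have "\<dots> = (\<integral>\<^sup>+y. \<integral>\<^sup>+s. G (s *\<^sub>R (y /\<^sub>R norm y)) * ennreal (3 * s\<^sup>2) * indicator {0<..} s * indicator (cball 0 1) y \<partial>lborel \<partial>lborel)"
    by (rule lborel_pair.Fubini') measurable
  also have "\<dots> = (\<integral>\<^sup>+y. \<integral>\<^sup>+t. G (t *\<^sub>R y) * ennreal (3 * t\<^sup>2 * norm y ^ 3) * indicator {0<..} t * indicator (cball 0 1) y \<partial>lborel \<partial>lborel)"
  proof (rule nn_integral_cong_AE)
    show "AE y in lborel. (\<integral>\<^sup>+s. G (s *\<^sub>R (y /\<^sub>R norm y)) * ennreal (3 * s\<^sup>2) * indicator {0<..} s * indicator (cball 0 1) y \<partial>lborel)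
       = (\<integral>\<^sup>+t. G (t *\<^sub>R y) * ennreal (3 * t\<^sup>2 * norm y ^ 3) * indicator {0<..} t * indicator (cball 0 1) y \<partial>lborel)"
      using AE_lborel_singleton[of "0::real^3"]
    proof eventually_elim
      case (elim y)
      have m1: "(\<lambda>s. G (s *\<^sub>R (y /\<^sub>R norm y)) * ennreal (3 * s\<^sup>2) * indicator {0<..} s) \<in> borel_measurable lborel" by measurable
      have m2: "(\<lambda>t. G (t *\<^sub>R y) * ennreal (3 * t\<^sup>2 * norm y ^ 3) * indicator {0<..} t) \<in> borel_measurable lborel" by measurable
      show ?case unfolding nn_integral_multc[OF m1] nn_integral_multc[OF m2] inner[OF elim] ..
    qed
  qed
  also have "\<dots> = (\<integral>\<^sup>+t. \<integral>\<^sup>+y. G (t *\<^sub>R y) * ennreal (3 * t\<^sup>2 * norm y ^ 3) * indicator {0<..} t * indicator (cball 0 1) y \<partial>lborel \<partial>lborel)"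
    by (rule lborel_pair.Fubini') measurable
  also have "\<dots> = (\<integral>\<^sup>+t. \<integral>\<^sup>+x. G x * ennreal (3 / t ^ 4 * norm x ^ 3) * indicator {0<..} t * indicator (cball 0 t) x \<partial>lborel \<partial>lborel)"
  proof (rule nn_integral_cong)
    fix t :: real
    show "(\<integral>\<^sup>+y. G (t *\<^sub>R y) * ennreal (3 * t\<^sup>2 * norm y ^ 3) * indicator {0<..} t * indicator (cball 0 1) y \<partial>lborel)
        = (\<integral>\<^sup>+x. G x * ennreal (3 / t ^ 4 * norm x ^ 3) * indicator {0<..} t * indicator (cball 0 t) x \<partial>lborel)"
    proof (cases "t > 0")
      case True
      have "(\<integral>\<^sup>+x. G x * ennreal (3 / t ^ 4 * norm x ^ 3) * indicator {0<..} t * indicator (cball 0 t) x \<partial>lborel)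
          = ennreal (t ^ 3) * (\<integral>\<^sup>+y. G (t *\<^sub>R y) * ennreal (3 / t ^ 4 * norm (t *\<^sub>R y) ^ 3) * indicator {0<..} t * indicator (cball 0 t) (t *\<^sub>R y) \<partial>lborel)"
        using nn_integral_lborel_scale[of "\<lambda>x::real^3. G x * ennreal (3 / t ^ 4 * norm x ^ 3) * indicator {0<..} t * indicator (cball 0 t) x" t] True
        by simp
      also have "\<dots> = (\<integral>\<^sup>+y. G (t *\<^sub>R y) * ennreal (3 * t\<^sup>2 * norm y ^ 3) * indicator {0<..} t * indicator (cball 0 1) y \<partial>lborel)"
      proof (subst nn_integral_cmult[symmetric])
        show "(\<integral>\<^sup>+y. ennreal (t ^ 3) * (G (t *\<^sub>R y) * ennreal (3 / t ^ 4 * norm (t *\<^sub>R y) ^ 3) * indicator {0<..} t * indicator (cball 0 t) (t *\<^sub>R y)) \<partial>lborel)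
          = (\<integral>\<^sup>+y. G (t *\<^sub>R y) * ennreal (3 * t\<^sup>2 * norm y ^ 3) * indicator {0<..} t * indicator (cball 0 1) y \<partial>lborel)"
        proof (rule nn_integral_cong)
          fix y :: "real^3"
          have "t ^ 3 * (3 / t ^ 4 * norm (t *\<^sub>R y) ^ 3) = 3 * t\<^sup>2 * norm y ^ 3"
            using True by (simp add: field_simps power_mult_distrib power4_eq_xxxx power3_eq_cube power2_eq_square)
          then have "ennreal (t ^ 3) * ennreal (3 / t ^ 4 * norm (t *\<^sub>R y) ^ 3) = ennreal (3 * t\<^sup>2 * norm y ^ 3)"
            using True by (simp add: ennreal_mult'[symmetric])
          moreover have "indicator (cball 0 t) (t *\<^sub>R y) = (indicator (cball 0 1) y :: ennreal)"
            using True by (simp add: indicator_def)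
          ultimately show "ennreal (t ^ 3) * (G (t *\<^sub>R y) * ennreal (3 / t ^ 4 * norm (t *\<^sub>R y) ^ 3) * indicator {0<..} t * indicator (cball 0 t) (t *\<^sub>R y))
             = G (t *\<^sub>R y) * ennreal (3 * t\<^sup>2 * norm y ^ 3) * indicator {0<..} t * indicator (cball 0 1) y"
            by (simp only: mult.assoc[of _ "indicator {0<..} t"] mult_regroup)
        qed
      qed measurable
      finally show ?thesis by simp
    qed simp
  qed
  also have "\<dots> = (\<integral>\<^sup>+x. \<integral>\<^sup>+t. G x * ennreal (3 / t ^ 4 * norm x ^ 3) * indicator {0<..} t * indicator (cball 0 t) x \<partial>lborel \<partial>lborel)"
  proof (rule lborel_pair.Fubini')
    let ?S = "{z :: (real^3) \<times> real. norm (fst z) \<le> snd z}"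
    have "closed ?S" by (intro closed_Collect_le continuous_intros)
    then have "?S \<in> sets (borel \<Otimes>\<^sub>M borel)" unfolding borel_prod by (rule borel_closed)
    then have [measurable]: "?S \<in> sets (lborel \<Otimes>\<^sub>M lborel)" by simp
    have "(\<lambda>(x, t). G x * ennreal (3 / t ^ 4 * norm x ^ 3) * indicator {0<..} t * indicator (cball 0 t) x)
        = (\<lambda>z. G (fst z) * ennreal (3 / snd z ^ 4 * norm (fst z) ^ 3) * indicator {0<..} (snd z) * indicator ?S z)"
      by (auto simp: indicator_def fun_eq_iff)
    also have "\<dots> \<in> borel_measurable (lborel \<Otimes>\<^sub>M lborel)" by measurable
    finally show "(\<lambda>(x, t). G x * ennreal (3 / t ^ 4 * norm x ^ 3) * indicator {0<..} t * indicator (cball 0 t) x) \<in> borel_measurable (lborel \<Otimes>\<^sub>M lborel)" .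
  qed
  also have "\<dots> = (\<integral>\<^sup>+x. G x \<partial>lborel)"
  proof (rule nn_integral_cong_AE)
    show "AE x in lborel. (\<integral>\<^sup>+t. G x * ennreal (3 / t ^ 4 * norm x ^ 3) * indicator {0<..} t * indicator (cball 0 t) x \<partial>lborel) = G x"
      using AE_lborel_singleton[of "0::real^3"]
    proof eventually_elim
      case (elim x)
      then have nx: "norm x > 0" by simp
      have "(\<integral>\<^sup>+t. G x * ennreal (3 / t ^ 4 * norm x ^ 3) * indicator {0<..} t * indicator (cball 0 t) x \<partial>lborel)
          = (\<integral>\<^sup>+t. (G x * ennreal (norm x ^ 3)) * (ennreal (3 / t ^ 4) * indicator {norm x..} t) \<partial>lborel)"
      proof (rule nn_integral_cong)
        fix t :: real
        have "ennreal (3 / t ^ 4 * norm x ^ 3) = ennreal (norm x ^ 3) * ennreal (3 / t ^ 4)"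
          by (simp add: ennreal_mult'[symmetric] mult.commute)
        moreover have "indicator {0<..} t * indicator (cball 0 t) x = (indicator {norm x..} t :: ennreal)"
          by (auto simp: indicator_def intro: less_le_trans[OF nx])
        ultimately show "G x * ennreal (3 / t ^ 4 * norm x ^ 3) * indicator {0<..} t * indicator (cball 0 t) x
            = (G x * ennreal (norm x ^ 3)) * (ennreal (3 / t ^ 4) * indicator {norm x..} t)"
          by (simp only: mult.assoc)
      qed
      also have "\<dots> = (G x * ennreal (norm x ^ 3)) * ennreal (1 / norm x ^ 3)"
        by (subst nn_integral_cmult) (auto simp: nn_integral_inverse_fourth[OF nx])
      also have "\<dots> = G x"
        using nx by (simp add: mult.assoc ennreal_mult'[symmetric])
      finally show ?case .
    qed
  qed
  finally show ?thesis by simp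
qed

section \<open>Rotations about the axis and concentration at the equator\<close>

definition rotz :: "real \<Rightarrow> real^3 \<Rightarrow> real^3" where
  "rotz \<alpha> x = vector [cos \<alpha> * x$1 - sin \<alpha> * x$2, sin \<alpha> * x$1 + cos \<alpha> * x$2, x$3]"

definition planar :: "real^3 \<Rightarrow> complex" where
  "planar x = Complex (x$1) (x$2)"

lemma rotz_nth [simp]: "rotz \<alpha> x $ 1 = cos \<alpha> * x$1 - sin \<alpha> * x$2" "rotz \<alpha> x $ 2 = sin \<alpha> * x$1 + cos \<alpha> * x$2"
  "rotz \<alpha> x $ 3 = x$3"
  by (simp_all add: rotz_def)

lemma rotz_add: "rotz \<alpha> (rotz \<beta> x) = rotz (\<alpha> + \<beta>) x"
  by (simp add: vec_eq_iff forall_3 cos_add sin_add algebra_simps)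

lemma rotz_0 [simp]: "rotz 0 x = x"
  by (simp add: vec_eq_iff forall_3)

lemma linear_rotz: "linear (rotz \<alpha>)"
  by (rule linearI) (simp_all add: vec_eq_iff forall_3 algebra_simps)

lemma norm_rotz [simp]: "norm (rotz \<alpha> x) = norm x"
proof -
  have "(cos \<alpha> * x$1 - sin \<alpha> * x$2)\<^sup>2 + (sin \<alpha> * x$1 + cos \<alpha> * x$2)\<^sup>2 = ((cos \<alpha>)\<^sup>2 + (sin \<alpha>)\<^sup>2) * ((x$1)\<^sup>2 + (x$2)\<^sup>2)"
    by algebra
  then show ?thesis by (simp add: norm_vec_def L2_set_def sum_3)
qed

lemma planar_rotz: "planar (rotz \<alpha> x) = cis \<alpha> * planar x"
  by (simp add: planar_def complex_eq_iff)

lemma norm_planar_le: "norm (planar x) \<le> norm x"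
  by (simp add: planar_def complex_norm norm_vec_def L2_set_def sum_3)

lemma borel_measurable_linear_euclidean:
  fixes f :: "'a::euclidean_space \<Rightarrow> 'b::real_normed_vector"
  assumes "linear f" shows "f \<in> borel_measurable borel"
  by (rule borel_measurable_continuous_onI, rule linear_continuous_on) (simp add: linear_conv_bounded_linear[symmetric] assms)

lemma measurable_rotz [measurable]: "rotz \<alpha> \<in> borel_measurable borel"
  by (rule borel_measurable_linear_euclidean[OF linear_rotz])

lemma measurable_planar [measurable]: "planar \<in> borel_measurable borel"
proof (rule borel_measurable_linear_euclidean)
  show "linear planar" by (rule linearI) (simp_all add: planar_def complex_eq_iff)
qed

text \<open>It suffices to test boxes. The preimage of a box is its image under the inverse
  rotation, an orthogonal map, which preserves Lebesgue measure.\<close>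

lemma distr_lborel_rotz: "distr lborel borel (rotz \<alpha>) = lborel"
proof (rule lborel_eqI[symmetric])
  fix l u :: "real^3" assume le: "\<And>b. b \<in> Basis \<Longrightarrow> l \<bullet> b \<le> u \<bullet> b"
  have ot: "orthogonal_transformation (rotz (- \<alpha>))"
    by (simp add: orthogonal_transformation linear_rotz)
  have im: "rotz \<alpha> -` box l u = rotz (- \<alpha>) ` box l u"
  proof (intro set_eqI iffI)
    fix x assume "x \<in> rotz \<alpha> -` box l u"
    then have "x = rotz (- \<alpha>) (rotz \<alpha> x)" "rotz \<alpha> x \<in> box l u" by (simp_all add: rotz_add)
    then show "x \<in> rotz (- \<alpha>) ` box l u" by blast
  qed (auto simp: rotz_add)
  have "emeasure (distr lborel borel (rotz \<alpha>)) (box l u) = emeasure lborel (rotz (- \<alpha>) ` box l u)"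
    by (subst emeasure_distr) (auto simp: im)
  also have "\<dots> = emeasure lebesgue (rotz (- \<alpha>) ` box l u)"
    using im measurable_sets[OF measurable_rotz, of "box l u" \<alpha>] by (simp add: emeasure_completion)
  also have "\<dots> = ennreal (measure lebesgue (rotz (- \<alpha>) ` box l u))"
    by (rule emeasure_eq_ennreal_measure, rule fmeasurableD2, rule measurable_orthogonal_image[OF ot]) simp
  also have "\<dots> = ennreal (measure lebesgue (box l u))"
    by (subst measure_orthogonal_image[OF ot]) simp_all
  also have "\<dots> = (\<Prod>b\<in>Basis. (u - l) \<bullet> b)"
    using le by (simp add: measure_completion measure_lborel_box_eq)
  finally show "emeasure (distr lborel borel (rotz \<alpha>)) (box l u) = ennreal (\<Prod>b\<in>Basis. (u - l) \<bullet> b)" .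
qed simp

lemma nn_integral_sphere_rotz:
  fixes H :: "real^3 \<Rightarrow> ennreal"
  assumes [measurable]: "H \<in> borel_measurable borel"
  shows "(\<integral>\<^sup>+\<omega>. H (rotz \<alpha> \<omega>) \<partial>sphere_measure) = (\<integral>\<^sup>+\<omega>. H \<omega> \<partial>sphere_measure)"
proof -
  have "(\<integral>\<^sup>+\<omega>. H \<omega> \<partial>sphere_measure) = (\<integral>\<^sup>+y. H (y /\<^sub>R norm y) * indicator (cball 0 1) y \<partial>distr lborel borel (rotz \<alpha>))"
    by (simp add: nn_integral_sphere distr_lborel_rotz)
  also have "\<dots> = (\<integral>\<^sup>+y. H (rotz \<alpha> y /\<^sub>R norm (rotz \<alpha> y)) * indicator (cball 0 1) (rotz \<alpha> y) \<partial>lborel)"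
    by (rule nn_integral_distr) measurable
  also have "\<dots> = (\<integral>\<^sup>+y. H (rotz \<alpha> (y /\<^sub>R norm y)) * indicator (cball 0 1) y \<partial>lborel)"
    by (simp add: linear_cmul[OF linear_rotz] indicator_def)
  also have "\<dots> = (\<integral>\<^sup>+\<omega>. H (rotz \<alpha> \<omega>) \<partial>sphere_measure)"
    by (subst nn_integral_sphere) simp_all
  finally show ?thesis by simp
qed

lemma AE_norm_planar_le: "AE \<omega> in sphere_measure. norm (planar \<omega>) \<le> 1"
  using AE_sphere_measure by eventually_elim (metis norm_planar_le)

lemma integrable_sphere_bounded:
  fixes f :: "real^3 \<Rightarrow> real"
  assumes "f \<in> borel_measurable borel" "\<And>\<omega>. norm (planar \<omega>) \<le> 1 \<Longrightarrow> \<bar>f \<omega>\<bar> \<le> B"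
  shows "integrable sphere_measure f"
proof (rule sphere_measure.integrable_const_bound)
  show "AE \<omega> in sphere_measure. norm (f \<omega>) \<le> B"
    using AE_norm_planar_le by eventually_elim (simp add: assms(2))
  show "f \<in> borel_measurable sphere_measure"
    using assms(1) by (simp cong: measurable_cong_sets)
qed

text \<open>One third of the squared L2 norm, over the unit sphere, of Z^n, the spherical harmonic
  of highest weight.\<close>

definition equatorial :: "nat \<Rightarrow> real" where
  "equatorial n = (\<integral>\<omega>. norm (planar \<omega>) ^ (2 * n) \<partial>sphere_measure)"

lemma integrable_equatorial: "integrable sphere_measure (\<lambda>\<omega>. norm (planar \<omega>) ^ (2 * n))"
  by (rule integrable_sphere_bounded[where B=1]) (auto intro: power_le_one)

text \<open>The cone over the set contains a non-empty open set: the defining inequality is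
  homogeneous and strict, and the point \<open>axis 1 (1/2)\<close> of the equatorial plane
  satisfies it.\<close>

lemma sphere_measure_near_equator_pos:
  assumes "\<eta> > 0" shows "measure sphere_measure {\<omega>. norm (planar \<omega>) > 1 - \<eta>} > 0"
proof -
  let ?A = "{\<omega>. norm (planar \<omega>) > 1 - \<eta>}"
  let ?U = "{y::real^3. norm (planar y) > (1 - \<eta>) * norm y} \<inter> ball 0 1 \<inter> - {0}"
  have [measurable]: "?A \<in> sets borel" by measurable
  have cp: "continuous_on UNIV planar"
    by (rule linear_continuous_on, subst linear_conv_bounded_linear[symmetric], rule linearI) (simp_all add: planar_def complex_eq_iff)
  have "open ?U"
    by (intro open_Int open_Collect_less continuous_intros cp open_ball)
  moreover have "axis 1 (1/2) \<in> ?U"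
  proof -
    have "planar (axis 1 (1/2)) = Complex (1/2) 0" by (simp add: planar_def axis_def)
    moreover have "norm (axis 1 (1/2) :: real^3) = 1/2"
      by (simp add: norm_vec_def L2_set_def sum_3 axis_def)
    moreover have "(1 - \<eta>) * (1/2) < 1/2" using assms by simp
    ultimately show ?thesis by (simp add: complex_norm axis_eq_0_iff mult.assoc)
  qed
  ultimately have "\<not> negligible ?U" using open_not_negligible by blast
  then have "emeasure lborel ?U \<noteq> 0"
    using \<open>open ?U\<close> null_sets_completionI[of ?U lborel] by (auto simp: negligible_iff_null_sets null_sets_def)
  moreover have "emeasure lborel ?U \<le> emeasure sphere_measure ?A"
  proof -
    have "emeasure lborel ?U = (\<integral>\<^sup>+y. indicator ?U y \<partial>lborel)"
      using \<open>open ?U\<close> by simp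
    also have "\<dots> \<le> (\<integral>\<^sup>+y. indicator ?A (y /\<^sub>R norm y) * indicator (cball 0 1) y \<partial>lborel)"
    proof (rule nn_integral_mono)
      fix y :: "real^3"
      have "planar (y /\<^sub>R norm y) = planar y /\<^sub>R norm y" by (simp add: planar_def complex_eq_iff)
      then show "indicator ?U y \<le> (indicator ?A (y /\<^sub>R norm y) * indicator (cball 0 1) y :: ennreal)"
        by (auto simp: indicator_def field_simps)
    qed
    also have "\<dots> = emeasure sphere_measure ?A"
      by (subst nn_integral_sphere[symmetric]) simp_all
    finally show ?thesis .
  qed
  ultimately have "emeasure sphere_measure ?A \<noteq> 0" by auto
  then show ?thesis
    by (simp add: sphere_measure.emeasure_eq_measure zero_less_measure_iff)
qed

lemma equatorial_pos: "equatorial n > 0"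
proof -
  let ?A = "{\<omega>. norm (planar \<omega>) > 1 - 1/2}"
  have "0 < (1/2) ^ (2 * n) * measure sphere_measure ?A"
    using sphere_measure_near_equator_pos[of "1/2"] by simp
  also have "\<dots> = (\<integral>\<omega>. (1/2) ^ (2 * n) * indicator ?A \<omega> \<partial>sphere_measure)" by simp
  also have "\<dots> \<le> equatorial n"
    unfolding equatorial_def
    by (intro integral_mono integrable_equatorial)
      (auto split: split_indicator intro!: power_mono simp: sphere_measure.emeasure_eq_measure less_top[symmetric])
  finally show ?thesis .
qed

text \<open>Outside the band the integrand is at most (1 - \<eta>)^(2n). On |Z| > 1 - \<eta>/2, a
  set of positive measure, it is at least (1 - \<eta>/2)^(2n). The ratio of the two is q^n and tends
  to 0, so the outer part is eventually at most half of the total.\<close>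

lemma equatorial_concentration:
  assumes "0 < \<eta>" "\<eta> < 1"
  shows "\<forall>\<^sub>F n in sequentially. equatorial n \<le> 2 * (\<integral>\<omega>. norm (planar \<omega>) ^ (2 * n) * indicator {\<omega>. norm (planar \<omega>) \<ge> 1 - \<eta>} \<omega> \<partial>sphere_measure)"
proof -
  define \<mu> where "\<mu> = measure sphere_measure {\<omega>. norm (planar \<omega>) > 1 - \<eta> / 2}"
  define M where "M = measure sphere_measure UNIV"
  define q where "q = ((1 - \<eta>) / (1 - \<eta> / 2))\<^sup>2"
  have \<mu>: "\<mu> > 0" unfolding \<mu>_def using assms by (intro sphere_measure_near_equator_pos) auto
  have q: "0 \<le> q" "q < 1"
    unfolding q_def using assms by (auto simp: power_less_one_iff abs_square_less_1)
  have "(\<lambda>n. M * q ^ n) \<longlonglongrightarrow> M * 0"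
    using q by (intro tendsto_intros LIMSEQ_realpow_zero) auto
  then have "\<forall>\<^sub>F n in sequentially. M * q ^ n < \<mu> / 2"
    using \<mu> order_tendstoD(2)[of "\<lambda>n. M * q ^ n" 0 sequentially "\<mu> / 2"] by simp
  then show ?thesis
  proof eventually_elim
    case (elim n)
    let ?f = "\<lambda>\<omega>. norm (planar \<omega>) ^ (2 * n)"
    let ?N = "{\<omega>. norm (planar \<omega>) \<ge> 1 - \<eta>}"
    have i1: "integrable sphere_measure (\<lambda>\<omega>. ?f \<omega> * indicator ?N \<omega>)"
      by (rule integrable_sphere_bounded[where B=1]) (auto split: split_indicator intro: power_le_one)
    have i2: "integrable sphere_measure (\<lambda>\<omega>. ?f \<omega> * indicator (- ?N) \<omega>)"
      by (rule integrable_sphere_bounded[where B=1]) (auto split: split_indicator intro: power_le_one)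
    have "equatorial n = (\<integral>\<omega>. ?f \<omega> * indicator ?N \<omega> + ?f \<omega> * indicator (- ?N) \<omega> \<partial>sphere_measure)"
      unfolding equatorial_def by (rule Bochner_Integration.integral_cong) (auto split: split_indicator)
    also have "\<dots> = (\<integral>\<omega>. ?f \<omega> * indicator ?N \<omega> \<partial>sphere_measure) + (\<integral>\<omega>. ?f \<omega> * indicator (- ?N) \<omega> \<partial>sphere_measure)"
      by (rule Bochner_Integration.integral_add[OF i1 i2])
    also have "(\<integral>\<omega>. ?f \<omega> * indicator (- ?N) \<omega> \<partial>sphere_measure) \<le> (\<integral>\<omega>. (1 - \<eta>) ^ (2 * n) \<partial>sphere_measure)"
      using assms by (intro integral_mono i2) (auto split: split_indicator intro!: power_mono)
    also have "\<dots> = (1 - \<eta> / 2) ^ (2 * n) * (M * q ^ n)"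
    proof -
      have "(1 - \<eta> / 2)\<^sup>2 * q = (1 - \<eta>)\<^sup>2"
        unfolding q_def power_mult_distrib[symmetric] using assms by simp
      then have "(1 - \<eta>) ^ (2 * n) = (1 - \<eta> / 2) ^ (2 * n) * q ^ n"
        by (simp add: power_mult power_mult_distrib[symmetric])
      then show ?thesis by (simp add: M_def mult_ac)
    qed
    also have "\<dots> \<le> (1 - \<eta> / 2) ^ (2 * n) * (\<mu> / 2)"
      using elim by (intro mult_left_mono) auto
    also have "\<dots> = (\<integral>\<omega>. (1 - \<eta> / 2) ^ (2 * n) * indicator {\<omega>. norm (planar \<omega>) > 1 - \<eta> / 2} \<omega> \<partial>sphere_measure) / 2"
      by (simp add: \<mu>_def)
    also have "\<dots> \<le> equatorial n / 2"
      unfolding equatorial_def using assms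
      by (intro divide_right_mono integral_mono integrable_equatorial)
        (auto split: split_indicator intro!: power_mono simp: sphere_measure.emeasure_eq_measure less_top[symmetric])
    finally show ?case by simp
  qed
qed

lemma distr_sphere_rotz: "distr sphere_measure borel (rotz \<alpha>) = sphere_measure"
proof (rule measure_eqI)
  fix A assume "A \<in> sets (distr sphere_measure borel (rotz \<alpha>))"
  then have [measurable]: "A \<in> sets borel" by simp
  have "emeasure (distr sphere_measure borel (rotz \<alpha>)) A = (\<integral>\<^sup>+\<omega>. indicator A \<omega> \<partial>distr sphere_measure borel (rotz \<alpha>))" by simp
  also have "\<dots> = (\<integral>\<^sup>+\<omega>. indicator A (rotz \<alpha> \<omega>) \<partial>sphere_measure)" by (rule nn_integral_distr) measurable
  also have "\<dots> = (\<integral>\<^sup>+\<omega>. indicator A \<omega> \<partial>sphere_measure)" by (rule nn_integral_sphere_rotz) measurable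
  finally show "emeasure (distr sphere_measure borel (rotz \<alpha>)) A = emeasure sphere_measure A" by simp
qed simp

lemma integral_sphere_rotz:
  fixes f :: "real^3 \<Rightarrow> real"
  assumes [measurable]: "f \<in> borel_measurable borel"
  shows "(\<integral>\<omega>. f (rotz \<alpha> \<omega>) \<partial>sphere_measure) = (\<integral>\<omega>. f \<omega> \<partial>sphere_measure)"
proof -
  have "(\<integral>\<omega>. f \<omega> \<partial>distr sphere_measure borel (rotz \<alpha>)) = (\<integral>\<omega>. f (rotz \<alpha> \<omega>) \<partial>sphere_measure)"
    by (rule integral_distr) measurable
  then show ?thesis by (simp add: distr_sphere_rotz)
qed

section \<open>Concentration at one longitude\<close>

lemma norm_cis_diff_le: "norm (cis a - cis b) \<le> \<bar>a - b\<bar>"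
proof -
  have d: "((\<lambda>x. exp (\<i> * of_real x)) has_vector_derivative \<i> * exp (\<i> * of_real x)) (at x)" for x
  proof -
    have "((\<lambda>z. exp (\<i> * z)) has_field_derivative \<i> * exp (\<i> * of_real x)) (at (of_real x))"
      by (auto intro!: derivative_eq_intros)
    from has_vector_derivative_real_field[OF this] show ?thesis by simp
  qed
  have "norm (exp (\<i> * complex_of_real a) - exp (\<i> * of_real b)) \<le> 1 * norm (a - b)"
  proof (rule differentiable_bound[of UNIV _ "\<lambda>x v. v *\<^sub>R (\<i> * exp (\<i> * of_real x))"])
    show "((\<lambda>x. exp (\<i> * complex_of_real x)) has_derivative (\<lambda>v. v *\<^sub>R (\<i> * exp (\<i> * of_real x)))) (at x within UNIV)" for x
      using d[of x] by (simp add: has_vector_derivative_def)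
    show "onorm (\<lambda>v. v *\<^sub>R (\<i> * exp (\<i> * complex_of_real x))) \<le> 1" for x
      by (rule onorm_le) (simp add: norm_mult norm_exp_i_times)
  qed auto
  then show ?thesis by (simp add: cis_conv_exp)
qed

text \<open>The angle \<psi> in [0, 2 pi) turns Z onto the positive real axis. Rounding it down to a
  multiple of 2 pi/N costs at most 2 pi/N, and the modulus is off by at most \<eta>.\<close>

lemma rotate_near_one:
  fixes Z :: complex
  assumes "norm Z \<le> 1" "norm Z \<ge> 1 - \<eta>" "N > 0"
  shows "\<exists>j<N. norm (cis (2 * pi * real j / real N) * Z - 1) \<le> \<eta> + 2 * pi / real N"
proof -
  define \<psi> where "\<psi> = - Arg Z + (if Arg Z > 0 then 2 * pi else 0)"
  have \<psi>: "0 \<le> \<psi>" "\<psi> < 2 * pi" using Arg_bounded[of Z] by (auto simp: \<psi>_def)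
  have cz: "cis \<psi> * Z = of_real (norm Z)"
  proof -
    have "cis \<psi> = cis (- Arg Z)" by (simp add: \<psi>_def complex_eq_iff)
    moreover have "Z = of_real (norm Z) * cis (Arg Z)"
      using rcis_cmod_Arg[of Z] by (simp add: rcis_def)
    ultimately show ?thesis by (metis cis_mult mult.assoc mult.left_commute add.left_inverse cis_zero mult_1_right)
  qed
  define j where "j = nat \<lfloor>\<psi> * real N / (2 * pi)\<rfloor>"
  have t0: "0 \<le> \<psi> * real N / (2 * pi)" using \<psi> by simp
  have jle: "real j \<le> \<psi> * real N / (2 * pi)" and jge: "\<psi> * real N / (2 * pi) < real j + 1"
    using t0 by (simp_all add: j_def of_nat_floor)
  have "\<psi> * real N / (2 * pi) < real N"
    using \<psi> assms(3) by (simp add: field_simps)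
  then have "j < N" using jle by linarith
  have "\<bar>2 * pi * real j / real N - \<psi>\<bar> \<le> 2 * pi / real N"
  proof -
    have "2 * pi * real j / real N \<le> \<psi>" using jle assms(3) by (simp add: field_simps)
    moreover have "\<psi> < 2 * pi * real j / real N + 2 * pi / real N" using jge assms(3) by (simp add: field_simps)
    ultimately show ?thesis by linarith
  qed
  then have 1: "norm (cis (2 * pi * real j / real N) * Z - cis \<psi> * Z) \<le> 2 * pi / real N"
  proof -
    assume h: "\<bar>2 * pi * real j / real N - \<psi>\<bar> \<le> 2 * pi / real N"
    have "norm (cis (2 * pi * real j / real N) * Z - cis \<psi> * Z) = norm (cis (2 * pi * real j / real N) - cis \<psi>) * norm Z"
      by (simp add: norm_mult[symmetric] left_diff_distrib)
    also have "\<dots> \<le> (2 * pi / real N) * 1"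
      using order_trans[OF norm_cis_diff_le h] assms(1) by (intro mult_mono) auto
    finally show ?thesis by simp
  qed
  have "norm (cis \<psi> * Z - 1) = \<bar>norm Z - 1\<bar>"
    unfolding cz by (metis norm_of_real of_real_1 of_real_diff)
  then have 2: "norm (cis \<psi> * Z - 1) \<le> \<eta>" using assms(1,2) by simp
  have "norm (cis (2 * pi * real j / real N) * Z - 1) \<le> norm (cis (2 * pi * real j / real N) * Z - cis \<psi> * Z) + norm (cis \<psi> * Z - 1)"
    using norm_triangle_ineq[of "cis (2 * pi * real j / real N) * Z - cis \<psi> * Z" "cis \<psi> * Z - 1"] by simp
  then show ?thesis using \<open>j < N\<close> 1 2 by (intro exI[of _ j]) auto
qed

text \<open>Parallelogram law: |1 + Z|^2 + |1 - Z|^2 = 2 + 2 |Z|^2, so what separates Z from 1 is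
  missing from the midpoint.\<close>

lemma half_sum_norm_le:
  fixes Z :: complex assumes "norm Z \<le> 1"
  shows "norm ((1 + Z) / 2) \<le> 1" "(norm ((1 + Z) / 2))\<^sup>2 \<le> 1 - (norm (Z - 1))\<^sup>2 / 4"
proof -
  have "norm (1 + Z) \<le> 2" using norm_triangle_ineq[of 1 Z] assms by simp
  then show "norm ((1 + Z) / 2) \<le> 1" by (simp add: norm_divide)
  have "(norm (1 + Z))\<^sup>2 + (norm (Z - 1))\<^sup>2 = 2 + 2 * (norm Z)\<^sup>2"
    unfolding cmod_power2 by (simp add: power2_eq_square algebra_simps)
  moreover have "(norm Z)\<^sup>2 \<le> 1" using assms by (simp add: power_le_one)
  ultimately show "(norm ((1 + Z) / 2))\<^sup>2 \<le> 1 - (norm (Z - 1))\<^sup>2 / 4"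
    by (simp add: norm_divide power_divide field_simps)
qed

text \<open>The squared modulus of Z^n ((1 + Z)/2)^K, a binomial superposition of the harmonics
  Z^(n+k). The power n confines it to the equator, and K confines it along the equator to the point
  Z = 1.\<close>

definition beam_weight :: "nat \<Rightarrow> nat \<Rightarrow> complex \<Rightarrow> real" where
  "beam_weight K n Z = norm Z ^ (2 * n) * norm ((1 + Z) / 2) ^ (2 * K)"

lemma beam_weight_measurable [measurable]: "beam_weight K n \<in> borel_measurable borel"
  unfolding beam_weight_def[abs_def] by (intro borel_measurable_continuous_onI continuous_intros) auto

lemma beam_weight_nonneg: "beam_weight K n Z \<ge> 0" by (simp add: beam_weight_def)

lemma beam_weight_le: "norm Z \<le> 1 \<Longrightarrow> beam_weight K n Z \<le> norm Z ^ (2 * n)"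
  using half_sum_norm_le(1)[of Z] by (simp add: beam_weight_def mult_left_le power_le_one)

lemma beam_weight_le_1: "norm Z \<le> 1 \<Longrightarrow> \<bar>beam_weight K n Z\<bar> \<le> 1"
  using beam_weight_le[of Z K n] power_le_one[of "norm Z" "2 * n"] beam_weight_nonneg[of K n Z] by simp

text \<open>K and C depend on \<epsilon> alone, since K is fixed before the frequency n. Averaging
  over N rotations compares the mass J of the weight with that of |Z|^(2n): near the equator some
  rotated point is close to 1, where the factor with exponent 2K is at least \<kappa>^(2K), so
  \<open>equatorial n\<close> is at most C J. At distance \<epsilon> from 1 that factor is at most
  q^K with q < \<kappa>^2, and a large K makes the far part at most J/2.\<close>

theorem angular_concentration:
  assumes e: "0 < \<epsilon>" "\<epsilon> \<le> 1"
  shows "\<exists>K. \<exists>C>0. \<forall>\<^sub>F n in sequentially.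
    (\<integral>\<omega>. beam_weight K n (planar \<omega>) \<partial>sphere_measure)
        \<le> 2 * (\<integral>\<omega>. beam_weight K n (planar \<omega>) * indicator {\<omega>. norm (planar \<omega> - 1) < \<epsilon>} \<omega> \<partial>sphere_measure) \<and>
    equatorial n \<le> C * (\<integral>\<omega>. beam_weight K n (planar \<omega>) \<partial>sphere_measure)"
proof -
  \<comment> \<open>A rotated point Y with |Y - 1| \<le> \<epsilon>^2/8 has |1 + Y|/2 \<ge>
    \<kappa>, whereas |Z - 1| \<ge> \<epsilon> gives |1 + Z|^2/4 \<le> 1 - \<epsilon>^2/4. Working
    at the quadratic scale \<epsilon>^2 near the equator is what makes the second bound smaller than
    \<kappa>^2.\<close>
  define \<kappa> where "\<kappa> = 1 - \<epsilon>\<^sup>2 / 16"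
  have e2: "0 < \<epsilon>\<^sup>2" "\<epsilon>\<^sup>2 \<le> 1" using e by (simp_all add: power_le_one)
  have k: "0 < \<kappa>" "\<kappa> \<le> 1" using e2 by (simp_all add: \<kappa>_def)
  define q where "q = 1 - \<epsilon>\<^sup>2 / 4"
  have "\<kappa>\<^sup>2 > q"
  proof -
    have "\<kappa>\<^sup>2 = 1 - \<epsilon>\<^sup>2 / 8 + (\<epsilon>\<^sup>2 / 16)\<^sup>2" by (simp add: \<kappa>_def power2_eq_square algebra_simps)
    then show ?thesis using e2 zero_le_power2[of "\<epsilon>\<^sup>2 / 16"] unfolding q_def by linarith
  qed
  have q0: "q \<ge> 0" using e2 by (simp add: q_def)
  obtain N :: nat where N: "real N > 32 * pi / \<epsilon>\<^sup>2" using reals_Archimedean2 by blast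
  have "0 < 32 * pi / \<epsilon>\<^sup>2" using e2 by simp
  then have N0: "N > 0" using N by (cases N) auto
  have Nb: "2 * pi / real N \<le> \<epsilon>\<^sup>2 / 16" using N N0 e2 by (simp add: field_simps)
  \<comment> \<open>With C = 2N/\<kappa>^(2K) the far part is at most q^K C J = 2N (q/\<kappa>^2)^K
    J, which has to be at most J/2; this explains the factor 4N.\<close>
  have "(\<lambda>K. 4 * real N * (q / \<kappa>\<^sup>2) ^ K) \<longlonglongrightarrow> 4 * real N * 0"
    using \<open>\<kappa>\<^sup>2 > q\<close> q0 k by (intro tendsto_intros LIMSEQ_realpow_zero) auto
  then obtain K where K: "4 * real N * (q / \<kappa>\<^sup>2) ^ K < 1"
    using order_tendstoD(2)[of _ "4 * real N * 0" sequentially 1] by (auto simp: eventually_sequentially)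
  define C where "C = 2 * real N / \<kappa> ^ (2 * K)"
  have C0: "C > 0" using N0 k by (simp add: C_def)
  have "0 < \<epsilon>\<^sup>2 / 16" "\<epsilon>\<^sup>2 / 16 < 1" using e2 by auto
  from equatorial_concentration[OF this]
  have "\<forall>\<^sub>F n in sequentially.
    (\<integral>\<omega>. beam_weight K n (planar \<omega>) \<partial>sphere_measure)
        \<le> 2 * (\<integral>\<omega>. beam_weight K n (planar \<omega>) * indicator {\<omega>. norm (planar \<omega> - 1) < \<epsilon>} \<omega> \<partial>sphere_measure) \<and>
    equatorial n \<le> C * (\<integral>\<omega>. beam_weight K n (planar \<omega>) \<partial>sphere_measure)"
  proof eventually_elim
    case (elim n)
    let ?W = "\<lambda>\<omega>. beam_weight K n (planar \<omega>)"
    let ?E = "{\<omega>. norm (planar \<omega>) \<ge> 1 - \<epsilon>\<^sup>2 / 16}"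
    let ?A = "{\<omega>. norm (planar \<omega> - 1) < \<epsilon>}"
    let ?rot = "\<lambda>j. rotz (2 * pi * real j / real N)"
    define J where "J = (\<integral>\<omega>. ?W \<omega> \<partial>sphere_measure)"
    have iW: "integrable sphere_measure (\<lambda>\<omega>. ?W (rotz \<alpha> \<omega>))" for \<alpha>
      by (rule integrable_sphere_bounded[where B=1]) (measurable, simp add: planar_rotz beam_weight_le_1 norm_mult)
    have iW0: "integrable sphere_measure ?W" using iW[of 0] by simp
    have iE: "integrable sphere_measure (\<lambda>\<omega>. norm (planar \<omega>) ^ (2 * n) * indicator ?E \<omega>)"
      by (rule integrable_sphere_bounded[where B=1]) (auto split: split_indicator intro: power_le_one)
    have iA: "integrable sphere_measure (\<lambda>\<omega>. ?W \<omega> * indicator ?A \<omega>)" "integrable sphere_measure (\<lambda>\<omega>. ?W \<omega> * indicator (- ?A) \<omega>)"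
      by (rule integrable_sphere_bounded[where B=1]; auto split: split_indicator intro: beam_weight_le_1)+
    have "(\<integral>\<omega>. \<kappa> ^ (2 * K) * (norm (planar \<omega>) ^ (2 * n) * indicator ?E \<omega>) \<partial>sphere_measure)
        \<le> (\<integral>\<omega>. (\<Sum>j<N. ?W (?rot j \<omega>)) \<partial>sphere_measure)"
    proof (rule integral_mono_AE)
      show "AE \<omega> in sphere_measure. \<kappa> ^ (2 * K) * (norm (planar \<omega>) ^ (2 * n) * indicator ?E \<omega>) \<le> (\<Sum>j<N. ?W (?rot j \<omega>))"
        using AE_norm_planar_le
      proof eventually_elim
        case (elim \<omega>)
        let ?Z = "planar \<omega>"
        have nn: "0 \<le> (\<Sum>j<N. ?W (?rot j \<omega>))" by (intro sum_nonneg beam_weight_nonneg)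
        show ?case
        proof (cases "\<omega> \<in> ?E")
          case True
          then have zE: "norm ?Z \<ge> 1 - \<epsilon>\<^sup>2 / 16" by simp
          obtain j where j: "j < N" "norm (cis (2 * pi * real j / real N) * ?Z - 1) \<le> \<epsilon>\<^sup>2 / 16 + 2 * pi / real N"
            using rotate_near_one[OF elim zE N0] by blast
          define Y where "Y = cis (2 * pi * real j / real N) * ?Z"
          have "norm (Y - 1) \<le> \<epsilon>\<^sup>2 / 8" using j(2) Nb by (simp add: Y_def)
          then have "norm (1 + Y) \<ge> 2 * \<kappa>"
            using norm_triangle_ineq2[of 2 "1 - Y"] by (simp add: \<kappa>_def norm_minus_commute)
          then have "\<kappa> \<le> norm ((1 + Y) / 2)" by (simp add: norm_divide)
          then have "\<kappa> ^ (2 * K) \<le> norm ((1 + Y) / 2) ^ (2 * K)" using k by (intro power_mono) auto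
          then have "\<kappa> ^ (2 * K) * norm ?Z ^ (2 * n) \<le> norm ((1 + Y) / 2) ^ (2 * K) * norm ?Z ^ (2 * n)"
            by (rule mult_right_mono) simp
          also have "\<dots> = ?W (?rot j \<omega>)"
            unfolding beam_weight_def planar_rotz by (simp add: Y_def norm_mult mult.commute)
          also have "\<dots> \<le> (\<Sum>j<N. ?W (?rot j \<omega>))"
            by (rule member_le_sum) (use j in \<open>auto simp: beam_weight_nonneg\<close>)
          finally show ?thesis using True by simp
        qed (use nn in simp)
      qed
    qed (auto intro!: iE iW)
    also have "\<dots> = (\<Sum>j<N. (\<integral>\<omega>. ?W (?rot j \<omega>) \<partial>sphere_measure))"
      by (rule Bochner_Integration.integral_sum) (rule iW)
    also have "\<dots> = real N * J"
      unfolding J_def by (subst integral_sphere_rotz) simp_all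
    finally have "\<kappa> ^ (2 * K) * (\<integral>\<omega>. norm (planar \<omega>) ^ (2 * n) * indicator ?E \<omega> \<partial>sphere_measure) \<le> real N * J" by simp
    then have "(\<integral>\<omega>. norm (planar \<omega>) ^ (2 * n) * indicator ?E \<omega> \<partial>sphere_measure) \<le> real N * J / \<kappa> ^ (2 * K)"
      using k by (simp add: field_simps)
    then have eJ: "equatorial n \<le> C * J" using elim by (simp add: C_def)
    have "J = (\<integral>\<omega>. ?W \<omega> * indicator ?A \<omega> + ?W \<omega> * indicator (- ?A) \<omega> \<partial>sphere_measure)"
      unfolding J_def by (rule Bochner_Integration.integral_cong) (auto split: split_indicator)
    also have "\<dots> = (\<integral>\<omega>. ?W \<omega> * indicator ?A \<omega> \<partial>sphere_measure) + (\<integral>\<omega>. ?W \<omega> * indicator (- ?A) \<omega> \<partial>sphere_measure)"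
      by (rule Bochner_Integration.integral_add[OF iA])
    also have "(\<integral>\<omega>. ?W \<omega> * indicator (- ?A) \<omega> \<partial>sphere_measure) \<le> (\<integral>\<omega>. q ^ K * norm (planar \<omega>) ^ (2 * n) \<partial>sphere_measure)"
    proof (rule integral_mono_AE[OF iA(2)])
      show "integrable sphere_measure (\<lambda>\<omega>. q ^ K * norm (planar \<omega>) ^ (2 * n))"
        by (intro integrable_mult_right integrable_equatorial)
      show "AE \<omega> in sphere_measure. ?W \<omega> * indicator (- ?A) \<omega> \<le> q ^ K * norm (planar \<omega>) ^ (2 * n)"
        using AE_norm_planar_le
      proof eventually_elim
        case (elim \<omega>)
        show ?case
        proof (cases "\<omega> \<in> ?A")
          case False
          then have "norm (planar \<omega> - 1) \<ge> \<epsilon>" by simp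
          then have "(norm (planar \<omega> - 1))\<^sup>2 \<ge> \<epsilon>\<^sup>2" using e by (intro power_mono) auto
          then have "(norm ((1 + planar \<omega>) / 2))\<^sup>2 \<le> q"
            using half_sum_norm_le(2)[OF elim] by (simp add: q_def)
          then have "((norm ((1 + planar \<omega>) / 2))\<^sup>2) ^ K \<le> q ^ K" by (rule power_mono) simp
          then have "norm ((1 + planar \<omega>) / 2) ^ (2 * K) \<le> q ^ K" by (simp only: power_mult)
          then have "norm (planar \<omega>) ^ (2 * n) * norm ((1 + planar \<omega>) / 2) ^ (2 * K) \<le> norm (planar \<omega>) ^ (2 * n) * q ^ K"
            by (rule mult_left_mono) simp
          then show ?thesis using False by (simp add: beam_weight_def mult.commute)
        qed (use q0 in simp)
      qed
    qed
    also have "\<dots> = q ^ K * equatorial n" by (simp add: equatorial_def)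
    also have "\<dots> \<le> q ^ K * (C * J)" using eJ q0 by (intro mult_left_mono) auto
    also have "\<dots> = (2 * real N * (q / \<kappa>\<^sup>2) ^ K) * J" by (simp add: C_def power_divide power_mult)
    also have "\<dots> \<le> 1/2 * J"
      using K equatorial_pos[of n] eJ C0 by (intro mult_right_mono) (auto simp: zero_less_mult_iff dest: less_le_trans)
    finally have "J \<le> 2 * (\<integral>\<omega>. ?W \<omega> * indicator ?A \<omega> \<partial>sphere_measure)" by simp
    then show ?case using eJ by (simp add: J_def)
  qed
  then show ?thesis using C0 by blast
qed

section \<open>The wave equation with potential in one space dimension\<close>

lemma chain_vector_derivative:
  assumes "(f has_derivative D) (at (\<gamma> s))" "(\<gamma> has_vector_derivative v) (at s)"
  shows "((\<lambda>s. f (\<gamma> s)) has_vector_derivative D v) (at s)"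
  using vector_derivative_diff_chain_within[of \<gamma> v s UNIV f D, OF assms(2) has_derivative_at_withinI[OF assms(1)]]
  by (simp add: o_def)

text \<open>Rescaling to the fixed interval [0, 1] moves the upper limit t into the integrand, the
  form required by \<open>Cdiff_integral\<close>, and treats both signs of t at once.\<close>

lemma integral_scaled_derivative:
  fixes \<phi> :: "real \<Rightarrow> 'a::banach"
  assumes "\<And>s. (\<Phi> has_vector_derivative \<phi> s) (at s)"
  shows "integral {0..1} (\<lambda>\<theta>. t *\<^sub>R \<phi> (t * \<theta>)) = \<Phi> t - \<Phi> 0"
proof -
  have "((\<lambda>\<theta>. t *\<^sub>R \<phi> (t * \<theta>)) has_integral \<Phi> (t * 1) - \<Phi> (t * 0)) {0..1}"
  proof (rule fundamental_theorem_of_calculus)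
    fix \<theta> :: real
    have "((\<lambda>\<theta>. t * \<theta>) has_vector_derivative t) (at \<theta>)"
      by (auto intro!: derivative_eq_intros)
    then have "((\<lambda>\<theta>. \<Phi> (t * \<theta>)) has_vector_derivative t *\<^sub>R \<phi> (t * \<theta>)) (at \<theta>)"
      using assms[of "t * \<theta>"] unfolding has_vector_derivative_def
      by (rule_tac chain_vector_derivative[unfolded has_vector_derivative_def,
            where D="\<lambda>v. v *\<^sub>R \<phi> (t * \<theta>)"]) auto
    then show "((\<lambda>\<theta>. \<Phi> (t * \<theta>)) has_vector_derivative t *\<^sub>R \<phi> (t * \<theta>)) (at \<theta> within {0..1})"
      by (rule has_vector_derivative_at_within)
  qed simp
  from integral_unique[OF this] show ?thesis by (simp only: mult_1_right mult_zero_right)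
qed

lemma Cdiff_fst_compose: "open S \<Longrightarrow> Cdiff k S f \<Longrightarrow> Cdiff k S (\<lambda>x. fst (f x))"
  by (rule Cdiff_linear_compose[OF _ bounded_linear_fst])

lemma Cdiff_snd_compose: "open S \<Longrightarrow> Cdiff k S f \<Longrightarrow> Cdiff k S (\<lambda>x. snd (f x))"
  by (rule Cdiff_linear_compose[OF _ bounded_linear_snd])

text \<open>The solution with zero data at \<open>t = 0\<close> of the transport equation
  \<open>(\<partial>\<^sub>t - c \<partial>\<^sub>x) P = G\<close>.\<close>

definition transport :: "real \<Rightarrow> (real \<times> real \<Rightarrow> complex) \<Rightarrow> real \<times> real \<Rightarrow> complex" where
  "transport c G p = integral {0..1} (\<lambda>\<theta>. fst p *\<^sub>R G (fst p * \<theta>, snd p + c * (fst p * (1 - \<theta>))))"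

lemma Cdiff_transport:
  assumes "Cdiff k UNIV G" shows "Cdiff k UNIV (transport c G)"
proof -
  have f: "Cdiff k UNIV (\<lambda>y::(real \<times> real) \<times> real. fst (fst y))"
    and s: "Cdiff k UNIV (\<lambda>y::(real \<times> real) \<times> real. snd (fst y))"
    and z: "Cdiff k UNIV (\<lambda>y::(real \<times> real) \<times> real. snd y)"
    by (rule Cdiff_fst_compose Cdiff_snd_compose Cdiff_ident Cdiff_fst Cdiff_snd open_UNIV)+
  have "Cdiff k UNIV (\<lambda>y::(real \<times> real) \<times> real. (fst (fst y) * snd y, snd (fst y) + c * (fst (fst y) * (1 - snd y))))"
    by (rule Cdiff_Pair Cdiff_add Cdiff_mult Cdiff_diff Cdiff_const f s z open_UNIV)+
  from Cdiff_compose[OF open_UNIV open_UNIV subset_UNIV assms this]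
  have "Cdiff k UNIV (\<lambda>y. fst (fst y) *\<^sub>R G (fst (fst y) * snd y, snd (fst y) + c * (fst (fst y) * (1 - snd y))))"
    by (rule Cdiff_scaleR[OF open_UNIV f])
  from Cdiff_integral[OF this] show ?thesis
    unfolding transport_def[abs_def] by (simp only: fst_conv snd_conv)
qed

lemma continuous_on_transport: "continuous_on UNIV G \<Longrightarrow> continuous_on UNIV (transport c G)"
  using Cdiff_transport[of 0] by simp

lemma transport_0 [simp]: "transport c G (0, x) = 0"
  by (simp add: transport_def)

lemma transport_integrable:
  fixes G :: "real \<times> real \<Rightarrow> complex"
  assumes "continuous_on UNIV G"
  shows "(\<lambda>\<theta>. t *\<^sub>R G (t * \<theta>, x + c * (t * (1 - \<theta>)))) integrable_on {0..1}"
  by (rule integrable_continuous_real) (intro continuous_intros continuous_on_compose2[OF assms] subset_UNIV)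

lemma transport_along_characteristic:
  assumes "continuous_on UNIV G"
  shows "((\<lambda>t. transport c G (t, y - c * t)) has_vector_derivative G (t, y - c * t)) (at t)"
proof -
  let ?\<phi> = "\<lambda>s. G (s, y - c * s)"
  have "isCont ?\<phi> s" for s
    by (rule continuous_on_interior[of UNIV]) (auto intro!: continuous_intros continuous_on_compose2[OF assms])
  then obtain \<Phi> where \<Phi>: "\<And>s. (\<Phi> has_vector_derivative ?\<phi> s) (at s)"
    using einterval_antiderivative[of "-\<infinity>" "\<infinity>" ?\<phi>] by auto
  have "transport c G (t, y - c * t) = \<Phi> t - \<Phi> 0" for t
    unfolding integral_scaled_derivative[OF \<Phi>, symmetric] transport_def
    by (rule Henstock_Kurzweil_Integration.integral_cong) (simp add: algebra_simps)
  moreover have "((\<lambda>t. \<Phi> t - \<Phi> 0) has_vector_derivative ?\<phi> t) (at t)"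
    using has_vector_derivative_diff[OF \<Phi> has_vector_derivative_const] by simp
  ultimately show ?thesis by simp
qed

lemma transport_equation:
  assumes "Cdiff (Suc 0) UNIV G"
  shows "frechet_derivative (transport c G) (at (t, x)) (1, - c) = G (t, x)"
proof -
  have "((\<lambda>s. (s, (x + c * t) - c * s)) has_vector_derivative (1, - c)) (at t)"
    by (auto intro!: derivative_eq_intros has_vector_derivative_Pair)
  from chain_vector_derivative[OF _ this, of "transport c G"]
  have "((\<lambda>s. transport c G (s, (x + c * t) - c * s)) has_vector_derivative
      frechet_derivative (transport c G) (at (t, x)) (1, - c)) (at t)"
    using Cdiff_has_derivative[OF Cdiff_transport[OF assms], of "(t, x)"] by simp
  moreover have "((\<lambda>s. transport c G (s, (x + c * t) - c * s)) has_vector_derivative G (t, x)) (at t)"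
    using transport_along_characteristic[of G c "x + c * t" t] Cdiff_imp_continuous_on[OF assms] by simp
  ultimately show ?thesis
    by (rule vector_derivative_unique_at)
qed

lemma transport_diff:
  assumes "continuous_on UNIV G" "continuous_on UNIV H"
  shows "transport c (\<lambda>p. G p - H p) p = transport c G p - transport c H p"
  unfolding transport_def
  using integral_diff[OF transport_integrable[OF assms(1)] transport_integrable[OF assms(2)]]
  by (simp add: scaleR_diff_right)

text \<open>Each integration in time turns |s|^n into |t|^(n+1)/(n+1); iterated, this produces the
  factorials that make Picard iteration converge on every strip.\<close>

lemma transport_bound:
  assumes "continuous_on UNIV G" "a \<ge> 0"
    "\<And>s y. \<bar>s\<bar> \<le> \<bar>t\<bar> \<Longrightarrow> norm (G (s, y)) \<le> a * \<bar>s\<bar> ^ n"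
  shows "norm (transport c G (t, x)) \<le> a * \<bar>t\<bar> ^ (n + 1) / (n + 1)"
proof -
  have "((\<lambda>\<theta>. (\<bar>t\<bar> * a * \<bar>t\<bar> ^ n) * \<theta> ^ n) has_integral (\<bar>t\<bar> * a * \<bar>t\<bar> ^ n) * (1 / (n + 1))) {0..1}"
  proof (rule has_integral_mult_right)
    have "((\<lambda>\<theta>::real. \<theta> ^ n) has_integral 1 ^ (n + 1) / (n + 1) - 0 ^ (n + 1) / (n + 1)) {0..1}"
    proof (rule fundamental_theorem_of_calculus)
      fix x :: real
      have "((\<lambda>x. x ^ Suc n) has_real_derivative real (Suc n) * x ^ n) (at x)"
        using DERIV_pow[of "Suc n" x] by simp
      from DERIV_cdivide[OF this, of "real n + 1"]
      have "((\<lambda>x. x ^ (n + 1) / (n + 1)) has_real_derivative x ^ n) (at x)"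
        by (simp add: add.commute)
      then show "((\<lambda>x. x ^ (n + 1) / (n + 1)) has_vector_derivative x ^ n) (at x within {0..1})"
        by (simp add: has_real_derivative_iff_has_vector_derivative has_vector_derivative_at_within)
    qed simp
    then show "((\<lambda>\<theta>::real. \<theta> ^ n) has_integral 1 / (n + 1)) {0..1}" by simp
  qed
  then have i: "((\<lambda>\<theta>. (\<bar>t\<bar> * a * \<bar>t\<bar> ^ n) * \<theta> ^ n) has_integral a * \<bar>t\<bar> ^ (n + 1) / (n + 1)) {0..1}"
    by (simp add: algebra_simps)
  have "norm (t *\<^sub>R G (t * \<theta>, x + c * (t * (1 - \<theta>)))) \<le> (\<bar>t\<bar> * a * \<bar>t\<bar> ^ n) * \<theta> ^ n"
    if "\<theta> \<in> {0..1}" for \<theta>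
  proof -
    have "norm (G (t * \<theta>, x + c * (t * (1 - \<theta>)))) \<le> a * \<bar>t * \<theta>\<bar> ^ n"
      using that by (intro assms(3)) (simp add: abs_mult mult_left_le)
    then show ?thesis
      using that mult_left_mono[of _ _ "\<bar>t\<bar>"] by (simp add: abs_mult power_mult_distrib mult.assoc)
  qed
  then have "norm (integral {0..1} (\<lambda>\<theta>. t *\<^sub>R G (t * \<theta>, x + c * (t * (1 - \<theta>)))))
      \<le> integral {0..1} (\<lambda>\<theta>. (\<bar>t\<bar> * a * \<bar>t\<bar> ^ n) * \<theta> ^ n)"
    by (intro integral_norm_bound_integral transport_integrable assms(1) has_integral_integrable[OF i])
  then show ?thesis
    unfolding integral_unique[OF i] by (simp only: transport_def fst_conv snd_conv)
qed

lemma transport_outside_cone: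
  assumes "\<And>t x. \<bar>x\<bar> \<ge> R + \<bar>t\<bar> \<Longrightarrow> G (t, x) = 0" "\<bar>c\<bar> \<le> 1" "\<bar>x\<bar> \<ge> R + \<bar>t\<bar>"
  shows "transport c G (t, x) = 0"
proof -
  have z: "G (t * \<theta>, x + c * (t * (1 - \<theta>))) = 0" if "\<theta> \<in> {0..1}" for \<theta>
  proof (rule assms(1))
    have "\<bar>c * (t * (1 - \<theta>))\<bar> \<le> 1 * (\<bar>t\<bar> * (1 - \<theta>))"
      unfolding abs_mult using that assms(2) by (intro mult_mono) auto
    moreover have "\<bar>t\<bar> * (1 - \<theta>) = \<bar>t\<bar> - \<bar>t * \<theta>\<bar>"
      using that by (simp add: abs_mult algebra_simps)
    ultimately show "\<bar>x + c * (t * (1 - \<theta>))\<bar> \<ge> R + \<bar>t * \<theta>\<bar>"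
      using assms(3) by linarith
  qed
  have "transport c G (t, x) = integral {0..1::real} (\<lambda>\<theta>. 0 :: complex)"
    unfolding transport_def by (rule Henstock_Kurzweil_Integration.integral_cong) (simp add: z)
  then show ?thesis by simp
qed

text \<open>The solution with zero Cauchy data at \<open>t = 0\<close> of \<open>e\<^sub>t\<^sub>t - e\<^sub>x\<^sub>x = G\<close>; its derivatives
  \<open>e\<^sub>t \<plusminus> e\<^sub>x\<close> are \<open>transport (\<plusminus>1) G\<close>.\<close>

definition duhamel :: "(real \<times> real \<Rightarrow> complex) \<Rightarrow> real \<times> real \<Rightarrow> complex" where
  "duhamel G = transport 0 (\<lambda>p. (1/2) *\<^sub>R (transport 1 G p + transport (-1) G p))"

lemma Cdiff_duhamel: "Cdiff k UNIV G \<Longrightarrow> Cdiff k UNIV (duhamel G)"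
  unfolding duhamel_def
  by (rule Cdiff_transport Cdiff_scaleR Cdiff_const Cdiff_add open_UNIV | assumption)+

text \<open>The t-derivative is the transport equation with speed 0. For the x-derivative, P_t - P_x
  = G = Q_t + Q_x gives (P + Q)_x = (P - Q)_t; after differentiation under the integral the
  integrand is thus a t-derivative, and P = Q = 0 at t = 0 leaves (P - Q)/2.\<close>

lemma duhamel_has_derivative:
  assumes G: "Cdiff (Suc 0) UNIV G"
  shows "(duhamel G has_derivative (\<lambda>v. fst v *\<^sub>R ((1/2) *\<^sub>R (transport 1 G p + transport (-1) G p))
      + snd v *\<^sub>R ((1/2) *\<^sub>R (transport 1 G p - transport (-1) G p)))) (at p)"
proof -
  obtain t x where p: "p = (t, x)" by (cases p)
  define P Q where "P = transport 1 G" and "Q = transport (-1) G"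
  define R where "R p = (1/2) *\<^sub>R (P p + Q p)" for p
  have P1: "Cdiff (Suc 0) UNIV P" and Q1: "Cdiff (Suc 0) UNIV Q"
    unfolding P_def Q_def by (intro Cdiff_transport G)+
  have R1: "Cdiff (Suc 0) UNIV R"
    unfolding R_def by (rule Cdiff_scaleR Cdiff_const Cdiff_add open_UNIV P1 Q1)+
  have e: "duhamel G = transport 0 R"
    by (simp add: duhamel_def R_def[abs_def] P_def Q_def)
  have dP: "(P has_derivative frechet_derivative P (at y)) (at y)" for y
    using Cdiff_has_derivative[OF P1] by simp
  have dQ: "(Q has_derivative frechet_derivative Q (at y)) (at y)" for y
    using Cdiff_has_derivative[OF Q1] by simp
  have dR: "(R has_derivative (\<lambda>v. (1/2) *\<^sub>R (frechet_derivative P (at y) v + frechet_derivative Q (at y) v))) (at y)" for y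
    unfolding R_def by (intro has_derivative_scaleR_right has_derivative_add dP dQ)
  let ?DR = "\<lambda>y. (1/2) *\<^sub>R (frechet_derivative P (at y) (0, 1) + frechet_derivative Q (at y) (0, 1))"
  have cP: "continuous_on UNIV (\<lambda>y. frechet_derivative P (at y) v)"
    and cQ: "continuous_on UNIV (\<lambda>y. frechet_derivative Q (at y) v)" for v
    using P1 Q1 by (metis differentiable_times_on.simps)+
  have DR_eq: "?DR y = (1/2) *\<^sub>R (frechet_derivative P (at y) (1, 0) - frechet_derivative Q (at y) (1, 0))" for y
  proof -
    obtain a b where y: "y = (a, b)" by (cases y)
    have "frechet_derivative P (at y) ((1, 0) - (0, 1)) = G y"
      using transport_equation[OF G, of 1 a b] by (simp add: P_def y)
    moreover have "frechet_derivative Q (at y) ((1, 0) + (0, 1)) = G y"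
      using transport_equation[OF G, of "-1" a b] by (simp add: Q_def y)
    ultimately have "frechet_derivative P (at y) (1, 0) - frechet_derivative P (at y) (0, 1)
        = frechet_derivative Q (at y) (1, 0) + frechet_derivative Q (at y) (0, 1)"
      using linear_diff[OF has_derivative_linear[OF dP]] linear_add[OF has_derivative_linear[OF dQ]] by metis
    then show ?thesis by (simp add: algebra_simps)
  qed
  have "((\<lambda>x. integral (cbox 0 1) (\<lambda>\<theta>. t *\<^sub>R R (t * \<theta>, x))) has_vector_derivative
      integral (cbox 0 1) (\<lambda>\<theta>. t *\<^sub>R ?DR (t * \<theta>, x))) (at x within UNIV)"
  proof (rule leibniz_rule_vector_derivative)
    fix x \<theta> :: real
    have "((\<lambda>x. (t * \<theta>, x)) has_vector_derivative (0, 1)) (at x)"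
      by (auto intro!: derivative_eq_intros has_vector_derivative_Pair)
    from chain_vector_derivative[OF dR this]
    have "((\<lambda>x. R (t * \<theta>, x)) has_vector_derivative ?DR (t * \<theta>, x)) (at x)" .
    from has_vector_derivative_scaleR[OF DERIV_const this, of t]
    show "((\<lambda>x. t *\<^sub>R R (t * \<theta>, x)) has_vector_derivative t *\<^sub>R ?DR (t * \<theta>, x)) (at x within UNIV)"
      by simp
    show "(\<lambda>\<theta>. t *\<^sub>R R (t * \<theta>, x)) integrable_on cbox 0 1"
      using transport_integrable[OF Cdiff_imp_continuous_on[OF R1], of t x 0] by simp
    show "continuous_on (UNIV \<times> cbox 0 1) (\<lambda>(x, \<theta>). t *\<^sub>R ?DR (t * \<theta>, x))"
      unfolding split_beta
      by (intro continuous_intros continuous_on_compose2[OF cP] continuous_on_compose2[OF cQ] subset_UNIV)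
  qed auto
  moreover have "integral (cbox 0 1) (\<lambda>\<theta>. t *\<^sub>R R (t * \<theta>, x)) = duhamel G (t, x)" for x
    by (simp add: e transport_def)
  moreover have "integral (cbox 0 1) (\<lambda>\<theta>. t *\<^sub>R ?DR (t * \<theta>, x)) = (1/2) *\<^sub>R (P (t, x) - Q (t, x))"
  proof -
    have "((\<lambda>s. (1/2) *\<^sub>R (P (s, x) - Q (s, x))) has_vector_derivative ?DR (s, x)) (at s)" for s
    proof -
      have l: "((\<lambda>s. (s, x)) has_vector_derivative (1, 0)) (at s)"
        by (auto intro!: derivative_eq_intros has_vector_derivative_Pair)
      show ?thesis
        unfolding DR_eq
        using has_vector_derivative_scaleR[OF DERIV_const has_vector_derivative_diff[OF
            chain_vector_derivative[OF dP l] chain_vector_derivative[OF dQ l]], of "1/2"] by simp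
    qed
    from integral_scaled_derivative[OF this, of t] show ?thesis
      by (simp add: P_def Q_def)
  qed
  ultimately have dx: "((\<lambda>x. duhamel G (t, x)) has_vector_derivative (1/2) *\<^sub>R (P (t, x) - Q (t, x))) (at x)"
    by simp
  have D: "(duhamel G has_derivative frechet_derivative (duhamel G) (at p)) (at p)"
    using Cdiff_has_derivative[OF Cdiff_duhamel[OF G]] by simp
  have "((\<lambda>x. (t, x)) has_vector_derivative (0, 1)) (at x)"
    by (auto intro!: derivative_eq_intros has_vector_derivative_Pair)
  from chain_vector_derivative[OF _ this, of "duhamel G"] D
  have "((\<lambda>x. duhamel G (t, x)) has_vector_derivative frechet_derivative (duhamel G) (at p) (0, 1)) (at x)"
    by (simp add: p)
  with dx have x1: "frechet_derivative (duhamel G) (at p) (0, 1) = (1/2) *\<^sub>R (P p - Q p)"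
    by (simp add: p vector_derivative_unique_at)
  have t1: "frechet_derivative (duhamel G) (at p) (1, 0) = R p"
    using transport_equation[OF R1, of 0 t x] by (simp add: e p)
  have lin: "linear (frechet_derivative (duhamel G) (at p))"
    using D by (rule has_derivative_linear)
  have "frechet_derivative (duhamel G) (at p) v = fst v *\<^sub>R R p + snd v *\<^sub>R ((1/2) *\<^sub>R (P p - Q p))" for v
  proof -
    have "v = fst v *\<^sub>R (1, 0) + snd v *\<^sub>R (0, 1)" by (simp add: prod_eq_iff)
    then have "frechet_derivative (duhamel G) (at p) v
      = fst v *\<^sub>R frechet_derivative (duhamel G) (at p) (1, 0) + snd v *\<^sub>R frechet_derivative (duhamel G) (at p) (0, 1)"
      by (metis linear_add[OF lin] linear_cmul[OF lin])
    then show ?thesis by (simp add: x1 t1)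
  qed
  then have "frechet_derivative (duhamel G) (at p) = (\<lambda>v. fst v *\<^sub>R R p + snd v *\<^sub>R ((1/2) *\<^sub>R (P p - Q p)))"
    by (rule ext)
  then show ?thesis
    using D unfolding R_def P_def Q_def by metis
qed

lemma duhamel_diff:
  assumes "continuous_on UNIV G" "continuous_on UNIV H"
  shows "duhamel (\<lambda>p. G p - H p) p = duhamel G p - duhamel H p"
proof -
  have c: "continuous_on UNIV (\<lambda>p. (1/2) *\<^sub>R (transport 1 G p + transport (-1) G p))"
    if "continuous_on UNIV G" for G
    by (intro continuous_intros continuous_on_transport that)
  show ?thesis
    unfolding duhamel_def transport_diff[OF c[OF assms(1)] c[OF assms(2)], symmetric]
    by (simp add: transport_diff[OF assms] algebra_simps)
qed

lemma duhamel_bound: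
  assumes "continuous_on UNIV G" "a \<ge> 0"
    "\<And>s y. \<bar>s\<bar> \<le> \<bar>t\<bar> \<Longrightarrow> norm (G (s, y)) \<le> a * \<bar>s\<bar> ^ n"
  shows "norm (duhamel G (t, x)) \<le> a * \<bar>t\<bar> ^ (n + 2) / ((n + 1) * (n + 2))"
proof -
  have "norm ((1/2) *\<^sub>R (transport 1 G (s, y) + transport (-1) G (s, y))) \<le> (a / (n + 1)) * \<bar>s\<bar> ^ (n + 1)"
    if "\<bar>s\<bar> \<le> \<bar>t\<bar>" for s y
  proof -
    have "norm (transport c G (s, y)) \<le> a * \<bar>s\<bar> ^ (n + 1) / (n + 1)" for c
      using that by (intro transport_bound assms) auto
    from this[of 1] this[of "-1"] norm_triangle_ineq[of "transport 1 G (s, y)" "transport (-1) G (s, y)"]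
    have "norm ((1/2) *\<^sub>R (transport 1 G (s, y) + transport (-1) G (s, y))) \<le> a * \<bar>s\<bar> ^ (n + 1) / (n + 1)"
      unfolding norm_scaleR by linarith
    then show ?thesis by simp
  qed
  from transport_bound[OF _ _ this, of t 0 x] assms(2) show ?thesis
    unfolding duhamel_def
    by (simp add: continuous_intros continuous_on_transport assms(1) algebra_simps)
qed

lemma duhamel_outside_cone:
  assumes "\<And>t x. \<bar>x\<bar> \<ge> R + \<bar>t\<bar> \<Longrightarrow> G (t, x) = 0" "\<bar>x\<bar> \<ge> R + \<bar>t\<bar>"
  shows "duhamel G (t, x) = 0"
  unfolding duhamel_def
  by (rule transport_outside_cone[OF _ _ assms(2)]) (simp_all add: transport_outside_cone[where G=G, OF assms(1)])

section \<open>Picard iteration for the wave equation with a bounded potential\<close>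

primrec picard :: "(real \<Rightarrow> real) \<Rightarrow> (real \<times> real \<Rightarrow> complex) \<Rightarrow> nat \<Rightarrow> real \<times> real \<Rightarrow> complex" where
  "picard V F 0 = (\<lambda>p. 0)"
| "picard V F (Suc n) = duhamel (\<lambda>p. - F p - V (snd p) *\<^sub>R picard V F n p)"

context
  fixes V :: "real \<Rightarrow> real" and F :: "real \<times> real \<Rightarrow> complex" and M R :: real
  assumes V: "\<And>k. Cdiff k UNIV V" "\<And>x. \<bar>V x\<bar> \<le> M"
    and F: "\<And>k. Cdiff k UNIV F" "\<And>t x. \<bar>x\<bar> \<ge> R + \<bar>t\<bar> \<Longrightarrow> F (t, x) = 0"
begin

lemma Cdiff_source: "Cdiff k UNIV e \<Longrightarrow> Cdiff k UNIV (\<lambda>p. - F p - V (snd p) *\<^sub>R e p)"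
  by (rule Cdiff_diff Cdiff_minus Cdiff_scaleR Cdiff_compose[OF open_UNIV open_UNIV subset_UNIV V(1)]
      Cdiff_snd F(1) open_UNIV | assumption)+

lemma Cdiff_picard: "Cdiff k UNIV (picard V F n)"
  by (induction n) (simp_all del: differentiable_times_on.simps add: Cdiff_duhamel Cdiff_source)

lemma continuous_on_source: "continuous_on UNIV e \<Longrightarrow> continuous_on UNIV (\<lambda>p. - F p - V (snd p) *\<^sub>R e p)"
  using Cdiff_source[of 0 e] by simp

lemma continuous_on_picard: "continuous_on UNIV (picard V F n)"
  using Cdiff_picard[of 0 n] by simp

lemma M_nonneg: "M \<ge> 0" using V(2)[of 0] by linarith

text \<open>F vanishes outside a cone, so for |t| \<le> T its values are taken on a compact
  set.\<close>

lemma source_bounded: "\<exists>C\<ge>0. \<forall>t x. \<bar>t\<bar> \<le> T \<longrightarrow> norm (F (t, x)) \<le> C"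
proof -
  have "compact ((\<lambda>p. norm (F p)) ` ({-T..T} \<times> {-(R + T)..R + T}))"
    using Cdiff_imp_continuous_on[OF F(1)]
    by (intro compact_continuous_image compact_Times compact_Icc continuous_intros) (auto intro: continuous_on_subset)
  then obtain C where C: "\<And>p. p \<in> {-T..T} \<times> {-(R + T)..R + T} \<Longrightarrow> norm (F p) \<le> C"
    by (meson bounded_imp_bdd_above bdd_above.E compact_imp_bounded imageI)
  have "norm (F (t, x)) \<le> \<bar>C\<bar>" if "\<bar>t\<bar> \<le> T" for t x
  proof (cases "\<bar>x\<bar> \<le> R + T")
    case True
    then have "(t, x) \<in> {-T..T} \<times> {-(R + T)..R + T}" using that by auto
    from C[OF this] show ?thesis by linarith
  next
    case False
    then show ?thesis using that F(2)[of t x] by simp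
  qed
  then show ?thesis by (intro exI[of _ "\<bar>C\<bar>"]) auto
qed

text \<open>One iteration multiplies by V and integrates twice in time: a factor M is gained and (2n
  + 3)(2n + 4) appears in the denominator.\<close>

lemma picard_step_bound:
  assumes C: "C \<ge> 0" "\<And>t x. \<bar>t\<bar> \<le> T \<Longrightarrow> norm (F (t, x)) \<le> C" and "\<bar>t\<bar> \<le> T"
  shows "norm (picard V F (Suc n) (t, x) - picard V F n (t, x)) \<le> (C * M ^ n / fact (2 * n + 2)) * \<bar>t\<bar> ^ (2 * n + 2)"
  using assms(3)
proof (induction n arbitrary: t x)
  case 0
  have "norm (- F (s, y) - V (snd (s, y)) *\<^sub>R 0) \<le> C * \<bar>s\<bar> ^ 0" if "\<bar>s\<bar> \<le> \<bar>t\<bar>" for s y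
    using that C(2)[of s y] 0 by simp
  from duhamel_bound[OF _ C(1) this, of t x] show ?case
    using continuous_on_source[of "\<lambda>_. 0"] by (simp add: numeral_2_eq_2)
next
  case (Suc n)
  define D where "D p = (- F p - V (snd p) *\<^sub>R picard V F (Suc n) p) - (- F p - V (snd p) *\<^sub>R picard V F n p)" for p
  have eq: "picard V F (Suc (Suc n)) (t, x) - picard V F (Suc n) (t, x) = duhamel D (t, x)"
    unfolding D_def picard.simps(2)[of V F "Suc n"]
    by (subst duhamel_diff) (simp_all add: continuous_on_source continuous_on_picard del: picard.simps(2), simp)
  have cD: "continuous_on UNIV D"
    unfolding D_def by (intro continuous_on_diff continuous_on_source continuous_on_picard)
  let ?a = "M * (C * M ^ n / fact (2 * n + 2))"
  have "norm (D (s, y)) \<le> ?a * \<bar>s\<bar> ^ (2 * n + 2)" if "\<bar>s\<bar> \<le> \<bar>t\<bar>" for s y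
  proof -
    have "D (s, y) = - (V y *\<^sub>R (picard V F (Suc n) (s, y) - picard V F n (s, y)))"
      by (simp add: D_def algebra_simps del: picard.simps(2))
    then have "norm (D (s, y)) = \<bar>V y\<bar> * norm (picard V F (Suc n) (s, y) - picard V F n (s, y))"
      by (simp del: picard.simps(2))
    also have "\<dots> \<le> M * ((C * M ^ n / fact (2 * n + 2)) * \<bar>s\<bar> ^ (2 * n + 2))"
      by (rule mult_mono[OF V(2) Suc.IH _ norm_ge_zero]) (use that Suc.prems M_nonneg in auto)
    finally show ?thesis by (simp only: mult.assoc)
  qed
  then have "norm (duhamel D (t, x)) \<le> ?a * \<bar>t\<bar> ^ (2 * n + 2 + 2) / (real (2 * n + 2 + 1) * real (2 * n + 2 + 2))"
    using duhamel_bound[OF cD, of ?a t "2 * n + 2" x] M_nonneg C(1) by (simp only: of_nat_add of_nat_mult of_nat_1 of_nat_numeral) simp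
  also have "\<dots> = (C * M ^ Suc n / fact (2 * Suc n + 2)) * \<bar>t\<bar> ^ (2 * Suc n + 2)"
  proof -
    have e: "2 * Suc n + 2 = Suc (Suc (2 * n + 2))" by simp
    have "fact (2 * Suc n + 2) = real (2 * n + 2 + 2) * (real (2 * n + 2 + 1) * fact (2 * n + 2))"
      unfolding e fact_Suc by simp
    moreover have "\<bar>t\<bar> ^ (2 * Suc n + 2) = \<bar>t\<bar> ^ (2 * n + 2 + 2)" by (rule arg_cong) simp
    ultimately show ?thesis
      by (simp only: power_Suc times_divide_eq_left times_divide_eq_right divide_divide_eq_left ac_simps)
  qed
  finally show ?case unfolding eq .
qed

text \<open>The limit of the iterates, written as a telescoping series so that the step bound
  applies term by term.\<close>

definition wave_corr :: "real \<times> real \<Rightarrow> complex" where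
  "wave_corr p = (\<Sum>n. picard V F (Suc n) p - picard V F n p)"

lemma uniform_limit_picard:
  "uniform_limit {p. \<bar>fst p\<bar> < T} (picard V F) wave_corr sequentially"
proof -
  obtain C where C: "C \<ge> 0" "\<And>t x. \<bar>t\<bar> \<le> T \<Longrightarrow> norm (F (t, x)) \<le> C"
    using source_bounded[of T] by blast
  have "uniform_limit {p. \<bar>fst p\<bar> < T} (\<lambda>n p. \<Sum>i<n. picard V F (Suc i) p - picard V F i p)
      (\<lambda>p. \<Sum>n. picard V F (Suc n) p - picard V F n p) sequentially"
  proof (rule Weierstrass_m_test)
    show "norm (picard V F (Suc n) p - picard V F n p) \<le> (C * T\<^sup>2) * ((M * T\<^sup>2) ^ n /\<^sub>R fact n)"
      if "p \<in> {p. \<bar>fst p\<bar> < T}" for n p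
    proof -
      obtain t x where p: "p = (t, x)" by (cases p)
      have t: "\<bar>t\<bar> \<le> T" using that by (simp add: p)
      have "norm (picard V F (Suc n) p - picard V F n p) \<le> (C * M ^ n / fact (2 * n + 2)) * \<bar>t\<bar> ^ (2 * n + 2)"
        unfolding p by (rule picard_step_bound[OF C t])
      also have "\<dots> \<le> (C * M ^ n / fact n) * T ^ (2 * n + 2)"
      proof (intro mult_mono power_mono divide_left_mono)
        show "(fact n :: real) \<le> fact (2 * n + 2)" by (rule fact_mono) simp
      qed (use C t M_nonneg in auto)
      also have "\<dots> = (C * T\<^sup>2) * ((M * T\<^sup>2) ^ n /\<^sub>R fact n)"
        by (simp add: power_add power_mult power_mult_distrib power2_eq_square field_simps)
      finally show ?thesis .
    qed
    show "summable (\<lambda>n. (C * T\<^sup>2) * ((M * T\<^sup>2) ^ n /\<^sub>R fact n))"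
      by (intro summable_mult summable_exp_generic)
  qed
  moreover have "(\<Sum>i<n. picard V F (Suc i) p - picard V F i p) = picard V F n p" for n p
    by (subst sum_lessThan_telescope) simp
  ultimately show ?thesis
    unfolding wave_corr_def[abs_def] by simp
qed

lemma open_strip: "open {p::real \<times> real. \<bar>fst p\<bar> < T}"
  by (intro open_Collect_less continuous_intros)

lemma convex_strip: "convex {p::real \<times> real. \<bar>fst p\<bar> < T}"
proof -
  have "{p::real \<times> real. \<bar>fst p\<bar> < T} = {-T<..<T} \<times> UNIV" by auto
  then show ?thesis by (simp add: convex_Times)
qed

lemma continuous_on_wave_corr: "continuous_on UNIV wave_corr"
proof -
  have "continuous_on {p. \<bar>fst p\<bar> < T} wave_corr" for T
    by (rule uniform_limit_theorem[OF _ uniform_limit_picard])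
      (simp_all add: continuous_on_subset[OF continuous_on_picard])
  then have "isCont wave_corr p" for p
    using continuous_on_eq_continuous_at[OF open_strip[of "\<bar>fst p\<bar> + 1"]] by fastforce
  then show ?thesis by (simp add: continuous_at_imp_continuous_on)
qed

abbreviation "wave_src \<equiv> \<lambda>p. - F p - V (snd p) *\<^sub>R wave_corr p"

text \<open>The derivative of \<open>duhamel G\<close> is expressed through transports of G and
  contains no derivative of G. Uniform convergence of the iterates on a strip |t| < T therefore
  already gives uniform convergence of their derivatives, and the limit may be
  differentiated.\<close>

lemma wave_corr_derivative:
  "(wave_corr has_derivative (\<lambda>v. fst v *\<^sub>R ((1/2) *\<^sub>R (transport 1 wave_src p + transport (-1) wave_src p))
      + snd v *\<^sub>R ((1/2) *\<^sub>R (transport 1 wave_src p - transport (-1) wave_src p)))) (at p)"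
proof -
  define T where "T = \<bar>fst p\<bar> + 1"
  let ?S = "{p::real \<times> real. \<bar>fst p\<bar> < T}"
  let ?G = "\<lambda>n p. - F p - V (snd p) *\<^sub>R picard V F n p"
  let ?D = "\<lambda>G p v. fst v *\<^sub>R ((1/2) *\<^sub>R (transport 1 G p + transport (-1) G p))
      + snd v *\<^sub>R ((1/2) *\<^sub>R (transport 1 G p - transport (-1) G p))"
  have pS: "p \<in> ?S" by (simp add: T_def)
  have T0: "T > 0" by (simp add: T_def)
  have est: "norm (?D (?G n) q v - ?D wave_src q v) \<le> (2 * (M * \<epsilon>) * T) * norm v"
    if q: "q \<in> ?S" and n: "\<And>p. p \<in> ?S \<Longrightarrow> norm (picard V F n p - wave_corr p) \<le> \<epsilon>" and "\<epsilon> \<ge> 0" for n q v \<epsilon>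
  proof -
    have tr: "norm (transport c (?G n) q - transport c wave_src q) \<le> M * \<epsilon> * T" for c
    proof -
      obtain t x where [simp]: "q = (t, x)" by (cases q)
      have "norm (?G n (s, y) - wave_src (s, y)) \<le> (M * \<epsilon>) * \<bar>s\<bar> ^ 0" if "\<bar>s\<bar> \<le> \<bar>t\<bar>" for s y
      proof -
        have "?G n (s, y) - wave_src (s, y) = - (V y *\<^sub>R (picard V F n (s, y) - wave_corr (s, y)))"
          by (simp add: algebra_simps)
        then have "norm (?G n (s, y) - wave_src (s, y)) = \<bar>V y\<bar> * norm (picard V F n (s, y) - wave_corr (s, y))"
          by simp
        also have "\<dots> \<le> M * \<epsilon>"
          using q that M_nonneg by (intro mult_mono V(2) n) auto
        finally show ?thesis by simp
      qed
      note tb = transport_bound[OF continuous_on_diff[OF continuous_on_source[OF continuous_on_picard]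
            continuous_on_source[OF continuous_on_wave_corr]] _ this, of t c x]
      have "norm (transport c (\<lambda>p. ?G n p - wave_src p) (t, x)) \<le> M * \<epsilon> * \<bar>t\<bar> ^ (0 + 1) / (0 + 1)"
        using tb M_nonneg \<open>\<epsilon> \<ge> 0\<close> by (simp only: of_nat_0 mult_nonneg_nonneg of_nat_add of_nat_1)
      then have "norm (transport c (\<lambda>p. ?G n p - wave_src p) (t, x)) \<le> M * \<epsilon> * \<bar>t\<bar>" by (simp only: power_one_right add_0 div_by_1)
      also have "\<dots> \<le> M * \<epsilon> * T"
        using q M_nonneg \<open>\<epsilon> \<ge> 0\<close> by (intro mult_left_mono) auto
      finally show ?thesis
        by (subst (asm) transport_diff) (simp_all add: continuous_on_source continuous_on_picard continuous_on_wave_corr)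
    qed
    define a b where "a = transport 1 (?G n) q - transport 1 wave_src q"
      and "b = transport (-1) (?G n) q - transport (-1) wave_src q"
    have "?D (?G n) q v - ?D wave_src q v = fst v *\<^sub>R ((1/2) *\<^sub>R (a + b)) + snd v *\<^sub>R ((1/2) *\<^sub>R (a - b))"
      by (simp add: a_def b_def algebra_simps)
    also have "norm \<dots> \<le> \<bar>fst v\<bar> * ((1/2) * (norm a + norm b)) + \<bar>snd v\<bar> * ((1/2) * (norm a + norm b))"
      by (rule order_trans[OF norm_triangle_ineq])
        (auto intro!: add_mono mult_left_mono norm_triangle_ineq norm_triangle_ineq4)
    also have "\<dots> \<le> \<bar>fst v\<bar> * (M * \<epsilon> * T) + \<bar>snd v\<bar> * (M * \<epsilon> * T)"
      using tr[of 1] tr[of "-1"] unfolding a_def[symmetric] b_def[symmetric]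
      by (intro add_mono mult_left_mono) auto
    also have "\<dots> \<le> norm v * (M * \<epsilon> * T) + norm v * (M * \<epsilon> * T)"
      using M_nonneg \<open>\<epsilon> \<ge> 0\<close> T0 norm_fst_le[of "fst v" "snd v"] norm_snd_le[of "snd v" "fst v"]
      by (intro add_mono mult_right_mono) simp_all
    finally show ?thesis by (simp add: algebra_simps)
  qed
  have "\<exists>g. \<forall>x\<in>?S. (\<lambda>n. picard V F (Suc n) x) \<longlonglongrightarrow> g x \<and> (g has_derivative ?D wave_src x) (at x within ?S)"
  proof (rule has_derivative_sequence[OF convex_strip _ _ pS])
    show "(picard V F (Suc n) has_derivative ?D (?G n) x) (at x within ?S)" for n x
      unfolding picard.simps
      by (rule has_derivative_at_withinI, rule duhamel_has_derivative, rule Cdiff_source, rule Cdiff_picard)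
    show "(\<lambda>n. picard V F (Suc n) p) \<longlonglongrightarrow> wave_corr p"
      by (rule LIMSEQ_Suc[OF tendsto_uniform_limitI[OF uniform_limit_picard[of T] pS]])
    fix \<epsilon> :: real assume "\<epsilon> > 0"
    define \<delta> where "\<delta> = \<epsilon> / (2 * (M + 1) * T)"
    have d: "\<delta> > 0"
      using M_nonneg T0 \<open>\<epsilon> > 0\<close> by (simp add: \<delta>_def)
    have "2 * (M + 1) * T * \<delta> = \<epsilon>"
      using M_nonneg T0 by (simp add: \<delta>_def)
    then have "2 * (M * \<delta>) * T \<le> \<epsilon>"
      using mult_pos_pos[OF T0 d] by (simp add: algebra_simps)
    have "\<forall>\<^sub>F n in sequentially. \<forall>p\<in>?S. dist (picard V F n p) (wave_corr p) < \<delta>"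
      using uniform_limitD[OF uniform_limit_picard d] .
    then show "\<forall>\<^sub>F n in sequentially. \<forall>x\<in>?S. \<forall>h. norm (?D (?G n) x h - ?D wave_src x h) \<le> \<epsilon> * norm h"
    proof eventually_elim
      case (elim n)
      then have "norm (?D (?G n) x h - ?D wave_src x h) \<le> (2 * (M * \<delta>) * T) * norm h" if "x \<in> ?S" for x h
        using d by (intro est that) (auto simp: dist_norm less_imp_le)
      also have "(2 * (M * \<delta>) * T) * norm h \<le> \<epsilon> * norm h" for h :: "real \<times> real"
        by (rule mult_right_mono[OF \<open>2 * (M * \<delta>) * T \<le> \<epsilon>\<close>]) simp
      finally show ?case by blast
    qed
  qed
  then obtain g where g: "\<forall>x\<in>?S. (\<lambda>n. picard V F (Suc n) x) \<longlonglongrightarrow> g x \<and> (g has_derivative ?D wave_src x) (at x within ?S)"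
    by (elim exE)
  have gw: "g x = wave_corr x" if "x \<in> ?S" for x
    by (rule LIMSEQ_unique[OF conjunct1[OF bspec[OF g that]]
        LIMSEQ_Suc[OF tendsto_uniform_limitI[OF uniform_limit_picard[of T] that]]])
  have "(g has_derivative ?D wave_src p) (at p)"
    using conjunct2[OF bspec[OF g pS]] unfolding at_within_open[OF pS open_strip] .
  then show ?thesis
    by (rule has_derivative_transform_within_open[OF _ open_strip pS gw])
qed

text \<open>Bootstrapping: the first derivatives are transports of a source in which
  \<open>wave_corr\<close> occurs undifferentiated, so class C^k implies class C^(k+1).\<close>

lemma Cdiff_wave_corr: "Cdiff k UNIV wave_corr"
proof (induction k)
  case 0
  then show ?case by (simp add: continuous_on_wave_corr)
next
  case (Suc k)
  have "Cdiff k UNIV (transport c wave_src)" for c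
    by (intro Cdiff_transport Cdiff_source Suc)
  then have "Cdiff k UNIV (\<lambda>p. fst v *\<^sub>R ((1/2) *\<^sub>R (transport 1 wave_src p + transport (-1) wave_src p))
      + snd v *\<^sub>R ((1/2) *\<^sub>R (transport 1 wave_src p - transport (-1) wave_src p)))" for v :: "real \<times> real"
    by (intro Cdiff_add Cdiff_diff Cdiff_scaleR Cdiff_const open_UNIV)
  then show ?case
    by (rule_tac Cdiff_SucI[OF open_UNIV wave_corr_derivative])
qed

lemma wave_corr_outside_cone: "\<bar>x\<bar> \<ge> R + \<bar>t\<bar> \<Longrightarrow> wave_corr (t, x) = 0"
proof -
  have "picard V F n (t, x) = 0" if "\<bar>x\<bar> \<ge> R + \<bar>t\<bar>" for n t x
    using that
  proof (induction n arbitrary: t x)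
    case (Suc n)
    show ?case
      unfolding picard.simps by (rule duhamel_outside_cone[OF _ Suc.prems]) (simp add: F(2) Suc.IH)
  qed simp
  then show "\<bar>x\<bar> \<ge> R + \<bar>t\<bar> \<Longrightarrow> wave_corr (t, x) = 0"
    by (simp add: wave_corr_def del: picard.simps)
qed

lemma picard_0_data: "wave_corr (0, x) = 0"
proof -
  have "picard V F n (0, x) = 0" for n
    by (cases n) (simp_all add: duhamel_def)
  then show ?thesis by (simp add: wave_corr_def del: picard.simps)
qed

text \<open>Here e solves e_tt - e_xx + V e = -F with zero Cauchy data. The null derivatives P = e_t
  + e_x and Q = e_t - e_x are exposed because each satisfies a first order equation, and the energy
  estimate is written in terms of them.\<close>

theorem wave_1d_correction_exists:
  "\<exists>e P Q. (\<forall>k. Cdiff k UNIV e) \<and> (\<forall>k. Cdiff k UNIV P) \<and> (\<forall>k. Cdiff k UNIV Q) \<and>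
    (\<forall>p. (e has_derivative (\<lambda>v. fst v *\<^sub>R ((1/2) *\<^sub>R (P p + Q p)) + snd v *\<^sub>R ((1/2) *\<^sub>R (P p - Q p)))) (at p)) \<and>
    (\<forall>p. frechet_derivative P (at p) (1, -1) = - F p - V (snd p) *\<^sub>R e p) \<and>
    (\<forall>p. frechet_derivative Q (at p) (1, 1) = - F p - V (snd p) *\<^sub>R e p) \<and>
    (\<forall>x. e (0, x) = 0 \<and> P (0, x) = 0 \<and> Q (0, x) = 0) \<and>
    (\<forall>t x. \<bar>x\<bar> \<ge> R + \<bar>t\<bar> \<longrightarrow> e (t, x) = 0 \<and> P (t, x) = 0 \<and> Q (t, x) = 0)"
proof (intro exI conjI allI impI)
  show "(wave_corr has_derivative (\<lambda>v. fst v *\<^sub>R ((1/2) *\<^sub>R (transport 1 wave_src p + transport (-1) wave_src p))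
      + snd v *\<^sub>R ((1/2) *\<^sub>R (transport 1 wave_src p - transport (-1) wave_src p)))) (at p)" for p
    by (rule wave_corr_derivative)
  have s: "Cdiff k UNIV wave_src" for k by (rule Cdiff_source[OF Cdiff_wave_corr])
  show "Cdiff k UNIV wave_corr" for k by (rule Cdiff_wave_corr)
  show "Cdiff k UNIV (transport 1 wave_src)" "Cdiff k UNIV (transport (-1) wave_src)" for k
    by (rule Cdiff_transport[OF s])+
  show "frechet_derivative (transport 1 wave_src) (at p) (1, -1) = wave_src p" for p
    using transport_equation[OF s, of 1 "fst p" "snd p"] by simp
  show "frechet_derivative (transport (-1) wave_src) (at p) (1, 1) = wave_src p" for p
    using transport_equation[OF s, of "-1" "fst p" "snd p"] by simp
  show "wave_corr (0, x) = 0" for x by (rule picard_0_data)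
  have z: "wave_src (t, x) = 0" if "\<bar>x\<bar> \<ge> R + \<bar>t\<bar>" for t x
    using that by (simp add: F(2) wave_corr_outside_cone)
  show "wave_corr (t, x) = 0" "transport 1 wave_src (t, x) = 0" "transport (-1) wave_src (t, x) = 0"
    if "\<bar>x\<bar> \<ge> R + \<bar>t\<bar>" for t x
    using wave_corr_outside_cone[OF that] transport_outside_cone[where G=wave_src and c=1, OF z _ that]
      transport_outside_cone[where G=wave_src and c="-1", OF z _ that] by simp_all
qed (rule transport_0)+

end

section \<open>Energy estimate between the initial line and a spacelike slice\<close>

lemma has_real_derivative_inner_self:
  fixes f :: "real \<Rightarrow> 'a::real_inner"
  assumes "(f has_vector_derivative f') (at s)"
  shows "((\<lambda>s. f s \<bullet> f s) has_real_derivative 2 * (f s \<bullet> f')) (at s)"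
  using has_derivative_inner[OF assms[unfolded has_vector_derivative_def] assms[unfolded has_vector_derivative_def]]
  by (simp add: has_field_derivative_def inner_commute algebra_simps mult_commute_abs)

text \<open>On [0, 1] the function exp (- \<mu>) (E \<mu> + b) does not increase, so E 1 + b \<le>
  exp 1 * b, and exp 1 \<le> 3.\<close>

lemma gronwall_unit:
  fixes E E' :: "real \<Rightarrow> real"
  assumes "\<And>\<mu>. (E has_real_derivative E' \<mu>) (at \<mu>)" "\<And>\<mu>. 0 \<le> \<mu> \<Longrightarrow> \<mu> \<le> 1 \<Longrightarrow> E' \<mu> \<le> E \<mu> + b"
    and "E 0 = 0" "b \<ge> 0"
  shows "E 1 \<le> 2 * b"
proof -
  define f where "f \<mu> = exp (- \<mu>) * (E \<mu> + b)" for \<mu>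
  have "f 1 \<le> f 0"
  proof (rule DERIV_nonpos_imp_nonincreasing[of 0 1 f])
    fix \<mu> :: real assume "0 \<le> \<mu>" "\<mu> \<le> 1"
    have "((\<lambda>\<mu>. exp (- \<mu>) * (E \<mu> + b)) has_real_derivative exp (- \<mu>) * (E' \<mu> - (E \<mu> + b))) (at \<mu>)"
      by (auto intro!: derivative_eq_intros assms(1) simp: algebra_simps)
    moreover have "exp (- \<mu>) * (E' \<mu> - (E \<mu> + b)) \<le> 0"
      using assms(2)[OF \<open>0 \<le> \<mu>\<close> \<open>\<mu> \<le> 1\<close>] by (simp add: mult_nonneg_nonpos)
    ultimately show "\<exists>y. (f has_real_derivative y) (at \<mu>) \<and> y \<le> 0"
      unfolding f_def[abs_def] by blast
  qed simp
  then have "exp 1 * (exp (-1) * (E 1 + b)) \<le> exp 1 * b"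
    using assms(3) by (simp add: f_def)
  moreover have "exp 1 * (exp (-1) * (E 1 + b)) = E 1 + b"
    by (simp add: exp_minus field_simps)
  ultimately have "E 1 + b \<le> exp 1 * b" by simp
  also have "\<dots> \<le> 3 * b"
    using exp_le assms(4) by (intro mult_right_mono) auto
  finally show ?thesis by simp
qed

lemma slice_density_derivative:
  fixes a b c :: "real \<Rightarrow> real"
  assumes "(a has_real_derivative a') (at \<mu>)" "(b has_real_derivative b') (at \<mu>)" "(c has_real_derivative c') (at \<mu>)"
  shows "((\<lambda>\<mu>. (1 + \<mu> * \<kappa>) / 4 * a \<mu> + (1 - \<mu> * \<kappa>) / 4 * b \<mu> + v / 2 * c \<mu>) has_real_derivative
    \<kappa> / 4 * (a \<mu> - b \<mu>) + (1 + \<mu> * \<kappa>) / 4 * a' + (1 - \<mu> * \<kappa>) / 4 * b' + v / 2 * c') (at \<mu>)"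
  by (auto intro!: derivative_eq_intros assms simp: field_simps)

lemma slice_flux_derivative:
  fixes a b k :: "real \<Rightarrow> real"
  assumes "(a has_real_derivative a') (at x)" "(b has_real_derivative b') (at x)" "(k has_real_derivative k') (at x)"
  shows "((\<lambda>x. k x / 4 * (b x - a x)) has_real_derivative k' / 4 * (b x - a x) + k x / 4 * (b' - a')) (at x)"
  by (auto intro!: derivative_eq_intros assms simp: field_simps)

text \<open>The slices \<open>t = \<mu> k(x)\<close>, \<open>0 \<le> \<mu> \<le> 1\<close>, interpolate between the initial line \<open>t = 0\<close> and
  the slice \<open>t = k(x)\<close>; since \<open>|k'| < 1\<close> they are uniformly spacelike.\<close>

lemma slice_energy_estimate:
  fixes e P Q F :: "real \<times> real \<Rightarrow> complex" and V k k' :: "real \<Rightarrow> real"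
  assumes de: "\<And>p. (e has_derivative (\<lambda>v. fst v *\<^sub>R ((1/2) *\<^sub>R (P p + Q p)) + snd v *\<^sub>R ((1/2) *\<^sub>R (P p - Q p)))) (at p)"
    and C1: "Cdiff (Suc 0) UNIV P" "Cdiff (Suc 0) UNIV Q"
    and eqP: "\<And>p. frechet_derivative P (at p) (1, -1) = - F p - V (snd p) *\<^sub>R e p"
    and eqQ: "\<And>p. frechet_derivative Q (at p) (1, 1) = - F p - V (snd p) *\<^sub>R e p"
    and zero: "\<And>x. e (0, x) = 0" "\<And>x. P (0, x) = 0" "\<And>x. Q (0, x) = 0"
    and cone: "\<And>t x. \<bar>x\<bar> \<ge> R + \<bar>t\<bar> \<Longrightarrow> P (t, x) = 0" "\<And>t x. \<bar>x\<bar> \<ge> R + \<bar>t\<bar> \<Longrightarrow> Q (t, x) = 0"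
    and F: "continuous_on UNIV F" and V: "continuous_on UNIV V" "\<And>x. V x \<ge> 0"
    and k: "\<And>x. (k has_real_derivative k' x) (at x)" "continuous_on UNIV k'" "\<And>x. \<bar>k' x\<bar> \<le> 4/5"
    and X: "X \<ge> 0" "R + \<bar>k X\<bar> \<le> X" "R + \<bar>k (- X)\<bar> \<le> X"
    and B: "B \<ge> 0" "\<And>\<mu> x. 0 \<le> \<mu> \<Longrightarrow> \<mu> \<le> 1 \<Longrightarrow> \<bar>x\<bar> \<le> X \<Longrightarrow> \<bar>k x\<bar> * norm (F (\<mu> * k x, x)) \<le> B"
  shows "integral {-X..X} (\<lambda>x. (norm (P (k x, x)))\<^sup>2 + (norm (Q (k x, x)))\<^sup>2 + V x * (norm (e (k x, x)))\<^sup>2)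
      \<le> 200 * B\<^sup>2 * X"
proof -
  let ?DP = "\<lambda>p. frechet_derivative P (at p)" and ?DQ = "\<lambda>p. frechet_derivative Q (at p)"
  define Pt Px Qt Qx where "Pt p = ?DP p (1, 0)" and "Px p = ?DP p (0, 1)"
    and "Qt p = ?DQ p (1, 0)" and "Qx p = ?DQ p (0, 1)" for p
  have dP: "(P has_derivative ?DP p) (at p)" and dQ: "(Q has_derivative ?DQ p) (at p)" for p
    using Cdiff_has_derivative[OF C1(1)] Cdiff_has_derivative[OF C1(2)] by simp_all
  have DP: "?DP p (a, b) = a *\<^sub>R Pt p + b *\<^sub>R Px p" and DQ: "?DQ p (a, b) = a *\<^sub>R Qt p + b *\<^sub>R Qx p" for p a b
  proof -
    have ab: "(a, b) = a *\<^sub>R (1, 0) + b *\<^sub>R (0, 1)" by simp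
    show "?DP p (a, b) = a *\<^sub>R Pt p + b *\<^sub>R Px p"
      unfolding ab linear_add[OF has_derivative_linear[OF dP]] linear_cmul[OF has_derivative_linear[OF dP]] Pt_def Px_def ..
    show "?DQ p (a, b) = a *\<^sub>R Qt p + b *\<^sub>R Qx p"
      unfolding ab linear_add[OF has_derivative_linear[OF dQ]] linear_cmul[OF has_derivative_linear[OF dQ]] Qt_def Qx_def ..
  qed
  have eP: "Pt p - Px p = - F p - V (snd p) *\<^sub>R e p" and eQ: "Qt p + Qx p = - F p - V (snd p) *\<^sub>R e p" for p
    using eqP[of p] eqQ[of p] by (simp_all add: DP DQ)
  have cont: "continuous_on UNIV P" "continuous_on UNIV Q" "continuous_on UNIV e" "continuous_on UNIV Pt"
    "continuous_on UNIV Px" "continuous_on UNIV Qt" "continuous_on UNIV Qx"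
    using C1 Cdiff_imp_continuous_on[OF C1(1)] Cdiff_imp_continuous_on[OF C1(2)]
      has_derivative_continuous_on[OF has_derivative_at_withinI[OF de], of UNIV]
    unfolding Pt_def Px_def Qt_def Qx_def by (metis differentiable_times_on.simps)+
  have kc: "continuous_on UNIV k"
    using k(1) by (intro continuous_at_imp_continuous_on ballI DERIV_isCont)
  let ?g = "\<lambda>\<mu> x. (\<mu> * k x, x)"
  have cc: "continuous_on S (\<lambda>z. f (a z * k (b z), b z))"
    if "continuous_on UNIV f" "continuous_on S a" "continuous_on S b" for S :: "'z::topological_space set" and f :: "real \<times> real \<Rightarrow> complex" and a b
    by (rule continuous_on_compose2[OF that(1)])
      (auto intro!: continuous_intros that continuous_on_compose2[OF kc that(3)])
  \<comment> \<open>With P = e_t + e_x and Q = e_t - e_x this is the density of the energy current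
    of the vector field d/dt on the slice t = \<mu> k(x). \<open>Fl\<close> is the x-component of
    the same current, multiplied by the speed k with which the slices sweep out the region as \<mu>
    grows.\<close>
  define dens where "dens \<mu> x = (1 + \<mu> * k' x) / 4 * (P (?g \<mu> x) \<bullet> P (?g \<mu> x))
     + (1 - \<mu> * k' x) / 4 * (Q (?g \<mu> x) \<bullet> Q (?g \<mu> x)) + V x / 2 * (e (?g \<mu> x) \<bullet> e (?g \<mu> x))" for \<mu> x
  define D where "D \<mu> x = k' x / 4 * (P (?g \<mu> x) \<bullet> P (?g \<mu> x) - Q (?g \<mu> x) \<bullet> Q (?g \<mu> x))
     + (1 + \<mu> * k' x) / 2 * k x * (P (?g \<mu> x) \<bullet> Pt (?g \<mu> x))
     + (1 - \<mu> * k' x) / 2 * k x * (Q (?g \<mu> x) \<bullet> Qt (?g \<mu> x))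
     + V x * k x / 2 * (e (?g \<mu> x) \<bullet> (P (?g \<mu> x) + Q (?g \<mu> x)))" for \<mu> x
  define Fl where "Fl \<mu> x = k x / 4 * (Q (?g \<mu> x) \<bullet> Q (?g \<mu> x) - P (?g \<mu> x) \<bullet> P (?g \<mu> x))" for \<mu> x
  define Fl' where "Fl' \<mu> x = k' x / 4 * (Q (?g \<mu> x) \<bullet> Q (?g \<mu> x) - P (?g \<mu> x) \<bullet> P (?g \<mu> x))
     + k x / 2 * (Q (?g \<mu> x) \<bullet> ((\<mu> * k' x) *\<^sub>R Qt (?g \<mu> x) + Qx (?g \<mu> x))
                 - P (?g \<mu> x) \<bullet> ((\<mu> * k' x) *\<^sub>R Pt (?g \<mu> x) + Px (?g \<mu> x)))" for \<mu> x
  define S where "S \<mu> x = - (k x / 2 * ((P (?g \<mu> x) + Q (?g \<mu> x)) \<bullet> F (?g \<mu> x)))" for \<mu> x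
  have key: "D \<mu> x + Fl' \<mu> x = S \<mu> x" for \<mu> x
  proof -
    let ?z = "?g \<mu> x"
    have "D \<mu> x + Fl' \<mu> x = k x / 2 * (P ?z \<bullet> (Pt ?z - Px ?z) + Q ?z \<bullet> (Qt ?z + Qx ?z))
       + V x * k x / 2 * (e ?z \<bullet> (P ?z + Q ?z))"
      unfolding D_def Fl'_def inner_add_right inner_diff_right inner_scaleR_right by (simp add: field_simps)
    also have "\<dots> = S \<mu> x"
      unfolding eP eQ S_def by (simp add: algebra_simps inner_commute)
    finally show ?thesis .
  qed
  have ddens: "((\<lambda>\<mu>. dens \<mu> x) has_real_derivative D \<mu> x) (at \<mu>)" for \<mu> x
  proof -
    have g: "((\<lambda>\<mu>. ?g \<mu> x) has_vector_derivative (k x, 0)) (at \<mu>)"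
      by (auto intro!: derivative_eq_intros has_vector_derivative_Pair)
    have 1: "((\<lambda>\<mu>. P (?g \<mu> x) \<bullet> P (?g \<mu> x)) has_real_derivative 2 * (P (?g \<mu> x) \<bullet> (k x *\<^sub>R Pt (?g \<mu> x)))) (at \<mu>)"
      using has_real_derivative_inner_self[OF chain_vector_derivative[OF dP g]] by (simp add: DP)
    have 2: "((\<lambda>\<mu>. Q (?g \<mu> x) \<bullet> Q (?g \<mu> x)) has_real_derivative 2 * (Q (?g \<mu> x) \<bullet> (k x *\<^sub>R Qt (?g \<mu> x)))) (at \<mu>)"
      using has_real_derivative_inner_self[OF chain_vector_derivative[OF dQ g]] by (simp add: DQ)
    have 3: "((\<lambda>\<mu>. e (?g \<mu> x) \<bullet> e (?g \<mu> x)) has_real_derivative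
        2 * (e (?g \<mu> x) \<bullet> (k x *\<^sub>R ((1/2) *\<^sub>R (P (?g \<mu> x) + Q (?g \<mu> x)))))) (at \<mu>)"
      using has_real_derivative_inner_self[OF chain_vector_derivative[OF de g]] by simp
    show ?thesis
      unfolding dens_def
      by (rule DERIV_cong[OF slice_density_derivative[OF 1 2 3]]) (simp add: D_def field_simps inner_add_right)
  qed
  have dFl: "(Fl \<mu> has_real_derivative Fl' \<mu> x) (at x)" for \<mu> x
  proof -
    have g: "((\<lambda>x. ?g \<mu> x) has_vector_derivative (\<mu> * k' x, 1)) (at x)"
      using DERIV_cmult[OF k(1)[of x], of \<mu>]
      by (intro has_vector_derivative_Pair) (auto simp: has_real_derivative_iff_has_vector_derivative[symmetric])
    have 1: "((\<lambda>x. P (?g \<mu> x) \<bullet> P (?g \<mu> x)) has_real_derivative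
         2 * (P (?g \<mu> x) \<bullet> ((\<mu> * k' x) *\<^sub>R Pt (?g \<mu> x) + Px (?g \<mu> x)))) (at x)"
      using has_real_derivative_inner_self[OF chain_vector_derivative[OF dP g]] by (simp add: DP)
    have 2: "((\<lambda>x. Q (?g \<mu> x) \<bullet> Q (?g \<mu> x)) has_real_derivative
         2 * (Q (?g \<mu> x) \<bullet> ((\<mu> * k' x) *\<^sub>R Qt (?g \<mu> x) + Qx (?g \<mu> x)))) (at x)"
      using has_real_derivative_inner_self[OF chain_vector_derivative[OF dQ g]] by (simp add: DQ)
    show ?thesis
      unfolding Fl_def[abs_def]
      by (rule DERIV_cong[OF slice_flux_derivative[OF 1 2 k(1)]]) (simp add: Fl'_def field_simps)
  qed
  have cdens: "continuous_on UNIV (\<lambda>x. dens \<mu> x)" and cFl': "continuous_on UNIV (Fl' \<mu>)" and cS: "continuous_on UNIV (S \<mu>)" for \<mu>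
    unfolding dens_def Fl'_def[abs_def] S_def[abs_def]
    by (intro continuous_intros cc cont F V k kc; simp)+
  have cD: "continuous_on UNIV (\<lambda>(\<mu>, x). D \<mu> x)"
    unfolding D_def split_beta
    by (intro continuous_intros cc cont F continuous_on_compose2[OF V(1)] continuous_on_compose2[OF k(2)]
        continuous_on_compose2[OF kc] subset_UNIV; simp)
  define E where "E \<mu> = integral {-X..X} (dens \<mu>)" for \<mu>
  have int: "f integrable_on {-X..X}" if "continuous_on UNIV f" for f :: "real \<Rightarrow> real"
    using that by (intro integrable_continuous_real) (rule continuous_on_subset, auto)
  have cD1: "continuous_on UNIV (D \<mu>)" for \<mu>
    using continuous_on_compose2[OF cD, of UNIV "\<lambda>x. (\<mu>, x)"] by (simp add: continuous_intros)
  have dE: "(E has_real_derivative integral {-X..X} (D \<mu>)) (at \<mu>)" for \<mu>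
    using leibniz_rule_field_derivative[of UNIV "-X" X dens D \<mu>] ddens int[OF cdens]
      continuous_on_subset[OF cD subset_UNIV]
    by (simp add: E_def[abs_def])
  have intD: "integral {-X..X} (D \<mu>) = integral {-X..X} (S \<mu>)" if "0 \<le> \<mu>" "\<mu> \<le> 1" for \<mu>
  proof -
    have mk: "\<bar>\<mu> * k x\<bar> \<le> \<bar>k x\<bar>" for x
      using that by (simp add: abs_mult mult_left_le_one_le)
    have "(Fl' \<mu> has_integral Fl \<mu> X - Fl \<mu> (- X)) {-X..X}"
    proof (rule fundamental_theorem_of_calculus)
      show "(Fl \<mu> has_vector_derivative Fl' \<mu> x) (at x within {-X..X})" for x
        using dFl[of \<mu> x] unfolding has_real_derivative_iff_has_vector_derivative
        by (rule has_vector_derivative_at_within)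
    qed (use X(1) in simp)
    moreover have "Fl \<mu> X = 0" "Fl \<mu> (- X) = 0"
      using X mk[of X] mk[of "-X"] by (simp_all add: Fl_def cone)
    ultimately have "integral {-X..X} (Fl' \<mu>) = 0" by (simp add: integral_unique)
    moreover have "integral {-X..X} (S \<mu>) = integral {-X..X} (D \<mu>) + integral {-X..X} (Fl' \<mu>)"
      unfolding integral_add[OF int[OF cD1] int[OF cFl'], symmetric]
      by (rule Henstock_Kurzweil_Integration.integral_cong) (simp add: key)
    ultimately show ?thesis by simp
  qed
  \<comment> \<open>The bound |\<mu> k'| \<le> 4/5 leaves (1 - 4/5)/4 = 1/20. The potential enters
    through its sign alone, so the final constant is the same for all l.\<close>
  have pos: "1 / 20 * (P (?g \<mu> x) \<bullet> P (?g \<mu> x) + Q (?g \<mu> x) \<bullet> Q (?g \<mu> x)) + V x / 2 * (e (?g \<mu> x) \<bullet> e (?g \<mu> x)) \<le> dens \<mu> x"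
    if "0 \<le> \<mu>" "\<mu> \<le> 1" for \<mu> x
  proof -
    have "\<bar>\<mu> * k' x\<bar> \<le> 1 * (4/5)"
      unfolding abs_mult using that k(3)[of x] by (intro mult_mono) auto
    then have b: "1 / 20 \<le> (1 + \<mu> * k' x) / 4" "1 / 20 \<le> (1 - \<mu> * k' x) / 4" by (auto simp: abs_le_iff)
    show ?thesis using mult_right_mono[OF b(1) inner_ge_zero[of "P (?g \<mu> x)"]]
        mult_right_mono[OF b(2) inner_ge_zero[of "Q (?g \<mu> x)"]] unfolding dens_def by (simp add: distrib_left)
  qed
  \<comment> \<open>Young's inequality, weighted so that the quadratic part is exactly the one
    bounded by \<open>pos\<close>: 10 B (p + q) \<le> p^2 + q^2 + 50 B^2.\<close>
  have Sle: "S \<mu> x \<le> dens \<mu> x + 5/2 * B\<^sup>2" if "0 \<le> \<mu>" "\<mu> \<le> 1" "\<bar>x\<bar> \<le> X" for \<mu> x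
  proof -
    let ?p = "norm (P (?g \<mu> x))" and ?q = "norm (Q (?g \<mu> x))"
    have "S \<mu> x \<le> \<bar>k x\<bar> / 2 * (norm (P (?g \<mu> x) + Q (?g \<mu> x)) * norm (F (?g \<mu> x)))"
    proof -
      have "S \<mu> x \<le> \<bar>k x / 2 * ((P (?g \<mu> x) + Q (?g \<mu> x)) \<bullet> F (?g \<mu> x))\<bar>"
        unfolding S_def by linarith
      also have "\<dots> \<le> \<bar>k x\<bar> / 2 * (norm (P (?g \<mu> x) + Q (?g \<mu> x)) * norm (F (?g \<mu> x)))"
        unfolding abs_mult using Cauchy_Schwarz_ineq2 by (intro mult_mono) auto
      finally show ?thesis .
    qed
    also have "\<dots> = norm (P (?g \<mu> x) + Q (?g \<mu> x)) / 2 * (\<bar>k x\<bar> * norm (F (?g \<mu> x)))" by simp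
    also have "\<dots> \<le> (?p + ?q) / 2 * B"
      using B that by (intro mult_mono divide_right_mono norm_triangle_ineq) auto
    also have "\<dots> \<le> 1 / 20 * (?p\<^sup>2 + ?q\<^sup>2) + 5/2 * B\<^sup>2"
    proof -
      have "0 \<le> (?p - 5 * B)\<^sup>2 + (?q - 5 * B)\<^sup>2" by simp
      then show ?thesis by (simp add: power2_eq_square algebra_simps)
    qed
    also have "\<dots> \<le> dens \<mu> x + 5/2 * B\<^sup>2"
    proof -
      have "0 \<le> V x / 2 * (e (?g \<mu> x) \<bullet> e (?g \<mu> x))" using V(2)[of x] by simp
      then show ?thesis using pos[OF that(1,2), of x] unfolding power2_norm_eq_inner by linarith
    qed
    finally show ?thesis .
  qed
  have "integral {-X..X} (D \<mu>) \<le> E \<mu> + 5 * B\<^sup>2 * X" if m: "0 \<le> \<mu>" "\<mu> \<le> 1" for \<mu>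
  proof -
    have "integral {-X..X} (S \<mu>) \<le> integral {-X..X} (\<lambda>x. dens \<mu> x + 5/2 * B\<^sup>2)"
      by (intro integral_le int continuous_on_add cS cdens continuous_on_const Sle m) auto
    also have "\<dots> = E \<mu> + 5 * B\<^sup>2 * X"
      using X(1) by (subst integral_add[OF int[OF cdens] int]) (auto simp: E_def)
    finally show ?thesis by (simp add: intD[OF m])
  qed
  \<comment> \<open>Integrating 5/2 B^2 over an interval of length 2X gives 5 B^2 X, Gronwall
    doubles this, and the factor 20 from \<open>pos\<close> then leads to 200.\<close>
  then have "E 1 \<le> 2 * (5 * B\<^sup>2 * X)"
    by (intro gronwall_unit[OF dE]) (use X(1) in \<open>auto simp: E_def dens_def[abs_def] zero\<close>)
  moreover have "integral {-X..X} (\<lambda>x. (norm (P (k x, x)))\<^sup>2 + (norm (Q (k x, x)))\<^sup>2 + V x * (norm (e (k x, x)))\<^sup>2)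
      \<le> integral {-X..X} (\<lambda>x. 20 * dens 1 x)"
  proof (rule integral_le)
    show "(\<lambda>x. (norm (P (k x, x)))\<^sup>2 + (norm (Q (k x, x)))\<^sup>2 + V x * (norm (e (k x, x)))\<^sup>2) integrable_on {-X..X}"
      using cc[OF cont(1) continuous_on_const continuous_on_id, of UNIV 1]
        cc[OF cont(2) continuous_on_const continuous_on_id, of UNIV 1]
        cc[OF cont(3) continuous_on_const continuous_on_id, of UNIV 1]
      by (intro int continuous_intros V) simp_all
    show "(\<lambda>x. 20 * dens 1 x) integrable_on {-X..X}" by (intro int continuous_intros cdens)
    fix x
    define w y where "w = V x / 2 * (e (k x, x) \<bullet> e (k x, x))"
      and "y = P (k x, x) \<bullet> P (k x, x) + Q (k x, x) \<bullet> Q (k x, x)"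
    have "0 \<le> w" using V(2)[of x] by (simp add: w_def)
    moreover have "V x * (e (k x, x) \<bullet> e (k x, x)) = 2 * w" by (simp add: w_def)
    moreover have "1 / 20 * y + w \<le> dens 1 x"
      using pos[OF zero_le_one order_refl, of x] unfolding w_def y_def mult_1 .
    ultimately show "(norm (P (k x, x)))\<^sup>2 + (norm (Q (k x, x)))\<^sup>2 + V x * (norm (e (k x, x)))\<^sup>2 \<le> 20 * dens 1 x"
      unfolding power2_norm_eq_inner y_def[symmetric] by linarith
  qed
  ultimately show ?thesis by (simp add: E_def)
qed

section \<open>Radial coordinates and null rays near the photon sphere\<close>

text \<open>The tortoise coordinate, normalised to vanish on the photon sphere \<open>r = 3m\<close>.\<close>

definition tortoise :: "real \<Rightarrow> real \<Rightarrow> real" where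
  "tortoise m r = r - 3 * m + 2 * m * ln ((r - 2 * m) / m)"

lemma tortoise_derivative:
  assumes "m > 0" "r > 2 * m"
  shows "(tortoise m has_real_derivative r / (r - 2 * m)) (at r)"
  unfolding tortoise_def[abs_def]
  using assms by (auto intro!: derivative_eq_intros simp: field_simps)

lemma tortoise_less:
  assumes "m > 0" "2 * m < r" "r < s"
  shows "tortoise m r < tortoise m s"
proof (rule DERIV_pos_imp_increasing[OF assms(3)])
  fix x assume "r \<le> x" "x \<le> s"
  then show "\<exists>y. (tortoise m has_real_derivative y) (at x) \<and> 0 < y"
    using tortoise_derivative[of m x] assms by (intro exI[of _ "x / (x - 2 * m)"]) auto
qed

lemma tortoise_inj:
  assumes "m > 0" shows "inj_on (tortoise m) {2 * m<..}"
  using tortoise_less[OF assms] by (intro linorder_inj_onI) (auto simp: less_imp_neq)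

lemma tortoise_surj:
  assumes m: "m > 0" shows "\<exists>r>2 * m. tortoise m r = x"
proof -
  \<comment> \<open>At \<open>r1\<close> the linear part of \<open>tortoise\<close> is at most 0 and
    the logarithmic part at most x; at \<open>r2\<close> the logarithmic part is nonnegative and the
    linear part at least x.\<close>
  define r1 where "r1 = 2 * m + m * min 1 (exp (x / (2 * m)))"
  define r2 where "r2 = max (3 * m) (x + 3 * m)"
  have mm: "0 < min 1 (exp (x / (2 * m)))" by simp
  have r1: "2 * m < r1" "r1 \<le> 3 * m"
    using m mult_pos_pos[OF m mm] mult_left_mono[of "min 1 (exp (x / (2 * m)))" 1 m]
    by (auto simp: r1_def)
  have "ln ((r1 - 2 * m) / m) \<le> ln (exp (x / (2 * m)))"
    using m mm by (subst ln_le_cancel_iff) (auto simp: r1_def)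
  then have "2 * m * ln ((r1 - 2 * m) / m) \<le> 2 * m * (x / (2 * m))"
    using m by (intro mult_left_mono) auto
  then have t1: "tortoise m r1 \<le> x"
    using m r1 by (simp add: tortoise_def)
  have "ln ((r2 - 2 * m) / m) \<ge> 0"
    using m by (intro ln_ge_zero) (auto simp: r2_def field_simps)
  then have "2 * m * ln ((r2 - 2 * m) / m) \<ge> 0" using m by simp
  moreover have "r2 - 3 * m \<ge> x" by (simp add: r2_def)
  ultimately have t2: "x \<le> tortoise m r2" by (simp add: tortoise_def)
  have "r1 \<le> r2" using r1 by (simp add: r2_def)
  moreover have "continuous_on {r1..r2} (tortoise m)"
    using r1 m by (intro DERIV_continuous_on[OF has_field_derivative_at_within[OF tortoise_derivative]]) auto
  ultimately obtain r where "r1 \<le> r" "tortoise m r = x"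
    using IVT'[of "tortoise m" r1 x r2] t1 t2 by auto
  then show ?thesis using r1 by (intro exI[of _ r]) auto
qed

definition areal :: "real \<Rightarrow> real \<Rightarrow> real" where
  "areal m = inv_into {2 * m<..} (tortoise m)"

lemma areal:
  assumes "m > 0"
  shows areal_gt: "areal m x > 2 * m" and tortoise_areal: "tortoise m (areal m x) = x"
proof -
  have "x \<in> tortoise m ` {2 * m<..}" using tortoise_surj[OF assms, of x] by auto
  from inv_into_into[OF this] f_inv_into_f[OF this] show "areal m x > 2 * m" "tortoise m (areal m x) = x"
    by (simp_all add: areal_def)
qed

lemma areal_tortoise: "m > 0 \<Longrightarrow> r > 2 * m \<Longrightarrow> areal m (tortoise m r) = r"
  unfolding areal_def by (rule inv_into_f_f[OF tortoise_inj]) auto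

lemma areal_0: "m > 0 \<Longrightarrow> areal m 0 = 3 * m"
  using areal_tortoise[of m "3 * m"] by (simp add: tortoise_def)

lemma areal_derivative:
  assumes m: "m > 0"
  shows "(areal m has_real_derivative 1 - 2 * m / areal m x) (at x)"
proof -
  let ?r = "areal m x"
  have r: "?r > 2 * m" by (rule areal_gt[OF m])
  have "isCont (areal m) (tortoise m ?r)"
  proof (rule isCont_inverse_function2[of "(2 * m + ?r) / 2" ?r "?r + 1"])
    fix z assume "(2 * m + ?r) / 2 \<le> z" "z \<le> ?r + 1"
    then have "z > 2 * m" using r by (simp add: field_simps)
    then show "areal m (tortoise m z) = z" "isCont (tortoise m) z"
      using areal_tortoise[OF m] DERIV_isCont[OF tortoise_derivative[OF m]] by auto
  qed (use r in auto)
  then have c: "isCont (areal m) x" by (simp add: tortoise_areal[OF m])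
  have "(areal m has_real_derivative inverse (?r / (?r - 2 * m))) (at x)"
    using r m by (intro DERIV_inverse_function[where g="areal m" and x=x and f="tortoise m" and a="x - 1" and b="x + 1", OF tortoise_derivative[OF m r]])
      (auto simp: tortoise_areal[OF m] c)
  moreover have "inverse (?r / (?r - 2 * m)) = 1 - 2 * m / ?r"
    using r m by (simp add: field_simps)
  ultimately show ?thesis by simp
qed

lemma areal_pos: "m > 0 \<Longrightarrow> areal m x > 0"
  using areal_gt[of m x] by simp

lemma areal_nz: "m > 0 \<Longrightarrow> areal m x \<noteq> 0"
  using areal_pos[of m x] by simp

text \<open>Bootstrapping in the equation r' = 1 - 2m/r: a right hand side of class C^k makes r of
  class C^(k+1).\<close>

lemma Cdiff_areal:
  assumes m: "m > 0" shows "Cdiff k UNIV (areal m)"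
proof (induction k)
  case 0
  show ?case using DERIV_continuous_on[OF has_field_derivative_at_within[OF areal_derivative[OF m]]] by simp
next
  case (Suc k)
  have "Cdiff k UNIV (\<lambda>x. 1 - 2 * m / areal m x)"
    by (rule Cdiff_diff Cdiff_divide Cdiff_const open_UNIV Suc)+ (use areal_pos[OF m] in \<open>simp add: less_imp_neq[symmetric]\<close>)
  then show ?case by (rule Cdiff_real_derivative[OF open_UNIV areal_derivative[OF m]])
qed

section \<open>Null rays with the critical impact parameter\<close>

definition orbit_freq :: "real \<Rightarrow> real" where "orbit_freq m = 1 / (sqrt 27 * m)"

lemma orbit_freq_pos: "m > 0 \<Longrightarrow> orbit_freq m > 0" by (simp add: orbit_freq_def)

lemma orbit_freq_sq: "m > 0 \<Longrightarrow> (orbit_freq m)\<^sup>2 = 1 / (27 * m\<^sup>2)"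
  by (simp add: orbit_freq_def power_divide power_mult_distrib)

text \<open>The potential (1 - 2m/r)/r^2 of null geodesics. Its maximum 1/(27 m^2), attained on the
  photon sphere, is the square of \<open>orbit_freq\<close>, the angular velocity of the circular
  orbit.\<close>

definition photon_pot :: "real \<Rightarrow> real \<Rightarrow> real" where
  "photon_pot m x = (areal m x - 2 * m) / (areal m x) ^ 3"

text \<open>Radial velocity \<open>- ray_speed\<close> of the null rays with the critical impact parameter
  \<open>\<surd>27 m\<close>, which spiral towards the photon sphere.\<close>

definition ray_factor :: "real \<Rightarrow> real \<Rightarrow> real" where
  "ray_factor m x = sqrt ((areal m x + 6 * m) / areal m x)"

definition ray_speed :: "real \<Rightarrow> real \<Rightarrow> real" where
  "ray_speed m x = (areal m x - 3 * m) / areal m x * ray_factor m x"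

lemma ray_factor_pos: "m > 0 \<Longrightarrow> ray_factor m x > 0"
  using areal_pos[of m x] by (simp add: ray_factor_def)

lemma ray_factor_sq: "m > 0 \<Longrightarrow> (ray_factor m x)\<^sup>2 = (areal m x + 6 * m) / areal m x"
  using areal_pos[of m x] by (simp add: ray_factor_def)

text \<open>Rests on r^3 - 27 m^2 (r - 2m) = (r - 3m)^2 (r + 6m). The double zero at r = 3m is what
  allows a smooth square root that changes sign there.\<close>

lemma ray_speed_sq:
  assumes "m > 0"
  shows "1 - (ray_speed m x)\<^sup>2 = 27 * m\<^sup>2 * photon_pot m x"
proof -
  define r where "r = areal m x"
  have r: "r > 0" using areal_pos[OF assms] by (simp add: r_def)
  have "(ray_speed m x)\<^sup>2 = ((r - 3 * m) / r)\<^sup>2 * ((r + 6 * m) / r)"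
    unfolding ray_speed_def power_mult_distrib ray_factor_sq[OF assms] r_def ..
  then show ?thesis
    using r by (simp add: photon_pot_def r_def[symmetric] field_simps power2_eq_square power3_eq_cube)
qed

text \<open>The eikonal equation for the phase - \<omega> t + S0(x) with S0' = - \<omega>
  \<open>ray_speed\<close>, after division by the square of the large frequency.\<close>

lemma eikonal: "m > 0 \<Longrightarrow> (orbit_freq m)\<^sup>2 - (orbit_freq m * ray_speed m x)\<^sup>2 = photon_pot m x"
proof -
  assume m: "m > 0"
  have "(orbit_freq m)\<^sup>2 * (27 * m\<^sup>2) = 1" unfolding orbit_freq_sq[OF m] using m by simp
  then show ?thesis using ray_speed_sq[OF m, of x] by algebra
qed

lemma photon_pot_pos: "m > 0 \<Longrightarrow> photon_pot m x > 0"
  using areal_gt[of m x] areal_pos[of m x] by (simp add: photon_pot_def)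

lemma ray_speed_less_1: "m > 0 \<Longrightarrow> \<bar>ray_speed m x\<bar> < 1"
proof -
  assume m: "m > 0"
  have "27 * m\<^sup>2 * photon_pot m x > 0" using photon_pot_pos[OF m] m by simp
  then have "1 - (ray_speed m x)\<^sup>2 > 0" unfolding ray_speed_sq[OF m] .
  then have "(ray_speed m x)\<^sup>2 < 1" by simp
  then show ?thesis using abs_square_less_1 by blast
qed

lemma Cdiff_ray_factor: "m > 0 \<Longrightarrow> Cdiff k UNIV (ray_factor m)"
  unfolding ray_factor_def[abs_def]
  by (rule Cdiff_sqrt_compose Cdiff_divide Cdiff_add Cdiff_const Cdiff_areal open_UNIV
      | assumption | simp add: areal_nz areal_pos add_pos_pos del: differentiable_times_on.simps)+

lemma Cdiff_ray_speed: "m > 0 \<Longrightarrow> Cdiff k UNIV (ray_speed m)"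
  unfolding ray_speed_def[abs_def]
  by (rule Cdiff_mult Cdiff_divide Cdiff_diff Cdiff_const Cdiff_areal Cdiff_ray_factor open_UNIV
      | assumption | simp add: areal_nz del: differentiable_times_on.simps)+

lemma Cdiff_photon_pot: "m > 0 \<Longrightarrow> Cdiff k UNIV (photon_pot m)"
  unfolding photon_pot_def[abs_def]
  by (rule Cdiff_power Cdiff_divide Cdiff_diff Cdiff_const Cdiff_areal open_UNIV
      | assumption | simp add: areal_nz del: differentiable_times_on.simps)+

text \<open>\<open>z\<close> is the coordinate which linearises the ray flow: \<open>ray_speed * z' = orbit_freq * z\<close>.
  The logarithmic derivative of \<open>z\<close> with respect to \<open>r\<close> is \<open>1/(r - 3m)\<close> plus the function \<open>g\<close>
  below, in which the pole at \<open>r = 3m\<close> has been removed by rationalising.\<close>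

lemma linearising_coordinate_exists:
  assumes m: "m > 0"
  shows "\<exists>z B. (\<forall>k. Cdiff k UNIV z) \<and> (\<forall>k. Cdiff k UNIV B) \<and> z 0 = 0 \<and> (\<forall>x. B x > 0) \<and>
     (\<forall>x. (z has_real_derivative (B x)\<^sup>2) (at x)) \<and> (\<forall>x. ray_speed m x * (B x)\<^sup>2 = orbit_freq m * z x) \<and>
     (\<exists>G. continuous_on UNIV G \<and> (\<forall>x. z x = (areal m x - 3 * m) * exp (G x)))"
proof -
  let ?r = "areal m" and ?w = "orbit_freq m" and ?\<rho> = "ray_factor m"
  \<comment> \<open>With a = \<omega> r^2 and b = (r - 2m) \<open>ray_factor\<close>, the wanted
    quantity a/b - 1 equals (a^2 - b^2)/(b (a + b)). The quartic is the quotient of a^2 - b^2 by r -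
    3m, up to the factor 27 m^2 r.\<close>
  define g where "g x = (?r x ^ 4 + 3 * m * ?r x ^ 3 - 18 * m\<^sup>2 * ?r x ^ 2 - 108 * m ^ 3 * ?r x + 216 * m ^ 4)
     / (27 * m\<^sup>2 * ?r x * ((?r x - 2 * m) * ?\<rho> x) * (?w * ?r x ^ 2 + (?r x - 2 * m) * ?\<rho> x))" for x
  have rp: "?r x > 0" "?r x > 2 * m" "?\<rho> x > 0" for x
    using areal_pos[OF m] areal_gt[OF m] ray_factor_pos[OF m] by auto
  have wp: "?w > 0" by (rule orbit_freq_pos[OF m])
  have d1: "(?r x - 2 * m) * ?\<rho> x > 0" for x using rp by simp
  have d2: "?w * ?r x ^ 2 + (?r x - 2 * m) * ?\<rho> x > 0" for x using rp[of x] wp d1[of x] by (simp add: add_pos_pos)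
  have gk: "1 + (?r x - 3 * m) * g x = ?w * ?r x ^ 2 / ((?r x - 2 * m) * ?\<rho> x)" for x
  proof -
    define r where "r = ?r x"
    define a b where "a = ?w * r ^ 2" and "b = (r - 2 * m) * ?\<rho> x"
    define q where "q = r ^ 4 + 3 * m * r ^ 3 - 18 * m\<^sup>2 * r ^ 2 - 108 * m ^ 3 * r + 216 * m ^ 4"
    have r: "r > 0" "b > 0" "a + b > 0" using rp[of x] d1[of x] d2[of x] by (simp_all add: r_def a_def b_def)
    have a2: "a\<^sup>2 = r ^ 4 / (27 * m\<^sup>2)"
      unfolding a_def power_mult_distrib orbit_freq_sq[OF m] by (simp add: r_def)
    have b2: "b\<^sup>2 = (r - 2 * m)\<^sup>2 * ((r + 6 * m) / r)"
      unfolding b_def power_mult_distrib ray_factor_sq[OF m] by (simp add: r_def)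
    have "(a\<^sup>2 - b\<^sup>2) * (27 * m\<^sup>2 * r) = (r - 3 * m) * q"
    proof -
      have "(a\<^sup>2 - b\<^sup>2) * (27 * m\<^sup>2 * r) = r ^ 4 * r - 27 * m\<^sup>2 * ((r - 2 * m)\<^sup>2 * (r + 6 * m))"
        unfolding a2 b2 using r m by (simp add: field_simps)
      also have "\<dots> = (r - 3 * m) * q" unfolding q_def by (simp add: algebra_simps power2_eq_square power3_eq_cube power4_eq_xxxx)
      finally show ?thesis .
    qed
    moreover have "27 * m\<^sup>2 * r \<noteq> 0" using r m by simp
    ultimately have "a\<^sup>2 - b\<^sup>2 = (r - 3 * m) * q / (27 * m\<^sup>2 * r)"
      by (simp add: nonzero_eq_divide_eq)
    moreover have "a\<^sup>2 - b\<^sup>2 = (a - b) * (a + b)" by (simp add: power2_eq_square algebra_simps)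
    ultimately have "(r - 3 * m) * (q / (27 * m\<^sup>2 * r * b * (a + b))) = (a - b) * (a + b) / (b * (a + b))"
      by (simp add: divide_divide_eq_left mult.assoc)
    also have "\<dots> = (a - b) / b" using r by simp
    also have "\<dots> = a / b - 1" using r by (simp add: diff_divide_distrib)
    finally show ?thesis
      unfolding g_def r_def[symmetric] a_def[symmetric] b_def[symmetric] q_def[symmetric] by simp
  qed
  note Cr = Cdiff_areal[OF m] and C\<rho> = Cdiff_ray_factor[OF m]
  have Cg: "Cdiff k UNIV g" for k
    unfolding g_def[abs_def]
  proof (rule Cdiff_divide[OF open_UNIV])
    show "27 * m\<^sup>2 * ?r x * ((?r x - 2 * m) * ?\<rho> x) * (?w * ?r x ^ 2 + (?r x - 2 * m) * ?\<rho> x) \<noteq> 0" for x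
      using rp[of x] d1[of x] d2[of x] m by auto
  qed (rule Cdiff_add Cdiff_diff Cdiff_mult Cdiff_power Cdiff_const Cr C\<rho> open_UNIV)+
  have "Cdiff k UNIV (\<lambda>x. g x * (1 - 2 * m / ?r x))" for k
    by (rule Cdiff_mult Cdiff_diff Cdiff_divide Cdiff_const Cg Cr open_UNIV)+ (use rp in \<open>simp add: less_imp_neq[symmetric]\<close>)
  then obtain G where G: "\<And>x. (G has_real_derivative g x * (1 - 2 * m / ?r x)) (at x)"
    using Cdiff_antiderivative by blast
  have CG: "Cdiff k UNIV G" for k
  proof (cases k)
    case 0
    show ?thesis using DERIV_continuous_on[OF has_field_derivative_at_within[OF G]] by (simp add: 0)
  next
    case (Suc n)
    show ?thesis unfolding Suc
      by (rule Cdiff_real_derivative[OF open_UNIV G \<open>Cdiff n UNIV (\<lambda>x. g x * (1 - 2 * m / ?r x))\<close>])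
  qed
  define z where "z x = (?r x - 3 * m) * exp (G x)" for x
  \<comment> \<open>The value forced by \<open>ray_speed\<close> B^2 = \<omega> z, with the common
    factor r - 3m cancelled; that B^2 is also the derivative of z is then the content of
    \<open>gk\<close>.\<close>
  define B where "B x = sqrt (?w * ?r x * exp (G x) / ?\<rho> x)" for x
  have Bp: "?w * ?r x * exp (G x) / ?\<rho> x > 0" for x using rp[of x] wp by simp
  have B2: "(B x)\<^sup>2 = ?w * ?r x * exp (G x) / ?\<rho> x" for x unfolding B_def using Bp[of x] by simp
  show ?thesis
  proof (rule exI[of _ z], rule exI[of _ B], intro conjI allI)
    show "Cdiff k UNIV z" for k
      unfolding z_def[abs_def] by (rule Cdiff_mult Cdiff_diff Cdiff_const Cdiff_exp_compose Cr CG open_UNIV)+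
    show "Cdiff k UNIV B" for k
      unfolding B_def[abs_def]
      by (rule Cdiff_sqrt_compose[OF open_UNIV _ Bp], rule Cdiff_divide[OF open_UNIV],
          (rule Cdiff_mult Cdiff_const Cdiff_exp_compose Cr CG C\<rho> open_UNIV)+) (use rp in \<open>simp add: less_imp_neq[symmetric]\<close>)
    show "\<exists>G. continuous_on UNIV G \<and> (\<forall>x. z x = (areal m x - 3 * m) * exp (G x))"
      using Cdiff_imp_continuous_on[OF CG] by (intro exI[of _ G]) (simp add: z_def)
    show "z 0 = 0" by (simp add: z_def areal_0[OF m])
    show "B x > 0" for x unfolding B_def using Bp by simp
    show "ray_speed m x * (B x)\<^sup>2 = ?w * z x" for x
      unfolding B2 ray_speed_def z_def using rp[of x] by (simp add: field_simps)
    show "(z has_real_derivative (B x)\<^sup>2) (at x)" for x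
    proof -
      obtain \<kappa> where \<kappa>: "\<kappa> = 1 - 2 * m / ?r x" by simp
      have "(z has_real_derivative (1 - 2 * m / ?r x) * exp (G x) * (1 + (?r x - 3 * m) * g x)) (at x)"
        unfolding z_def[abs_def]
        by (rule DERIV_cong[OF DERIV_mult[OF DERIV_diff[OF areal_derivative[OF m] DERIV_const] DERIV_fun_exp[OF G]]])
          (unfold \<kappa>[symmetric], simp add: algebra_simps)
      moreover have "(1 - 2 * m / ?r x) * exp (G x) * (?w * ?r x ^ 2 / ((?r x - 2 * m) * ?\<rho> x)) = ?w * ?r x * exp (G x) / ?\<rho> x"
      proof -
        have "1 - 2 * m / ?r x = (?r x - 2 * m) / ?r x" using rp[of x] by (simp add: field_simps)
        then show ?thesis using rp[of x] by (simp add: power2_eq_square)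
      qed
      ultimately show ?thesis unfolding gk B2 by simp
    qed
  qed
qed

section \<open>Approximate and exact modes\<close>

definition Dt :: "(real \<times> real \<Rightarrow> 'a::real_normed_vector) \<Rightarrow> real \<times> real \<Rightarrow> 'a" where
  "Dt f p = frechet_derivative f (at p) (1, 0)"

definition Dx :: "(real \<times> real \<Rightarrow> 'a::real_normed_vector) \<Rightarrow> real \<times> real \<Rightarrow> 'a" where
  "Dx f p = frechet_derivative f (at p) (0, 1)"

lemma Dt_eq: "(f has_derivative D) (at p) \<Longrightarrow> Dt f p = D (1, 0)"
  unfolding Dt_def using frechet_derivative_at by metis

lemma Dx_eq: "(f has_derivative D) (at p) \<Longrightarrow> Dx f p = D (0, 1)"
  unfolding Dx_def using frechet_derivative_at by metis

lemma Cdiff_Dt: "Cdiff (Suc k) UNIV f \<Longrightarrow> Cdiff k UNIV (Dt f)"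
  unfolding Dt_def[abs_def] by simp

lemma Cdiff_Dx: "Cdiff (Suc k) UNIV f \<Longrightarrow> Cdiff k UNIV (Dx f)"
  unfolding Dx_def[abs_def] by simp

lemma has_derivative_Dt_Dx:
  assumes "Cdiff (Suc k) UNIV f"
  shows "(f has_derivative (\<lambda>v. fst v *\<^sub>R Dt f p + snd v *\<^sub>R Dx f p)) (at p)"
proof -
  let ?D = "frechet_derivative f (at p)"
  have d: "(f has_derivative ?D) (at p)" using Cdiff_has_derivative[OF assms] by simp
  have lin: "linear ?D" using d by (rule has_derivative_linear)
  have "?D v = fst v *\<^sub>R Dt f p + snd v *\<^sub>R Dx f p" for v
  proof -
    have "v = fst v *\<^sub>R (1, 0) + snd v *\<^sub>R (0, 1)" by (simp add: prod_eq_iff)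
    then have "?D v = ?D (fst v *\<^sub>R (1, 0) + snd v *\<^sub>R (0, 1))" by simp
    then show ?thesis by (simp only: linear_add[OF lin] linear_cmul[OF lin] Dt_def Dx_def)
  qed
  then have "?D = (\<lambda>v. fst v *\<^sub>R Dt f p + snd v *\<^sub>R Dx f p)" by (rule ext)
  then show ?thesis using d by simp
qed

lemma Dt_Dx_add:
  assumes "Cdiff (Suc k) UNIV f" "Cdiff (Suc j) UNIV g"
  shows "Dt (\<lambda>p. f p + g p) p = Dt f p + Dt g p" "Dx (\<lambda>p. f p + g p) p = Dx f p + Dx g p"
  using Dt_eq[OF has_derivative_add[OF has_derivative_Dt_Dx[OF assms(1)] has_derivative_Dt_Dx[OF assms(2)]]]
    Dx_eq[OF has_derivative_add[OF has_derivative_Dt_Dx[OF assms(1)] has_derivative_Dt_Dx[OF assms(2)]]]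
  by simp_all

lemma Dt_Dx_mult:
  fixes f g :: "real \<times> real \<Rightarrow> 'a::real_normed_algebra"
  assumes "Cdiff (Suc k) UNIV f" "Cdiff (Suc j) UNIV g"
  shows "Dt (\<lambda>p. f p * g p) p = f p * Dt g p + Dt f p * g p" "Dx (\<lambda>p. f p * g p) p = f p * Dx g p + Dx f p * g p"
  using Dt_eq[OF has_derivative_mult[OF has_derivative_Dt_Dx[OF assms(1)] has_derivative_Dt_Dx[OF assms(2)]]]
    Dx_eq[OF has_derivative_mult[OF has_derivative_Dt_Dx[OF assms(1)] has_derivative_Dt_Dx[OF assms(2)]]]
  by simp_all

lemma Dt_Dx_of_real:
  fixes f :: "real \<times> real \<Rightarrow> real"
  assumes "Cdiff (Suc k) UNIV f"
  shows "Dt (\<lambda>p. complex_of_real (f p)) p = of_real (Dt f p)" "Dx (\<lambda>p. complex_of_real (f p)) p = of_real (Dx f p)"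
  using Dt_eq[OF has_derivative_of_real[OF has_derivative_Dt_Dx[OF assms]]]
    Dx_eq[OF has_derivative_of_real[OF has_derivative_Dt_Dx[OF assms]]]
  by simp_all

lemma Dt_Dx_snd:
  assumes "(f has_real_derivative f') (at (snd p))"
  shows "Dt (\<lambda>p. f (snd p)) p = 0" "Dx (\<lambda>p. f (snd p)) p = f'"
  using Dt_eq[OF DERIV_compose_FDERIV[OF assms bounded_linear_imp_has_derivative[OF bounded_linear_snd]]]
    Dx_eq[OF DERIV_compose_FDERIV[OF assms bounded_linear_imp_has_derivative[OF bounded_linear_snd]]]
  by simp_all

lemma Cdiff_snd_fun: "Cdiff k UNIV f \<Longrightarrow> Cdiff k UNIV (\<lambda>p::real \<times> real. f (snd p))" for f :: "real \<Rightarrow> 'b::real_normed_vector"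
  by (rule Cdiff_compose[OF open_UNIV open_UNIV subset_UNIV _ Cdiff_snd[OF open_UNIV]])

text \<open>The Regge-Wheeler potential (1 - 2m/r)(l (l + 1)/r^2 + 2m/r^3) of scalar waves, as a
  function of the tortoise coordinate.\<close>

definition mode_pot :: "real \<Rightarrow> nat \<Rightarrow> real \<Rightarrow> real" where
  "mode_pot m l x = (real l * (real l + 1) + 2 * m / areal m x) * photon_pot m x"

text \<open>By \<open>dz\<close> and \<open>zB\<close>, the radial ray flow dx/dt = -
  \<open>ray_speed\<close> becomes dz/dt = - \<omega> z. B is the square root of z', which is needed
  because squared amplitudes behave like densities; S0 is the radial part of the phase, normalised
  on the photon sphere x = 0.\<close>

locale wkb =
  fixes m :: real and z B S0 :: "real \<Rightarrow> real"
  assumes m: "m > 0"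
    and Cz: "Cdiff k UNIV z" and CB: "Cdiff k UNIV B" and CS0: "Cdiff k UNIV S0"
    and z0: "z 0 = 0" and Bpos: "B x > 0"
    and dz: "(z has_real_derivative (B x)\<^sup>2) (at x)"
    and zB: "ray_speed m x * (B x)\<^sup>2 = orbit_freq m * z x"
    and dS0: "(S0 has_real_derivative - orbit_freq m * ray_speed m x) (at x)"
    and S00: "S0 0 = 0"
begin

abbreviation "w0 \<equiv> orbit_freq m"

lemma w0_pos: "w0 > 0" by (rule orbit_freq_pos[OF m])

text \<open>Because |\<open>ray_speed\<close>| < 1, \<open>zB\<close> makes both z exp (- \<omega>
  x) and z exp (\<omega> x) increasing in x. This is the finite propagation speed of the bump: its
  edge |z| = \<delta> exp (- \<omega> t) stays inside a light cone, also for negative t.\<close>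

lemma z_growth:
  assumes "x1 > 0" "\<bar>x\<bar> \<ge> x1"
  shows "\<bar>z x\<bar> \<ge> min (z x1) (- z (- x1)) * exp (w0 * (\<bar>x\<bar> - x1))"
proof -
  have r: "\<bar>ray_speed m y\<bar> < 1" for y by (rule ray_speed_less_1[OF m])
  have d1: "((\<lambda>y. z y * exp (- w0 * y)) has_real_derivative exp (- w0 * y) * ((B y)\<^sup>2 * (1 - ray_speed m y))) (at y)" for y
    by (auto intro!: derivative_eq_intros dz simp: zB[symmetric] algebra_simps)
  have d2: "((\<lambda>y. z y * exp (w0 * y)) has_real_derivative exp (w0 * y) * ((B y)\<^sup>2 * (1 + ray_speed m y))) (at y)" for y
    by (auto intro!: derivative_eq_intros dz simp: zB[symmetric] algebra_simps)
  consider "x \<ge> x1" | "x \<le> - x1" using assms by linarith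
  then show ?thesis
  proof cases
    case 1
    have "z x1 * exp (- w0 * x1) \<le> z x * exp (- w0 * x)"
    proof (rule DERIV_nonneg_imp_nondecreasing[OF 1])
      fix y show "\<exists>d. ((\<lambda>y. z y * exp (- w0 * y)) has_real_derivative d) (at y) \<and> 0 \<le> d"
        using d1[of y] r[of y] by (intro exI conjI) (assumption, simp add: abs_less_iff)
    qed
    then have "z x1 * exp (- w0 * x1) * exp (w0 * x) \<le> z x * exp (- w0 * x) * exp (w0 * x)"
      by (rule mult_right_mono) simp
    then have A: "z x1 * exp (w0 * (x - x1)) \<le> z x"
      by (simp add: mult.assoc exp_add[symmetric] algebra_simps)
    have "min (z x1) (- z (- x1)) * exp (w0 * (x - x1)) \<le> z x1 * exp (w0 * (x - x1))"
      by (intro mult_right_mono) auto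
    from order_trans[OF order_trans[OF this A] abs_ge_self] show ?thesis using 1 assms(1) by simp
  next
    case 2
    have "z x * exp (w0 * x) \<le> z (- x1) * exp (w0 * (- x1))"
    proof (rule DERIV_nonneg_imp_nondecreasing[OF 2])
      fix y show "\<exists>d. ((\<lambda>y. z y * exp (w0 * y)) has_real_derivative d) (at y) \<and> 0 \<le> d"
        using d2[of y] r[of y] by (intro exI conjI) (assumption, simp add: abs_less_iff)
    qed
    then have "z x * exp (w0 * x) * exp (- w0 * x) \<le> z (- x1) * exp (w0 * (- x1)) * exp (- w0 * x)"
      by (rule mult_right_mono) simp
    then have A: "- z (- x1) * exp (w0 * (- x - x1)) \<le> - z x"
      by (simp add: mult.assoc exp_add[symmetric] algebra_simps)
    have "min (z x1) (- z (- x1)) * exp (w0 * (- x - x1)) \<le> - z (- x1) * exp (w0 * (- x - x1))"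
      by (intro mult_right_mono) auto
    from order_trans[OF order_trans[OF this A] abs_ge_minus_self] show ?thesis using 2 assms(1) by simp
  qed
qed

text \<open>Since B^2 = z', the prefactor exp (\<omega> t/2) B makes the measure amp^2 dx equal to
  \<delta> times the square of the profile times dy, in the variable y = exp (\<omega> t)
  z/\<delta>: mass is conserved at constant t while the bump is squeezed towards z = 0.\<close>

definition amp :: "real \<Rightarrow> real \<times> real \<Rightarrow> real" where
  "amp \<delta> p = exp (w0 / 2 * fst p) * B (snd p) * flat 0 (1 - (exp (w0 * fst p) * z (snd p) / \<delta>)\<^sup>2)"

lemma Cdiff_amp: "Cdiff k UNIV (amp \<delta>)"
  unfolding amp_def[abs_def] divide_inverse
  by (rule Cdiff_mult Cdiff_diff Cdiff_power Cdiff_const Cdiff_exp_compose Cdiff_fst Cdiff_snd_fun[OF CB] Cdiff_snd_fun[OF Cz]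
      Cdiff_compose[OF open_UNIV open_UNIV subset_UNIV Cdiff_flat] open_UNIV)+

lemma amp_outside_cone:
  assumes "x1 > 0" "0 < \<delta>" "\<delta> \<le> min (z x1) (- z (- x1))" "\<bar>x\<bar> \<ge> x1 + \<bar>t\<bar>"
  shows "amp \<delta> (t, x) = 0"
proof -
  have "\<delta> * exp (w0 * \<bar>t\<bar>) \<le> min (z x1) (- z (- x1)) * exp (w0 * (\<bar>x\<bar> - x1))"
    using assms w0_pos by (intro mult_mono) auto
  also have "\<dots> \<le> \<bar>z x\<bar>" using assms by (intro z_growth) auto
  finally have A: "exp (w0 * t) * (\<delta> * exp (w0 * \<bar>t\<bar>)) \<le> exp (w0 * t) * \<bar>z x\<bar>" by (intro mult_left_mono) auto
  have "\<delta> \<le> exp (w0 * t) * (\<delta> * exp (w0 * \<bar>t\<bar>))"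
  proof -
    have "w0 * t + w0 * \<bar>t\<bar> \<ge> 0" using w0_pos by (simp add: distrib_left[symmetric])
    then have "1 \<le> exp (w0 * t + w0 * \<bar>t\<bar>)" by simp
    from mult_left_mono[OF this, of \<delta>] show ?thesis using assms(2) by (simp add: exp_add mult_ac)
  qed
  from order_trans[OF this A] have "1 \<le> \<bar>exp (w0 * t) * z x / \<delta>\<bar>" using assms(2) by (simp add: abs_mult le_divide_eq)
  then have "1\<^sup>2 \<le> (exp (w0 * t) * z x / \<delta>)\<^sup>2" unfolding abs_le_square_iff[symmetric] by (simp only: abs_one)
  then show ?thesis by (simp add: amp_def flat_def)
qed

text \<open>The profile depends on exp (\<omega> t) z, which is constant along dx/dt = -
  \<open>ray_speed\<close>. For the prefactor the claim reduces to 2 \<open>ray_speed\<close> B' +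
  \<open>ray_speed\<close>' B = \<omega> B, which is \<open>zB\<close> differentiated and divided by
  B.\<close>

lemma amp_transport:
  assumes "\<delta> > 0"
  shows "Dt (amp \<delta>) p = ray_speed m (snd p) * Dx (amp \<delta>) p + deriv (ray_speed m) (snd p) / 2 * amp \<delta> p"
proof -
  obtain t x where p: "p = (t, x)" by (cases p)
  define b where "b = deriv B x"
  have db: "(B has_real_derivative b) (at x)"
    using CB[of "Suc 0"] unfolding b_def by (simp add: DERIV_deriv_iff_real_differentiable)
  define r' where "r' = deriv (ray_speed m) x"
  have dr: "(ray_speed m has_real_derivative r') (at x)"
    using Cdiff_ray_speed[OF m, of "Suc 0"] unfolding r'_def by (simp add: DERIV_deriv_iff_real_differentiable)
  have key: "2 * ray_speed m x * b + r' * B x = w0 * B x"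
  proof -
    have "((\<lambda>x. ray_speed m x * (B x)\<^sup>2) has_real_derivative r' * (B x)\<^sup>2 + 2 * ray_speed m x * B x * b) (at x)"
      by (auto intro!: derivative_eq_intros dr db)
    moreover have "((\<lambda>x. w0 * z x) has_real_derivative w0 * (B x)\<^sup>2) (at x)"
      by (auto intro!: derivative_eq_intros dz)
    ultimately have "r' * (B x)\<^sup>2 + 2 * ray_speed m x * B x * b = w0 * (B x)\<^sup>2"
      unfolding zB by (rule DERIV_unique)
    then have "B x * (2 * ray_speed m x * b + r' * B x) = B x * (w0 * B x)"
      by (simp add: power2_eq_square algebra_simps)
    then show ?thesis using Bpos[of x] by simp
  qed
  define E where "E = exp (w0 / 2 * t)"
  define y where "y = exp (w0 * t) * z x / \<delta>"
  define \<phi> where "\<phi> = flat 0 (1 - y\<^sup>2)"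
  define \<phi>' where "\<phi>' = flat 2 (1 - y\<^sup>2) * (- 2 * y)"
  have df: "((\<lambda>y. flat 0 (1 - y\<^sup>2)) has_real_derivative \<phi>') (at y)"
  proof -
    have "((\<lambda>y. flat 0 (1 - y\<^sup>2)) has_real_derivative (flat (0 + 2) (1 - y\<^sup>2) - real 0 * flat (0 + 1) (1 - y\<^sup>2)) * (- 2 * y)) (at y)"
      by (rule DERIV_chain2[OF flat_derivative]) (auto intro!: derivative_eq_intros)
    then show ?thesis by (simp add: \<phi>'_def numeral_2_eq_2)
  qed
  have dA: "(amp \<delta> has_derivative (\<lambda>v. fst v *\<^sub>R Dt (amp \<delta>) p + snd v *\<^sub>R Dx (amp \<delta>) p)) (at p)"
    by (rule has_derivative_Dt_Dx[OF Cdiff_amp])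
  have 1: "Dt (amp \<delta>) p = w0 / 2 * E * B x * \<phi> + E * B x * (\<phi>' * (w0 * y))"
  proof -
    have "((\<lambda>s. (s, x)) has_vector_derivative (1, 0)) (at t)"
      by (auto intro!: derivative_eq_intros has_vector_derivative_Pair)
    from chain_vector_derivative[OF dA[unfolded p] this]
    have "((\<lambda>s. amp \<delta> (s, x)) has_real_derivative Dt (amp \<delta>) p) (at t)"
      by (simp add: p has_real_derivative_iff_has_vector_derivative)
    moreover have "((\<lambda>s. amp \<delta> (s, x)) has_real_derivative w0 / 2 * E * B x * \<phi> + E * B x * (\<phi>' * (w0 * y))) (at t)"
    proof -
      have "((\<lambda>s. exp (w0 * s) * z x / \<delta>) has_real_derivative w0 * y) (at t)"
        using assms by (auto intro!: derivative_eq_intros simp: y_def)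
      from DERIV_chain2[OF df[unfolded y_def] this]
      have c: "((\<lambda>s. flat 0 (1 - (exp (w0 * s) * z x / \<delta>)\<^sup>2)) has_real_derivative \<phi>' * (w0 * y)) (at t)" .
      have "((\<lambda>s. exp (w0 / 2 * s) * B x) has_real_derivative w0 / 2 * E * B x) (at t)"
        by (auto intro!: derivative_eq_intros simp: E_def)
      from DERIV_mult[OF this c] show ?thesis
        by (simp add: amp_def E_def y_def \<phi>_def mult_ac)
    qed
    ultimately show ?thesis by (rule DERIV_unique)
  qed
  have 2: "Dx (amp \<delta>) p = E * b * \<phi> + E * B x * (\<phi>' * (exp (w0 * t) * (B x)\<^sup>2 / \<delta>))"
  proof -
    have "((\<lambda>s. (t, s)) has_vector_derivative (0, 1)) (at x)"
      by (auto intro!: derivative_eq_intros has_vector_derivative_Pair)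
    from chain_vector_derivative[OF dA[unfolded p] this]
    have "((\<lambda>s. amp \<delta> (t, s)) has_real_derivative Dx (amp \<delta>) p) (at x)"
      by (simp add: p has_real_derivative_iff_has_vector_derivative)
    moreover have "((\<lambda>s. amp \<delta> (t, s)) has_real_derivative E * b * \<phi> + E * B x * (\<phi>' * (exp (w0 * t) * (B x)\<^sup>2 / \<delta>))) (at x)"
    proof -
      have "((\<lambda>s. exp (w0 * t) * z s / \<delta>) has_real_derivative exp (w0 * t) * (B x)\<^sup>2 / \<delta>) (at x)"
        using assms by (auto intro!: derivative_eq_intros dz)
      from DERIV_chain2[OF df[unfolded y_def] this]
      have c: "((\<lambda>s. flat 0 (1 - (exp (w0 * t) * z s / \<delta>)\<^sup>2)) has_real_derivative \<phi>' * (exp (w0 * t) * (B x)\<^sup>2 / \<delta>)) (at x)" .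
      have "((\<lambda>s. exp (w0 / 2 * t) * B s) has_real_derivative E * b) (at x)"
        by (auto intro!: derivative_eq_intros db simp: E_def)
      from DERIV_mult[OF this c] show ?thesis
        by (simp add: amp_def E_def y_def \<phi>_def mult_ac)
    qed
    ultimately show ?thesis by (rule DERIV_unique)
  qed
  have A: "amp \<delta> p = E * B x * \<phi>" by (simp add: amp_def p E_def \<phi>_def y_def)
  have "ray_speed m x * (exp (w0 * t) * (B x)\<^sup>2 / \<delta>) = w0 * y"
    using zB[of x] by (simp add: y_def mult.commute mult.left_commute)
  then have "ray_speed m x * (E * B x * (\<phi>' * (exp (w0 * t) * (B x)\<^sup>2 / \<delta>))) = E * B x * (\<phi>' * (w0 * y))"
    by (metis mult.commute mult.left_commute)
  moreover have "ray_speed m x * (E * b * \<phi>) + r' / 2 * (E * B x * \<phi>) = w0 / 2 * E * B x * \<phi>"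
  proof -
    have "ray_speed m x * (E * b * \<phi>) + r' / 2 * (E * B x * \<phi>) = E * \<phi> / 2 * (2 * ray_speed m x * b + r' * B x)"
      by (simp add: algebra_simps)
    then show ?thesis unfolding key by simp
  qed
  ultimately show ?thesis
    unfolding 1 2 A by (simp add: p r'_def[symmetric] distrib_left)
qed

end

lemma has_derivative_cis: "(cis has_derivative (\<lambda>v. v *\<^sub>R (\<i> * cis x))) (at x)"
proof -
  have "((\<lambda>z. exp (\<i> * z)) has_field_derivative \<i> * exp (\<i> * of_real x)) (at (of_real x))"
    by (auto intro!: derivative_eq_intros)
  from has_vector_derivative_real_field[OF this]
  show ?thesis unfolding has_vector_derivative_def cis_conv_exp[abs_def] by simp
qed

text \<open>Coincides with the function \<open>\<tau> - t\<close> on the slices as long as \<open>r \<ge> 5m/2\<close>, but stays uniformly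
  spacelike near the horizon.\<close>

lemma slice_height_exists:
  assumes m: "m > 0"
  shows "\<exists>kap. (\<forall>x. (kap has_real_derivative 2 * m / max (areal m x) (5 * m / 2)) (at x)) \<and>
     (\<forall>x. \<bar>kap x\<bar> \<le> 4/5 * \<bar>x\<bar>) \<and> (\<forall>r\<ge>5 * m / 2. kap (tortoise m r) = tortoise m r - r + 3 * m)"
proof -
  let ?g = "\<lambda>x. 2 * m / max (areal m x) (5 * m / 2)"
  have mx: "max (areal m x) (5 * m / 2) > 0" for x using m by auto
  have c: "continuous_on UNIV ?g"
    using Cdiff_imp_continuous_on[OF Cdiff_areal[OF m]] mx by (intro continuous_intros) (auto simp: less_imp_neq[symmetric])
  then obtain kap where k0: "kap 0 = 0" and k: "\<And>x. (kap has_real_derivative ?g x) (at x)"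
    using Cdiff_antiderivative[of 0 ?g] by auto
  have g: "\<bar>?g x\<bar> \<le> 4/5" for x
  proof -
    have "2 * m / max (areal m x) (5 * m / 2) \<le> 2 * m / (5 * m / 2)"
      using m mx by (intro divide_left_mono) auto
    then show ?thesis using m mx[of x] by simp
  qed
  have "\<bar>kap x\<bar> \<le> 4/5 * \<bar>x\<bar>" for x
  proof -
    have "norm (kap x - kap 0) \<le> 4/5 * norm (x - 0)"
      by (rule field_differentiable_bound[of UNIV kap ?g]) (use k g in auto)
    then show ?thesis by (simp add: k0)
  qed
  moreover have "kap (tortoise m r) = tortoise m r - r + 3 * m" if r: "r \<ge> 5 * m / 2" for r
  proof -
    \<comment> \<open>The function x - r + 3m has x-derivative 1 - (1 - 2m/r) = 2m/r, the slope
      prescribed for \<open>kap\<close> where r \<ge> 5m/2; both functions vanish at r = 3m.\<close>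
    define d where "d s = kap (tortoise m s) - (tortoise m s - s + 3 * m)" for s
    have dd: "(d has_real_derivative 0) (at s)" if s: "s \<ge> 5 * m / 2" for s
    proof -
      have s2: "s > 2 * m" using s m by simp
      have 1: "(tortoise m has_real_derivative s / (s - 2 * m)) (at s)" by (rule tortoise_derivative[OF m s2])
      have gm: "?g (tortoise m s) = 2 * m / s" using s areal_tortoise[OF m s2] by (simp add: max_def)
      have "((\<lambda>s. kap (tortoise m s)) has_real_derivative 2 * m / s * (s / (s - 2 * m))) (at s)"
        using DERIV_chain2[OF k 1] unfolding gm .
      from DERIV_diff[OF this DERIV_add[OF DERIV_diff[OF 1 DERIV_ident] DERIV_const]]
      have "(d has_real_derivative 2 * m / s * (s / (s - 2 * m)) - (s / (s - 2 * m) - 1 + 0)) (at s)"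
        unfolding d_def[abs_def] .
      moreover have "2 * m / s * (s / (s - 2 * m)) - (s / (s - 2 * m) - 1 + 0) = 0"
        using s2 m by (simp add: field_simps)
      ultimately show ?thesis by simp
    qed
    have d3: "d (3 * m) = 0" using m by (simp add: d_def tortoise_def k0)
    have "d r = d (3 * m)"
    proof (cases r "3 * m" rule: linorder_cases)
      case less
      have c: "continuous_on {r..3 * m} d"
        using r by (intro continuous_at_imp_continuous_on ballI DERIV_isCont[OF dd]) auto
      have "d (3 * m) = d r"
        by (rule DERIV_isconst_end[OF less c]) (use r in \<open>auto intro: dd\<close>)
      then show ?thesis by simp
    next
      case greater
      have m3: "5 * m / 2 \<le> 3 * m" using m by simp
      have c: "continuous_on {3 * m..r} d"
        using m3 by (intro continuous_at_imp_continuous_on ballI DERIV_isCont[OF dd]) auto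
      show ?thesis
        by (rule DERIV_isconst_end[OF greater c]) (use m3 in \<open>auto intro: dd\<close>)
    qed simp
    then show ?thesis using d3 by (simp add: d_def)
  qed
  ultimately show ?thesis using k by blast
qed

section \<open>WKB modes and their exact corrections\<close>

context wkb
begin

text \<open>From (l + 1/2)^2 = l (l + 1) + 1/4 the eikonal equation removes l (l + 1) from the
  potential and leaves a bounded remainder; the frequency l would leave a term of order l.\<close>

definition carrier_wave :: "nat \<Rightarrow> real \<times> real \<Rightarrow> complex" where
  "carrier_wave l p = cis ((real l + 1/2) * (- w0 * fst p + S0 (snd p)))"

definition wkb_mode :: "real \<Rightarrow> nat \<Rightarrow> real \<times> real \<Rightarrow> complex" where
  "wkb_mode \<delta> l p = of_real (amp \<delta> p) * carrier_wave l p"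

text \<open>What remains of the wave equation once the orders l^2 and l have cancelled; the absence
  of l is the source of all uniformity in l. The 1/4 is (l + 1/2)^2 - l (l + 1).\<close>

definition residual :: "real \<Rightarrow> real \<times> real \<Rightarrow> real" where
  "residual \<delta> p = Dt (Dt (amp \<delta>)) p - Dx (Dx (amp \<delta>)) p + (2 * m / areal m (snd p) - 1/4) * photon_pot m (snd p) * amp \<delta> p"

lemma Cdiff_carrier: "Cdiff k UNIV (carrier_wave l)"
  unfolding carrier_wave_def[abs_def]
  by (rule Cdiff_cis_compose Cdiff_mult Cdiff_add Cdiff_const Cdiff_fst Cdiff_snd_fun[OF CS0] open_UNIV)+

lemma Cdiff_ampc: "Cdiff k UNIV (\<lambda>p. complex_of_real (amp \<delta> p))"
  by (rule Cdiff_of_real[OF open_UNIV Cdiff_amp])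

lemma Cdiff_wkb_mode: "Cdiff k UNIV (wkb_mode \<delta> l)"
  unfolding wkb_mode_def[abs_def] by (rule Cdiff_mult[OF open_UNIV Cdiff_ampc Cdiff_carrier])

lemma carrier_derivs:
  "Dt (carrier_wave l) p = - \<i> * of_real ((real l + 1/2) * w0) * carrier_wave l p"
  "Dx (carrier_wave l) p = - \<i> * of_real ((real l + 1/2) * w0 * ray_speed m (snd p)) * carrier_wave l p"
proof -
  let ?L = "real l + 1/2"
  have g: "((\<lambda>p. ?L * (- w0 * fst p + S0 (snd p))) has_derivative (\<lambda>v. ?L * (- w0 * fst v + snd v * (- w0 * ray_speed m (snd p))))) (at p)"
    by (intro has_derivative_mult_right has_derivative_add
        DERIV_compose_FDERIV[OF dS0 bounded_linear_imp_has_derivative[OF bounded_linear_snd]]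
        bounded_linear_imp_has_derivative[OF bounded_linear_fst])
  have "(carrier_wave l has_derivative (\<lambda>v. (?L * (- w0 * fst v + snd v * (- w0 * ray_speed m (snd p)))) *\<^sub>R
      (\<i> * cis (?L * (- w0 * fst p + S0 (snd p)))))) (at p)"
    using diff_chain_at[OF g has_derivative_cis] unfolding carrier_wave_def[abs_def] o_def .
  from Dt_eq[OF this] Dx_eq[OF this]
  show "Dt (carrier_wave l) p = - \<i> * of_real (?L * w0) * carrier_wave l p"
    "Dx (carrier_wave l) p = - \<i> * of_real (?L * w0 * ray_speed m (snd p)) * carrier_wave l p"
    by (simp_all add: carrier_wave_def scaleR_conv_of_real)
qed

lemma mult_carrier_derivs:
  assumes "Cdiff (Suc k) UNIV f"
  shows "Dt (\<lambda>p. f p * carrier_wave l p) p = (Dt f p - \<i> * of_real ((real l + 1/2) * w0) * f p) * carrier_wave l p"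
    "Dx (\<lambda>p. f p * carrier_wave l p) p = (Dx f p - \<i> * of_real ((real l + 1/2) * w0 * ray_speed m (snd p)) * f p) * carrier_wave l p"
  unfolding Dt_Dx_mult[OF assms Cdiff_carrier] carrier_derivs by (simp_all add: algebra_simps)

lemma wkb_mode_derivs:
  "Dt (wkb_mode \<delta> l) p = (of_real (Dt (amp \<delta>) p) - \<i> * of_real ((real l + 1/2) * w0) * of_real (amp \<delta> p)) * carrier_wave l p"
  "Dx (wkb_mode \<delta> l) p = (of_real (Dx (amp \<delta>) p) - \<i> * of_real ((real l + 1/2) * w0 * ray_speed m (snd p)) * of_real (amp \<delta> p)) * carrier_wave l p"
  unfolding wkb_mode_def[abs_def] mult_carrier_derivs[OF Cdiff_ampc] Dt_Dx_of_real[OF Cdiff_amp] by simp_all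

text \<open>After division by the carrier, the real part contains the terms quadratic in l + 1/2,
  which combine with the potential by \<open>eikonal\<close>; the imaginary part is linear in l +
  1/2 and vanishes by \<open>amp_transport\<close>.\<close>

lemma wkb_mode_residual:
  assumes "\<delta> > 0"
  shows "Dt (Dt (wkb_mode \<delta> l)) p - Dx (Dx (wkb_mode \<delta> l)) p + mode_pot m l (snd p) *\<^sub>R wkb_mode \<delta> l p
    = of_real (residual \<delta> p) * carrier_wave l p"
proof -
  let ?A = "amp \<delta>" and ?L = "real l + 1/2"
  define \<rho> \<rho>' where "\<rho> = ray_speed m (snd p)" and "\<rho>' = deriv (ray_speed m) (snd p)"
  define c where "c = carrier_wave l p"
  have dr: "(ray_speed m has_real_derivative \<rho>') (at (snd p))"
    using Cdiff_ray_speed[OF m, of "Suc 0"] unfolding \<rho>'_def by (simp add: DERIV_deriv_iff_real_differentiable)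
  have At: "Cdiff k UNIV (Dt ?A)" and Ax: "Cdiff k UNIV (Dx ?A)" for k
    by (rule Cdiff_Dt[OF Cdiff_amp], rule Cdiff_Dx[OF Cdiff_amp])
  have CrA: "Cdiff k UNIV (\<lambda>p. ray_speed m (snd p) * ?A p)" for k
    by (rule Cdiff_mult[OF open_UNIV Cdiff_snd_fun[OF Cdiff_ray_speed[OF m]] Cdiff_amp])
  define g where "g p = complex_of_real (Dt ?A p) + (- \<i> * of_real (?L * w0)) * of_real (?A p)" for p
  define h where "h p = complex_of_real (Dx ?A p) + (- \<i> * of_real (?L * w0)) * of_real (ray_speed m (snd p) * ?A p)" for p
  have c0: "Cdiff k UNIV (\<lambda>p::real \<times> real. - \<i> * of_real (?L * w0))" for k by (rule Cdiff_const)
  have Cg: "Cdiff k UNIV g" and Ch: "Cdiff k UNIV h" for k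
    unfolding g_def[abs_def] h_def[abs_def]
    by (rule Cdiff_add Cdiff_mult Cdiff_const Cdiff_of_real[OF open_UNIV At] Cdiff_of_real[OF open_UNIV Ax] Cdiff_ampc
        Cdiff_of_real[OF open_UNIV CrA] open_UNIV)+
  have z: "Dt (\<lambda>p::real \<times> real. - \<i> * of_real (?L * w0)) p = 0" "Dx (\<lambda>p::real \<times> real. - \<i> * of_real (?L * w0)) p = 0" for p
    by (rule Dt_eq[OF has_derivative_const], rule Dx_eq[OF has_derivative_const])
  have Dg: "Dt g p = of_real (Dt (Dt ?A) p) + (- \<i> * of_real (?L * w0)) * of_real (Dt ?A p)"
    unfolding g_def[abs_def] Dt_Dx_add[OF Cdiff_of_real[OF open_UNIV At] Cdiff_mult[OF open_UNIV c0 Cdiff_ampc]]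
      Dt_Dx_mult[OF c0 Cdiff_ampc] z Dt_Dx_of_real[OF At] Dt_Dx_of_real[OF Cdiff_amp] by simp
  have Dh: "Dx h p = of_real (Dx (Dx ?A) p) + (- \<i> * of_real (?L * w0)) * of_real (\<rho> * Dx ?A p + \<rho>' * ?A p)"
    unfolding h_def[abs_def] Dt_Dx_add[OF Cdiff_of_real[OF open_UNIV Ax] Cdiff_mult[OF open_UNIV c0 Cdiff_of_real[OF open_UNIV CrA]]]
      Dt_Dx_mult[OF c0 Cdiff_of_real[OF open_UNIV CrA]] z Dt_Dx_of_real[OF Ax] Dt_Dx_of_real[OF CrA]
      Dt_Dx_mult[OF Cdiff_snd_fun[OF Cdiff_ray_speed[OF m]] Cdiff_amp] Dt_Dx_snd[OF dr] by (simp add: \<rho>_def)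
  have 1: "Dt (wkb_mode \<delta> l) = (\<lambda>p. g p * carrier_wave l p)"
    by (rule ext) (simp add: wkb_mode_derivs g_def)
  have 2: "Dx (wkb_mode \<delta> l) = (\<lambda>p. h p * carrier_wave l p)"
    by (rule ext) (simp add: wkb_mode_derivs h_def mult_ac)
  have T: "Dt ?A p = \<rho> * Dx ?A p + \<rho>' / 2 * ?A p"
    unfolding \<rho>_def \<rho>'_def by (rule amp_transport[OF assms])
  have E: "w0 * w0 - (w0 * \<rho>) * (w0 * \<rho>) = photon_pot m (snd p)"
    using eikonal[OF m, of "snd p"] by (simp add: \<rho>_def power2_eq_square)
  have 3: "Dt (Dt (wkb_mode \<delta> l)) p - Dx (Dx (wkb_mode \<delta> l)) p + mode_pot m l (snd p) *\<^sub>R wkb_mode \<delta> l p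
     = ((Dt g p - \<i> * of_real (?L * w0) * g p) - (Dx h p - \<i> * of_real (?L * w0 * \<rho>) * h p) + of_real (mode_pot m l (snd p)) * of_real (?A p)) * c"
    unfolding 1 2 mult_carrier_derivs[OF Cg] mult_carrier_derivs[OF Ch] wkb_mode_def
    by (simp add: c_def \<rho>_def scaleR_conv_of_real algebra_simps)
  have re: "(Dt (Dt ?A) p - ?L * w0 * (?L * w0 * ?A p)) - (Dx (Dx ?A) p - ?L * w0 * \<rho> * (?L * w0 * (\<rho> * ?A p)))
     + mode_pot m l (snd p) * ?A p = residual \<delta> p"
  proof -
    have "(Dt (Dt ?A) p - ?L * w0 * (?L * w0 * ?A p)) - (Dx (Dx ?A) p - ?L * w0 * \<rho> * (?L * w0 * (\<rho> * ?A p)))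
       + mode_pot m l (snd p) * ?A p
       = Dt (Dt ?A) p - Dx (Dx ?A) p + (mode_pot m l (snd p) - ?L * ?L * (w0 * w0 - (w0 * \<rho>) * (w0 * \<rho>))) * ?A p"
      by (simp add: algebra_simps)
    also have "mode_pot m l (snd p) - ?L * ?L * (w0 * w0 - (w0 * \<rho>) * (w0 * \<rho>)) = (2 * m / areal m (snd p) - 1/4) * photon_pot m (snd p)"
      unfolding E mode_pot_def by (simp add: algebra_simps)
    finally show ?thesis by (simp add: residual_def)
  qed
  have im: "- (?L * w0 * Dt ?A p) - ?L * w0 * Dt ?A p - (- (?L * w0 * (\<rho> * Dx ?A p + \<rho>' * ?A p)) - ?L * w0 * \<rho> * Dx ?A p) = 0"
    unfolding T by (simp add: algebra_simps)
  have "(Dt g p - \<i> * of_real (?L * w0) * g p) - (Dx h p - \<i> * of_real (?L * w0 * \<rho>) * h p) + of_real (mode_pot m l (snd p)) * of_real (?A p)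
      = of_real (residual \<delta> p)"
  proof (rule complex_eqI)
    show "Re ((Dt g p - \<i> * of_real (?L * w0) * g p) - (Dx h p - \<i> * of_real (?L * w0 * \<rho>) * h p) + of_real (mode_pot m l (snd p)) * of_real (?A p))
      = Re (of_real (residual \<delta> p))"
      unfolding Dg Dh using re by (simp add: g_def h_def \<rho>_def)
    show "Im ((Dt g p - \<i> * of_real (?L * w0) * g p) - (Dx h p - \<i> * of_real (?L * w0 * \<rho>) * h p) + of_real (mode_pot m l (snd p)) * of_real (?A p))
      = Im (of_real (residual \<delta> p))"
      unfolding Dg Dh using im by (simp add: g_def h_def \<rho>_def)
  qed
  then show ?thesis unfolding 3 c_def by simp
qed

lemma photon_pot_le: "photon_pot m x \<le> 1 / (27 * m\<^sup>2)"
proof -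
  have "27 * m\<^sup>2 * photon_pot m x \<le> 1" unfolding ray_speed_sq[OF m, symmetric] by simp
  then show ?thesis using m by (simp add: pos_le_divide_eq mult.commute)
qed

lemma mode_pot_bounds: "0 \<le> mode_pot m l x" "mode_pot m l x \<le> (real l * (real l + 1) + 1) / (27 * m\<^sup>2)"
  "real l * real l * photon_pot m x \<le> mode_pot m l x"
proof -
  have r: "0 < 2 * m / areal m x" "2 * m / areal m x \<le> 1"
    using areal_gt[OF m, of x] areal_pos[OF m, of x] m by simp_all
  have h: "0 < photon_pot m x" by (rule photon_pot_pos[OF m])
  show "0 \<le> mode_pot m l x" unfolding mode_pot_def using r h by (intro mult_nonneg_nonneg) auto
  have "mode_pot m l x \<le> (real l * (real l + 1) + 1) * (1 / (27 * m\<^sup>2))"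
    unfolding mode_pot_def using r h photon_pot_le by (intro mult_mono) auto
  then show "mode_pot m l x \<le> (real l * (real l + 1) + 1) / (27 * m\<^sup>2)" by simp
  show "real l * real l * photon_pot m x \<le> mode_pot m l x"
    unfolding mode_pot_def using r h by (intro mult_right_mono) (auto simp: algebra_simps)
qed

lemma Cdiff_mode_pot: "Cdiff k UNIV (mode_pot m l)"
  unfolding mode_pot_def[abs_def]
  by (rule Cdiff_mult Cdiff_add Cdiff_const Cdiff_divide Cdiff_areal[OF m] Cdiff_photon_pot[OF m] open_UNIV
      | simp add: areal_nz[OF m] del: differentiable_times_on.simps)+

lemma Cdiff_residual: "Cdiff k UNIV (residual \<delta>)"
proof -
  have p: "Cdiff k UNIV (\<lambda>x. (2 * m / areal m x - 1/4) * photon_pot m x)"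
    by (rule Cdiff_mult Cdiff_diff Cdiff_const Cdiff_divide Cdiff_areal[OF m] Cdiff_photon_pot[OF m] open_UNIV
      | simp add: areal_nz[OF m] del: differentiable_times_on.simps)+
  show ?thesis
    unfolding residual_def[abs_def]
    by (rule Cdiff_add Cdiff_diff Cdiff_mult Cdiff_Dt Cdiff_Dx Cdiff_amp Cdiff_snd_fun[OF p] open_UNIV)+
qed

lemma residual_outside_cone:
  assumes "x1 > 0" "0 < \<delta>" "\<delta> \<le> min (z x1) (- z (- x1))" "\<bar>x\<bar> > x1 + \<bar>t\<bar>"
  shows "residual \<delta> (t, x) = 0"
proof -
  let ?U = "{p::real \<times> real. \<bar>snd p\<bar> > x1 + \<bar>fst p\<bar>}"
  have U: "open ?U" by (intro open_Collect_less continuous_intros)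
  have z: "Dt f p = 0 \<and> Dx f p = 0" if "\<And>p. p \<in> ?U \<Longrightarrow> f p = 0" "p \<in> ?U" for f :: "real \<times> real \<Rightarrow> real" and p
  proof -
    have "(f has_derivative (\<lambda>_. 0)) (at p)"
      by (rule has_derivative_transform_within_open[OF has_derivative_const[of 0] U that(2)]) (simp add: that(1))
    from Dt_eq[OF this] Dx_eq[OF this] show ?thesis by simp
  qed
  have a: "amp \<delta> p = 0" if "p \<in> ?U" for p
    using amp_outside_cone[OF assms(1-3), of "fst p" "snd p"] that by simp
  have "Dt (amp \<delta>) p = 0" "Dx (amp \<delta>) p = 0" if "p \<in> ?U" for p using z[OF a that] by auto
  then have "Dt (Dt (amp \<delta>)) (t, x) = 0" "Dx (Dx (amp \<delta>)) (t, x) = 0"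
    using z[of "Dt (amp \<delta>)" "(t, x)"] z[of "Dx (amp \<delta>)" "(t, x)"] assms(4) by auto
  then show ?thesis using a[of "(t, x)"] assms(4) by (simp add: residual_def)
qed

text \<open>The coordinates (t + 2m ln m, x) of the points of radius r on \<Sigma>_s, obtained by
  eliminating the logarithm between \<open>tstar\<close> and \<open>tortoise\<close>.\<close>

definition on_slice :: "real \<Rightarrow> real \<Rightarrow> real \<times> real" where
  "on_slice s r = (s - tortoise m r + r - 3 * m, tortoise m r)"

text \<open>The bound C precedes l; it may depend on \<delta> and on the slice s. The exact mode is
  the WKB mode plus the solution e, with zero data at t = 0, that cancels its residual, and P, Q are
  e_t + e_x and e_t - e_x. The energy is recorded for 5m/2 \<le> r \<le> 7m/2, a range where
  \<Sigma>_s agrees with a slice that is uniformly spacelike in (t, x).\<close>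

theorem mode_exists:
  assumes x1: "x1 > 0" and \<delta>: "0 < \<delta>" "\<delta> \<le> min (z x1) (- z (- x1))"
  shows "\<exists>C. \<forall>l. \<exists>v e P Q. (\<forall>k. Cdiff k UNIV v) \<and>
    (\<forall>p. Dt (Dt v) p - Dx (Dx v) p + mode_pot m l (snd p) *\<^sub>R v p = 0) \<and>
    (\<forall>p. v p = wkb_mode \<delta> l p + e p) \<and>
    (\<forall>p. Dt v p = Dt (wkb_mode \<delta> l) p + (1/2) *\<^sub>R (P p + Q p)) \<and>
    (\<forall>p. Dx v p = Dx (wkb_mode \<delta> l) p + (1/2) *\<^sub>R (P p - Q p)) \<and>
    (\<forall>t x. \<bar>x\<bar> \<ge> 2 * x1 + \<bar>t\<bar> \<longrightarrow> v (t, x) = 0) \<and>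
    continuous_on UNIV e \<and> continuous_on UNIV P \<and> continuous_on UNIV Q \<and>
    (\<forall>s. (\<integral>\<^sup>+r. ennreal ((norm (P (on_slice s r)))\<^sup>2 + (norm (Q (on_slice s r)))\<^sup>2
        + mode_pot m l (tortoise m r) * (norm (e (on_slice s r)))\<^sup>2) * indicator {5 * m / 2..7 * m / 2} r \<partial>lborel) \<le> ennreal (C s))"
proof -
  obtain kap where kap: "\<And>x. (kap has_real_derivative 2 * m / max (areal m x) (5 * m / 2)) (at x)"
    "\<And>x. \<bar>kap x\<bar> \<le> 4/5 * \<bar>x\<bar>" "\<And>r. r \<ge> 5 * m / 2 \<Longrightarrow> kap (tortoise m r) = tortoise m r - r + 3 * m"
    using slice_height_exists[OF m] by blast
  \<comment> \<open>At |x| = X one has |s - kap x| \<le> |s| + 4/5 X, so the summand 5 (2 x1 + |s|)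
    puts both ends of [-X, X] outside the cone. The other summands make the interval contain the
    image of 5m/2 \<le> r \<le> 7m/2.\<close>
  define X where "X s = 5 * (2 * x1 + \<bar>s\<bar>) + \<bar>tortoise m (5 * m / 2)\<bar> + \<bar>tortoise m (7 * m / 2)\<bar>" for s
  have X0: "X s \<ge> 0" for s using x1 by (simp add: X_def)
  have Xk: "2 * x1 + \<bar>s - kap x\<bar> \<le> X s" if "\<bar>x\<bar> = X s" for s x
  proof -
    have "\<bar>s - kap x\<bar> \<le> \<bar>s\<bar> + 4/5 * X s" using kap(2)[of x] that by linarith
    moreover have "2 * x1 + \<bar>s\<bar> \<le> 1/5 * X s" by (simp add: X_def)
    ultimately show ?thesis by linarith
  qed
  \<comment> \<open>The carrier has modulus one, so the source of the correction has the size of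
    \<open>residual\<close>, and this bound serves all l.\<close>
  have "\<exists>B\<ge>0. \<forall>\<mu> x. 0 \<le> \<mu> \<longrightarrow> \<mu> \<le> 1 \<longrightarrow> \<bar>x\<bar> \<le> X s \<longrightarrow> \<bar>s - kap x\<bar> * \<bar>residual \<delta> (\<mu> * (s - kap x), x)\<bar> \<le> B" for s
  proof -
    have kc: "continuous_on UNIV kap" using kap(1) by (intro continuous_at_imp_continuous_on ballI DERIV_isCont)
    have rc: "continuous_on UNIV (residual \<delta>)" by (rule Cdiff_imp_continuous_on[OF Cdiff_residual[of 0]])
    let ?f = "\<lambda>q. \<bar>s - kap (snd q)\<bar> * \<bar>residual \<delta> (fst q * (s - kap (snd q)), snd q)\<bar>"
    have "continuous_on ({0..1} \<times> {- X s..X s}) ?f"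
      by (intro continuous_intros continuous_on_compose2[OF kc] continuous_on_compose2[OF rc] subset_UNIV)
    then have "bounded (?f ` ({0..1} \<times> {- X s..X s}))"
      by (intro compact_imp_bounded compact_continuous_image compact_Times compact_Icc)
    then obtain B where B: "\<And>q. q \<in> {0..1} \<times> {- X s..X s} \<Longrightarrow> ?f q \<le> B"
    proof -
      assume a: "\<And>B. (\<And>q. q \<in> {0..1} \<times> {- X s..X s} \<Longrightarrow> ?f q \<le> B) \<Longrightarrow> thesis"
      from \<open>bounded _\<close> obtain B where "\<forall>y\<in>?f ` ({0..1} \<times> {- X s..X s}). norm y \<le> B" unfolding bounded_iff by blast
      then have "?f q \<le> B" if "q \<in> {0..1} \<times> {- X s..X s}" for q using imageI[OF that, of ?f] by (auto simp: abs_le_iff dest!: bspec)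
      then show thesis by (rule a)
    qed
    show ?thesis
    proof (intro exI[of _ "\<bar>B\<bar>"] conjI allI impI)
      fix \<mu> x :: real assume "0 \<le> \<mu>" "\<mu> \<le> 1" "\<bar>x\<bar> \<le> X s"
      then have "(\<mu>, x) \<in> {0..1} \<times> {- X s..X s}" by auto
      from B[OF this] show "\<bar>s - kap x\<bar> * \<bar>residual \<delta> (\<mu> * (s - kap x), x)\<bar> \<le> \<bar>B\<bar>" by simp
    qed simp
  qed
  then obtain B where B0: "\<And>s. B s \<ge> 0"
    and B: "\<And>s \<mu> x. 0 \<le> \<mu> \<Longrightarrow> \<mu> \<le> 1 \<Longrightarrow> \<bar>x\<bar> \<le> X s \<Longrightarrow> \<bar>s - kap x\<bar> * \<bar>residual \<delta> (\<mu> * (s - kap x), x)\<bar> \<le> B s"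
    by metis
  show ?thesis
  proof (rule exI[of _ "\<lambda>s. 200 * (B s)\<^sup>2 * X s"], rule allI)
    fix l
    let ?V = "mode_pot m l" and ?w = "wkb_mode \<delta> l"
    define F where "F p = complex_of_real (residual \<delta> p) * carrier_wave l p" for p
    have CF: "Cdiff k UNIV F" for k
      unfolding F_def[abs_def] by (rule Cdiff_mult[OF open_UNIV Cdiff_of_real[OF open_UNIV Cdiff_residual] Cdiff_carrier])
    have Vb: "\<bar>?V x\<bar> \<le> (real l * (real l + 1) + 1) / (27 * m\<^sup>2)" for x
      using mode_pot_bounds(1,2)[of l x] by simp
    \<comment> \<open>The vanishing of \<open>residual\<close>, which contains derivatives of the
      amplitude, is available on the open complement of the cone; passing from x1 to 2 x1 turns it
      into the closed condition of the existence theorem.\<close>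
    have F0: "F (t, x) = 0" if "\<bar>x\<bar> \<ge> 2 * x1 + \<bar>t\<bar>" for t x
      using residual_outside_cone[OF x1 \<delta>, of t x] that x1 by (simp add: F_def)
    have ex: "\<exists>e P Q. (\<forall>k. Cdiff k UNIV e) \<and> (\<forall>k. Cdiff k UNIV P) \<and> (\<forall>k. Cdiff k UNIV Q) \<and>
      (\<forall>p. (e has_derivative (\<lambda>v. fst v *\<^sub>R ((1/2) *\<^sub>R (P p + Q p)) + snd v *\<^sub>R ((1/2) *\<^sub>R (P p - Q p)))) (at p)) \<and>
      (\<forall>p. frechet_derivative P (at p) (1, -1) = - F p - ?V (snd p) *\<^sub>R e p) \<and>
      (\<forall>p. frechet_derivative Q (at p) (1, 1) = - F p - ?V (snd p) *\<^sub>R e p) \<and>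
      (\<forall>x. e (0, x) = 0 \<and> P (0, x) = 0 \<and> Q (0, x) = 0) \<and>
      (\<forall>t x. \<bar>x\<bar> \<ge> 2 * x1 + \<bar>t\<bar> \<longrightarrow> e (t, x) = 0 \<and> P (t, x) = 0 \<and> Q (t, x) = 0)"
      by (rule wave_1d_correction_exists[OF Cdiff_mode_pot Vb CF]) (erule F0)
    then obtain e P Q where H: "(\<forall>k. Cdiff k UNIV e) \<and> (\<forall>k. Cdiff k UNIV P) \<and> (\<forall>k. Cdiff k UNIV Q) \<and>
      (\<forall>p. (e has_derivative (\<lambda>v. fst v *\<^sub>R ((1/2) *\<^sub>R (P p + Q p)) + snd v *\<^sub>R ((1/2) *\<^sub>R (P p - Q p)))) (at p)) \<and>
      (\<forall>p. frechet_derivative P (at p) (1, -1) = - F p - ?V (snd p) *\<^sub>R e p) \<and>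
      (\<forall>p. frechet_derivative Q (at p) (1, 1) = - F p - ?V (snd p) *\<^sub>R e p) \<and>
      (\<forall>x. e (0, x) = 0 \<and> P (0, x) = 0 \<and> Q (0, x) = 0) \<and>
      (\<forall>t x. \<bar>x\<bar> \<ge> 2 * x1 + \<bar>t\<bar> \<longrightarrow> e (t, x) = 0 \<and> P (t, x) = 0 \<and> Q (t, x) = 0)"
      by (elim exE) (rule that)
    note H2 = H[THEN conjunct2] note H3 = H2[THEN conjunct2] note H4 = H3[THEN conjunct2] note H5 = H4[THEN conjunct2]
    note H6 = H5[THEN conjunct2] note H7 = H6[THEN conjunct2] note H8 = H7[THEN conjunct2]
    note Ce = H[THEN conjunct1, THEN spec] note CP = H2[THEN conjunct1, THEN spec] note CQ = H3[THEN conjunct1, THEN spec]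
    note de = H4[THEN conjunct1, THEN spec] note eP = H5[THEN conjunct1, THEN spec] note eQ = H6[THEN conjunct1, THEN spec]
    have zero: "\<And>x. e (0, x) = 0" "\<And>x. P (0, x) = 0" "\<And>x. Q (0, x) = 0" using H7 by blast+
    have cone: "\<And>t x. \<bar>x\<bar> \<ge> 2 * x1 + \<bar>t\<bar> \<Longrightarrow> e (t, x) = 0" "\<And>t x. \<bar>x\<bar> \<ge> 2 * x1 + \<bar>t\<bar> \<Longrightarrow> P (t, x) = 0"
        "\<And>t x. \<bar>x\<bar> \<ge> 2 * x1 + \<bar>t\<bar> \<Longrightarrow> Q (t, x) = 0" using H8 by blast+
    have Dte: "Dt e = (\<lambda>p. (1/2) *\<^sub>R (P p + Q p))" and Dxe: "Dx e = (\<lambda>p. (1/2) *\<^sub>R (P p - Q p))"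
      using Dt_eq[OF de] Dx_eq[OF de] by (auto simp: fun_eq_iff)
    have eP': "Dt P p - Dx P p = - F p - ?V (snd p) *\<^sub>R e p" for p
      unfolding eP[of p, symmetric] frechet_derivative_at[OF has_derivative_Dt_Dx[OF CP], of p, symmetric] by simp
    have eQ': "Dt Q p + Dx Q p = - F p - ?V (snd p) *\<^sub>R e p" for p
      unfolding eQ[of p, symmetric] frechet_derivative_at[OF has_derivative_Dt_Dx[OF CQ], of p, symmetric] by simp
    have DDe: "Dt (Dt e) p - Dx (Dx e) p = - F p - ?V (snd p) *\<^sub>R e p" for p
    proof -
      have 1: "((\<lambda>p. (1/2) *\<^sub>R (P p + Q p)) has_derivative (\<lambda>v. (1/2) *\<^sub>R ((fst v *\<^sub>R Dt P p + snd v *\<^sub>R Dx P p) + (fst v *\<^sub>R Dt Q p + snd v *\<^sub>R Dx Q p)))) (at p)"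
        by (intro has_derivative_scaleR_right has_derivative_add has_derivative_Dt_Dx[OF CP] has_derivative_Dt_Dx[OF CQ])
      have 2: "((\<lambda>p. (1/2) *\<^sub>R (P p - Q p)) has_derivative (\<lambda>v. (1/2) *\<^sub>R ((fst v *\<^sub>R Dt P p + snd v *\<^sub>R Dx P p) - (fst v *\<^sub>R Dt Q p + snd v *\<^sub>R Dx Q p)))) (at p)"
        by (intro has_derivative_scaleR_right has_derivative_diff has_derivative_Dt_Dx[OF CP] has_derivative_Dt_Dx[OF CQ])
      have "Dt (Dt e) p - Dx (Dx e) p = (1/2) *\<^sub>R ((Dt P p - Dx P p) + (Dt Q p + Dx Q p))"
        unfolding Dte Dxe Dt_eq[OF 1] Dx_eq[OF 2] by (simp add: algebra_simps)
      also have "\<dots> = - F p - ?V (snd p) *\<^sub>R e p" unfolding eP' eQ' by (simp only: scaleR_half_double)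
      finally show ?thesis .
    qed
    define v where "v p = ?w p + e p" for p
    have Cv: "Cdiff k UNIV v" for k
      unfolding v_def[abs_def] by (rule Cdiff_add[OF open_UNIV Cdiff_wkb_mode Ce])
    have Dtv: "Dt v = (\<lambda>p. Dt ?w p + Dt e p)" and Dxv: "Dx v = (\<lambda>p. Dx ?w p + Dx e p)"
      unfolding v_def[abs_def] using Dt_Dx_add[OF Cdiff_wkb_mode Ce] by (auto simp: fun_eq_iff)
    have wave: "Dt (Dt v) p - Dx (Dx v) p + ?V (snd p) *\<^sub>R v p = 0" for p
    proof -
      have "Dt (Dt v) p - Dx (Dx v) p + ?V (snd p) *\<^sub>R v p
         = (Dt (Dt ?w) p - Dx (Dx ?w) p + ?V (snd p) *\<^sub>R ?w p) + (Dt (Dt e) p - Dx (Dx e) p) + ?V (snd p) *\<^sub>R e p"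
        unfolding Dtv Dxv Dt_Dx_add[OF Cdiff_Dt[OF Cdiff_wkb_mode] Cdiff_Dt[OF Ce]] Dt_Dx_add[OF Cdiff_Dx[OF Cdiff_wkb_mode] Cdiff_Dx[OF Ce]] v_def
        by (simp add: algebra_simps)
      also have "\<dots> = 0" unfolding wkb_mode_residual[OF \<delta>(1)] DDe F_def by simp
      finally show ?thesis .
    qed
    have cont: "continuous_on UNIV e" "continuous_on UNIV P" "continuous_on UNIV Q"
      using Cdiff_imp_continuous_on[OF Ce[of 0]] Cdiff_imp_continuous_on[OF CP[of 0]] Cdiff_imp_continuous_on[OF CQ[of 0]] by auto
    have v0: "v (t, x) = 0" if "\<bar>x\<bar> \<ge> 2 * x1 + \<bar>t\<bar>" for t x
      using cone(1)[OF that] amp_outside_cone[OF x1 \<delta>, of t x] that x1 by (simp add: v_def wkb_mode_def)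
    have energy: "(\<integral>\<^sup>+r. ennreal ((norm (P (on_slice s r)))\<^sup>2 + (norm (Q (on_slice s r)))\<^sup>2
        + ?V (tortoise m r) * (norm (e (on_slice s r)))\<^sup>2) * indicator {5 * m / 2..7 * m / 2} r \<partial>lborel) \<le> ennreal (200 * (B s)\<^sup>2 * X s)" for s
    proof -
      let ?k = "\<lambda>x. s - kap x"
      define f where "f x = (norm (P (?k x, x)))\<^sup>2 + (norm (Q (?k x, x)))\<^sup>2 + ?V x * (norm (e (?k x, x)))\<^sup>2" for x
      have f0: "f x \<ge> 0" for x unfolding f_def using mode_pot_bounds(1) by simp
      have kc: "continuous_on UNIV kap" using kap(1) by (intro continuous_at_imp_continuous_on ballI DERIV_isCont)
      have Vc: "continuous_on UNIV ?V" by (rule Cdiff_imp_continuous_on[OF Cdiff_mode_pot[of 0]])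
      have fc: "continuous_on UNIV f"
        unfolding f_def[abs_def]
        by (intro continuous_intros Vc continuous_on_compose2[OF cont(1)] continuous_on_compose2[OF cont(2)] continuous_on_compose2[OF cont(3)] kc subset_UNIV)
      have mx: "max (areal m x) (5 * m / 2) > 0" for x using m by auto
      have est: "integral {- X s..X s} f \<le> 200 * (B s)\<^sup>2 * X s"
        unfolding f_def
      proof (rule slice_energy_estimate[OF de CP CQ eP eQ zero cone(2,3)])
        show "continuous_on UNIV F" by (rule Cdiff_imp_continuous_on[OF CF[of 0]])
        show "continuous_on UNIV ?V" by (rule Vc)
        show "?V x \<ge> 0" for x by (rule mode_pot_bounds(1))
        show "((\<lambda>x. s - kap x) has_real_derivative - (2 * m / max (areal m x) (5 * m / 2))) (at x)" for x
          using DERIV_diff[OF DERIV_const kap(1)] by simp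
        show "continuous_on UNIV (\<lambda>x. - (2 * m / max (areal m x) (5 * m / 2)))"
          using Cdiff_imp_continuous_on[OF Cdiff_areal[OF m]] mx by (intro continuous_intros) (auto simp: less_imp_neq[symmetric])
        show "\<bar>- (2 * m / max (areal m x) (5 * m / 2))\<bar> \<le> 4/5" for x
        proof -
          have "2 * m / max (areal m x) (5 * m / 2) \<le> 2 * m / (5 * m / 2)"
            using m mx by (intro divide_left_mono) auto
          then show ?thesis using m mx[of x] by simp
        qed
        show "X s \<ge> 0" by (rule X0)
        show "2 * x1 + \<bar>s - kap (X s)\<bar> \<le> X s" "2 * x1 + \<bar>s - kap (- X s)\<bar> \<le> X s"
          using Xk[of "X s" s] Xk[of "- X s" s] X0[of s] by auto
        show "B s \<ge> 0" by (rule B0)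
        show "\<bar>s - kap x\<bar> * norm (F (\<mu> * (s - kap x), x)) \<le> B s" if "0 \<le> \<mu>" "\<mu> \<le> 1" "\<bar>x\<bar> \<le> X s" for \<mu> x
          using B[OF that] by (simp add: F_def norm_mult carrier_wave_def)
      qed
      have "(\<integral>\<^sup>+r. ennreal ((norm (P (on_slice s r)))\<^sup>2 + (norm (Q (on_slice s r)))\<^sup>2
          + ?V (tortoise m r) * (norm (e (on_slice s r)))\<^sup>2) * indicator {5 * m / 2..7 * m / 2} r \<partial>lborel)
        \<le> (\<integral>\<^sup>+r. ennreal (f (tortoise m r)) * ennreal (r / (r - 2 * m)) * indicator {5 * m / 2..7 * m / 2} r \<partial>lborel)"
      proof (rule nn_integral_mono)
        fix r
        show "ennreal ((norm (P (on_slice s r)))\<^sup>2 + (norm (Q (on_slice s r)))\<^sup>2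
          + ?V (tortoise m r) * (norm (e (on_slice s r)))\<^sup>2) * indicator {5 * m / 2..7 * m / 2} r
          \<le> ennreal (f (tortoise m r)) * ennreal (r / (r - 2 * m)) * indicator {5 * m / 2..7 * m / 2} r"
        proof (cases "r \<in> {5 * m / 2..7 * m / 2}")
          case True
          \<comment> \<open>The lower limit r \<ge> 5m/2 enters here: in this range the slice t = s
            - kap x is the true \<Sigma>_s. The factor r/(r - 2m) \<ge> 1, the derivative of
            \<open>tortoise\<close>, is inserted next to prepare the substitution x =
            \<open>tortoise m r\<close>.\<close>
          then have os: "on_slice s r = (?k (tortoise m r), tortoise m r)" using kap(3)[of r] by (simp add: on_slice_def)
          have "1 \<le> r / (r - 2 * m)" using True m by (simp add: field_simps)
          then have "f (tortoise m r) * 1 \<le> f (tortoise m r) * (r / (r - 2 * m))" using f0 by (intro mult_left_mono) auto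
          then have "ennreal (f (tortoise m r)) \<le> ennreal (f (tortoise m r) * (r / (r - 2 * m)))" by (simp add: ennreal_leI)
          also have "\<dots> = ennreal (f (tortoise m r)) * ennreal (r / (r - 2 * m))" by (rule ennreal_mult'[OF f0])
          finally show ?thesis using True unfolding os f_def by simp
        qed simp
      qed
      also have "\<dots> = (\<integral>\<^sup>+x. ennreal (f x) * indicator {tortoise m (5 * m / 2)..tortoise m (7 * m / 2)} x \<partial>lborel)"
      proof (rule nn_integral_substitution_aux[symmetric])
        show "(tortoise m has_real_derivative r / (r - 2 * m)) (at r)" if "r \<in> {5 * m / 2..7 * m / 2}" for r
          using that m by (intro tortoise_derivative) auto
        show "continuous_on {5 * m / 2..7 * m / 2} (\<lambda>r. r / (r - 2 * m))" using m by (intro continuous_intros) auto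
      qed (use m borel_measurable_continuous_onI[OF fc] in auto)
      also have "\<dots> \<le> (\<integral>\<^sup>+x. ennreal (f x * indicator {- X s..X s} x) \<partial>lborel)"
      proof (rule nn_integral_mono)
        have "- X s \<le> tortoise m (5 * m / 2)" "tortoise m (7 * m / 2) \<le> X s"
          using x1 by (auto simp: X_def)
        then show "ennreal (f x) * indicator {tortoise m (5 * m / 2)..tortoise m (7 * m / 2)} x \<le> ennreal (f x * indicator {- X s..X s} x)" for x
          by (auto split: split_indicator)
      qed
      also have "\<dots> = ennreal (integral {- X s..X s} f)"
      proof (rule nn_integral_has_integral_lborel)
        show "(\<lambda>x. f x * indicator {- X s..X s} x) \<in> borel_measurable borel"
          using borel_measurable_continuous_onI[OF fc] by measurable
        show "0 \<le> f x * indicator {- X s..X s} x" for x using f0 by simp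
        have "(f has_integral integral {- X s..X s} f) {- X s..X s}"
          by (intro integrable_integral integrable_continuous_real continuous_on_subset[OF fc] subset_UNIV)
        moreover have "(\<lambda>x. f x * indicator {- X s..X s} x) = (\<lambda>x. if x \<in> {- X s..X s} then f x else 0)"
          by (auto simp: indicator_def fun_eq_iff)
        ultimately show "((\<lambda>x. f x * indicator {- X s..X s} x) has_integral integral {- X s..X s} f) UNIV"
          by (simp only: has_integral_restrict_UNIV)
      qed
      also have "\<dots> \<le> ennreal (200 * (B s)\<^sup>2 * X s)" using est by (rule ennreal_leI)
      finally show ?thesis .
    qed
    show "\<exists>v e P Q. (\<forall>k. Cdiff k UNIV v) \<and>
    (\<forall>p. Dt (Dt v) p - Dx (Dx v) p + mode_pot m l (snd p) *\<^sub>R v p = 0) \<and>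
    (\<forall>p. v p = wkb_mode \<delta> l p + e p) \<and>
    (\<forall>p. Dt v p = Dt (wkb_mode \<delta> l) p + (1/2) *\<^sub>R (P p + Q p)) \<and>
    (\<forall>p. Dx v p = Dx (wkb_mode \<delta> l) p + (1/2) *\<^sub>R (P p - Q p)) \<and>
    (\<forall>t x. \<bar>x\<bar> \<ge> 2 * x1 + \<bar>t\<bar> \<longrightarrow> v (t, x) = 0) \<and>
    continuous_on UNIV e \<and> continuous_on UNIV P \<and> continuous_on UNIV Q \<and>
    (\<forall>s. (\<integral>\<^sup>+r. ennreal ((norm (P (on_slice s r)))\<^sup>2 + (norm (Q (on_slice s r)))\<^sup>2
        + mode_pot m l (tortoise m r) * (norm (e (on_slice s r)))\<^sup>2) * indicator {5 * m / 2..7 * m / 2} r \<partial>lborel) \<le> ennreal (200 * (B s)\<^sup>2 * X s))"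
    proof (rule exI[of _ v], rule exI[of _ e], rule exI[of _ P], rule exI[of _ Q], intro conjI allI impI)
      show "Dt v p = Dt ?w p + (1/2) *\<^sub>R (P p + Q p)" "Dx v p = Dx ?w p + (1/2) *\<^sub>R (P p - Q p)" for p
        unfolding Dtv Dxv Dte Dxe by (rule refl)+
      show "v p = ?w p + e p" for p by (rule v_def)
    qed (fact Cv wave v0 cont energy)+
  qed
qed

end

section \<open>Geometry of the exterior\<close>

lemma pd_eq: "(f has_derivative D) (at p) \<Longrightarrow> pd i f p = D (axis i 1)"
  unfolding pd_def using frechet_derivative_at by metis

lemma has_derivative_pd_sum:
  assumes "(f has_derivative D) (at p)"
  shows "D v = (\<Sum>i\<in>UNIV. v $ i *\<^sub>R pd i f p)"
proof -
  have lin: "linear D" using assms by (rule has_derivative_linear)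
  have "D v = D (\<Sum>i\<in>UNIV. v $ i *\<^sub>R axis i 1)"
    by (simp add: basis_expansion flip: scalar_mult_eq_scaleR)
  then show ?thesis
    by (simp add: linear_sum[OF lin] linear_cmul[OF lin] pd_eq[OF assms])
qed

lemma inner_4: "(x::real^4) \<bullet> y = x$1 * y$1 + x$2 * y$2 + x$3 * y$3 + x$4 * y$4"
  by (simp add: inner_vec_def sum_4)

lemma dt_nth [simp]: "dt $ 1 = 1" "dt $ 2 = 0" "dt $ 3 = 0" "dt $ 4 = 0"
  by (simp_all add: dt_def axis_def)

lemma dr_1 [simp]: "dr p $ 1 = 0" by (simp add: dr_def)

lemma radius_has_derivative:
  assumes "radius p > 0"
  shows "(radius has_derivative (\<lambda>v. dr p \<bullet> v)) (at p)"
proof -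
  have pos: "(p$2)\<^sup>2 + (p$3)\<^sup>2 + (p$4)\<^sup>2 > 0" using assms by (simp add: radius_def)
  have "((\<lambda>p. sqrt ((p$2)\<^sup>2 + (p$3)\<^sup>2 + (p$4)\<^sup>2)) has_derivative (\<lambda>v. dr p \<bullet> v)) (at p)"
    by (rule has_derivative_eq_rhs, (rule derivative_intros bounded_linear.has_derivative[OF bounded_linear_vec_nth] | rule pos)+)
      (use assms pos in \<open>auto simp: fun_eq_iff inner_4 dr_def radius_def field_simps\<close>)
  then show ?thesis unfolding radius_def[abs_def] .
qed

lemma dr_norm: "radius p > 0 \<Longrightarrow> (dr p $ 2)\<^sup>2 + (dr p $ 3)\<^sup>2 + (dr p $ 4)\<^sup>2 = 1"
proof -
  assume r: "radius p > 0"
  have "(radius p)\<^sup>2 = (p$2)\<^sup>2 + (p$3)\<^sup>2 + (p$4)\<^sup>2" by (simp add: radius_def)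
  moreover from r have "(radius p)\<^sup>2 \<noteq> 0" by simp
  ultimately show ?thesis
    by (simp add: dr_def power_divide flip: add_divide_distrib)
qed

lemma dr_has_derivative:
  assumes "radius p > 0" "i \<noteq> 1"
  shows "((\<lambda>q. dr q $ i) has_derivative (\<lambda>v. (v $ i - dr p $ i * (dr p \<bullet> v)) / radius p)) (at p)"
proof -
  have "((\<lambda>q. q $ i / radius q) has_derivative (\<lambda>v. (v $ i - dr p $ i * (dr p \<bullet> v)) / radius p)) (at p)"
    by (rule has_derivative_eq_rhs, rule has_derivative_divide[OF bounded_linear.has_derivative[OF bounded_linear_vec_nth has_derivative_ident] radius_has_derivative[OF assms(1)]])
      (use assms in \<open>auto simp: fun_eq_iff dr_def field_simps\<close>)
  then show ?thesis using assms(2) by (simp add: dr_def)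
qed

context
  fixes m :: real and p :: "real^4"
  assumes m: "m > 0" and p: "p \<in> exterior m"
begin

text \<open>\<open>lapse\<close> denotes 1 - 2m/r itself, not its square root. \<open>psi\<close>
  has two roles: it is the excess of the coefficient of dr^2 over the flat metric, and it is the
  r-derivative 2m/(r - 2m) of \<open>tstar\<close>.\<close>

definition "beta = 2 * m / radius p"
definition "lapse = 1 - 2 * m / radius p"
definition "psi = inverse (1 - 2 * m / radius p) - 1"
private abbreviation "a \<equiv> dr p $ 2"
private abbreviation "b \<equiv> dr p $ 3"
private abbreviation "c \<equiv> dr p $ 4"

lemma rad: "radius p > 2 * m" "radius p > 0"
  using m p by (simp_all add: exterior_def)

lemma beta_bounds: "0 < beta" "beta < 1" "0 < lapse" "lapse = 1 - beta"
  using rad m by (simp_all add: beta_def lapse_def)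

lemma psi_eq: "psi = beta / lapse" "psi = 2 * m / (radius p - 2 * m)" "lapse * psi = beta" "psi - beta - psi * beta = 0"
  using rad m by (simp_all add: psi_def beta_def lapse_def field_simps)

lemma abc: "a * a + b * b + c * c = 1"
  using dr_norm[OF rad(2)] by (simp add: power2_eq_square)

lemma metric_nth: "schwarzschild m p $ i $ j = - lapse * dt $ i * dt $ j + (if i = j \<and> i \<noteq> 1 then 1 else 0) + psi * dr p $ i * dr p $ j"
  by (simp add: schwarzschild_def sphere_part_def lapse_def psi_def algebra_simps)

definition "cometric = (\<chi> i j. - inverse lapse * dt $ i * dt $ j + (if i = j \<and> i \<noteq> 1 then 1 else 0) - beta * dr p $ i * dr p $ j)"

text \<open>On the spatial part the metric is the identity plus \<open>psi\<close> times the
  projection onto the unit covector dr; its inverse is the identity minus psi/(1 + psi) =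
  \<open>beta\<close> times the same projection.\<close>

lemma metric_cometric: "schwarzschild m p ** cometric = mat 1"
proof -
  note h = abc psi_eq(4)
  have l: "lapse * inverse lapse = 1" using beta_bounds(3) by simp
  have "\<forall>i j. (\<Sum>k\<in>UNIV. schwarzschild m p $ i $ k * cometric $ k $ j) = mat 1 $ i $ j"
    unfolding forall_4
    by (simp add: sum_4 metric_nth cometric_def mat_def l, intro conjI; use h in algebra)
  then show ?thesis
    by (simp add: vec_eq_iff matrix_matrix_mult_def)
qed

lemma inverse_metric_schwarzschild: "inverse_metric (schwarzschild m) p = cometric"
proof -
  have "inverse_metric (schwarzschild m) p ** (schwarzschild m p ** cometric) = cometric"
    using inverse_metric_inverts(2)[of "schwarzschild m" p, OF invertible_schwarzschild[OF m p]]
    by (simp only: matrix_mul_assoc matrix_mul_lid)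
  then show ?thesis by (simp add: metric_cometric)
qed

lemma tstar_has_derivative: "(tstar m has_derivative (\<lambda>v. v $ 1 + psi * (dr p \<bullet> v))) (at p)"
proof -
  have "((\<lambda>q. q $ 1 + 2 * m * ln (radius q - 2 * m)) has_derivative (\<lambda>v. v $ 1 + psi * (dr p \<bullet> v))) (at p)"
  proof -
    have "((\<lambda>s. 2 * m * ln (s - 2 * m)) has_real_derivative psi) (at (radius p))"
      using rad by (auto intro!: derivative_eq_intros simp: psi_eq(2))
    from has_derivative_add[OF bounded_linear_imp_has_derivative[OF bounded_linear_vec_nth]
        DERIV_compose_FDERIV[OF this radius_has_derivative[OF rad(2)]]]
    show ?thesis by (simp add: mult.commute)
  qed
  then show ?thesis by (simp add: tstar_def[abs_def])
qed

lemma differential_tstar: "differential (tstar m) p = (\<chi> i. dt $ i + psi * dr p $ i)"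
  unfolding vec_eq_iff forall_4
  by (simp add: differential_def pd_eq[OF tstar_has_derivative] inner_axis axis_eq_axis, simp add: axis_def)

lemma N_field_eq: "N_field m p = (\<chi> i. inverse lapse * dt $ i - beta * dr p $ i)"
proof -
  note h = abc psi_eq(4)
  have "\<forall>i. N_field m p $ i = inverse lapse * dt $ i - beta * dr p $ i"
    unfolding forall_4 N_field_def sharp_def inverse_metric_schwarzschild differential_tstar
    by (simp add: matrix_vector_mult_def sum_4 cometric_def, intro conjI; use h in algebra)
  then show ?thesis by (simp add: vec_eq_iff)
qed

lemma ip_schwarzschild: "ip (schwarzschild m) p X Y = - lapse * X$1 * Y$1 + X$2 * Y$2 + X$3 * Y$3 + X$4 * Y$4
    + psi * (dr p \<bullet> X) * (dr p \<bullet> Y)"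
  by (simp add: ip_def sum_4 metric_nth inner_4 algebra_simps)

lemma ip_N_N: "ip (schwarzschild m) p (N_field m p) (N_field m p) = - (1 + beta)"
proof -
  have l: "lapse * inverse lapse = 1" "inverse lapse * (1 - beta) = 1" using beta_bounds by simp_all
  have 1: "ip (schwarzschild m) p (N_field m p) (N_field m p)
     = - (lapse * inverse lapse) * inverse lapse + beta * beta * (a * a + b * b + c * c) + psi * (beta * (a * a + b * b + c * c))\<^sup>2"
    by (simp add: ip_schwarzschild N_field_eq inner_4 algebra_simps power2_eq_square)
  have "psi = inverse lapse * beta" by (simp add: psi_eq(1) field_simps)
  then show ?thesis unfolding 1 abc l(1) using l(2) by algebra
qed

lemma ip_N: "ip (schwarzschild m) p (N_field m p) X = - (X $ 1 + psi * (dr p \<bullet> X))"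
proof -
  have l: "lapse * inverse lapse = 1" using beta_bounds by simp
  have 1: "ip (schwarzschild m) p (N_field m p) X
     = - (lapse * inverse lapse) * X $ 1 - (beta + psi * beta * (a * a + b * b + c * c)) * (dr p \<bullet> X)"
    by (simp add: ip_schwarzschild N_field_eq inner_4 algebra_simps)
  show ?thesis unfolding 1 abc l using psi_eq(4) by algebra
qed

lemma unit_normal_eq:
  "unit_normal (schwarzschild m) (N_field m) (tstar m) p = (1 / sqrt (1 + beta)) *\<^sub>R N_field m p"
proof -
  have d: "tstar m differentiable (at p)" using tstar_has_derivative by (rule differentiableI)
  have neg: "ip (schwarzschild m) p (N_field m p) (N_field m p) < 0"
    using beta_bounds by (simp add: ip_N_N)
  have "is_unit_normal (schwarzschild m) (N_field m) (tstar m) p n \<longleftrightarrow> n = (1 / sqrt (1 + beta)) *\<^sub>R N_field m p" for n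
    using is_unit_normal_iff[of "schwarzschild m" p "tstar m" "N_field m" n, OF transpose_schwarzschild
        invertible_schwarzschild[OF m p] d N_field_def neg] unfolding ip_N_N by (simp add: add.commute)
  then show ?thesis by (simp add: unit_normal_def)
qed

text \<open>Lowering the index undoes \<open>sharp\<close>, so g(J, X) = T(N, X) by linearity of T
  in its second slot, and the unit normal is N divided by sqrt (1 + beta).\<close>

lemma energy_density_eq_stress:
  assumes "u differentiable (at p)"
  shows "ip (schwarzschild m) p (current (schwarzschild m) (N_field m) u p)
       (unit_normal (schwarzschild m) (N_field m) (tstar m) p)
     = stress_energy (schwarzschild m) u p (N_field m p) (N_field m p) / sqrt (1 + beta)"
proof -
  let ?g = "schwarzschild m" and ?N = "N_field m p"
  define \<omega> where "\<omega> = (\<chi> i. stress_energy ?g u p ?N (axis i 1))"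
  define D where "D = frechet_derivative u (at p)"
  have D: "(u has_derivative D) (at p)" using assms by (simp add: D_def frechet_derivative_works)
  have Dp: "D v = (\<Sum>i\<in>UNIV. v $ i *\<^sub>R pd i u p)" for v by (rule has_derivative_pd_sum[OF D])
  have Da: "D (axis i 1) = pd i u p" for i by (simp add: pd_def D_def)
  have gs: "?g p *v (inverse_metric ?g p *v \<omega>) = \<omega>"
    using inverse_metric_inverts(1)[of "schwarzschild m" p, OF invertible_schwarzschild[OF m p]]
    by (simp add: matrix_vector_mul_assoc)
  have ip: "ip ?g p X Y = Y \<bullet> (?g p *v X)" for X Y
  proof -
    have "ip ?g p X Y = X \<bullet> (?g p *v Y)"
      by (simp add: ip_def inner_vec_def matrix_vector_mult_def sum_distrib_left ac_simps)
    also have "\<dots> = Y \<bullet> (?g p *v X)"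
      by (metis dot_lmul_matrix inner_commute transpose_matrix_vector transpose_schwarzschild)
    finally show ?thesis .
  qed
  have "ip ?g p (current ?g (N_field m) u p) Y = (\<Sum>i\<in>UNIV. Y $ i * stress_energy ?g u p ?N (axis i 1))" for Y
    unfolding ip current_def sharp_def \<omega>_def[symmetric] gs by (simp add: inner_vec_def \<omega>_def)
  moreover have "(\<Sum>i\<in>UNIV. Y $ i * stress_energy ?g u p ?N (axis i 1)) = stress_energy ?g u p ?N Y" for Y
  proof -
    define q where "q = (\<Sum>i\<in>UNIV. \<Sum>j\<in>UNIV. complex_of_real (inverse_metric ?g p $ i $ j) * pd i u p * cnj (pd j u p))"
    have ipl: "ip ?g p ?N Y = (\<Sum>i\<in>UNIV. Y $ i * ip ?g p ?N (axis i 1))"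
      unfolding ip inner_axis' by (simp add: inner_vec_def)
    have T: "stress_energy ?g u p ?N Z = Re (cnj (D ?N) * D Z) - 1/2 * ip ?g p ?N Z * Re q" for Z
      unfolding stress_energy_def stress_energy_complex_def Let_def q_def[symmetric] D_def[symmetric]
      by (simp add: algebra_simps)
    show ?thesis
      unfolding T Da ipl unfolding Dp[of Y]
      by (simp add: sum_subtractf sum_distrib_left sum_distrib_right algebra_simps)
  qed
  ultimately have "ip ?g p (current ?g (N_field m) u p) Y = stress_energy ?g u p ?N Y" for Y by simp
  moreover have "ip ?g p X (s *\<^sub>R Y) = s * ip ?g p X Y" for X Y s
    by (simp add: ip)
  ultimately show ?thesis
    unfolding unit_normal_eq
    by (metis (no_types, lifting) ip_def mult.commute divide_inverse mult_1 inverse_eq_divide)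
qed

lemma stress_energy_N_N:
  assumes "u differentiable (at p)"
  defines "Ur \<equiv> a *\<^sub>R pd 2 u p + b *\<^sub>R pd 3 u p + c *\<^sub>R pd 4 u p"
  shows "stress_energy (schwarzschild m) u p (N_field m p) (N_field m p)
    = (norm (inverse lapse *\<^sub>R pd 1 u p - beta *\<^sub>R Ur))\<^sup>2
      + (1 + beta) / 2 * (- inverse lapse * (norm (pd 1 u p))\<^sup>2
          + ((norm (pd 2 u p))\<^sup>2 + (norm (pd 3 u p))\<^sup>2 + (norm (pd 4 u p))\<^sup>2) - beta * (norm Ur)\<^sup>2)"
proof -
  let ?g = "schwarzschild m" and ?N = "N_field m p"
  define q where "q = (\<Sum>i\<in>UNIV. \<Sum>j\<in>UNIV. complex_of_real (inverse_metric ?g p $ i $ j) * pd i u p * cnj (pd j u p))"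
  define D where "D = frechet_derivative u (at p)"
  have D: "(u has_derivative D) (at p)" using assms by (simp add: D_def frechet_derivative_works)
  have DN: "D ?N = inverse lapse *\<^sub>R pd 1 u p - beta *\<^sub>R Ur"
    unfolding has_derivative_pd_sum[OF D] by (simp add: sum_4 N_field_eq Ur_def algebra_simps)
  have "stress_energy ?g u p ?N ?N = Re (cnj (D ?N) * D ?N) - 1/2 * ip ?g p ?N ?N * Re q"
    unfolding stress_energy_def stress_energy_complex_def Let_def q_def[symmetric] D_def[symmetric]
    by (simp add: algebra_simps)
  also have "Re (cnj (D ?N) * D ?N) = (norm (D ?N))\<^sup>2"
    by (simp add: cmod_power2 flip: power2_eq_square)
  also have "Re q = - inverse lapse * (norm (pd 1 u p))\<^sup>2
          + ((norm (pd 2 u p))\<^sup>2 + (norm (pd 3 u p))\<^sup>2 + (norm (pd 4 u p))\<^sup>2) - beta * (norm Ur)\<^sup>2"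
  proof -
    define il where "il = inverse lapse"
    have cm: "(cmod z)\<^sup>2 = Re z * Re z + Im z * Im z" for z
      unfolding cmod_power2 by (simp add: power2_eq_square)
    show ?thesis
      unfolding q_def inverse_metric_schwarzschild Ur_def cm cometric_def il_def[symmetric]
      by (simp add: sum_4 algebra_simps)
  qed
  finally have "stress_energy ?g u p ?N ?N = (norm (D ?N))\<^sup>2 - 1/2 * ip ?g p ?N ?N * (- inverse lapse * (norm (pd 1 u p))\<^sup>2
          + ((norm (pd 2 u p))\<^sup>2 + (norm (pd 3 u p))\<^sup>2 + (norm (pd 4 u p))\<^sup>2) - beta * (norm Ur)\<^sup>2)" .
  moreover have "A - 1/2 * (- (1 + beta)) * B = A + (1 + beta) / 2 * B" for A B :: real by (simp add: field_simps)
  ultimately show ?thesis unfolding DN ip_N_N by simp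
qed

text \<open>Cauchy-Schwarz via Lagrange's identity for the unit vector (a, b, c), applied to real
  and imaginary parts separately.\<close>

lemma norm_radial_part_le:
  fixes x y z :: complex
  shows "(norm (a *\<^sub>R x + b *\<^sub>R y + c *\<^sub>R z))\<^sup>2 \<le> (norm x)\<^sup>2 + (norm y)\<^sup>2 + (norm z)\<^sup>2"
proof -
  have cs: "(a * s + b * t + c * v)\<^sup>2 \<le> s\<^sup>2 + t\<^sup>2 + v\<^sup>2" for s t v
  proof -
    have "s\<^sup>2 + t\<^sup>2 + v\<^sup>2 = (a * a + b * b + c * c) * (s\<^sup>2 + t\<^sup>2 + v\<^sup>2)" by (simp add: abc)
    also have "\<dots> = (a * s + b * t + c * v)\<^sup>2 + (a * t - b * s)\<^sup>2 + (a * v - c * s)\<^sup>2 + (b * v - c * t)\<^sup>2"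
      by (simp add: power2_eq_square algebra_simps)
    finally show ?thesis by simp
  qed
  show ?thesis
    unfolding cmod_power2 using cs[of "Re x" "Re y" "Re z"] cs[of "Im x" "Im y" "Im z"] by simp
qed

text \<open>From below the time derivative suffices, since it alone carries the full frequency of a
  beam. From above all Cartesian derivatives are used, at a distance from the horizon: for r \<ge>
  5m/2 one has 1/\<open>lapse\<close> \<le> 5, and 50 is 2 times 25.\<close>

lemma stress_energy_N_N_bounds:
  assumes "u differentiable (at p)"
  defines "T \<equiv> stress_energy (schwarzschild m) u p (N_field m p) (N_field m p)"
  shows "(norm (pd 1 u p))\<^sup>2 / 2 \<le> T"
    and "radius p \<ge> 5 * m / 2 \<Longrightarrow> T \<le> 50 * (\<Sum>i\<in>UNIV. (norm (pd i u p))\<^sup>2)"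
    and "(\<And>i. pd i u p = 0) \<Longrightarrow> T = 0"
proof -
  define A B where "A = inverse lapse *\<^sub>R pd 1 u p" and "B = a *\<^sub>R pd 2 u p + b *\<^sub>R pd 3 u p + c *\<^sub>R pd 4 u p"
  define S where "S = (norm (pd 2 u p))\<^sup>2 + (norm (pd 3 u p))\<^sup>2 + (norm (pd 4 u p))\<^sup>2"
  have BS: "(norm B)\<^sup>2 \<le> S" unfolding B_def S_def by (rule norm_radial_part_le)
  have U: "norm (pd 1 u p) = lapse * norm A"
    using beta_bounds by (simp add: A_def)
  have "inverse lapse * (norm (pd 1 u p))\<^sup>2 = lapse * (norm A)\<^sup>2"
    unfolding U using beta_bounds by (simp add: power2_eq_square)
  then have T: "T = (norm (A - beta *\<^sub>R B))\<^sup>2 + (1 + beta) / 2 * (- (lapse * (norm A)\<^sup>2) + S - beta * (norm B)\<^sup>2)"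
    unfolding T_def stress_energy_N_N[OF assms(1)] A_def[symmetric] B_def[symmetric] S_def[symmetric] by simp
  have exp: "(norm (A - beta *\<^sub>R B))\<^sup>2 = (norm A)\<^sup>2 - 2 * beta * (A \<bullet> B) + beta\<^sup>2 * (norm B)\<^sup>2"
    unfolding power2_norm_eq_inner by (simp add: algebra_simps power2_eq_square inner_commute)
  have AB: "2 * \<bar>A \<bullet> B\<bar> \<le> (norm A)\<^sup>2 + (norm B)\<^sup>2"
  proof -
    have "0 \<le> (norm A - norm B)\<^sup>2" by simp
    then show ?thesis using Cauchy_Schwarz_ineq2[of A B] by (simp add: power2_eq_square algebra_simps)
  qed
  have bAB: "2 * beta * (A \<bullet> B) \<le> beta * ((norm A)\<^sup>2 + (norm B)\<^sup>2)" "- (2 * beta * (A \<bullet> B)) \<le> beta * ((norm A)\<^sup>2 + (norm B)\<^sup>2)"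
  proof -
    have "beta * (2 * (A \<bullet> B)) \<le> beta * ((norm A)\<^sup>2 + (norm B)\<^sup>2)" "beta * (- (2 * (A \<bullet> B))) \<le> beta * ((norm A)\<^sup>2 + (norm B)\<^sup>2)"
      using AB beta_bounds(1) by (intro mult_left_mono; linarith)+
    then show "2 * beta * (A \<bullet> B) \<le> beta * ((norm A)\<^sup>2 + (norm B)\<^sup>2)" "- (2 * beta * (A \<bullet> B)) \<le> beta * ((norm A)\<^sup>2 + (norm B)\<^sup>2)"
      by (simp_all only: mult.assoc mult.left_commute mult_minus_right)
  qed
  have Tx: "T = (norm A)\<^sup>2 - 2 * beta * (A \<bullet> B) + beta\<^sup>2 * (norm B)\<^sup>2
      + (1 + beta) / 2 * (- (lapse * (norm A)\<^sup>2) - beta * (norm B)\<^sup>2) + (1 + beta) / 2 * S"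
    unfolding T exp by (simp add: algebra_simps add_divide_distrib)
  \<comment> \<open>With S replaced by its lower bound |B|^2 and the cross term estimated by beta
    (|A|^2 + |B|^2), the coefficients of |A|^2 and of |B|^2 both collapse to (1 - beta)^2/2.\<close>
  have "T \<ge> (1 - beta)\<^sup>2 / 2 * ((norm A)\<^sup>2 + (norm B)\<^sup>2)"
  proof -
    have "(1 + beta) / 2 * (norm B)\<^sup>2 \<le> (1 + beta) / 2 * S"
      using BS beta_bounds by (intro mult_left_mono) auto
    then have "T \<ge> (norm A)\<^sup>2 - beta * ((norm A)\<^sup>2 + (norm B)\<^sup>2) + beta\<^sup>2 * (norm B)\<^sup>2
        + (1 + beta) / 2 * (- (lapse * (norm A)\<^sup>2) - beta * (norm B)\<^sup>2) + (1 + beta) / 2 * (norm B)\<^sup>2"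
      unfolding Tx using bAB(1) by linarith
    also have "(norm A)\<^sup>2 - beta * ((norm A)\<^sup>2 + (norm B)\<^sup>2) + beta\<^sup>2 * (norm B)\<^sup>2
        + (1 + beta) / 2 * (- (lapse * (norm A)\<^sup>2) - beta * (norm B)\<^sup>2) + (1 + beta) / 2 * (norm B)\<^sup>2
        = (1 - beta)\<^sup>2 / 2 * ((norm A)\<^sup>2 + (norm B)\<^sup>2)"
      unfolding beta_bounds(4) by (simp add: field_simps power2_eq_square)
    finally show ?thesis .
  qed
  moreover have "(1 - beta)\<^sup>2 / 2 * ((norm A)\<^sup>2 + (norm B)\<^sup>2) \<ge> (norm (pd 1 u p))\<^sup>2 / 2"
    unfolding U beta_bounds(4) by (simp add: power_mult_distrib distrib_left)
  ultimately show "(norm (pd 1 u p))\<^sup>2 / 2 \<le> T" by linarith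
  show "T \<le> 50 * (\<Sum>i\<in>UNIV. (norm (pd i u p))\<^sup>2)" if r: "radius p \<ge> 5 * m / 2"
  proof -
    have "5 * lapse \<ge> 1" using r rad m by (simp add: lapse_def field_simps)
    then have "norm A \<le> 5 * norm (pd 1 u p)"
      unfolding U using mult_right_mono[of 1 "5 * lapse" "norm A"] by (simp add: mult.assoc)
    then have "(norm A)\<^sup>2 \<le> 25 * (norm (pd 1 u p))\<^sup>2"
      using power_mono[of "norm A" "5 * norm (pd 1 u p)" 2] by (simp add: power_mult_distrib)
    moreover have "T \<le> 2 * (norm A)\<^sup>2 + 2 * S"
    proof -
      have b1: "beta * (norm A)\<^sup>2 \<le> (norm A)\<^sup>2" "beta * (norm B)\<^sup>2 \<le> (norm B)\<^sup>2" "beta\<^sup>2 * (norm B)\<^sup>2 \<le> beta * (norm B)\<^sup>2"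
        using beta_bounds by (auto intro!: mult_left_le_one_le mult_right_mono simp: power2_eq_square mult_left_le)
      have "(1 + beta) / 2 * (- (lapse * (norm A)\<^sup>2) + S - beta * (norm B)\<^sup>2) \<le> (1 + beta) / 2 * (S - beta * (norm B)\<^sup>2)"
        using beta_bounds by (intro mult_left_mono) auto
      also have "\<dots> \<le> 1 * (S - beta * (norm B)\<^sup>2)"
        using beta_bounds b1 BS by (intro mult_right_mono) auto
      finally have "T \<le> (norm A)\<^sup>2 - 2 * beta * (A \<bullet> B) + beta\<^sup>2 * (norm B)\<^sup>2 + (S - beta * (norm B)\<^sup>2)"
        unfolding T exp mult_1 by (rule add_left_mono)
      moreover have "beta * ((norm A)\<^sup>2 + (norm B)\<^sup>2) = beta * (norm A)\<^sup>2 + beta * (norm B)\<^sup>2" by (rule distrib_left)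
      ultimately show ?thesis using bAB(2) b1 BS by linarith
    qed
    moreover have "S \<ge> 0" by (simp add: S_def)
    moreover have "(\<Sum>i\<in>UNIV. (norm (pd i u p))\<^sup>2) = (norm (pd 1 u p))\<^sup>2 + S" by (simp add: sum_4 S_def)
    ultimately show ?thesis by simp
  qed
  show "T = 0" if "\<And>i. pd i u p = 0"
    unfolding T_def stress_energy_N_N[OF assms(1)] by (simp add: that)
qed

end

section \<open>Volume element and energy density of the slices\<close>

lemma radius_slice_chart: "radius (slice_chart m \<tau> x) = norm x"
  by (simp add: radius_def slice_chart_def vector_4 norm_vec_def L2_set_def sum_3)

lemma slice_chart_exterior: "norm x > 2 * m \<Longrightarrow> slice_chart m \<tau> x \<in> exterior m"
  by (simp add: exterior_def radius_slice_chart)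

lemma slice_chart_has_derivative:
  assumes "m > 0" "norm x > 2 * m"
  shows "(slice_chart m \<tau> has_derivative
    (\<lambda>v. vector [- (2 * m / (norm x - 2 * m)) * ((x \<bullet> v) / norm x), v$1, v$2, v$3])) (at x)"
proof -
  have x0: "x \<noteq> 0" using assms by auto
  have n: "(norm has_derivative (\<lambda>v. (x \<bullet> v) / norm x)) (at x)"
    using has_derivative_norm[OF x0] by (simp add: sgn_div_norm inner_commute divide_inverse mult.commute)
  have "((\<lambda>s. \<tau> - 2 * m * ln (s - 2 * m)) has_real_derivative - (2 * m / (norm x - 2 * m))) (at (norm x))"
    using assms by (auto intro!: derivative_eq_intros)
  from DERIV_compose_FDERIV[OF this n]
  have 1: "((\<lambda>x. \<tau> - 2 * m * ln (norm x - 2 * m)) has_derivative (\<lambda>v. - (2 * m / (norm x - 2 * m)) * ((x \<bullet> v) / norm x))) (at x)"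
    by (simp add: mult.commute)
  have "((\<lambda>x. slice_chart m \<tau> x $ i) has_derivative
      (\<lambda>v. (vector [- (2 * m / (norm x - 2 * m)) * ((x \<bullet> v) / norm x), v$1, v$2, v$3] :: real^4) $ i)) (at x)" for i
    using exhaust_4[of i] 1
    by (elim disjE; hypsubst; simp only: slice_chart_def vector_4)
       (auto intro!: bounded_linear_imp_has_derivative bounded_linear_vec_nth)
  then show ?thesis
    by (subst has_derivative_componentwise_within) (auto simp: Basis_vec_def inner_axis)
qed

text \<open>In the chart the induced metric is the identity plus \<open>beta\<close> n n with the
  unit vector n = x/|x|, whose determinant is 1 + \<open>beta\<close>. The coefficient arises as psi
  - lapse psi^2 = beta, the time component of the tangent vectors being - psi times the radial
  one.\<close>

lemma det_induced_metric:
  assumes "m > 0" "norm x > 2 * m"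
  shows "det (induced_metric (schwarzschild m) (slice_chart m \<tau>) x) = 1 + 2 * m / norm x"
proof -
  define p where "p = slice_chart m \<tau> x"
  have pe: "p \<in> exterior m" unfolding p_def by (rule slice_chart_exterior[OF assms(2)])
  note [simp] = radius_slice_chart
  have n: "dr p $ 2 = x$1 / norm x" "dr p $ 3 = x$2 / norm x" "dr p $ 4 = x$3 / norm x"
    by (simp_all add: dr_def p_def, simp_all add: slice_chart_def vector_4)
  define \<psi> where "\<psi> = psi m p"
  have pd: "pd i (slice_chart m \<tau>) x = vector [- \<psi> * (x $ i / norm x), axis i 1 $ 1, axis i 1 $ 2, axis i 1 $ 3]" for i
    using psi_eq(2)[OF assms(1) pe]
    by (simp add: pd_eq[OF slice_chart_has_derivative[OF assms]] \<psi>_def p_def inner_axis)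
  define d where "d i j = (if i = j then 1 else 0 :: real)" for i j :: 3
  have lp: "psi m p - lapse m p * psi m p * psi m p = beta m p"
    using psi_eq[OF assms(1) pe] by algebra
  have ind: "induced_metric (schwarzschild m) (slice_chart m \<tau>) x $ i $ j = d i j + beta m p * (x $ i / norm x) * (x $ j / norm x)" for i j
    unfolding induced_metric_def p_def[symmetric] pd
    apply (simp add: ip_schwarzschild[OF assms(1) pe] vector_4 inner_4 n)
    using exhaust_3[of i] exhaust_3[of j] unfolding lp[symmetric] \<psi>_def
    by (elim disjE; hypsubst; simp add: d_def axis_def algebra_simps diff_divide_distrib)
  have nx: "(x$1 / norm x) * (x$1 / norm x) + (x$2 / norm x) * (x$2 / norm x) + (x$3 / norm x) * (x$3 / norm x) = 1"
    using abc[OF assms(1) pe] by (simp add: n)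
  have "det (induced_metric (schwarzschild m) (slice_chart m \<tau>) x)
      = 1 + beta m p * ((x$1 / norm x) * (x$1 / norm x) + (x$2 / norm x) * (x$2 / norm x) + (x$3 / norm x) * (x$3 / norm x))"
  proof -
    define y where "y i = x $ i / norm x" for i
    show ?thesis unfolding det_3 ind y_def[symmetric] by (simp add: d_def algebra_simps)
  qed
  then show ?thesis unfolding nx using beta_def[OF assms(1) pe] by (simp add: p_def)
qed

text \<open>The volume factor sqrt (1 + beta) cancels the factor 1/sqrt (1 + beta) of the unit
  normal, so the energy is the Lebesgue integral of T(N, N) over the chart.\<close>

lemma energy_integrand:
  assumes "m > 0" "norm x > 2 * m" "u differentiable (at (slice_chart m \<tau> x))"
  shows "(let p = slice_chart m \<tau> x in
          ip (schwarzschild m) p (current (schwarzschild m) (N_field m) u p)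
             (unit_normal (schwarzschild m) (N_field m) (tstar m) p)
          * sqrt (det (induced_metric (schwarzschild m) (slice_chart m \<tau>) x)))
    = stress_energy (schwarzschild m) u (slice_chart m \<tau> x) (N_field m (slice_chart m \<tau> x)) (N_field m (slice_chart m \<tau> x))"
proof -
  have pe: "slice_chart m \<tau> x \<in> exterior m" by (rule slice_chart_exterior[OF assms(2)])
  have "2 * m / norm x > 0" using assms by (intro divide_pos_pos) auto
  then show ?thesis
    by (simp add: Let_def energy_density_eq_stress[OF assms(1) pe assms(3)] det_induced_metric[OF assms(1,2)]
        beta_def[OF assms(1) pe] radius_slice_chart)
qed

section \<open>Contracted Christoffel symbols and the wave operator\<close>

context
  fixes m :: real and p :: "real^4"
  assumes m: "m > 0" and p: "p \<in> exterior m"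
begin

private abbreviation "n i \<equiv> dr p $ i"
private abbreviation "h \<equiv> cometric m p"
private abbreviation "r \<equiv> radius p"

text \<open>\<open>proj l i / r\<close> is the l-th partial derivative of the i-th component of
  \<open>dr\<close>, and \<open>dpsi\<close> is the r-derivative of \<open>psi\<close>; together
  they give \<open>dmetric l i j\<close>, the l-th derivative of the (i, j) component of the
  metric.\<close>

definition "proj l i = (if i = 1 then 0 else if l = i then 1 else 0) - n i * n l"
definition "dpsi = - (2 * m / (r - 2 * m)\<^sup>2)"
definition "dmetric l i j = - (2 * m / r\<^sup>2) * (n l * (dt $ i * dt $ j)) + dpsi * (n l * (n i * n j))
   + psi m p / r * (proj l i * n j + n i * proj l j)"

lemmas rads = rad[OF m p]

lemma dr_has_derivative':
  "((\<lambda>q. dr q $ i) has_derivative (\<lambda>v. ((if i = 1 then 0 else v $ i) - n i * (dr p \<bullet> v)) / r)) (at p)"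
  using dr_has_derivative[OF rads(2), of i] by (cases "i = 1") simp_all

lemma pd_metric: "pd l (\<lambda>q. schwarzschild m q $ i $ j) p = dmetric l i j"
proof -
  have eq: "schwarzschild m q $ i $ j = - (1 - 2 * m / radius q) * (dt $ i * dt $ j) + (if i = j \<and> i \<noteq> 1 then 1 else 0)
     + (inverse (1 - 2 * m / radius q) - 1) * (dr q $ i * dr q $ j)" for q
    by (simp add: schwarzschild_def sphere_part_def algebra_simps)
  have 1: "((\<lambda>s. - (1 - 2 * m / s) * (dt $ i * dt $ j) + (if i = j \<and> i \<noteq> 1 then 1 else 0)) has_real_derivative
      - (2 * m / r\<^sup>2) * (dt $ i * dt $ j)) (at r)"
    using rads by (auto intro!: derivative_eq_intros simp: power2_eq_square)
  have 2: "((\<lambda>s. inverse (1 - 2 * m / s) - 1) has_real_derivative dpsi) (at r)"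
    using rads m by (auto intro!: derivative_eq_intros simp: power2_eq_square dpsi_def field_simps)
  have ps: "inverse (1 - 2 * m / r) - 1 = psi m p" by (simp add: psi_def[OF m p])
  note D = has_derivative_add[OF DERIV_compose_FDERIV[OF 1 radius_has_derivative[OF rads(2)]]
      has_derivative_mult[OF DERIV_compose_FDERIV[OF 2 radius_has_derivative[OF rads(2)]]
        has_derivative_mult[OF dr_has_derivative'[of i] dr_has_derivative'[of j]]]]
  have ax: "(if k = 1 then 0 else axis l (1::real) $ k) - n k * (dr p \<bullet> axis l 1) = proj l k" for k
    unfolding proj_def inner_axis by (simp add: axis_def)
  show ?thesis
    unfolding eq pd_eq[OF D] ax ps dmetric_def by (simp add: inner_axis algebra_simps add_divide_distrib)
qed

lemma cometric_form: "(\<Sum>i\<in>UNIV. \<Sum>j\<in>UNIV. h $ i $ j * (x i * y j))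
   = - inverse (lapse m p) * (x 1 * y 1) + (x 2 * y 2 + x 3 * y 3 + x 4 * y 4)
     - beta m p * ((n 2 * x 2 + n 3 * x 3 + n 4 * x 4) * (n 2 * y 2 + n 3 * y 3 + n 4 * y 4))"
  by (simp add: sum_4 cometric_def[OF m p] algebra_simps)

lemmas n_norm = abc[OF m p]

lemma cometric_contractions:
  "(\<Sum>i\<in>UNIV. \<Sum>j\<in>UNIV. h $ i $ j * (n i * dt $ j)) = 0"
  "(\<Sum>i\<in>UNIV. \<Sum>j\<in>UNIV. h $ i $ j * (dt $ i * dt $ j)) = - inverse (lapse m p)"
  "(\<Sum>i\<in>UNIV. \<Sum>j\<in>UNIV. h $ i $ j * (n i * n j)) = lapse m p"
  "(\<Sum>i\<in>UNIV. \<Sum>j\<in>UNIV. h $ i $ j * (proj i l * n j)) = 0"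
  "(\<Sum>i\<in>UNIV. \<Sum>j\<in>UNIV. h $ i $ j * (proj l i * n j)) = 0"
  "(\<Sum>i\<in>UNIV. \<Sum>j\<in>UNIV. h $ i $ j * proj i j) = 2"
proof -
  show "(\<Sum>i\<in>UNIV. \<Sum>j\<in>UNIV. h $ i $ j * (n i * dt $ j)) = 0"
    "(\<Sum>i\<in>UNIV. \<Sum>j\<in>UNIV. h $ i $ j * (dt $ i * dt $ j)) = - inverse (lapse m p)"
    unfolding cometric_form by simp_all
  show 3: "(\<Sum>i\<in>UNIV. \<Sum>j\<in>UNIV. h $ i $ j * (n i * n j)) = lapse m p"
    unfolding cometric_form n_norm beta_bounds(4)[OF m p] by simp
  have z: "n 2 * proj 2 l + n 3 * proj 3 l + n 4 * proj 4 l = 0" "n 2 * proj l 2 + n 3 * proj l 3 + n 4 * proj l 4 = 0" for l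
  proof -
    have "n 2 * proj 2 l + n 3 * proj 3 l + n 4 * proj 4 l = n l * (1 - (n 2 * n 2 + n 3 * n 3 + n 4 * n 4))"
      using exhaust_4[of l] by (elim disjE; hypsubst; simp add: proj_def algebra_simps)
    then show "n 2 * proj 2 l + n 3 * proj 3 l + n 4 * proj 4 l = 0" by (simp add: n_norm)
    have "n 2 * proj l 2 + n 3 * proj l 3 + n 4 * proj l 4 = n l * (1 - (n 2 * n 2 + n 3 * n 3 + n 4 * n 4))"
      using exhaust_4[of l] by (elim disjE; hypsubst; simp add: proj_def algebra_simps)
    then show "n 2 * proj l 2 + n 3 * proj l 3 + n 4 * proj l 4 = 0" by (simp add: n_norm)
  qed
  show "(\<Sum>i\<in>UNIV. \<Sum>j\<in>UNIV. h $ i $ j * (proj i l * n j)) = 0"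
    unfolding cometric_form z using z(1)[of l] by (simp add: mult.commute)
  show "(\<Sum>i\<in>UNIV. \<Sum>j\<in>UNIV. h $ i $ j * (proj l i * n j)) = 0"
    unfolding cometric_form z using z(2)[of l] by (simp add: mult.commute)
  have "(\<Sum>i\<in>UNIV. \<Sum>j\<in>UNIV. h $ i $ j * proj i j)
      = (h $ 2 $ 2 + h $ 3 $ 3 + h $ 4 $ 4) - (\<Sum>i\<in>UNIV. \<Sum>j\<in>UNIV. h $ i $ j * (n i * n j))"
    by (simp add: sum_4 proj_def algebra_simps)
  also have "h $ 2 $ 2 + h $ 3 $ 3 + h $ 4 $ 4 = 3 - beta m p * (n 2 * n 2 + n 3 * n 3 + n 4 * n 4)"
    by (simp add: cometric_def[OF m p] algebra_simps)
  finally show "(\<Sum>i\<in>UNIV. \<Sum>j\<in>UNIV. h $ i $ j * proj i j) = 2"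
    unfolding 3 n_norm beta_bounds(4)[OF m p] by simp
qed

lemma h_sym: "h $ i $ j = h $ j $ i"
  by (auto simp: cometric_def[OF m p])

text \<open>The vanishing of the third trace reflects that the determinant of the metric is
  constant: in these Cartesian coordinates it equals -1, and the trace is its logarithmic
  derivative.\<close>

lemma cometric_dmetric:
  "(\<Sum>i\<in>UNIV. \<Sum>j\<in>UNIV. h $ i $ j * dmetric i j l) = (dpsi * lapse m p + 2 * psi m p / r) * n l"
  "(\<Sum>i\<in>UNIV. \<Sum>j\<in>UNIV. h $ i $ j * dmetric j i l) = (dpsi * lapse m p + 2 * psi m p / r) * n l"
  "(\<Sum>i\<in>UNIV. \<Sum>j\<in>UNIV. h $ i $ j * dmetric l i j) = 0"
proof -
  define F where "F = 2 * m / r\<^sup>2"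
  define G where "G = psi m p / r"
  let ?S = "\<lambda>f. \<Sum>i\<in>UNIV. \<Sum>j\<in>UNIV. h $ i $ j * f i j"
  have dm: "dmetric i j k = - F * (n i * (dt $ j * dt $ k)) + dpsi * (n i * (n j * n k)) + G * (proj i j * n k + n j * proj i k)" for i j k
    by (simp add: dmetric_def F_def G_def)
  have lin: "?S (\<lambda>i j. x i j + y i j) = ?S x + ?S y" "?S (\<lambda>i j. c * x i j) = c * ?S x" for x y c
    by (simp_all add: distrib_left sum.distrib sum_distrib_left mult.left_commute)
  have "dmetric i j l = (- F * dt $ l) * (n i * dt $ j) + (dpsi * n l) * (n i * n j) + ((G * n l) * proj i j + G * (proj i l * n j))" for i j
    by (simp add: dm algebra_simps)
  then have "?S (\<lambda>i j. dmetric i j l) = (- F * dt $ l) * ?S (\<lambda>i j. n i * dt $ j) + (dpsi * n l) * ?S (\<lambda>i j. n i * n j)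
      + ((G * n l) * ?S proj + G * ?S (\<lambda>i j. proj i l * n j))"
    by (simp only: lin)
  then show 1: "?S (\<lambda>i j. dmetric i j l) = (dpsi * lapse m p + 2 * psi m p / r) * n l"
    unfolding cometric_contractions by (simp add: G_def algebra_simps)
  have "?S (\<lambda>i j. dmetric j i l) = (\<Sum>j\<in>UNIV. \<Sum>i\<in>UNIV. h $ i $ j * dmetric j i l)" by (rule sum.swap)
  also have "\<dots> = ?S (\<lambda>i j. dmetric i j l)" by (simp add: h_sym)
  finally show "?S (\<lambda>i j. dmetric j i l) = (dpsi * lapse m p + 2 * psi m p / r) * n l" using 1 by simp
  have sw: "?S (\<lambda>i j. n i * proj l j) = ?S (\<lambda>i j. proj l i * n j)"
  proof -
    have "?S (\<lambda>i j. n i * proj l j) = (\<Sum>j\<in>UNIV. \<Sum>i\<in>UNIV. h $ i $ j * (n i * proj l j))" by (rule sum.swap)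
    also have "\<dots> = ?S (\<lambda>i j. proj l i * n j)" by (simp add: h_sym mult.commute)
    finally show ?thesis .
  qed
  have "dmetric l i j = (- F * n l) * (dt $ i * dt $ j) + (dpsi * n l) * (n i * n j) + G * (proj l i * n j + n i * proj l j)" for i j
    by (simp add: dm algebra_simps)
  then have "?S (\<lambda>i j. dmetric l i j) = (- F * n l) * ?S (\<lambda>i j. dt $ i * dt $ j) + (dpsi * n l) * ?S (\<lambda>i j. n i * n j)
      + G * (?S (\<lambda>i j. proj l i * n j) + ?S (\<lambda>i j. n i * proj l j))"
    by (simp only: lin)
  also have "\<dots> = n l * (F * inverse (lapse m p) + dpsi * lapse m p)"
    unfolding sw cometric_contractions by (simp add: algebra_simps)
  also have "F * inverse (lapse m p) + dpsi * lapse m p = 0"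
  proof -
    define s where "s = r - 2 * m"
    have "s > 0" "r > 0" "lapse m p = s / r" using rads by (simp_all add: s_def lapse_def[OF m p] field_simps)
    then show ?thesis unfolding F_def dpsi_def s_def[symmetric] by (simp add: field_simps power2_eq_square)
  qed
  finally show "?S (\<lambda>i j. dmetric l i j) = 0" by simp
qed

text \<open>The wave operator sees the connection through this trace only, so the individual symbols
  need not be listed.\<close>

lemma cometric_christoffel:
  "(\<Sum>i\<in>UNIV. \<Sum>j\<in>UNIV. h $ i $ j * christoffel (schwarzschild m) k i j p) = 2 * m / r\<^sup>2 * n k"
proof -
  let ?S = "\<lambda>f. \<Sum>i\<in>UNIV. \<Sum>j\<in>UNIV. h $ i $ j * f i j"
  let ?c = "dpsi * lapse m p + 2 * psi m p / r"
  have lin: "?S (\<lambda>i j. x i j + y i j) = ?S x + ?S y" "?S (\<lambda>i j. x i j - y i j) = ?S x - ?S y" "?S (\<lambda>i j. c * x i j) = c * ?S x" for x y c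
    by (simp_all add: distrib_left right_diff_distrib sum.distrib sum_subtractf sum_distrib_left mult.left_commute)
  have "christoffel (schwarzschild m) k i j p
     = (h$k$1 / 2) * (dmetric i j 1 + dmetric j i 1 - dmetric 1 i j) + (h$k$2 / 2) * (dmetric i j 2 + dmetric j i 2 - dmetric 2 i j)
      + (h$k$3 / 2) * (dmetric i j 3 + dmetric j i 3 - dmetric 3 i j) + (h$k$4 / 2) * (dmetric i j 4 + dmetric j i 4 - dmetric 4 i j)" for i j
    unfolding christoffel_def inverse_metric_schwarzschild[OF m p] pd_metric sum_4 by (simp add: add_divide_distrib)
  then have "?S (\<lambda>i j. christoffel (schwarzschild m) k i j p)
     = (h$k$1 / 2) * (?c * n 1 + ?c * n 1 - 0) + (h$k$2 / 2) * (?c * n 2 + ?c * n 2 - 0)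
      + (h$k$3 / 2) * (?c * n 3 + ?c * n 3 - 0) + (h$k$4 / 2) * (?c * n 4 + ?c * n 4 - 0)"
    by (simp only: lin cometric_dmetric)
  also have "\<dots> = ?c * (h$k$2 * n 2 + h$k$3 * n 3 + h$k$4 * n 4)"
    by (simp add: algebra_simps)
  also have "h$k$2 * n 2 + h$k$3 * n 3 + h$k$4 * n 4 = n k * (1 - beta m p * (n 2 * n 2 + n 3 * n 3 + n 4 * n 4))"
    using exhaust_4[of k] by (elim disjE; hypsubst; simp add: cometric_def[OF m p] algebra_simps)
  also have "\<dots> = lapse m p * n k" by (simp add: n_norm beta_bounds(4)[OF m p])
  also have "?c * (lapse m p * n k) = 2 * m / r\<^sup>2 * n k"
  proof -
    have "?c * lapse m p = 2 * m / r\<^sup>2"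
    proof -
      define s where "s = r - 2 * m"
      have "s > 0" "r > 0" using rads by (simp_all add: s_def)
      moreover have L: "lapse m p = s / r" using rads by (simp add: s_def lapse_def[OF m p] field_simps)
      ultimately show ?thesis unfolding psi_eq(2)[OF m p] dpsi_def s_def[symmetric] L
        by (simp add: field_simps power2_eq_square)
    qed
    then show ?thesis by (metis mult.assoc)
  qed
  finally show ?thesis .
qed

lemma wave_op_schwarzschild:
  fixes u :: "real^4 \<Rightarrow> complex"
  defines "U i j \<equiv> pd i (pd j u) p"
  shows "wave_op (schwarzschild m) u p = - inverse (lapse m p) *\<^sub>R U 1 1 + (U 2 2 + U 3 3 + U 4 4)
     - beta m p *\<^sub>R (n 2 *\<^sub>R (n 2 *\<^sub>R U 2 2 + n 3 *\<^sub>R U 2 3 + n 4 *\<^sub>R U 2 4)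
        + n 3 *\<^sub>R (n 2 *\<^sub>R U 3 2 + n 3 *\<^sub>R U 3 3 + n 4 *\<^sub>R U 3 4)
        + n 4 *\<^sub>R (n 2 *\<^sub>R U 4 2 + n 3 *\<^sub>R U 4 3 + n 4 *\<^sub>R U 4 4))
     - (2 * m / r\<^sup>2) *\<^sub>R (n 2 *\<^sub>R pd 2 u p + n 3 *\<^sub>R pd 3 u p + n 4 *\<^sub>R pd 4 u p)"
proof -
  let ?C = "\<lambda>k i j. christoffel (schwarzschild m) k i j p"
  have "wave_op (schwarzschild m) u p = (\<Sum>i\<in>UNIV. \<Sum>j\<in>UNIV. h $ i $ j *\<^sub>R U i j)
      - (\<Sum>i\<in>UNIV. \<Sum>j\<in>UNIV. \<Sum>k\<in>UNIV. (h $ i $ j * ?C k i j) *\<^sub>R pd k u p)"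
    unfolding wave_op_def inverse_metric_schwarzschild[OF m p] U_def
    by (simp add: scaleR_diff_right sum_subtractf scaleR_sum_right)
  also have "(\<Sum>i\<in>UNIV. \<Sum>j\<in>UNIV. \<Sum>k\<in>UNIV. (h $ i $ j * ?C k i j) *\<^sub>R pd k u p)
      = (\<Sum>k\<in>UNIV. (\<Sum>i\<in>UNIV. \<Sum>j\<in>UNIV. h $ i $ j * ?C k i j) *\<^sub>R pd k u p)"
  proof -
    have "(\<Sum>i\<in>UNIV. \<Sum>j\<in>UNIV. \<Sum>k\<in>UNIV. (h $ i $ j * ?C k i j) *\<^sub>R pd k u p)
        = (\<Sum>i\<in>UNIV. \<Sum>k\<in>UNIV. \<Sum>j\<in>UNIV. (h $ i $ j * ?C k i j) *\<^sub>R pd k u p)"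
      by (intro sum.cong refl sum.swap)
    also have "\<dots> = (\<Sum>k\<in>UNIV. \<Sum>i\<in>UNIV. \<Sum>j\<in>UNIV. (h $ i $ j * ?C k i j) *\<^sub>R pd k u p)"
      by (rule sum.swap)
    finally show ?thesis by (simp add: scaleR_sum_left)
  qed
  also have "\<dots> = (2 * m / r\<^sup>2) *\<^sub>R (n 2 *\<^sub>R pd 2 u p + n 3 *\<^sub>R pd 3 u p + n 4 *\<^sub>R pd 4 u p)"
    unfolding cometric_christoffel by (simp add: sum_4 scaleR_add_right)
  also have "(\<Sum>i\<in>UNIV. \<Sum>j\<in>UNIV. h $ i $ j *\<^sub>R U i j) = - inverse (lapse m p) *\<^sub>R U 1 1 + (U 2 2 + U 3 3 + U 4 4)
     - beta m p *\<^sub>R (n 2 *\<^sub>R (n 2 *\<^sub>R U 2 2 + n 3 *\<^sub>R U 2 3 + n 4 *\<^sub>R U 2 4)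
        + n 3 *\<^sub>R (n 2 *\<^sub>R U 3 2 + n 3 *\<^sub>R U 3 3 + n 4 *\<^sub>R U 3 4)
        + n 4 *\<^sub>R (n 2 *\<^sub>R U 4 2 + n 3 *\<^sub>R U 4 3 + n 4 *\<^sub>R U 4 4))"
    by (simp add: sum_4 cometric_def[OF m p] algebra_simps)
  finally show ?thesis .
qed

end

section \<open>The domain of dependence\<close>

text \<open>The mean value inequality on each piece, added up over the break points. It serves
  twice: with a multiple of \<open>tstar\<close> as majorant of a causal curve, and with c = 0 as a
  monotonicity criterion for \<phi>.\<close>

lemma piecewise_derivative_bound:
  fixes c :: "real \<Rightarrow> 'a::real_normed_vector" and \<phi> a :: "_ \<Rightarrow> real"
  assumes a: "a 0 = 0" "strict_mono a" "filterlim a at_top sequentially"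
    and d: "\<And>k. \<exists>c' \<phi>'. \<forall>s\<in>{a k..a (Suc k)}. (c has_vector_derivative c' s) (at s within {a k..a (Suc k)}) \<and>
      (\<phi> has_vector_derivative \<phi>' s) (at s within {a k..a (Suc k)}) \<and> norm (c' s) \<le> \<phi>' s"
    and "0 \<le> s" "s \<le> t"
  shows "norm (c t - c s) \<le> \<phi> t - \<phi> s"
proof -
  have piece: "norm (c t - c s) \<le> \<phi> t - \<phi> s" if st: "a k \<le> s" "s \<le> t" "t \<le> a (Suc k)" for k s t
  proof (cases "s = t")
    case False
    obtain c' \<phi>' where cp: "\<And>s. s \<in> {a k..a (Suc k)} \<Longrightarrow> (c has_vector_derivative c' s) (at s within {a k..a (Suc k)})"
      "\<And>s. s \<in> {a k..a (Suc k)} \<Longrightarrow> (\<phi> has_vector_derivative \<phi>' s) (at s within {a k..a (Suc k)})"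
      "\<And>s. s \<in> {a k..a (Suc k)} \<Longrightarrow> norm (c' s) \<le> \<phi>' s"
      using d[of k] by blast
    have sub: "{s..t} \<subseteq> {a k..a (Suc k)}" using st by auto
    have at: "at x within {a k..a (Suc k)} = at x" if "s < x" "x < t" for x
      using that st by (intro at_within_interior) (auto simp: interior_atLeastAtMost_real)
    show ?thesis
    proof (rule differentiable_bound_general[of s t c \<phi> c' \<phi>'])
      show "continuous_on {s..t} c" "continuous_on {s..t} \<phi>"
        using continuous_on_vector_derivative[OF cp(1)] continuous_on_vector_derivative[OF cp(2)] sub
        by (auto intro: continuous_on_subset)
      show "(c has_vector_derivative c' x) (at x)" "(\<phi> has_vector_derivative \<phi>' x) (at x)" "norm (c' x) \<le> \<phi>' x"
        if "s < x" "x < t" for x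
        using cp[of x] at[OF that] that st by auto
    qed (use False st in auto)
  qed simp
  have "norm (c t - c s) \<le> \<phi> t - \<phi> s" if "0 \<le> s" "s \<le> t" "t \<le> a n" for n s t
    using that
  proof (induction n arbitrary: s t)
    case 0
    then have "s = t" using a(1) by auto
    then show ?case by simp
  next
    case (Suc n)
    show ?case
    proof (cases "t \<le> a n")
      case True
      then show ?thesis using Suc by blast
    next
      case t: False
      show ?thesis
      proof (cases "s \<le> a n")
        case True
        have "norm (c t - c s) \<le> norm (c t - c (a n)) + norm (c (a n) - c s)"
          using norm_triangle_ineq[of "c t - c (a n)" "c (a n) - c s"] by simp
        also have "\<dots> \<le> (\<phi> t - \<phi> (a n)) + (\<phi> (a n) - \<phi> s)"
          using t True Suc by (intro add_mono piece Suc.IH) auto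
        finally show ?thesis by simp
      next
        case False
        then show ?thesis using Suc.prems by (intro piece[of n]) auto
      qed
    qed
  qed
  moreover obtain n where "t \<le> a n"
    using a(3) by (metis eventually_sequentially filterlim_at_top order_refl)
  ultimately show ?thesis using assms(5,6) by blast
qed

context
  fixes m :: real and p X :: "real^4"
  assumes m: "m > 0" and p: "p \<in> exterior m" and X: "future_causal (schwarzschild m) (N_field m) p X"
begin

definition "dtau = X $ 1 + psi m p * (dr p \<bullet> X)"

text \<open>The three signs are the derivatives along X of \<open>tstar\<close>, of
  \<open>tstar\<close> + r and of \<open>tstar\<close> - r - 4m ln (r - 2m); the last two functions
  are the null coordinates t + x and t - x up to constants. Their signs follow from (1 + psi) |dr X|
  \<le> \<open>X $ 1\<close>, the causal bound of the radial component. The final inequality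
  compares Euclidean speed with the rate of \<open>tstar\<close> and degenerates at the
  horizon.\<close>

lemma future_causal_components:
  shows "dtau > 0" "dtau + dr p \<bullet> X \<ge> 0" "dtau - dr p \<bullet> X - 2 * psi m p * (dr p \<bullet> X) \<ge> 0"
    "norm X \<le> 2 / lapse m p * dtau"
proof -
  let ?l = "lapse m p" and ?b = "beta m p" and ?\<psi> = "psi m p" and ?y = "dr p \<bullet> X"
  note B = beta_bounds[OF m p] and P = psi_eq[OF m p]
  show d: "dtau > 0" using X unfolding future_causal_def ip_N[OF m p] dtau_def by simp
  define S where "S = X$2 * X$2 + X$3 * X$3 + X$4 * X$4"
  have c: "?l * (X$1 * X$1) \<ge> S + ?\<psi> * (?y * ?y)"
    using X unfolding future_causal_def ip_schwarzschild[OF m p] by (simp add: S_def algebra_simps)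
  have yS: "?y * ?y \<le> S"
    using norm_radial_part_le[OF m p, of "complex_of_real (X$2)" "complex_of_real (X$3)" "complex_of_real (X$4)"]
    by (simp add: scaleR_conv_of_real inner_4 S_def power2_eq_square flip: of_real_mult of_real_add)
  have psi0: "?\<psi> > 0" using B by (simp add: P(1))
  have l1: "?l * (1 + ?\<psi>) = 1" unfolding distrib_left P(3) using B(4) by simp
  have "(1 + ?\<psi>) * (?y * ?y) \<le> ?l * (X$1 * X$1)" using c yS by (simp add: algebra_simps)
  then have "?l * ((1 + ?\<psi>) * (?y * ?y)) \<le> ?l * (?l * (X$1 * X$1))"
    using B by (intro mult_left_mono) auto
  moreover have "?l * ((1 + ?\<psi>) * (?y * ?y)) = ?y * ?y" using l1 by (metis mult.assoc mult_1)
  ultimately have "?y\<^sup>2 \<le> (?l * X$1)\<^sup>2" by (simp add: power2_eq_square algebra_simps)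
  then have y: "\<bar>?y\<bar> \<le> ?l * \<bar>X$1\<bar>"
    using B(3) by (simp add: abs_le_square_iff[symmetric] abs_mult)
  have "?\<psi> * \<bar>?y\<bar> \<le> ?\<psi> * (?l * \<bar>X$1\<bar>)" using y psi0 by (intro mult_left_mono) auto
  also have "\<dots> = ?b * \<bar>X$1\<bar>" using P(3) by (simp add: algebra_simps)
  finally have py: "\<bar>?\<psi> * ?y\<bar> \<le> ?b * \<bar>X$1\<bar>" using psi0 by (simp add: abs_mult)
  have x1: "X$1 > 0"
  proof (rule ccontr)
    assume "\<not> X$1 > 0"
    then have "?\<psi> * ?y \<le> - (?b * X$1)" using py by (simp add: abs_le_iff)
    then have "dtau \<le> (1 - ?b) * X$1" by (simp add: dtau_def algebra_simps)
    also have "\<dots> \<le> 0" using \<open>\<not> X$1 > 0\<close> B by (simp add: mult_nonneg_nonpos)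
    finally show False using d by simp
  qed
  have "dtau \<ge> X$1 - ?b * X$1" using py x1 by (simp add: dtau_def abs_le_iff)
  then have dl: "dtau \<ge> ?l * X$1" by (simp add: B(4) algebra_simps)
  have yl: "(1 + ?\<psi>) * \<bar>?y\<bar> \<le> X$1"
  proof -
    have "(1 + ?\<psi>) * \<bar>?y\<bar> \<le> (1 + ?\<psi>) * (?l * X$1)" using y x1 psi0 by (intro mult_left_mono) auto
    also have "\<dots> = X$1" using l1 by (metis mult.assoc mult.commute mult_1)
    finally show ?thesis .
  qed
  have yy: "(1 + ?\<psi>) * ?y \<le> (1 + ?\<psi>) * \<bar>?y\<bar>" "(1 + ?\<psi>) * (- ?y) \<le> (1 + ?\<psi>) * \<bar>?y\<bar>"
    using psi0 by (intro mult_left_mono; simp)+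
  show "dtau + ?y \<ge> 0" "dtau - ?y - 2 * ?\<psi> * ?y \<ge> 0"
    using yy yl by (simp_all add: dtau_def algebra_simps)
  have "S \<le> X$1 * X$1"
  proof -
    have "?\<psi> * (?y * ?y) \<ge> 0" using psi0 by simp
    then have "S \<le> ?l * (X$1 * X$1)" using c by simp
    also have "\<dots> \<le> X$1 * X$1" using B x1 by (simp add: mult_left_le_one_le)
    finally show ?thesis .
  qed
  moreover have "(norm X)\<^sup>2 = X$1 * X$1 + S"
    unfolding power2_norm_eq_inner inner_4 by (simp add: S_def)
  moreover have "(2 * X$1)\<^sup>2 = 4 * (X$1 * X$1)" by (simp add: power2_eq_square)
  ultimately have "(norm X)\<^sup>2 \<le> (2 * X$1)\<^sup>2"
    using zero_le_square[of "X$1"] by linarith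
  then have "norm X \<le> 2 * X$1" by (rule power2_le_imp_le) (use x1 in simp)
  also have "\<dots> \<le> 2 / ?l * dtau" using dl B(3) by (simp add: field_simps)
  finally show "norm X \<le> 2 / ?l * dtau" .
qed

end

lemma continuous_on_radius: "continuous_on UNIV radius"
  unfolding radius_def[abs_def] by (intro continuous_intros)

text \<open>Along a past directed inextendible causal curve from p that missed the initial slice,
  \<open>tstar\<close> would decrease but stay positive. The two null coordinates then confine the
  curve to r \<ge> 2m + \<eta>, where its Euclidean length is bounded by a multiple of the drop of
  \<open>tstar\<close>. So the curve would converge inside the exterior, against
  inextendibility.\<close>

theorem DoD_contains_future:
  assumes m: "m > 0" and p: "p \<in> exterior m" "tstar m p \<ge> 0"
  shows "p \<in> DoD m"
proof -
  have "c ` {0..} \<inter> Sigma_slice m 0 \<noteq> {}"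
    if ic: "inextendible_causal_curve_from (exterior m) (schwarzschild m) (N_field m) (-1) p c" for c
  proof
    assume emp: "c ` {0..} \<inter> Sigma_slice m 0 = {}"
    have c0: "c 0 = p" and cM: "\<And>s. s \<ge> 0 \<Longrightarrow> c s \<in> exterior m"
      and noext: "\<not> (\<exists>q\<in>exterior m. (c \<longlongrightarrow> q) at_top)"
      using ic unfolding inextendible_causal_curve_from_def by auto
    obtain a where a: "a 0 = 0" "strict_mono a" "filterlim a at_top sequentially"
      and pieces: "\<And>k. \<exists>c'. \<forall>s\<in>{a k..a (Suc k)}. (c has_vector_derivative c' s) (at s within {a k..a (Suc k)}) \<and>
              future_causal (schwarzschild m) (N_field m) (c s) (- c' s)"
      using ic unfolding inextendible_causal_curve_from_def by (auto, meson)
    define I where "I k = {a k..a (Suc k)}" for k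
    obtain c' where c': "\<And>k s. s \<in> I k \<Longrightarrow> (c has_vector_derivative c' k s) (at s within I k)"
      "\<And>k s. s \<in> I k \<Longrightarrow> future_causal (schwarzschild m) (N_field m) (c s) (- c' k s)"
      using pieces unfolding I_def by metis
    have a_nonneg: "a k \<ge> 0" for k using strict_mono_less_eq[OF a(2), of 0 k] a(1) by simp
    have I0: "s \<ge> 0" if "s \<in> I k" for s k using that a_nonneg[of k] by (simp add: I_def)
    have ext: "c s \<in> exterior m" if "s \<in> I k" for s k by (rule cM[OF I0[OF that]])
    note FC = future_causal_components[OF m ext c'(2)]
    let ?f = "\<lambda>s. tstar m (c s)" and ?R = "\<lambda>s. radius (c s)"
    have chain: "((\<lambda>s. g (c s)) has_vector_derivative D (c' k s)) (at s within I k)"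
      if "s \<in> I k" "(g has_derivative D) (at (c s))" for g :: "real^4 \<Rightarrow> real" and D k s
      using vector_derivative_diff_chain_within[OF c'(1)[OF that(1)] has_derivative_at_withinI[OF that(2)]]
      by (simp add: o_def)
    define d y where "d k s = dtau m (c s) (- c' k s)" and "y k s = dr (c s) \<bullet> (- c' k s)" for k s
    have dd: "d k s = - (c' k s $ 1 + psi m (c s) * (dr (c s) \<bullet> c' k s))" if "s \<in> I k" for k s
      unfolding d_def dtau_def[OF m ext[OF that] c'(2)[OF that]] by simp
    have f': "(?f has_vector_derivative - d k s) (at s within I k)" if "s \<in> I k" for k s
      using chain[OF that tstar_has_derivative[OF m ext[OF that]]] by (simp add: dd[OF that] add.commute)
    have R': "(?R has_vector_derivative - y k s) (at s within I k)" if "s \<in> I k" for k s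
      using chain[OF that radius_has_derivative[OF rad(2)[OF m ext[OF that]]]] by (simp add: y_def)
    have L': "((\<lambda>s. 4 * m * ln (?R s - 2 * m)) has_vector_derivative - (2 * psi m (c s) * y k s)) (at s within I k)"
      if "s \<in> I k" for k s
    proof -
      have "((\<lambda>s. 4 * m * ln (s - 2 * m)) has_real_derivative 2 * psi m (c s)) (at (?R s))"
        using rad[OF m ext[OF that]] by (auto intro!: derivative_eq_intros simp: psi_eq(2)[OF m ext[OF that]])
      from DERIV_compose_FDERIV[OF this radius_has_derivative[OF rad(2)[OF m ext[OF that]]]]
      have "((\<lambda>q. 4 * m * ln (radius q - 2 * m)) has_derivative (\<lambda>v. (dr (c s) \<bullet> v) * (2 * psi m (c s)))) (at (c s))" .
      from chain[OF that this] show ?thesis by (simp add: y_def mult.commute)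
    qed
    have mono: "g t \<le> g s" if "0 \<le> s" "s \<le> t"
      "\<And>k s. s \<in> I k \<Longrightarrow> (g has_vector_derivative - g' k s) (at s within I k)" "\<And>k s. s \<in> I k \<Longrightarrow> g' k s \<ge> 0"
      for g :: "real \<Rightarrow> real" and g' s t
    proof -
      have "norm ((0::real) - 0) \<le> - g t - - g s"
      proof (rule piecewise_derivative_bound[OF a _ that(1,2), of "\<lambda>_. 0" "\<lambda>s. - g s"])
        fix k
        show "\<exists>c' \<phi>'. \<forall>s\<in>{a k..a (Suc k)}. ((\<lambda>_. 0::real) has_vector_derivative c' s) (at s within {a k..a (Suc k)}) \<and>
            ((\<lambda>s. - g s) has_vector_derivative \<phi>' s) (at s within {a k..a (Suc k)}) \<and> norm (c' s) \<le> \<phi>' s"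
          using that(4)[of _ k] has_vector_derivative_minus[OF that(3)[of _ k]]
          by (intro exI[of _ "\<lambda>_. 0"] exI[of _ "g' k"]) (auto simp: I_def)
      qed
      then show ?thesis by simp
    qed
    have f_mono: "?f t \<le> ?f s" if "0 \<le> s" "s \<le> t" for s t
      by (rule mono[OF that f']) (use FC(1) in \<open>auto simp: d_def less_imp_le\<close>)
    have v_mono: "?f t + ?R t \<le> ?f s + ?R s" if "0 \<le> s" "s \<le> t" for s t
    proof (rule mono[OF that, where g'="\<lambda>k s. d k s + y k s"])
      show "((\<lambda>s. ?f s + ?R s) has_vector_derivative - (d k s + y k s)) (at s within I k)" if "s \<in> I k" for k s
        using has_vector_derivative_add[OF f'[OF that] R'[OF that]] by simp
    qed (use FC(2) in \<open>auto simp: d_def y_def\<close>)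
    have u_mono: "?f t - ?R t - 4 * m * ln (?R t - 2 * m) \<le> ?f s - ?R s - 4 * m * ln (?R s - 2 * m)" if "0 \<le> s" "s \<le> t" for s t
    proof (rule mono[OF that, where g'="\<lambda>k s. d k s - y k s - 2 * psi m (c s) * y k s"])
      show "((\<lambda>s. ?f s - ?R s - 4 * m * ln (?R s - 2 * m)) has_vector_derivative - (d k s - y k s - 2 * psi m (c s) * y k s)) (at s within I k)"
        if "s \<in> I k" for k s
        using has_vector_derivative_diff[OF has_vector_derivative_diff[OF f'[OF that] R'[OF that]] L'[OF that]] by (simp add: algebra_simps)
    qed (use FC(3) in \<open>auto simp: d_def y_def\<close>)
    have nz: "?f s \<noteq> 0" if "s \<ge> 0" for s
      using emp cM[OF that] that by (auto simp: Sigma_slice_def)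
    have "\<forall>s. 0 \<le> s \<and> s \<le> a n \<longrightarrow> ?f s > 0" for n
    proof (induction n)
      case 0
      then show ?case using a(1) nz[of 0] p(2) c0 by auto
    next
      case (Suc n)
      have "?f s > 0" if s: "a n < s" "s \<le> a (Suc n)" for s
      proof (rule ccontr)
        assume "\<not> ?f s > 0"
        moreover have "continuous_on {a n..s} ?f"
          using continuous_on_vector_derivative[OF f', of n] s by (auto simp: I_def intro: continuous_on_subset)
        moreover have "?f (a n) > 0" using Suc a_nonneg by auto
        ultimately obtain s' where "a n \<le> s'" "s' \<le> s" "?f s' = 0"
          using IVT2'[of ?f s 0 "a n"] s by auto
        then show False using nz[of s'] a_nonneg[of n] by auto
      qed
      then show ?case using Suc by (meson not_le)
    qed
    then have fpos: "?f s > 0" if "s \<ge> 0" for s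
      using a(3) that by (metis eventually_sequentially filterlim_at_top order_refl)
    \<comment> \<open>Both null coordinates can only decrease towards the past. As
      \<open>tstar\<close> stays positive, the first bounds r from above by v0; with this, the
      second bounds ln (r - 2m) from below, which is the origin of \<eta>.\<close>
    define v0 u0 where "v0 = ?f 0 + ?R 0" and "u0 = ?f 0 - ?R 0 - 4 * m * ln (?R 0 - 2 * m)"
    define \<eta> where "\<eta> = exp (- (u0 + v0) / (4 * m))"
    have eta: "\<eta> > 0" by (simp add: \<eta>_def)
    have Rlow: "?R s \<ge> 2 * m + \<eta>" if "s \<ge> 0" for s
    proof -
      have "?R s \<le> v0" using v_mono[OF order_refl that] fpos[OF that] by (simp add: v0_def)
      moreover have "?f s - ?R s - 4 * m * ln (?R s - 2 * m) \<le> u0" using u_mono[OF order_refl that] by (simp add: u0_def)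
      ultimately have "- (u0 + v0) \<le> 4 * m * ln (?R s - 2 * m)" using fpos[OF that] by linarith
      then have "- (u0 + v0) / (4 * m) \<le> ln (?R s - 2 * m)" using m by (simp add: field_simps)
      then have "\<eta> \<le> exp (ln (?R s - 2 * m))" unfolding \<eta>_def by simp
      then show ?thesis using rad(1)[OF m cM[OF that]] by simp
    qed
    \<comment> \<open>A bound for 2/\<open>lapse\<close> on r \<ge> 2m + \<eta>, which makes the
      curve Lipschitz with respect to the drop of \<open>tstar\<close>.\<close>
    define C where "C = 2 * (2 * m + \<eta>) / \<eta>"
    have "C > 0" using m eta by (simp add: C_def)
    have lap: "2 / lapse m (c s) \<le> C" if "s \<ge> 0" for s
    proof -
      have "2 * m / ?R s \<le> 2 * m / (2 * m + \<eta>)"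
        using Rlow[OF that] m eta by (intro divide_left_mono mult_pos_pos) auto
      then have "lapse m (c s) \<ge> \<eta> / (2 * m + \<eta>)"
        using m eta by (simp add: lapse_def[OF m cM[OF that]] field_simps)
      then have "2 / lapse m (c s) \<le> 2 / (\<eta> / (2 * m + \<eta>))"
        using m eta beta_bounds(3)[OF m cM[OF that]] by (intro divide_left_mono mult_pos_pos) auto
      then show ?thesis by (simp add: C_def)
    qed
    have cb: "norm (c t - c s) \<le> C * (?f s - ?f t)" if "0 \<le> s" "s \<le> t" for s t
    proof -
      have "norm (c t - c s) \<le> - C * ?f t - - C * ?f s"
      proof (rule piecewise_derivative_bound[OF a _ that, of c "\<lambda>s. - C * ?f s"])
        fix k
        have "norm (c' k s) \<le> C * d k s" if "s \<in> I k" for s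
        proof -
          have "norm (- c' k s) \<le> 2 / lapse m (c s) * d k s" using FC(4)[OF that that] by (simp add: d_def)
          also have "\<dots> \<le> C * d k s"
            using lap[OF I0[OF that]] FC(1)[OF that that] by (intro mult_right_mono) (auto simp: d_def)
          finally show ?thesis by simp
        qed
        moreover have "((\<lambda>s. - C * ?f s) has_vector_derivative C * d k s) (at s within I k)" if "s \<in> I k" for s
          using has_vector_derivative_mult_right[OF f'[OF that], of "- C"] by simp
        ultimately show "\<exists>c' \<phi>'. \<forall>s\<in>{a k..a (Suc k)}. (c has_vector_derivative c' s) (at s within {a k..a (Suc k)}) \<and>
            ((\<lambda>s. - C * ?f s) has_vector_derivative \<phi>' s) (at s within {a k..a (Suc k)}) \<and> norm (c' s) \<le> \<phi>' s"
          using c'(1)[of _ k] unfolding I_def[symmetric] by (intro exI[of _ "c' k"] exI[of _ "\<lambda>s. C * d k s"]) auto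
      qed
      then show ?thesis by (simp add: algebra_simps)
    qed
    have "decseq (\<lambda>n. ?f (real n))" by (intro decseq_SucI f_mono) auto
    then obtain L where L: "(\<lambda>n. ?f (real n)) \<longlonglongrightarrow> L" "\<And>n. L \<le> ?f (real n)"
      using decseq_convergent[of "\<lambda>n. ?f (real n)" 0] fpos by (metis less_imp_le of_nat_0_le_iff)
    have Lle: "L \<le> ?f s" if "s \<ge> 0" for s
    proof -
      obtain n where "s \<le> real n" using real_arch_simple by blast
      then show ?thesis using f_mono[OF that] L(2)[of n] by (meson order_trans)
    qed
    have cL: "norm (c t - c s) \<le> C * (?f s - L)" if "0 \<le> s" "s \<le> t" for s t
    proof -
      have "C * (?f s - ?f t) \<le> C * (?f s - L)" using Lle[of t] that \<open>C > 0\<close> by (intro mult_left_mono) auto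
      then show ?thesis using cb[OF that] by linarith
    qed
    have lim0: "(\<lambda>n. C * (?f (real n) - L)) \<longlonglongrightarrow> C * (L - L)" by (intro tendsto_intros L)
    have small: "\<exists>N. C * (?f (real N) - L) < e" if "e > 0" for e
      using order_tendstoD(2)[OF lim0, of e] that by (auto simp: eventually_sequentially)
    have "Cauchy (\<lambda>n. c (real n))"
    proof (rule metric_CauchyI)
      fix e :: real assume "e > 0"
      then obtain N where N: "C * (?f (real N) - L) < e / 2" using small[of "e / 2"] by auto
      have dN: "dist (c (real i)) (c (real N)) < e / 2" if "i \<ge> N" for i
        using cL[of "real N" "real i"] that N by (simp add: dist_norm)
      have "dist (c (real i)) (c (real j)) < e" if "i \<ge> N" "j \<ge> N" for i j
        by (rule dist_triangle_half_l[OF dN[OF that(1)] dN[OF that(2)]])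
      then show "\<exists>M. \<forall>m\<ge>M. \<forall>n\<ge>M. dist (c (real m)) (c (real n)) < e" by blast
    qed
    then obtain q where q: "(\<lambda>n. c (real n)) \<longlonglongrightarrow> q" using Cauchy_convergent convergentD by blast
    have "(\<lambda>n. radius (c (real n))) \<longlonglongrightarrow> radius q"
      using continuous_on_tendsto_compose[OF continuous_on_radius q] by simp
    then have "radius q \<ge> 2 * m + \<eta>" by (rule LIMSEQ_le_const) (simp add: Rlow)
    then have "q \<in> exterior m" using eta by (simp add: exterior_def)
    moreover have "(c \<longlongrightarrow> q) at_top"
    proof (rule tendstoI)
      fix e :: real assume "e > 0"
      then obtain N where N: "C * (?f (real N) - L) < e / 2" using small[of "e / 2"] by auto
      have nq: "norm (q - c (real N)) \<le> C * (?f (real N) - L)"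
        by (rule LIMSEQ_le_const2[OF tendsto_norm[OF tendsto_diff[OF q tendsto_const]]]) (auto intro!: exI[of _ N] cL)
      have "dist (c s) q < e" if "s \<ge> real N" for s
        using cL[of "real N" s] that N nq norm_triangle_ineq4[of "c s - c (real N)" "q - c (real N)"]
        by (simp add: dist_norm)
      then show "\<forall>\<^sub>F x in at_top. dist (c x) q < e" by (auto simp: eventually_at_top_linorder)
    qed
    ultimately show False using noext by blast
  qed
  then show ?thesis
    using p(1) by (simp add: DoD_def domain_of_dependence_def future_domain_of_dependence_def)
qed

section \<open>Separated solutions of the wave equation\<close>

lemma open_exterior: "open (exterior m)"
  unfolding exterior_def by (rule open_Collect_less) (auto intro!: continuous_intros continuous_on_radius)

text \<open>The Cartesian form x + iy = r sin \<theta> exp (i \<phi>) of r Z. Its powers are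
  harmonic polynomials, smooth also on the axis where \<phi> is undefined.\<close>

definition plane_coord :: "real^4 \<Rightarrow> complex" where
  "plane_coord p = of_real (p $ 2) + \<i> * of_real (p $ 3)"

text \<open>The pair (t, x), with t shifted by 2m ln m. The shift matches the normalisation of
  \<open>tortoise\<close> and gives the photon sphere on \<Sigma>_\<tau> the first coordinate
  \<tau>.\<close>

definition null_coords :: "real \<Rightarrow> real^4 \<Rightarrow> real \<times> real" where
  "null_coords m p = (p $ 1 + 2 * m * ln m, tortoise m (radius p))"

definition inv_lapse :: "real \<Rightarrow> real^4 \<Rightarrow> real" where
  "inv_lapse m p = radius p / (radius p - 2 * m)"

lemma bounded_linear_plane_coord: "bounded_linear plane_coord"
  unfolding plane_coord_def[abs_def]
  by (intro bounded_linear_add bounded_linear_const_mult bounded_linear_compose[OF bounded_linear_of_real] bounded_linear_vec_nth)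

lemma plane_coord_axis: "plane_coord (axis 1 1) = 0" "plane_coord (axis 2 1) = 1" "plane_coord (axis 3 1) = \<i>" "plane_coord (axis 4 1) = 0"
  by (simp_all add: plane_coord_def axis_def)

lemma plane_coord_power_has_derivative:
  "((\<lambda>p. plane_coord p ^ l) has_derivative (\<lambda>v. of_nat l * plane_coord p ^ (l - 1) * plane_coord v)) (at p)"
  by (rule has_derivative_eq_rhs[OF has_derivative_power[OF bounded_linear_imp_has_derivative[OF bounded_linear_plane_coord]]])
    (simp add: mult_ac fun_eq_iff)

context
  fixes m :: real
  assumes m: "m > 0"
begin

lemma radD: "p \<in> exterior m \<Longrightarrow> radius p > 2 * m" "p \<in> exterior m \<Longrightarrow> radius p > 0"
  using m by (simp_all add: exterior_def)

lemma null_coords_has_derivative: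
  assumes p: "p \<in> exterior m"
  shows "(null_coords m has_derivative (\<lambda>v. (v $ 1, inv_lapse m p * (dr p \<bullet> v)))) (at p)"
proof -
  have 1: "((\<lambda>p::real^4. p $ 1 + 2 * m * ln m) has_derivative (\<lambda>v. v $ 1)) (at p)"
    by (auto intro!: derivative_eq_intros bounded_linear_imp_has_derivative bounded_linear_vec_nth)
  have 2: "((\<lambda>p. tortoise m (radius p)) has_derivative (\<lambda>v. (dr p \<bullet> v) * (radius p / (radius p - 2 * m)))) (at p)"
    by (rule DERIV_compose_FDERIV[OF tortoise_derivative[OF m radD(1)[OF p]] radius_has_derivative[OF radD(2)[OF p]]])
  show ?thesis
    unfolding null_coords_def[abs_def] inv_lapse_def using has_derivative_Pair[OF 1 2] by (simp add: mult.commute)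
qed

lemma comp_null_coords_has_derivative:
  assumes p: "p \<in> exterior m" and W: "\<And>k. Cdiff k UNIV W"
  shows "((\<lambda>p. W (null_coords m p)) has_derivative (\<lambda>v. v $ 1 *\<^sub>R Dt W (null_coords m p)
     + (inv_lapse m p * (dr p \<bullet> v)) *\<^sub>R Dx W (null_coords m p))) (at p)"
  using diff_chain_at[OF null_coords_has_derivative[OF p] has_derivative_Dt_Dx[OF W]] by (simp add: o_def)

lemma Cdiff_radius: "Cdiff k (exterior m) radius"
proof -
  have "Cdiff k (exterior m) (\<lambda>p::real^4. sqrt ((p$2)\<^sup>2 + (p$3)\<^sup>2 + (p$4)\<^sup>2))"
  proof (rule Cdiff_sqrt_compose[OF open_exterior])
    show "Cdiff k (exterior m) (\<lambda>p::real^4. (p$2)\<^sup>2 + (p$3)\<^sup>2 + (p$4)\<^sup>2)"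
      by (rule Cdiff_add Cdiff_power Cdiff_nth open_exterior)+
    fix p assume "p \<in> exterior m"
    from radD(2)[OF this] show "(p$2)\<^sup>2 + (p$3)\<^sup>2 + (p$4)\<^sup>2 > 0" by (simp add: radius_def)
  qed
  then show ?thesis by (simp add: radius_def[abs_def] del: differentiable_times_on.simps)
qed

lemma Cdiff_null_coords: "Cdiff k (exterior m) (null_coords m)"
proof -
  have "Cdiff k (exterior m) (\<lambda>p. ln ((radius p - 2 * m) / m))"
  proof (rule Cdiff_ln_compose[OF open_exterior])
    show "Cdiff k (exterior m) (\<lambda>p. (radius p - 2 * m) / m)"
      by (rule Cdiff_divide Cdiff_diff Cdiff_radius Cdiff_const open_exterior)+ (use m in simp)
  qed (use m radD in auto)
  then show ?thesis
    unfolding null_coords_def[abs_def] tortoise_def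
    by - (rule Cdiff_Pair Cdiff_add Cdiff_mult Cdiff_diff Cdiff_nth Cdiff_const Cdiff_radius open_exterior | assumption)+
qed

definition mode4 :: "nat \<Rightarrow> (real \<times> real \<Rightarrow> complex) \<Rightarrow> real^4 \<Rightarrow> complex" where
  "mode4 l W p = plane_coord p ^ l * W (null_coords m p)"

lemma Cdiff_mode4:
  assumes "\<And>k. Cdiff k UNIV W" shows "Cdiff k (exterior m) (mode4 l W)"
  unfolding mode4_def[abs_def]
  by (rule Cdiff_mult Cdiff_power Cdiff_bounded_linear[OF _ bounded_linear_plane_coord]
      Cdiff_compose[OF open_exterior open_UNIV subset_UNIV assms Cdiff_null_coords] open_exterior)+

lemma mode4_has_derivative:
  assumes p: "p \<in> exterior m" and W: "\<And>k. Cdiff k UNIV W"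
  defines "x \<equiv> null_coords m p" and "Q \<equiv> plane_coord p"
  shows "(mode4 l W has_derivative (\<lambda>v. of_nat l * Q ^ (l - 1) * plane_coord v * W x
     + Q ^ l * (v $ 1 *\<^sub>R Dt W x + (inv_lapse m p * (dr p \<bullet> v)) *\<^sub>R Dx W x))) (at p)"
  unfolding mode4_def[abs_def]
  by (rule has_derivative_eq_rhs[OF has_derivative_mult[OF plane_coord_power_has_derivative comp_null_coords_has_derivative[OF p W]]])
    (auto simp: fun_eq_iff x_def Q_def)

lemma pd_mode4:
  assumes p: "p \<in> exterior m" and W: "\<And>k. Cdiff k UNIV W"
  defines "x \<equiv> null_coords m p" and "Q \<equiv> plane_coord p"
  shows "pd j (mode4 l W) p = of_nat l * Q ^ (l - 1) * plane_coord (axis j 1) * W x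
     + Q ^ l * (dt $ j *\<^sub>R Dt W x + (inv_lapse m p * dr p $ j) *\<^sub>R Dx W x)"
proof -
  have "axis j 1 $ 1 = dt $ j" by (simp add: dt_def axis_def)
  then show ?thesis unfolding pd_eq[OF mode4_has_derivative[OF p W]] x_def Q_def by (simp add: inner_axis)
qed

lemma inv_lapse_dr_has_derivative:
  assumes p: "p \<in> exterior m"
  shows "((\<lambda>q. inv_lapse m q * dr q $ j) has_derivative (\<lambda>v. - (2 * m / (radius p - 2 * m)\<^sup>2) * (dr p \<bullet> v) * dr p $ j
     + inv_lapse m p * (((if j = 1 then 0 else v $ j) - dr p $ j * (dr p \<bullet> v)) / radius p))) (at p)"
proof -
  have "((\<lambda>r. r / (r - 2 * m)) has_real_derivative - (2 * m / (radius p - 2 * m)\<^sup>2)) (at (radius p))"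
    using radD[OF p] by (auto intro!: derivative_eq_intros simp: power2_eq_square field_simps)
  from DERIV_compose_FDERIV[OF this radius_has_derivative[OF radD(2)[OF p]]]
  have 1: "(inv_lapse m has_derivative (\<lambda>v. (dr p \<bullet> v) * - (2 * m / (radius p - 2 * m)\<^sup>2))) (at p)"
    unfolding inv_lapse_def[abs_def] .
  show ?thesis
    by (rule has_derivative_eq_rhs[OF has_derivative_mult[OF 1 dr_has_derivative'[OF m p]]]) (auto simp: fun_eq_iff)
qed

lemma pd_pd_mode4:
  assumes p: "p \<in> exterior m" and W: "\<And>k. Cdiff k UNIV W"
  defines "x \<equiv> null_coords m p" and "Q \<equiv> plane_coord p" and "e i \<equiv> plane_coord (axis i 1)" and "n i \<equiv> dr p $ i"
    and "\<phi> \<equiv> inv_lapse m p" and "\<phi>' \<equiv> - (2 * m / (radius p - 2 * m)\<^sup>2)"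
  shows "pd i (pd j (mode4 l W)) p = of_nat l * of_nat (l - 1) * Q ^ (l - 2) * e i * e j * W x
     + of_nat l * Q ^ (l - 1) * e j * (dt $ i *\<^sub>R Dt W x + (\<phi> * n i) *\<^sub>R Dx W x)
     + of_nat l * Q ^ (l - 1) * e i * (dt $ j *\<^sub>R Dt W x + (\<phi> * n j) *\<^sub>R Dx W x)
     + Q ^ l * (dt $ j *\<^sub>R (dt $ i *\<^sub>R Dt (Dt W) x + (\<phi> * n i) *\<^sub>R Dx (Dt W) x)
        + (\<phi>' * n i * n j + \<phi> * (((if j = 1 then 0 else if i = j then 1 else 0) - n j * n i) / radius p)) *\<^sub>R Dx W x
        + (\<phi> * n j) *\<^sub>R (dt $ i *\<^sub>R Dt (Dx W) x + (\<phi> * n i) *\<^sub>R Dx (Dx W) x))"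
proof -
  have Wt: "Cdiff k UNIV (Dt W)" and Wx: "Cdiff k UNIV (Dx W)" for k
    using Cdiff_Dt[OF W] Cdiff_Dx[OF W] by blast+
  let ?g = "\<lambda>q. (of_nat l * e j) * (plane_coord q ^ (l - 1) * W (null_coords m q))
     + plane_coord q ^ l * (dt $ j *\<^sub>R Dt W (null_coords m q) + (inv_lapse m q * dr q $ j) *\<^sub>R Dx W (null_coords m q))"
  note d1 = has_derivative_mult_right[OF has_derivative_mult[OF plane_coord_power_has_derivative[of "l - 1"] comp_null_coords_has_derivative[OF p W]], of "of_nat l * e j"]
  note d2 = has_derivative_mult[OF plane_coord_power_has_derivative[of l]
      has_derivative_add[OF has_derivative_scaleR_right[OF comp_null_coords_has_derivative[OF p Wt], of "dt $ j"]
        has_derivative_scaleR[OF inv_lapse_dr_has_derivative[OF p, of j] comp_null_coords_has_derivative[OF p Wx]]]]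
  note d = has_derivative_add[OF d1 d2]
  have eq: "pd j (mode4 l W) q = ?g q" if "q \<in> exterior m" for q
    unfolding pd_mode4[OF that W] by (simp add: e_def mult_ac)
  have ax: "axis i 1 $ 1 = dt $ i" "axis i (1::real) $ j = (if i = j then 1 else 0)" by (auto simp: dt_def axis_def)
  have l2: "l - 1 - 1 = l - 2" by simp
  define \<Delta> where "\<Delta> = (if j = 1 then 0 else if i = j then 1 else (0::real))"
  show ?thesis
    by (rule trans[OF pd_eq[OF has_derivative_transform_within_open[OF d open_exterior p eq[symmetric]]]], assumption)
      (simp only: inner_axis ax l2 x_def[symmetric] Q_def[symmetric] \<phi>_def[symmetric] \<phi>'_def[symmetric] n_def[symmetric] e_def[symmetric] inner_real_def mult_1_right \<Delta>_def[symmetric],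
       simp add: scaleR_conv_of_real algebra_simps add_divide_distrib diff_divide_distrib)
qed

lemma of_nat_pred: "complex_of_nat l * of_nat (l - 1) = of_nat l * (of_nat l - 1)"
  by (cases l) simp_all

lemma wave_op_mode4:
  assumes p: "p \<in> exterior m" and W: "\<And>k. Cdiff k UNIV W"
  defines "x \<equiv> null_coords m p" and "Q \<equiv> plane_coord p" and "r \<equiv> radius p"
  shows "wave_op (schwarzschild m) (mode4 l W) p = Q ^ l * (of_real (r / (r - 2 * m)) * (Dx (Dx W) x - Dt (Dt W) x)
     + of_real (2 * (real l + 1) / r) * Dx W x - of_real (2 * m * (real l)\<^sup>2 / r ^ 3) * W x)"
proof -
  define U where "U i j = pd i (pd j (mode4 l W)) p" for i j
  define \<phi> \<phi>' where "\<phi> = inv_lapse m p" and "\<phi>' = - (2 * m / (r - 2 * m)\<^sup>2)"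
  define A B C where "A = dr p $ 2" and "B = dr p $ 3" and "C = dr p $ 4"
  define a b c where "a = complex_of_real A" and "b = complex_of_real B" and "c = complex_of_real C"
  define X Y where "X = of_nat l * of_nat (l - 1) * Q ^ (l - 2)" and "Y = of_nat l * Q ^ (l - 1)"
  define F G where "F = complex_of_real \<phi>" and "G = complex_of_real \<phi>'"
  define H where "H = complex_of_real (\<phi> / r)"
  define w w1 w2 where "w = W x" and "w1 = Dx W x" and "w2 = Dx (Dx W) x"
  have r: "r > 2 * m" "r > 0" using radD[OF p] by (simp_all add: r_def)
  have nn: "a * a + b * b + c * c = 1"
    using dr_norm[of p] r unfolding a_def b_def c_def A_def B_def C_def r_def
    by (simp add: power2_eq_square flip: of_real_mult of_real_add)
  have Qab: "Q = of_real r * (a + \<i> * b)"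
    using r by (simp add: Q_def plane_coord_def a_def b_def A_def B_def dr_def r_def algebra_simps)
  have YQ: "Y * (a + \<i> * b) = of_real (real l / r) * Q ^ l"
  proof -
    have "Y * Q = of_nat l * Q ^ l" unfolding Y_def by (cases l) (simp_all add: mult_ac)
    then show ?thesis using r unfolding Qab[symmetric] by (simp add: Qab field_simps)
  qed
  have XQ: "X * ((a + \<i> * b) * (a + \<i> * b)) = of_real (real l * (real l - 1) / r\<^sup>2) * Q ^ l"
  proof -
    have "X * (Q * Q) = of_nat l * (of_nat l - 1) * Q ^ l" unfolding X_def
    proof (cases "l < 2")
      case True then show "of_nat l * of_nat (l - 1) * Q ^ (l - 2) * (Q * Q) = of_nat l * (of_nat l - 1) * Q ^ l" by (auto simp: less_2_cases_iff)
    next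
      case False
      then have "Q ^ l = Q ^ (l - 2) * (Q * Q)" by (metis le_add_diff_inverse2 not_less power2_eq_square power_add)
      then show "of_nat l * of_nat (l - 1) * Q ^ (l - 2) * (Q * Q) = of_nat l * (of_nat l - 1) * Q ^ l" unfolding of_nat_pred by simp
    qed
    then have "(X * ((a + \<i> * b) * (a + \<i> * b))) * (of_real r * of_real r) = of_nat l * (of_nat l - 1) * Q ^ l"
      by (simp only: Qab mult_ac)
    then show ?thesis using r by (simp add: field_simps power2_eq_square)
  qed
  have e: "plane_coord (axis 2 1) = 1" "plane_coord (axis 3 1) = \<i>" "plane_coord (axis 4 1) = 0" "plane_coord (axis 1 1) = 0"
    by (rule plane_coord_axis)+
  note U0 = pd_pd_mode4[OF p W, of _ _ l, folded U_def x_def Q_def r_def \<phi>_def \<phi>'_def, folded X_def Y_def]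
  have U11: "U 1 1 = Q ^ l * Dt (Dt W) x"
    unfolding U0 e by simp
  have Uab: "U 2 2 = X * w + 2 * (Y * F * a * w1) + Q ^ l * ((G * a * a + H * (1 - a * a)) * w1 + F * F * a * a * w2)"
    "U 3 3 = - (X * w) + 2 * (Y * \<i> * F * b * w1) + Q ^ l * ((G * b * b + H * (1 - b * b)) * w1 + F * F * b * b * w2)"
    "U 4 4 = Q ^ l * ((G * c * c + H * (1 - c * c)) * w1 + F * F * c * c * w2)"
    "U 2 3 = X * \<i> * w + Y * F * (\<i> * a + b) * w1 + Q ^ l * ((G * a * b - H * a * b) * w1 + F * F * a * b * w2)"
    "U 3 2 = X * \<i> * w + Y * F * (\<i> * a + b) * w1 + Q ^ l * ((G * a * b - H * a * b) * w1 + F * F * a * b * w2)"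
    "U 2 4 = Y * F * c * w1 + Q ^ l * ((G * a * c - H * a * c) * w1 + F * F * a * c * w2)"
    "U 4 2 = Y * F * c * w1 + Q ^ l * ((G * a * c - H * a * c) * w1 + F * F * a * c * w2)"
    "U 3 4 = Y * \<i> * F * c * w1 + Q ^ l * ((G * b * c - H * b * c) * w1 + F * F * b * c * w2)"
    "U 4 3 = Y * \<i> * F * c * w1 + Q ^ l * ((G * b * c - H * b * c) * w1 + F * F * b * c * w2)"
    unfolding U0 e w_def w1_def w2_def F_def G_def H_def a_def b_def c_def A_def[symmetric] B_def[symmetric] C_def[symmetric] X_def[symmetric] Y_def[symmetric]
    by (simp_all add: scaleR_conv_of_real \<phi>'_def algebra_simps diff_divide_distrib)
  have U1: "pd 2 (mode4 l W) p = Y * w + Q ^ l * (F * a * w1)" "pd 3 (mode4 l W) p = Y * \<i> * w + Q ^ l * (F * b * w1)"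
    "pd 4 (mode4 l W) p = Q ^ l * (F * c * w1)"
    unfolding pd_mode4[OF p W] e x_def[symmetric] Q_def[symmetric] \<phi>_def[symmetric] A_def[symmetric] B_def[symmetric] C_def[symmetric]
      Y_def[symmetric] w_def w1_def F_def a_def b_def c_def
    by (simp_all add: scaleR_conv_of_real)
  define s where "s = a + \<i> * b"
  \<comment> \<open>The terms with X cancel because (x + iy)^l is harmonic; in the radial second
    derivative \<open>rr\<close> they survive with the factor (a + ib)^2.\<close>
  have tr: "U 2 2 + U 3 3 + U 4 4 = 2 * F * w1 * (Y * s) + Q ^ l * ((G + 2 * H) * w1 + F * F * w2)"
  proof -
    have "U 2 2 + U 3 3 + U 4 4 = 2 * F * w1 * (Y * s) + Q ^ l * ((G * (a * a + b * b + c * c) + H * (3 - (a * a + b * b + c * c))) * w1 + F * F * (a * a + b * b + c * c) * w2)"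
      unfolding Uab s_def by (simp add: algebra_simps)
    then show ?thesis unfolding nn by simp
  qed
  have rr: "a * (a * U 2 2 + b * U 2 3 + c * U 2 4) + b * (a * U 3 2 + b * U 3 3 + c * U 3 4) + c * (a * U 4 2 + b * U 4 3 + c * U 4 4)
     = X * (s * s) * w + 2 * F * w1 * (Y * s) + Q ^ l * (G * w1 + F * F * w2)"
  proof -
    let ?n = "a * a + b * b + c * c"
    have "a * (a * U 2 2 + b * U 2 3 + c * U 2 4) + b * (a * U 3 2 + b * U 3 3 + c * U 3 4) + c * (a * U 4 2 + b * U 4 3 + c * U 4 4)
      = X * (s * s) * w + 2 * F * w1 * (Y * s) * ?n + Q ^ l * ((G * (?n * ?n) + H * (?n - ?n * ?n)) * w1 + F * F * (?n * ?n) * w2)"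
    proof -
      have i: "\<i> * (\<i> * z) = - z" for z by (simp add: mult.assoc[symmetric])
      show ?thesis unfolding Uab s_def by (simp add: algebra_simps i)
    qed
    then show ?thesis unfolding nn by simp
  qed
  have r1: "a * pd 2 (mode4 l W) p + b * pd 3 (mode4 l W) p + c * pd 4 (mode4 l W) p = (Y * s) * w + Q ^ l * (F * w1)"
  proof -
    have "a * pd 2 (mode4 l W) p + b * pd 3 (mode4 l W) p + c * pd 4 (mode4 l W) p = (Y * s) * w + Q ^ l * (F * (a * a + b * b + c * c) * w1)"
      unfolding U1 s_def by (simp add: algebra_simps)
    then show ?thesis unfolding nn by simp
  qed
  have il: "inverse (lapse m p) = \<phi>" using r by (simp add: lapse_def[OF m p] \<phi>_def inv_lapse_def r_def field_simps)
  have be: "beta m p = 2 * m / r" by (simp add: beta_def[OF m p] r_def)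
  let ?c1 = "2 * \<phi> * (real l / r) + \<phi>' + 2 * (\<phi> / r) - 2 * m / r * (2 * \<phi> * (real l / r) + \<phi>') - 2 * m / r\<^sup>2 * \<phi>"
  let ?c0 = "- (2 * m / r * (real l * (real l - 1) / r\<^sup>2)) - 2 * m / r\<^sup>2 * (real l / r)"
  have "wave_op (schwarzschild m) (mode4 l W) p = - F * U 1 1 + (U 2 2 + U 3 3 + U 4 4)
     - of_real (2 * m / r) * (a * (a * U 2 2 + b * U 2 3 + c * U 2 4) + b * (a * U 3 2 + b * U 3 3 + c * U 3 4) + c * (a * U 4 2 + b * U 4 3 + c * U 4 4))
     - of_real (2 * m / r\<^sup>2) * (a * pd 2 (mode4 l W) p + b * pd 3 (mode4 l W) p + c * pd 4 (mode4 l W) p)"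
    unfolding wave_op_schwarzschild[OF m p] U_def il be F_def a_def b_def c_def A_def B_def C_def r_def
    by (simp add: scaleR_conv_of_real)
  also have "\<dots> = Q ^ l * (of_real (- \<phi>) * Dt (Dt W) x + of_real (\<phi> * \<phi> * (1 - 2 * m / r)) * w2 + of_real ?c1 * w1 + of_real ?c0 * w)"
    unfolding U11 tr rr r1 s_def XQ YQ F_def G_def H_def
    by (simp add: algebra_simps)
  also have "\<phi> * \<phi> * (1 - 2 * m / r) = \<phi>"
  proof -
    have "1 - 2 * m / r = (r - 2 * m) / r" using r by (simp add: field_simps)
    then show ?thesis using r by (simp add: \<phi>_def inv_lapse_def r_def[symmetric])
  qed
  also have "?c1 = 2 * (real l + 1) / r"
  proof -
    have ph: "\<phi> = r / (r - 2 * m)" by (simp add: \<phi>_def inv_lapse_def r_def)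
    have "r - 2 * m \<noteq> 0" "r \<noteq> 0" using r by auto
    then show ?thesis unfolding ph \<phi>'_def by (simp add: divide_simps power2_eq_square) (simp add: algebra_simps)
  qed
  also have "?c0 = - (2 * m * (real l)\<^sup>2 / r ^ 3)"
    using r by (simp add: field_simps power2_eq_square power3_eq_cube)
  finally have E: "wave_op (schwarzschild m) (mode4 l W) p = Q ^ l * (of_real (- \<phi>) * Dt (Dt W) x + of_real \<phi> * w2
      + of_real (2 * (real l + 1) / r) * w1 + of_real (- (2 * m * (real l)\<^sup>2 / r ^ 3)) * w)" .
  have ph: "r / (r - 2 * m) = \<phi>" by (simp add: \<phi>_def inv_lapse_def r_def)
  show ?thesis unfolding E w_def w1_def w2_def ph of_real_minus by (simp add: algebra_simps)
qed

end

section \<open>Linear combinations of solutions on the exterior\<close>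

lemma DoD_subset_exterior: "DoD m \<subseteq> exterior m"
  by (auto simp: DoD_def domain_of_dependence_def future_domain_of_dependence_def past_domain_of_dependence_def)

text \<open>The exterior is an explicit open set on which the coordinates are smooth; solutions on
  the domain of dependence are obtained from it by restriction.\<close>

definition exterior_solution :: "real \<Rightarrow> (real^4 \<Rightarrow> complex) \<Rightarrow> bool" where
  "exterior_solution m u \<longleftrightarrow> (\<forall>k. Cdiff k (exterior m) u) \<and> (\<forall>p\<in>exterior m. wave_op (schwarzschild m) u p = 0)"

lemma exterior_solution_wave_solution: "exterior_solution m u \<Longrightarrow> wave_solution m u"
  unfolding exterior_solution_def wave_solution_def smooth_on_def
  using Cdiff_subset[OF _ DoD_subset_exterior] DoD_subset_exterior by blast

lemma pd_lincomb:
  assumes "u differentiable (at p)" "v differentiable (at p)"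
  shows "pd i (\<lambda>p. u p + c * v p) p = pd i u p + c * pd i (v :: _ \<Rightarrow> complex) p"
  unfolding pd_eq[OF has_derivative_add[OF assms(1)[unfolded frechet_derivative_works]
        has_derivative_mult_right[OF assms(2)[unfolded frechet_derivative_works]]]]
  by (simp add: pd_def)

lemma pd_cong_open:
  assumes "open S" "p \<in> S" "\<And>q. q \<in> S \<Longrightarrow> f q = g q" "f differentiable (at p)"
  shows "pd i g p = pd i f p"
  using pd_eq[OF has_derivative_transform_within_open[OF assms(4)[unfolded frechet_derivative_works] assms(1-3)]]
  by (simp add: pd_def)

lemma Cdiff_differentiable: "(\<And>k. Cdiff k S f) \<Longrightarrow> p \<in> S \<Longrightarrow> f differentiable (at p)"
  using Cdiff_has_derivative[of 0 S f p] unfolding differentiable_def by blast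

lemma Cdiff_pd: "(\<And>k. Cdiff k S f) \<Longrightarrow> Cdiff k S (pd i f)"
proof -
  assume "\<And>k. Cdiff k S f"
  then have "Cdiff (Suc k) S f" .
  then show "Cdiff k S (pd i f)" unfolding pd_def[abs_def] by simp
qed

lemma exterior_solution_lincomb:
  assumes m: "m > 0" and u: "exterior_solution m u" and v: "exterior_solution m v"
  shows "exterior_solution m (\<lambda>p. u p + c * v p)"
  unfolding exterior_solution_def
proof (intro conjI allI ballI)
  have Cu: "Cdiff k (exterior m) u" and Cv: "Cdiff k (exterior m) v" for k
    using u v by (auto simp: exterior_solution_def)
  show "Cdiff k (exterior m) (\<lambda>p. u p + c * v p)" for k
    by (rule Cdiff_add Cdiff_mult Cdiff_const Cu Cv open_exterior)+
  fix p assume p: "p \<in> exterior m"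
  have 1: "pd j (\<lambda>p. u p + c * v p) q = pd j u q + c * pd j v q" if "q \<in> exterior m" for j q
    by (rule pd_lincomb[OF Cdiff_differentiable[OF Cu that] Cdiff_differentiable[OF Cv that]])
  have 2: "pd i (pd j (\<lambda>p. u p + c * v p)) p = pd i (pd j u) p + c * pd i (pd j v) p" for i j
  proof -
    have d: "(\<lambda>q. pd j u q + c * pd j v q) differentiable (at p)"
      by (rule Cdiff_differentiable[OF _ p]) (rule Cdiff_add Cdiff_mult Cdiff_const Cdiff_pd Cu Cv open_exterior)+
    have "pd i (pd j (\<lambda>p. u p + c * v p)) p = pd i (\<lambda>q. pd j u q + c * pd j v q) p"
      by (rule pd_cong_open[OF open_exterior p _ d]) (rule 1[symmetric])
    also have "\<dots> = pd i (pd j u) p + c * pd i (pd j v) p"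
      by (rule pd_lincomb[OF Cdiff_differentiable[OF Cdiff_pd[OF Cu] p] Cdiff_differentiable[OF Cdiff_pd[OF Cv] p]])
    finally show ?thesis .
  qed
  have "wave_op (schwarzschild m) (\<lambda>p. u p + c * v p) p = wave_op (schwarzschild m) u p + c * wave_op (schwarzschild m) v p"
    unfolding wave_op_schwarzschild[OF m p] 1[OF p] 2 by (simp add: scaleR_conv_of_real algebra_simps)
  then show "wave_op (schwarzschild m) (\<lambda>p. u p + c * v p) p = 0"
    using u v p by (simp add: exterior_solution_def)
qed

lemma exterior_solution_zero: "exterior_solution m (\<lambda>p. 0)"
proof -
  have "pd i (\<lambda>p. 0::complex) = (\<lambda>p. 0)" for i :: 4 by (rule ext) (simp add: pd_eq[OF has_derivative_const])
  then show ?thesis by (simp add: exterior_solution_def wave_op_def del: differentiable_times_on.simps)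
qed

lemma exterior_solution_sum:
  assumes m: "m > 0" and "\<And>k. exterior_solution m (u k)"
  shows "exterior_solution m (\<lambda>p. \<Sum>k\<le>(K::nat). c k * u k p)"
proof (induction K)
  case 0
  show ?case using exterior_solution_lincomb[OF m exterior_solution_zero assms(2)[of 0], of "c 0"] by simp
next
  case (Suc K)
  show ?case using exterior_solution_lincomb[OF m Suc assms(2)[of "Suc K"], of "c (Suc K)"] by simp
qed

text \<open>Times (x + iy)^l this gives Z^l v/r: the power r^(-l) normalises the angular part, and
  1/r removes the first order term of the radial equation.\<close>

definition radial_mode :: "real \<Rightarrow> nat \<Rightarrow> (real \<times> real \<Rightarrow> complex) \<Rightarrow> real \<times> real \<Rightarrow> complex" where
  "radial_mode m l v p = of_real (inverse (areal m (snd p)) ^ (l + 1)) * v p"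

section \<open>Separated modes solve the wave equation\<close>

context
  fixes m :: real
  assumes m: "m > 0"
begin

text \<open>Minus the logarithmic derivative of the weight r^(-(l+1)) with respect to x.\<close>

private definition "kf l x = (real l + 1) * (1 - 2 * m / areal m x) / areal m x"

private lemma Cdiff_weight: "Cdiff k UNIV (\<lambda>p::real \<times> real. inverse (areal m (snd p)) ^ (l + 1))"
  by (rule Cdiff_power[OF open_UNIV Cdiff_snd_fun[OF Cdiff_inverse_compose[OF open_UNIV Cdiff_areal[OF m] areal_nz[OF m]]]])

lemma Cdiff_radial_mode:
  assumes "\<And>k. Cdiff k UNIV v" shows "Cdiff k UNIV (radial_mode m l v)"
  unfolding radial_mode_def[abs_def] by (rule Cdiff_mult[OF open_UNIV Cdiff_of_real[OF open_UNIV Cdiff_weight] assms])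

private lemma Cdiff_kf: "Cdiff k UNIV (\<lambda>p::real \<times> real. kf l (snd p))"
proof (rule Cdiff_snd_fun)
  show "Cdiff k UNIV (kf l)"
    unfolding kf_def[abs_def]
    by (rule Cdiff_divide Cdiff_mult Cdiff_diff Cdiff_const Cdiff_areal[OF m] areal_nz[OF m] open_UNIV)+
qed

lemma radial_mode_derivs:
  assumes v: "\<And>k. Cdiff k UNIV v"
  shows "Dt (radial_mode m l v) = radial_mode m l (Dt v)"
    "Dx (radial_mode m l v) = radial_mode m l (\<lambda>p. Dx v p + of_real (- kf l (snd p)) * v p)"
proof -
  have g: "((\<lambda>x. inverse (areal m x) ^ (l + 1)) has_real_derivative - kf l x * inverse (areal m x) ^ (l + 1)) (at x)" for x
  proof -
    have R: "areal m x > 0" by (rule areal_pos[OF m])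
    have i: "((\<lambda>x. inverse (areal m x)) has_real_derivative - (inverse (areal m x) * (1 - 2 * m / areal m x) * inverse (areal m x))) (at x)"
      using DERIV_inverse'[OF areal_derivative[OF m]] R by simp
    from DERIV_power[OF this, of "l + 1"] show ?thesis
      using R by (simp add: kf_def divide_inverse mult_ac add_ac)
  qed
  show "Dt (radial_mode m l v) = radial_mode m l (Dt v)"
    unfolding radial_mode_def[abs_def] Dt_Dx_mult[OF Cdiff_of_real[OF open_UNIV Cdiff_weight] v, abs_def]
      Dt_Dx_of_real[OF Cdiff_weight] Dt_Dx_snd[OF g] by simp
  show "Dx (radial_mode m l v) = radial_mode m l (\<lambda>p. Dx v p + of_real (- kf l (snd p)) * v p)"
    unfolding radial_mode_def[abs_def] Dt_Dx_mult[OF Cdiff_of_real[OF open_UNIV Cdiff_weight] v, abs_def]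
      Dt_Dx_of_real[OF Cdiff_weight] Dt_Dx_snd[OF g] by (simp add: algebra_simps)
qed

text \<open>With the weight inserted, the coefficient of v_x cancels by \<open>kF\<close>. After
  v_tt has been replaced through the one-dimensional equation, the coefficient of v is the identity
  labelled \<open>id\<close>, and it vanishes for the Regge-Wheeler potential.\<close>

theorem exterior_solution_mode:
  assumes v: "\<And>k. Cdiff k UNIV v"
    and wave: "\<And>p. Dt (Dt v) p - Dx (Dx v) p + mode_pot m l (snd p) *\<^sub>R v p = 0"
  shows "exterior_solution m (mode4 m l (radial_mode m l v))"
  unfolding exterior_solution_def
proof (intro conjI allI ballI)
  let ?W = "radial_mode m l v"
  have W: "Cdiff k UNIV ?W" for k by (rule Cdiff_radial_mode[OF v])
  show "Cdiff k (exterior m) (mode4 m l ?W)" for k by (rule Cdiff_mode4[OF m W])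
  fix p assume p: "p \<in> exterior m"
  define q where "q = null_coords m p"
  define r where "r = radius p"
  have r: "r > 2 * m" "r > 0" using p m by (simp_all add: exterior_def r_def)
  have ar: "areal m (snd q) = r" using areal_tortoise[OF m r(1)] by (simp add: q_def null_coords_def r_def)
  define g where "g = complex_of_real (inverse r ^ (l + 1))"
  define k k' where "k = kf l (snd q)" and "k' = (real l + 1) * ((1 - 2 * m / r) * (4 * m / r ^ 3 - 1 / r\<^sup>2))"
  have vt: "Cdiff j UNIV (Dt v)" and vx: "Cdiff j UNIV (Dx v)" for j
    using Cdiff_Dt[OF v] Cdiff_Dx[OF v] by blast+
  let ?v1 = "\<lambda>p. Dx v p + of_real (- kf l (snd p)) * v p"
  have Ck: "Cdiff j UNIV (\<lambda>p::real \<times> real. - kf l (snd p))" for j by (rule Cdiff_minus[OF open_UNIV Cdiff_kf])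
  have v1: "Cdiff j UNIV ?v1" for j
    by (rule Cdiff_add[OF open_UNIV vx Cdiff_mult[OF open_UNIV Cdiff_of_real[OF open_UNIV Ck] v]])
  have dk: "((\<lambda>x. - kf l x) has_real_derivative - k') (at (snd q))"
  proof -
    have "((\<lambda>x. - ((real l + 1) * (1 - 2 * m / areal m x) / areal m x)) has_real_derivative - k') (at (snd q))"
      using r by (auto intro!: derivative_eq_intros areal_derivative[OF m] simp: ar k'_def power2_eq_square power3_eq_cube)
        (simp add: field_simps)
    then show ?thesis by (simp add: kf_def[abs_def])
  qed
  have Dv1: "Dx ?v1 q = Dx (Dx v) q - of_real k * Dx v q - of_real k' * v q"
    unfolding Dt_Dx_add[OF vx Cdiff_mult[OF open_UNIV Cdiff_of_real[OF open_UNIV Ck] v]]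
      Dt_Dx_mult[OF Cdiff_of_real[OF open_UNIV Ck] v] Dt_Dx_of_real[OF Ck] Dt_Dx_snd[OF dk] by (simp add: k_def)
  have RM: "radial_mode m l f q = g * f q" for f by (simp add: radial_mode_def ar g_def)
  have W0: "?W q = g * v q" "Dx ?W q = g * (Dx v q - of_real k * v q)"
    "Dt (Dt ?W) q = g * Dt (Dt v) q"
    "Dx (Dx ?W) q = g * (Dx (Dx v) q - of_real (2 * k) * Dx v q + of_real (k\<^sup>2 - k') * v q)"
    unfolding radial_mode_derivs[OF v] radial_mode_derivs[OF vt] radial_mode_derivs[OF v1] RM Dv1 k_def[symmetric]
    by (simp_all add: algebra_simps power2_eq_square)
  define V where "V = mode_pot m l (snd q)"
  define F where "F = r / (r - 2 * m)"
  have vtt: "Dt (Dt v) q = Dx (Dx v) q - of_real V * v q"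
    using wave[of q] by (simp add: V_def scaleR_conv_of_real algebra_simps add_eq_0_iff2)
  have kF: "F * k = (real l + 1) / r"
  proof -
    have "1 - 2 * m / r = (r - 2 * m) / r" using r by (simp add: field_simps)
    then show ?thesis using r by (simp add: k_def kf_def ar F_def)
  qed
  have id: "F * (V + k\<^sup>2 - k') - 2 * (real l + 1) / r * k - 2 * m * (real l)\<^sup>2 / r ^ 3 = 0"
  proof -
    have f: "1 - 2 * m / r = (r - 2 * m) / r" using r by (simp add: field_simps)
    have nz: "r \<noteq> 0" "r - 2 * m \<noteq> 0" using r by auto
    have 1: "F * V = (real l * (real l + 1) + 2 * m / r) / r\<^sup>2"
      using nz by (simp add: F_def V_def mode_pot_def photon_pot_def ar power2_eq_square power3_eq_cube)
    have k: "k = (real l + 1) * (r - 2 * m) / r\<^sup>2" using nz by (simp add: k_def kf_def ar f power2_eq_square)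
    have 2: "F * k\<^sup>2 = (real l + 1) / r * k" unfolding power2_eq_square mult.assoc[symmetric] kF ..
    have 3: "F * k' = (real l + 1) * (4 * m / r ^ 3 - 1 / r\<^sup>2)" using nz by (simp add: F_def k'_def f)
    have "F * (V + k\<^sup>2 - k') = F * V + F * k\<^sup>2 - F * k'" by (simp add: algebra_simps)
    then show ?thesis unfolding 1 2 3 unfolding k using nz
      by (simp add: divide_simps power2_eq_square power3_eq_cube) (simp add: algebra_simps)
  qed
  have "wave_op (schwarzschild m) (mode4 m l ?W) p = plane_coord p ^ l * (of_real F * (Dx (Dx ?W) q - Dt (Dt ?W) q)
     + of_real (2 * (real l + 1) / r) * Dx ?W q - of_real (2 * m * (real l)\<^sup>2 / r ^ 3) * ?W q)"
    unfolding wave_op_mode4[OF m p W] q_def F_def r_def ..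
  also have "of_real F * (Dx (Dx ?W) q - Dt (Dt ?W) q)
     + of_real (2 * (real l + 1) / r) * Dx ?W q - of_real (2 * m * (real l)\<^sup>2 / r ^ 3) * ?W q
     = g * (of_real (2 * (real l + 1) / r - 2 * (F * k)) * Dx v q
        + of_real (F * (V + k\<^sup>2 - k') - 2 * (real l + 1) / r * k - 2 * m * (real l)\<^sup>2 / r ^ 3) * v q)"
    unfolding W0 vtt of_real_add of_real_diff of_real_mult by (simp only: of_real_numeral algebra_simps of_real_mult of_real_add of_real_diff)
  also have "\<dots> = 0" unfolding id kF by simp
  finally show "wave_op (schwarzschild m) (mode4 m l ?W) p = 0" by simp
qed

text \<open>The derivative is split into an angular term, a time term and two radial terms with the
  powers of Z displayed, so that each can be summed over l by the binomial theorem. Differentiating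
  (x + iy)^l lowers the power, hence Z^(l-1) in the angular term.\<close>

lemma pd_mode:
  assumes v: "\<And>k. Cdiff k UNIV v" and p: "p \<in> exterior m" and l: "l \<ge> 1"
  defines "q \<equiv> null_coords m p" and "r \<equiv> radius p"
  defines "Z \<equiv> plane_coord p / of_real r"
  shows "pd j (mode4 m l (radial_mode m l v)) p = of_real (1 / r) * (of_real (1 / r) * plane_coord (axis j 1) * (Z ^ (l - 1) * (of_nat l * v q))
    + of_real (dt $ j) * (Z ^ l * Dt v q) + of_real (inv_lapse m p * dr p $ j) * (Z ^ l * Dx v q)
    - of_real (dr p $ j / r) * (Z ^ l * (of_nat (l + 1) * v q)))"
proof -
  have r: "r > 2 * m" "r > 0" using p m by (simp_all add: exterior_def r_def)
  have ar: "areal m (snd q) = r" using areal_tortoise[OF m r(1)] by (simp add: q_def null_coords_def r_def)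
  have k: "inv_lapse m p * kf l (snd q) = real (l + 1) / r"
  proof -
    have "1 - 2 * m / r = (r - 2 * m) / r" using r by (simp add: field_simps)
    then show ?thesis using r by (simp add: kf_def ar inv_lapse_def r_def[symmetric])
  qed
  have k2: "inv_lapse m p * dr p $ j * kf l (snd q) = dr p $ j / r * real (l + 1)"
    using k by (metis mult.assoc mult.commute times_divide_eq_left times_divide_eq_right)
  have Q: "plane_coord p = of_real r * Z" using r by (simp add: Z_def)
  obtain n where n: "l = Suc n" using l by (cases l) auto
  have g1: "plane_coord p ^ l * of_real (inverse r ^ (l + 1)) = of_real (1 / r) * Z ^ l"
    unfolding Q power_mult_distrib using r by (simp add: field_simps power_mult_distrib)
  have g2: "plane_coord p ^ (l - 1) * of_real (inverse r ^ (l + 1)) = of_real (1 / r) * (of_real (1 / r) * Z ^ (l - 1))"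
    unfolding Q power_mult_distrib n using r by (simp add: field_simps power_mult_distrib)
  define g where "g = complex_of_real (inverse r ^ (l + 1))"
  have W: "radial_mode m l v q = g * v q" "Dt (radial_mode m l v) q = g * Dt v q"
    "Dx (radial_mode m l v) q = g * (Dx v q - of_real (kf l (snd q)) * v q)"
    unfolding radial_mode_derivs[OF v] by (simp_all add: radial_mode_def ar g_def)
  have "pd j (mode4 m l (radial_mode m l v)) p = (plane_coord p ^ (l - 1) * g) * (plane_coord (axis j 1) * of_nat l * v q)
    + (plane_coord p ^ l * g) * (of_real (dt $ j) * Dt v q + of_real (inv_lapse m p * dr p $ j) * Dx v q
      - of_real (inv_lapse m p * dr p $ j * kf l (snd q)) * v q)"
    unfolding pd_mode4[OF m p Cdiff_radial_mode[OF v]] q_def[symmetric] W by (simp add: scaleR_conv_of_real algebra_simps)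
  also have "\<dots> = (of_real (1 / r) * (of_real (1 / r) * Z ^ (l - 1))) * (plane_coord (axis j 1) * of_nat l * v q)
    + (of_real (1 / r) * Z ^ l) * (of_real (dt $ j) * Dt v q + of_real (inv_lapse m p * dr p $ j) * Dx v q
      - of_real (dr p $ j / r * real (l + 1)) * v q)"
    unfolding g_def g1 g2 k2 ..
  finally have E: "pd j (mode4 m l (radial_mode m l v)) p = (of_real (1 / r) * (of_real (1 / r) * Z ^ (l - 1))) * (plane_coord (axis j 1) * of_nat l * v q)
    + (of_real (1 / r) * Z ^ l) * (of_real (dt $ j) * Dt v q + of_real (inv_lapse m p * dr p $ j) * Dx v q
      - of_real (dr p $ j / r * real (l + 1)) * v q)" .
  show ?thesis unfolding E of_real_mult of_real_of_nat_eq by (simp only: algebra_simps)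
qed

end

text \<open>The coefficients in the expansion of ((1 + Z exp (i (S + \<alpha>)))/2)^K; the angle
  \<alpha> shifts the beam in longitude.\<close>

definition beam_coeff :: "nat \<Rightarrow> real \<Rightarrow> nat \<Rightarrow> complex" where
  "beam_coeff K \<alpha> k = of_real (real (K choose k) / 2 ^ K) * cis (real k * \<alpha>)"

lemma norm_beam_coeff: "norm (beam_coeff K \<alpha> k) = real (K choose k) / 2 ^ K"
  by (simp add: beam_coeff_def norm_mult norm_divide norm_power)

lemma sum_norm_beam_coeff: "(\<Sum>k\<le>K. norm (beam_coeff K \<alpha> k)) = 1"
  unfolding norm_beam_coeff by (simp flip: sum_divide_distrib of_nat_sum add: choose_row_sum)

lemma norm_beam_coeff_le: "norm (beam_coeff K \<alpha> k) \<le> 1"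
proof (cases "k \<le> K")
  case True
  then have "norm (beam_coeff K \<alpha> k) \<le> (\<Sum>k\<le>K. norm (beam_coeff K \<alpha> k))" by (intro member_le_sum) auto
  then show ?thesis by (simp add: sum_norm_beam_coeff)
qed (simp add: norm_beam_coeff binomial_eq_0)

text \<open>Binomial theorem: Z^l and the carrier depend on l = L + k through k-th powers, up to
  factors common to all k. The offset j is 1 in the angular term and 0 in the others.\<close>

lemma beam_sum_eq:
  fixes Z :: complex
  assumes "j \<le> L"
  shows "(\<Sum>k\<le>K. beam_coeff K \<alpha> k * (Z ^ (L + k - j) * cis ((real (L + k) + 1/2) * S)))
     = Z ^ (L - j) * cis ((real L + 1/2) * S) * ((1 + Z * cis (S + \<alpha>)) / 2) ^ K"
proof -
  have t: "beam_coeff K \<alpha> k * (Z ^ (L + k - j) * cis ((real (L + k) + 1/2) * S))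
    = Z ^ (L - j) * cis ((real L + 1/2) * S) / 2 ^ K * (of_nat (K choose k) * (Z * cis (S + \<alpha>)) ^ k * 1 ^ (K - k))" for k
  proof -
    have "L + k - j = (L - j) + k" using assms by simp
    moreover have "cis ((real (L + k) + 1/2) * S) = cis ((real L + 1/2) * S) * cis (real k * S)"
      by (simp add: cis_mult algebra_simps)
    moreover have "cis (S + \<alpha>) ^ k = cis (real k * S) * cis (real k * \<alpha>)"
      by (simp add: Complex.DeMoivre cis_mult algebra_simps)
    ultimately show ?thesis
      by (simp add: beam_coeff_def power_add power_mult_distrib)
  qed
  have "((1 + Z * cis (S + \<alpha>)) / 2) ^ K = (\<Sum>k\<le>K. of_nat (K choose k) * (Z * cis (S + \<alpha>)) ^ k * 1 ^ (K - k)) / 2 ^ K"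
    unfolding binomial_ring[symmetric] by (simp add: power_divide add.commute)
  then show ?thesis unfolding t sum_distrib_left[symmetric] by simp
qed

text \<open>The factors l, l + 1 or (l + 1/2) \<omega> produced by differentiation differ from
  \<gamma> L by at most M, with a bound that does not grow with L; replacing them gives the closed
  form of the main term. The error keeps the power |Z|^(L-1) so that its angular mass is measured by
  \<open>equatorial\<close>.\<close>

lemma beam_sum_bound:
  fixes Z :: complex and g :: "nat \<Rightarrow> complex" and A :: real
  assumes Z: "norm Z \<le> 1" and L: "L \<ge> 1" and j: "j \<le> 1" and M: "\<And>k. k \<le> K \<Longrightarrow> norm (g k - \<gamma> * of_nat L) \<le> M"
  shows "norm ((\<Sum>k\<le>K. beam_coeff K \<alpha> k * (Z ^ (L + k - j) * (g k * of_real A * cis ((real (L + k) + 1/2) * S) + h k)))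
     - \<gamma> * of_nat L * of_real A * (Z ^ (L - j) * cis ((real L + 1/2) * S) * ((1 + Z * cis (S + \<alpha>)) / 2) ^ K))
     \<le> norm Z ^ (L - 1) * (M * \<bar>A\<bar> + (\<Sum>k\<le>K. norm (h k)))"
proof -
  let ?c = "beam_coeff K \<alpha>" and ?\<kappa> = "\<lambda>k. cis ((real (L + k) + 1/2) * S)"
  have jL: "j \<le> L" using L j by simp
  have "(\<Sum>k\<le>K. ?c k * (Z ^ (L + k - j) * (g k * of_real A * ?\<kappa> k + h k)))
     - \<gamma> * of_nat L * of_real A * (Z ^ (L - j) * cis ((real L + 1/2) * S) * ((1 + Z * cis (S + \<alpha>)) / 2) ^ K)
     = (\<Sum>k\<le>K. ?c k * (Z ^ (L + k - j) * ((g k - \<gamma> * of_nat L) * of_real A * ?\<kappa> k + h k)))"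
    unfolding beam_sum_eq[OF jL, symmetric] sum_distrib_left sum_subtractf[symmetric]
    by (intro sum.cong refl) (simp add: algebra_simps)
  also have "norm \<dots> \<le> (\<Sum>k\<le>K. norm Z ^ (L - 1) * (M * \<bar>A\<bar> * norm (?c k) + norm (h k)))"
  proof (rule sum_norm_le)
    fix k assume k: "k \<in> {..K}"
    have M0: "0 \<le> M" using M[of 0] norm_ge_zero order_trans by blast
    have 1: "norm Z ^ (L + k - j) \<le> norm Z ^ (L - 1)" using Z L j by (intro power_decreasing) auto
    have 2: "norm ((g k - \<gamma> * of_nat L) * of_real A * ?\<kappa> k + h k) \<le> M * \<bar>A\<bar> + norm (h k)"
    proof (rule norm_triangle_le)
      have "norm ((g k - \<gamma> * of_nat L) * of_real A * ?\<kappa> k) \<le> M * \<bar>A\<bar>"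
        using mult_right_mono[OF M[of k], of "\<bar>A\<bar>"] k by (simp add: norm_mult)
      then show "norm ((g k - \<gamma> * of_nat L) * of_real A * ?\<kappa> k) + norm (h k) \<le> M * \<bar>A\<bar> + norm (h k)" by simp
    qed
    have "norm (?c k * (Z ^ (L + k - j) * ((g k - \<gamma> * of_nat L) * of_real A * ?\<kappa> k + h k)))
      \<le> norm (?c k) * (norm Z ^ (L - 1) * (M * \<bar>A\<bar> + norm (h k)))"
      unfolding norm_mult[of "?c k"] norm_mult[of "Z ^ (L + k - j)"] norm_power
      by (intro mult_left_mono mult_mono 1 2) auto
    also have "\<dots> = norm Z ^ (L - 1) * (M * \<bar>A\<bar> * norm (?c k) + norm (?c k) * norm (h k))" by (simp add: algebra_simps)
    also have "\<dots> \<le> norm Z ^ (L - 1) * (M * \<bar>A\<bar> * norm (?c k) + norm (h k))"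
      using mult_right_mono[OF norm_beam_coeff_le[of K \<alpha> k], of "norm (h k)"] by (intro mult_left_mono add_left_mono) auto
    finally show "norm (?c k * (Z ^ (L + k - j) * ((g k - \<gamma> * of_nat L) * of_real A * ?\<kappa> k + h k)))
      \<le> norm Z ^ (L - 1) * (M * \<bar>A\<bar> * norm (?c k) + norm (h k))" .
  qed
  also have "\<dots> = norm Z ^ (L - 1) * (M * \<bar>A\<bar> + (\<Sum>k\<le>K. norm (h k)))"
    unfolding sum_distrib_left[symmetric] sum.distrib sum_norm_beam_coeff by simp
  finally show ?thesis .
qed

section \<open>Beams along the photon sphere\<close>

lemma pd_sum:
  fixes f :: "nat \<Rightarrow> real^'n::finite \<Rightarrow> complex"
  assumes "\<And>k. f k differentiable (at p)"
  shows "pd i (\<lambda>p. \<Sum>k\<le>K. c k * f k p) p = (\<Sum>k\<le>K. c k * pd i (f k) p)"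
proof -
  have "((\<lambda>p. c k * f k p) has_derivative (\<lambda>v. c k * frechet_derivative (f k) (at p) v)) (at p)" for k
    by (rule has_derivative_mult_right[OF assms[unfolded frechet_derivative_works]])
  from pd_eq[OF has_derivative_sum[OF this]] show ?thesis by (simp add: pd_def)
qed

lemma norm_plane_coord_le:
  assumes "radius p > 0" shows "norm (plane_coord p / of_real (radius p)) \<le> 1"
proof -
  have "norm (plane_coord p) \<le> radius p"
    unfolding plane_coord_def radius_def cmod_def by (intro real_sqrt_le_mono) simp
  then show ?thesis using assms by (simp add: norm_divide)
qed

lemma dr_le_1: assumes "radius p > 0" shows "\<bar>dr p $ i\<bar> \<le> 1"
proof -
  note d = dr_norm[OF assms]
  have "(dr p $ 2)\<^sup>2 \<le> 1" "(dr p $ 3)\<^sup>2 \<le> 1" "(dr p $ 4)\<^sup>2 \<le> 1"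
    using d zero_le_power2[of "dr p $ 2"] zero_le_power2[of "dr p $ 3"] zero_le_power2[of "dr p $ 4"] by linarith+
  then have "\<forall>i. \<bar>dr p $ i\<bar> \<le> 1" unfolding forall_4 by (simp add: abs_square_le_1)
  then show ?thesis by blast
qed

context wkb
begin

definition phase :: "real \<times> real \<Rightarrow> real" where
  "phase q = - w0 * fst q + S0 (snd q)"

text \<open>In the upper bound 6 adds the coefficient 1 of the time term and 5 \<ge>
  \<open>inv_lapse\<close> of the radial one, 2/m stands for the two terms with a factor 1/r \<le>
  1/m, and the outer 1/m for the overall factor 1/r. The summand 4m serves the lower bound, where r
  \<le> 4m.\<close>

definition beam_const :: real where
  "beam_const = (6 + 2 / m) / m * (1 + w0) + 4 * m + 1"

lemma beam_const_pos: "beam_const > 0"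
  using m w0_pos by (simp add: beam_const_def add_pos_pos)

lemma on_slice_measurable [measurable]: "on_slice s \<in> borel_measurable borel"
  unfolding on_slice_def[abs_def] tortoise_def[abs_def] by (intro borel_measurable_Pair) measurable

lemma continuous_on_slice: "continuous_on {5 * m / 2..7 * m / 2} (on_slice s)"
proof -
  have "continuous_on {5 * m / 2..7 * m / 2} (tortoise m)"
    using m by (intro continuous_at_imp_continuous_on ballI DERIV_isCont[OF tortoise_derivative]) auto
  then show ?thesis unfolding on_slice_def[abs_def] by (intro continuous_intros)
qed

lemma slice_bounded:
  fixes f :: "real \<times> real \<Rightarrow> real"
  assumes "continuous_on UNIV f"
  shows "\<exists>M\<ge>0. \<forall>r\<in>{5 * m / 2..7 * m / 2}. \<bar>f (on_slice s r)\<bar> \<le> M"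
proof -
  have "continuous_on {5 * m / 2..7 * m / 2} (\<lambda>r. f (on_slice s r))"
    by (rule continuous_on_compose2[OF assms continuous_on_slice]) simp
  then have "bounded ((\<lambda>r. f (on_slice s r)) ` {5 * m / 2..7 * m / 2})"
    by (intro compact_imp_bounded compact_continuous_image compact_Icc)
  then obtain M where M: "\<forall>y\<in>(\<lambda>r. f (on_slice s r)) ` {5 * m / 2..7 * m / 2}. norm y \<le> M" unfolding bounded_iff by blast
  then have "\<forall>r\<in>{5 * m / 2..7 * m / 2}. \<bar>f (on_slice s r)\<bar> \<le> \<bar>M\<bar>" by force
  then show ?thesis by (intro exI[of _ "\<bar>M\<bar>"]) simp
qed

text \<open>Turns the potential part of the correction energy into a bound for l |e| that is uniform
  in l. In this range r^3 \<le> (4m)^3 and r - 2m \<ge> m/2.\<close>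

lemma photon_pot_ge:
  assumes "r \<in> {5 * m / 2..7 * m / 2}"
  shows "1 \<le> 128 * m\<^sup>2 * photon_pot m (tortoise m r)"
proof -
  have r: "r > 2 * m" "r > 0" "r \<le> 4 * m" using assms m by auto
  have "r ^ 3 \<le> (4 * m) ^ 3" using r by (intro power_mono) auto
  also have "\<dots> = 128 * m\<^sup>2 * (m / 2)" by (simp add: power2_eq_square power3_eq_cube)
  also have "\<dots> \<le> 128 * m\<^sup>2 * (r - 2 * m)" using assms by (intro mult_left_mono) auto
  finally show ?thesis using r by (simp add: photon_pot_def areal_tortoise[OF m r(1)] le_divide_eq)
qed

lemma beam_sum_bounds:
  fixes Z \<gamma> :: complex and g h :: "nat \<Rightarrow> complex" and A S \<alpha> \<rho> M :: real
  assumes Z: "norm Z \<le> 1" and L: "L \<ge> 1" and j: "j \<le> 1" and M: "\<And>k. k \<le> K \<Longrightarrow> norm (g k - \<gamma> * of_nat L) \<le> M"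
    and h: "M * \<bar>A\<bar> + (\<Sum>k\<le>K. norm (h k)) \<le> \<rho>"
  defines "T \<equiv> (\<Sum>k\<le>K. beam_coeff K \<alpha> k * (Z ^ (L + k - j) * (g k * of_real A * cis ((real (L + k) + 1/2) * S) + h k)))"
    and "D \<equiv> (1 + Z * cis (S + \<alpha>)) / 2"
  shows "norm T \<le> norm Z ^ (L - 1) * (norm \<gamma> * (real L * \<bar>A\<bar> * norm D ^ K) + \<rho>)"
    "norm \<gamma> * (real L * \<bar>A\<bar> * norm Z ^ (L - j) * norm D ^ K) \<le> norm T + norm Z ^ (L - 1) * \<rho>"
proof -
  define X where "X = \<gamma> * of_nat L * of_real A * (Z ^ (L - j) * cis ((real L + 1/2) * S) * D ^ K)"
  have "norm (T - X) \<le> norm Z ^ (L - 1) * (M * \<bar>A\<bar> + (\<Sum>k\<le>K. norm (h k)))"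
    unfolding T_def X_def D_def by (rule beam_sum_bound[OF Z L j M])
  also have "\<dots> \<le> norm Z ^ (L - 1) * \<rho>" by (intro mult_left_mono h) simp
  finally have TX: "norm (T - X) \<le> norm Z ^ (L - 1) * \<rho>" .
  have X: "norm X = norm \<gamma> * (real L * \<bar>A\<bar> * norm Z ^ (L - j) * norm D ^ K)"
    by (simp add: X_def norm_mult norm_power mult_ac)
  have "norm X \<le> norm T + norm (T - X)" by (metis norm_minus_commute norm_triangle_sub)
  then show "norm \<gamma> * (real L * \<bar>A\<bar> * norm Z ^ (L - j) * norm D ^ K) \<le> norm T + norm Z ^ (L - 1) * \<rho>"
    using TX unfolding X by linarith
  have "norm Z ^ (L - j) \<le> norm Z ^ (L - 1)" using Z j L by (intro power_decreasing) auto
  then have "norm X \<le> norm \<gamma> * (real L * \<bar>A\<bar> * norm Z ^ (L - 1) * norm D ^ K)"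
    unfolding X by (intro mult_left_mono mult_right_mono) auto
  moreover have "norm T \<le> norm X + norm (T - X)" by (metis norm_triangle_sub)
  ultimately have "norm T \<le> norm \<gamma> * (real L * \<bar>A\<bar> * norm Z ^ (L - 1) * norm D ^ K) + norm Z ^ (L - 1) * \<rho>" using TX by linarith
  then show "norm T \<le> norm Z ^ (L - 1) * (norm \<gamma> * (real L * \<bar>A\<bar> * norm D ^ K) + \<rho>)"
    by (simp add: algebra_simps)
qed

text \<open>CR precedes L: the remainder \<rho> is bounded in L2 along each slice uniformly in L,
  whereas the leading part of the derivatives carries a factor L. All derivatives are bounded from
  above; from below the time derivative is enough.\<close>

theorem beam_exists:
  assumes x1: "x1 > 0" and \<delta>: "0 < \<delta>" "\<delta> \<le> min (z x1) (- z (- x1))"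
  shows "\<exists>CR. \<forall>L\<ge>1. \<exists>u \<rho>. exterior_solution m u \<and>
    (\<forall>p\<in>exterior m. \<bar>tortoise m (radius p)\<bar> \<ge> 2 * x1 + \<bar>fst (null_coords m p)\<bar> \<longrightarrow> u p = 0) \<and>
    (\<forall>p\<in>exterior m. radius p \<in> {5 * m / 2..7 * m / 2} \<longrightarrow>
       (\<forall>q Z D. q = null_coords m p \<longrightarrow> Z = plane_coord p / of_real (radius p) \<longrightarrow> D = (1 + Z * cis (phase q + \<alpha>)) / 2 \<longrightarrow>
         (\<forall>i. norm (pd i u p) \<le> beam_const * (norm Z ^ (L - 1) * (real L * \<bar>amp \<delta> q\<bar> * norm D ^ K + \<rho> q))) \<and>
         w0 * (real L * \<bar>amp \<delta> q\<bar> * norm Z ^ L * norm D ^ K) \<le> beam_const * (norm (pd 1 u p) + norm Z ^ (L - 1) * \<rho> q))) \<and>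
    continuous_on UNIV \<rho> \<and> (\<forall>q. \<rho> q \<ge> 0) \<and>
    (\<forall>s. (\<integral>\<^sup>+r. ennreal ((\<rho> (on_slice s r))\<^sup>2) * indicator {5 * m / 2..7 * m / 2} r \<partial>lborel) \<le> ennreal (CR s))"
proof -
  define \<Phi> where "\<Phi> l v e P Q C \<longleftrightarrow> (\<forall>k. Cdiff k UNIV v) \<and>
    (\<forall>p. Dt (Dt v) p - Dx (Dx v) p + mode_pot m l (snd p) *\<^sub>R v p = 0) \<and>
    (\<forall>p. v p = wkb_mode \<delta> l p + e p) \<and>
    (\<forall>p. Dt v p = Dt (wkb_mode \<delta> l) p + (1/2) *\<^sub>R (P p + Q p)) \<and>
    (\<forall>p. Dx v p = Dx (wkb_mode \<delta> l) p + (1/2) *\<^sub>R (P p - Q p)) \<and>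
    (\<forall>t x. \<bar>x\<bar> \<ge> 2 * x1 + \<bar>t\<bar> \<longrightarrow> v (t, x) = 0) \<and>
    continuous_on UNIV e \<and> continuous_on UNIV P \<and> continuous_on UNIV Q \<and>
    (\<forall>s. (\<integral>\<^sup>+r. ennreal ((norm (P (on_slice s r)))\<^sup>2 + (norm (Q (on_slice s r)))\<^sup>2
        + mode_pot m l (tortoise m r) * (norm (e (on_slice s r)))\<^sup>2) * indicator {5 * m / 2..7 * m / 2} r \<partial>lborel) \<le> ennreal (C s))"
    for l v e P Q and C :: "real \<Rightarrow> real"
  obtain C where C: "\<And>l. \<exists>v e P Q. \<Phi> l v e P Q C"
    using mode_exists[OF x1 \<delta>] unfolding \<Phi>_def by blast
  \<comment> \<open>The errors known pointwise: replacing L + k by L costs a multiple of the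
    amplitude of order K, and the derivatives that fall on the amplitude carry no factor l.\<close>
  define a where "a q = (1 + w0) * (real K + 1) * (\<bar>amp \<delta> q\<bar> + \<bar>Dt (amp \<delta>) q\<bar> + \<bar>Dx (amp \<delta>) q\<bar>)" for q
  have ac: "continuous_on UNIV a"
    unfolding a_def[abs_def]
    by (intro continuous_intros Cdiff_imp_continuous_on[OF Cdiff_amp[of 0]] Cdiff_imp_continuous_on[OF Cdiff_Dt[OF Cdiff_amp[of "Suc 0"]]]
        Cdiff_imp_continuous_on[OF Cdiff_Dx[OF Cdiff_amp[of "Suc 0"]]])
  have a0: "a q \<ge> 0" for q unfolding a_def using w0_pos by (intro mult_nonneg_nonneg) auto
  have "\<forall>s. \<exists>M\<ge>0. \<forall>r\<in>{5 * m / 2..7 * m / 2}. \<bar>a (on_slice s r)\<bar> \<le> M" using slice_bounded[OF ac] by blast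
  then obtain Ma where Ma: "\<And>s. Ma s \<ge> 0" "\<And>s r. r \<in> {5 * m / 2..7 * m / 2} \<Longrightarrow> \<bar>a (on_slice s r)\<bar> \<le> Ma s" by metis
  define c where "c = 2 * (real K + 1) * (3 + 1536 * m\<^sup>2)"
  have c0: "c \<ge> 0" by (simp add: c_def)
  show ?thesis
  proof (rule exI[of _ "\<lambda>s. 2 * (Ma s)\<^sup>2 * m + (real K + 1) * (c * \<bar>C s\<bar>)"], intro allI impI)
    fix L :: nat assume L: "L \<ge> 1"
    have "\<forall>k. \<exists>v e P Q. \<Phi> (L + k) v e P Q C" using C by blast
    then obtain v e P Q where ph: "\<And>k. \<Phi> (L + k) (v k) (e k) (P k) (Q k) C" by metis
    note ph' = ph[unfolded \<Phi>_def]
    have v: "Cdiff j UNIV (v k)" for j k using ph'[of k] by blast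
    have vw: "Dt (Dt (v k)) p - Dx (Dx (v k)) p + mode_pot m (L + k) (snd p) *\<^sub>R v k p = 0" for k p using ph'[of k] by blast
    have v1: "v k p = wkb_mode \<delta> (L + k) p + e k p" "Dt (v k) p = Dt (wkb_mode \<delta> (L + k)) p + (1/2) *\<^sub>R (P k p + Q k p)"
      "Dx (v k) p = Dx (wkb_mode \<delta> (L + k)) p + (1/2) *\<^sub>R (P k p - Q k p)" for k p using ph'[of k] by blast+
    have vz: "v k (t, x) = 0" if "\<bar>x\<bar> \<ge> 2 * x1 + \<bar>t\<bar>" for k t x using ph'[of k] that by blast
    have cont: "continuous_on UNIV (e k)" "continuous_on UNIV (P k)" "continuous_on UNIV (Q k)" for k using ph'[of k] by blast+
    have int: "(\<integral>\<^sup>+r. ennreal ((norm (P k (on_slice s r)))\<^sup>2 + (norm (Q k (on_slice s r)))\<^sup>2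
        + mode_pot m (L + k) (tortoise m r) * (norm (e k (on_slice s r)))\<^sup>2) * indicator {5 * m / 2..7 * m / 2} r \<partial>lborel) \<le> ennreal (C s)" for k s
      using ph'[of k] by blast
    let ?u = "\<lambda>k. mode4 m (L + k) (radial_mode m (L + k) (v k))" and ?c = "beam_coeff K \<alpha>"
    define u where "u p = (\<Sum>k\<le>K. ?c k * ?u k p)" for p
    \<comment> \<open>The factor 2 (L + k) also covers l + 1 = L + k + 1, which comes from the
      weight r^(-(l+1)), because L \<ge> 1.\<close>
    define y where "y k q = norm (P k q) + norm (Q k q) + 2 * real (L + k) * norm (e k q)" for k q
    define \<rho> where "\<rho> q = a q + (\<Sum>k\<le>K. y k q)" for q
    have y0: "y k q \<ge> 0" for k q by (simp add: y_def)
    have sol: "exterior_solution m (?u k)" for k by (rule exterior_solution_mode[OF m v vw])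
    have ud: "?u k differentiable (at p)" if "p \<in> exterior m" for k p
      using sol[of k] by (intro Cdiff_differentiable[OF _ that]) (simp add: exterior_solution_def del: differentiable_times_on.simps)
    have A1: "exterior_solution m u" unfolding u_def[abs_def] by (rule exterior_solution_sum[OF m sol])
    have A2: "u p = 0" if "\<bar>tortoise m (radius p)\<bar> \<ge> 2 * x1 + \<bar>fst (null_coords m p)\<bar>" for p
    proof -
      have "v k (null_coords m p) = 0" for k using vz that by (simp add: null_coords_def)
      then show ?thesis by (simp add: u_def mode4_def[OF m] radial_mode_def)
    qed
    have A3: "(\<forall>i. norm (pd i u p) \<le> beam_const * (norm Z ^ (L - 1) * (real L * \<bar>amp \<delta> q\<bar> * norm D ^ K + \<rho> q))) \<and>
         w0 * (real L * \<bar>amp \<delta> q\<bar> * norm Z ^ L * norm D ^ K) \<le> beam_const * (norm (pd 1 u p) + norm Z ^ (L - 1) * \<rho> q)"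
      if p: "p \<in> exterior m" and rI: "radius p \<in> {5 * m / 2..7 * m / 2}" and q: "q = null_coords m p"
        and Zd: "Z = plane_coord p / of_real (radius p)" and D: "D = (1 + Z * cis (phase q + \<alpha>)) / 2" for p q Z D
    proof -
      define r where "r = radius p"
      have r: "r > 0" "r \<ge> m" "r \<le> 4 * m" "r - 2 * m \<ge> m / 2" using rI m by (auto simp: r_def)
      have Z: "norm Z \<le> 1" unfolding Zd by (rule norm_plane_coord_le) (use r in \<open>simp add: r_def\<close>)
      define A where "A = amp \<delta> q"
      define S where "S = phase q"
      define zz where "zz = norm Z ^ (L - 1)"
      define Y where "Y = real L * \<bar>A\<bar> * norm D ^ K"
      have zz0: "zz \<ge> 0" and Y0: "Y \<ge> 0" by (simp_all add: zz_def Y_def)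
      have rho0: "\<rho> q \<ge> 0" unfolding \<rho>_def using a0 y0 by (intro add_nonneg_nonneg sum_nonneg) auto
      have kap: "carrier_wave (L + k) q = cis ((real (L + k) + 1/2) * S)" for k
        by (simp add: carrier_wave_def S_def phase_def)
      \<comment> \<open>One absorption step for the four sums \<open>T1\<close> to
        \<open>T4\<close>: M is the frequency mismatch, b a derivative of the amplitude, and
        \<open>y k\<close> the contribution of the correction.\<close>
      have H: "M * \<bar>A\<bar> + (\<Sum>k\<le>K. norm (h k)) \<le> \<rho> q"
        if M: "M \<le> (1 + w0) * (real K + 1)" and h: "\<And>k. norm (h k) \<le> b + y k q" and b: "0 \<le> b" "b \<le> \<bar>Dt (amp \<delta>) q\<bar> + \<bar>Dx (amp \<delta>) q\<bar>"
        for M b and h :: "nat \<Rightarrow> complex"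
      proof -
        have "(\<Sum>k\<le>K. norm (h k)) \<le> (\<Sum>k\<le>K. b + y k q)" by (intro sum_mono h)
        also have "\<dots> = (real K + 1) * b + (\<Sum>k\<le>K. y k q)" by (simp add: sum.distrib algebra_simps)
        finally have 1: "(\<Sum>k\<le>K. norm (h k)) \<le> (real K + 1) * b + (\<Sum>k\<le>K. y k q)" .
        have "(real K + 1) * b \<le> ((1 + w0) * (real K + 1)) * (\<bar>Dt (amp \<delta>) q\<bar> + \<bar>Dx (amp \<delta>) q\<bar>)"
          using b w0_pos by (intro mult_mono) (auto simp: algebra_simps)
        moreover have "M * \<bar>A\<bar> \<le> ((1 + w0) * (real K + 1)) * \<bar>amp \<delta> q\<bar>" unfolding A_def by (intro mult_right_mono M) simp
        moreover have "a q = ((1 + w0) * (real K + 1)) * \<bar>amp \<delta> q\<bar> + ((1 + w0) * (real K + 1)) * (\<bar>Dt (amp \<delta>) q\<bar> + \<bar>Dx (amp \<delta>) q\<bar>)"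
          by (simp add: a_def algebra_simps)
        ultimately show ?thesis using 1 unfolding \<rho>_def by linarith
      qed
      define T1 where "T1 = (\<Sum>k\<le>K. ?c k * (Z ^ (L + k - 1) * (of_nat (L + k) * v k q)))"
      define T2 where "T2 = (\<Sum>k\<le>K. ?c k * (Z ^ (L + k) * Dt (v k) q))"
      define T3 where "T3 = (\<Sum>k\<le>K. ?c k * (Z ^ (L + k) * Dx (v k) q))"
      define T4 where "T4 = (\<Sum>k\<le>K. ?c k * (Z ^ (L + k) * (of_nat (L + k + 1) * v k q)))"
      have pdu: "pd i u p = of_real (1 / r) * (of_real (1 / r) * plane_coord (axis i 1) * T1
          + of_real (dt $ i) * T2 + of_real (inv_lapse m p * dr p $ i) * T3 - of_real (dr p $ i / r) * T4)" for i
      proof -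
        have "pd i u p = (\<Sum>k\<le>K. ?c k * pd i (?u k) p)" unfolding u_def[abs_def] by (rule pd_sum[OF ud[OF p]])
        also have "\<dots> = (\<Sum>k\<le>K. of_real (1 / r) * (of_real (1 / r) * plane_coord (axis i 1) * (?c k * (Z ^ (L + k - 1) * (of_nat (L + k) * v k q)))
            + of_real (dt $ i) * (?c k * (Z ^ (L + k) * Dt (v k) q)) + of_real (inv_lapse m p * dr p $ i) * (?c k * (Z ^ (L + k) * Dx (v k) q))
            - of_real (dr p $ i / r) * (?c k * (Z ^ (L + k) * (of_nat (L + k + 1) * v k q)))))"
        proof (rule sum.cong[OF refl])
          fix k
          have l: "1 \<le> L + k" using L by simp
          show "?c k * pd i (?u k) p = of_real (1 / r) * (of_real (1 / r) * plane_coord (axis i 1) * (?c k * (Z ^ (L + k - 1) * (of_nat (L + k) * v k q)))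
            + of_real (dt $ i) * (?c k * (Z ^ (L + k) * Dt (v k) q)) + of_real (inv_lapse m p * dr p $ i) * (?c k * (Z ^ (L + k) * Dx (v k) q))
            - of_real (dr p $ i / r) * (?c k * (Z ^ (L + k) * (of_nat (L + k + 1) * v k q))))"
            unfolding pd_mode[OF m v p l] q[symmetric] Zd r_def[symmetric] by (simp only: algebra_simps)
        qed
        also have "\<dots> = of_real (1 / r) * (of_real (1 / r) * plane_coord (axis i 1) * T1
          + of_real (dt $ i) * T2 + of_real (inv_lapse m p * dr p $ i) * T3 - of_real (dr p $ i / r) * T4)"
          unfolding T1_def T2_def T3_def T4_def sum_distrib_left sum.distrib[symmetric] sum_subtractf[symmetric] ..
        finally show ?thesis .
      qed
      have nw: "norm (of_real w * (\<i> * c)) = \<bar>w\<bar> * norm c" for w c by (simp add: norm_mult)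
      have B1: "norm T1 \<le> zz * (norm (1::complex) * Y + \<rho> q)"
      proof -
        have T: "T1 = (\<Sum>k\<le>K. ?c k * (Z ^ (L + k - 1) * (of_nat (L + k) * of_real A * cis ((real (L + k) + 1/2) * S) + of_nat (L + k) * e k q)))"
          unfolding T1_def v1 wkb_mode_def kap A_def by (simp only: distrib_left mult.assoc)
        show ?thesis unfolding T zz_def Y_def D S_def[symmetric]
        proof (rule beam_sum_bounds(1)[OF Z L])
          show "norm (of_nat (L + k) - 1 * of_nat L :: complex) \<le> real K" if "k \<le> K" for k using that by simp
          show "real K * \<bar>A\<bar> + (\<Sum>k\<le>K. norm (of_nat (L + k) * e k q)) \<le> \<rho> q"
          proof (rule H)
            have "real K + 1 \<le> (1 + w0) * (real K + 1)" using w0_pos by (simp add: algebra_simps)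
            then show "real K \<le> (1 + w0) * (real K + 1)" by (rule order_trans[rotated]) simp
            have "real (L + k) * norm (e k q) \<le> 2 * real (L + k) * norm (e k q)" for k by (intro mult_right_mono) auto
            then show "norm (of_nat (L + k) * e k q) \<le> 0 + y k q" for k
              unfolding y_def norm_mult norm_of_nat by (meson add_increasing norm_ge_zero order_refl order_trans add_nonneg_nonneg)
          qed auto
        qed simp
      qed
      have B4: "norm T4 \<le> zz * (norm (1::complex) * Y + \<rho> q)"
      proof -
        have T: "T4 = (\<Sum>k\<le>K. ?c k * (Z ^ (L + k - 0) * (of_nat (L + k + 1) * of_real A * cis ((real (L + k) + 1/2) * S) + of_nat (L + k + 1) * e k q)))"
          unfolding T4_def v1 wkb_mode_def kap A_def diff_zero by (simp only: distrib_left mult.assoc)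
        show ?thesis unfolding T zz_def Y_def D S_def[symmetric]
        proof (rule beam_sum_bounds(1)[OF Z L])
          show "norm (of_nat (L + k + 1) - 1 * of_nat L :: complex) \<le> real K + 1" if "k \<le> K" for k
          proof -
            have "(of_nat (L + k + 1) - 1 * of_nat L :: complex) = of_nat (k + 1)" by simp
            then show ?thesis using that by (simp only: norm_of_nat)
          qed
          show "(real K + 1) * \<bar>A\<bar> + (\<Sum>k\<le>K. norm (of_nat (L + k + 1) * e k q)) \<le> \<rho> q"
          proof (rule H)
            show "real K + 1 \<le> (1 + w0) * (real K + 1)" using w0_pos by (simp add: algebra_simps)
            have "real (L + k + 1) * norm (e k q) \<le> 2 * real (L + k) * norm (e k q)" for k using L by (intro mult_right_mono) auto
            then show "norm (of_nat (L + k + 1) * e k q) \<le> 0 + y k q" for k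
              unfolding y_def norm_mult norm_of_nat by (meson add_increasing norm_ge_zero order_refl order_trans add_nonneg_nonneg)
          qed auto
        qed simp
      qed
      have hb: "norm (of_real b * cis x + (1/2) *\<^sub>R (P k q + Q k q)) \<le> \<bar>b\<bar> + y k q"
        "norm (of_real b * cis x + (1/2) *\<^sub>R (P k q - Q k q)) \<le> \<bar>b\<bar> + y k q" for b x k
      proof -
        have e0: "0 \<le> 2 * real (L + k) * norm (e k q)" by simp
        have "norm (of_real b * cis x :: complex) = \<bar>b\<bar>" by (simp add: norm_mult)
        moreover have "norm ((1/2) *\<^sub>R (P k q + Q k q)) \<le> norm (P k q) + norm (Q k q)"
          using norm_triangle_ineq[of "P k q" "Q k q"] norm_ge_zero[of "P k q + Q k q"] by (simp only: norm_scaleR; simp)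
        moreover have "norm ((1/2) *\<^sub>R (P k q - Q k q)) \<le> norm (P k q) + norm (Q k q)"
          using norm_triangle_ineq4[of "P k q" "Q k q"] norm_ge_zero[of "P k q - Q k q"] by (simp only: norm_scaleR; simp)
        ultimately show "norm (of_real b * cis x + (1/2) *\<^sub>R (P k q + Q k q)) \<le> \<bar>b\<bar> + y k q"
          "norm (of_real b * cis x + (1/2) *\<^sub>R (P k q - Q k q)) \<le> \<bar>b\<bar> + y k q"
          using e0 norm_triangle_ineq[of "of_real b * cis x" "(1/2) *\<^sub>R (P k q + Q k q)"]
            norm_triangle_ineq[of "of_real b * cis x" "(1/2) *\<^sub>R (P k q - Q k q)"] unfolding y_def by linarith+
      qed
      have gk: "norm (- \<i> * of_real ((real (L + k) + 1/2) * w) - (- \<i> * of_real w) * of_nat L) \<le> w0 * (real K + 1)"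
        if "k \<le> K" "\<bar>w\<bar> \<le> w0" for k w
      proof -
        have "- \<i> * of_real ((real (L + k) + 1/2) * w) - (- \<i> * of_real w) * of_nat L = - \<i> * of_real (w * (real k + 1/2))"
          by (simp add: algebra_simps)
        then have "norm (- \<i> * of_real ((real (L + k) + 1/2) * w) - (- \<i> * of_real w) * of_nat L) = \<bar>w\<bar> * (real k + 1/2)"
          by (simp only: norm_mult norm_minus_cancel norm_ii norm_of_real; simp add: abs_mult)
        also have "\<dots> \<le> w0 * (real K + 1)" using that by (intro mult_mono) auto
        finally show ?thesis .
      qed
      have M2: "w0 * (real K + 1) \<le> (1 + w0) * (real K + 1)" by (simp add: algebra_simps)
      have T2: "T2 = (\<Sum>k\<le>K. ?c k * (Z ^ (L + k - 0) * ((- \<i> * of_real ((real (L + k) + 1/2) * w0)) * of_real A * cis ((real (L + k) + 1/2) * S)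
          + (of_real (Dt (amp \<delta>) q) * cis ((real (L + k) + 1/2) * S) + (1/2) *\<^sub>R (P k q + Q k q)))))"
        unfolding T2_def v1 wkb_mode_derivs kap A_def diff_zero by (intro sum.cong refl) (simp add: algebra_simps)
      have T3: "T3 = (\<Sum>k\<le>K. ?c k * (Z ^ (L + k - 0) * ((- \<i> * of_real ((real (L + k) + 1/2) * (w0 * ray_speed m (snd q)))) * of_real A * cis ((real (L + k) + 1/2) * S)
          + (of_real (Dx (amp \<delta>) q) * cis ((real (L + k) + 1/2) * S) + (1/2) *\<^sub>R (P k q - Q k q)))))"
        unfolding T3_def v1 wkb_mode_derivs kap A_def diff_zero by (intro sum.cong refl) (simp add: algebra_simps)
      have ray: "\<bar>w0 * ray_speed m (snd q)\<bar> \<le> w0"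
        using ray_speed_less_1[OF m, of "snd q"] w0_pos by (simp add: abs_mult)
      have H2: "w0 * (real K + 1) * \<bar>A\<bar> + (\<Sum>k\<le>K. norm (of_real (Dt (amp \<delta>) q) * cis ((real (L + k) + 1/2) * S) + (1/2) *\<^sub>R (P k q + Q k q))) \<le> \<rho> q"
        by (rule H[OF M2 hb(1)]) auto
      have H3: "w0 * (real K + 1) * \<bar>A\<bar> + (\<Sum>k\<le>K. norm (of_real (Dx (amp \<delta>) q) * cis ((real (L + k) + 1/2) * S) + (1/2) *\<^sub>R (P k q - Q k q))) \<le> \<rho> q"
        by (rule H[OF M2 hb(2)]) auto
      have w0a: "\<bar>w0\<bar> \<le> w0" using w0_pos by simp
      have B2: "norm T2 \<le> zz * (norm (- \<i> * of_real w0) * Y + \<rho> q)"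
        unfolding T2 zz_def Y_def D S_def[symmetric]
        by (rule beam_sum_bounds(1)[OF Z L _ gk[OF _ w0a] H2]) simp
      have B2': "norm (- \<i> * of_real w0) * (real L * \<bar>A\<bar> * norm Z ^ (L - 0) * norm D ^ K) \<le> norm T2 + zz * \<rho> q"
        unfolding T2 zz_def D S_def[symmetric]
        by (rule beam_sum_bounds(2)[OF Z L _ gk[OF _ w0a] H2]) simp
      have B3: "norm T3 \<le> zz * (norm (- \<i> * of_real (w0 * ray_speed m (snd q))) * Y + \<rho> q)"
        unfolding T3 zz_def Y_def D S_def[symmetric]
        by (rule beam_sum_bounds(1)[OF Z L _ gk[OF _ ray] H3]) simp
      define E where "E = zz * ((1 + w0) * (Y + \<rho> q))"
      have up: "zz * (x * Y + \<rho> q) \<le> E" if "x \<le> 1 + w0" for x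
      proof -
        have "x * Y \<le> (1 + w0) * Y" by (intro mult_right_mono that Y0)
        moreover have "\<rho> q \<le> (1 + w0) * \<rho> q" using rho0 w0_pos by (simp add: algebra_simps)
        ultimately show ?thesis unfolding E_def distrib_left[of "1 + w0"] by (intro mult_left_mono zz0) linarith
      qed
      have T: "norm T1 \<le> E" "norm T2 \<le> E" "norm T3 \<le> E" "norm T4 \<le> E"
        using order_trans[OF B1 up] order_trans[OF B2 up] order_trans[OF B3 up] order_trans[OF B4 up] w0_pos ray
        by (simp_all add: norm_mult)
      have E0: "E \<ge> 0" using T(1) norm_ge_zero order_trans by blast
      have upper: "norm (pd i u p) \<le> beam_const * (zz * (Y + \<rho> q))" for i
      proof -
        have n1: "\<bar>dr p $ i\<bar> \<le> 1" by (rule dr_le_1) (use r in \<open>simp add: r_def\<close>)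
        have n2: "\<bar>dt $ i\<bar> \<le> 1" by (simp add: dt_def axis_def)
        have n3: "norm (plane_coord (axis i 1)) \<le> 1"
        proof -
          have "\<forall>i. norm (plane_coord (axis i 1)) \<le> 1" unfolding forall_4 by (simp add: plane_coord_axis)
          then show ?thesis by blast
        qed
        have n4: "\<bar>inv_lapse m p\<bar> \<le> 5"
        proof -
          have "r \<le> 5 * (r - 2 * m)" using rI m by (simp add: r_def)
          then show ?thesis using r m unfolding inv_lapse_def r_def[symmetric] by (simp add: divide_le_eq)
        qed
        have n5: "1 / r \<le> 1 / m" "0 \<le> 1 / r" using r m by (auto intro: divide_left_mono)
        have "norm (of_real (1 / r) * plane_coord (axis i 1) * T1) \<le> (1 / m) * 1 * E"
          unfolding norm_mult norm_of_real using n5 n3 T E0 m by (intro mult_mono) auto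
        moreover have "norm (of_real (dt $ i) * T2) \<le> 1 * E"
          unfolding norm_mult norm_of_real using n2 T by (intro mult_mono) auto
        moreover have "norm (of_real (inv_lapse m p * dr p $ i) * T3) \<le> (5 * 1) * E"
          unfolding norm_mult norm_of_real abs_mult using n1 n4 T by (intro mult_mono) auto
        moreover have "norm (of_real (dr p $ i / r) * T4) \<le> (1 * (1 / m)) * E"
        proof -
          have eqn: "\<bar>dr p $ i / r\<bar> = \<bar>dr p $ i\<bar> * (1 / r)" using r by (simp add: abs_divide)
          show ?thesis unfolding norm_mult norm_of_real eqn using n1 n5 T m by (intro mult_mono) auto
        qed
        ultimately have "norm (of_real (1 / r) * plane_coord (axis i 1) * T1
          + of_real (dt $ i) * T2 + of_real (inv_lapse m p * dr p $ i) * T3 - of_real (dr p $ i / r) * T4) \<le> (6 + 2 / m) * E"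
          (is "norm (?a + ?b + ?c - ?d) \<le> _")
        proof -
          assume b: "norm ?a \<le> (1 / m) * 1 * E" "norm ?b \<le> 1 * E" "norm ?c \<le> (5 * 1) * E" "norm ?d \<le> (1 * (1 / m)) * E"
          have "norm (?a + ?b + ?c - ?d) \<le> norm ?a + norm ?b + norm ?c + norm ?d"
            using norm_triangle_ineq4[of "?a + ?b + ?c" ?d] norm_triangle_ineq[of "?a + ?b" ?c] norm_triangle_ineq[of ?a ?b] by linarith
          also have "\<dots> \<le> (1 / m) * 1 * E + 1 * E + (5 * 1) * E + (1 * (1 / m)) * E" using b by (intro add_mono)
          also have "\<dots> = (6 + 2 / m) * E" by (simp add: algebra_simps)
          finally show ?thesis .
        qed
        then have "norm (pd i u p) \<le> (1 / m) * ((6 + 2 / m) * E)"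
          unfolding pdu norm_mult norm_of_real using n5 m by (intro mult_mono) auto
        also have "\<dots> = ((6 + 2 / m) / m * (1 + w0)) * (zz * (Y + \<rho> q))" by (simp add: E_def)
        also have "\<dots> \<le> beam_const * (zz * (Y + \<rho> q))"
          unfolding beam_const_def using m zz0 Y0 rho0 by (intro mult_right_mono mult_nonneg_nonneg) auto
        finally show ?thesis .
      qed
      \<comment> \<open>In the direction of t the angular and radial terms drop out, so
        \<open>pd 1 u\<close> is T2/r and the main term of T2 stands alone.\<close>
      have lower: "w0 * (real L * \<bar>A\<bar> * norm Z ^ L * norm D ^ K) \<le> beam_const * (norm (pd 1 u p) + zz * \<rho> q)"
      proof -
        have "pd 1 u p = of_real (1 / r) * T2" unfolding pdu by (simp add: plane_coord_axis)
        then have "norm T2 = r * norm (pd 1 u p)" using r by (simp add: norm_mult norm_divide)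
        also have "\<dots> \<le> 4 * m * norm (pd 1 u p)" using r by (intro mult_right_mono) auto
        finally have t: "norm T2 \<le> 4 * m * norm (pd 1 u p)" .
        have c: "4 * m \<le> beam_const" "1 \<le> beam_const" using m w0_pos by (simp_all add: beam_const_def)
        have "w0 * (real L * \<bar>A\<bar> * norm Z ^ L * norm D ^ K) \<le> norm T2 + zz * \<rho> q"
          using B2' w0_pos by (simp add: norm_mult)
        also have "\<dots> \<le> beam_const * norm (pd 1 u p) + beam_const * (zz * \<rho> q)"
          using mult_right_mono[OF c(1), of "norm (pd 1 u p)"] mult_right_mono[OF c(2), of "zz * \<rho> q"] t zz0 rho0 by simp
        finally show ?thesis by (simp add: distrib_left)
      qed
      show ?thesis using upper lower unfolding zz_def Y_def A_def by blast
    qed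
    have A4: "continuous_on UNIV \<rho>"
      unfolding \<rho>_def[abs_def] y_def by (intro continuous_intros ac cont)
    have A5: "\<rho> q \<ge> 0" for q unfolding \<rho>_def using a0 y0 by (intro add_nonneg_nonneg sum_nonneg) auto
    have A6: "(\<integral>\<^sup>+r. ennreal ((\<rho> (on_slice s r))\<^sup>2) * indicator {5 * m / 2..7 * m / 2} r \<partial>lborel)
        \<le> ennreal (2 * (Ma s)\<^sup>2 * m + (real K + 1) * (c * \<bar>C s\<bar>))" for s
    proof -
      let ?I = "{5 * m / 2..7 * m / 2}"
      define f where "f k r = (norm (P k (on_slice s r)))\<^sup>2 + (norm (Q k (on_slice s r)))\<^sup>2
        + mode_pot m (L + k) (tortoise m r) * (norm (e k (on_slice s r)))\<^sup>2" for k r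
      have f0: "f k r \<ge> 0" for k r unfolding f_def using mode_pot_bounds(1) by simp
      have fm [measurable]: "f k \<in> borel_measurable borel" for k
      proof -
        have t: "tortoise m \<in> borel_measurable borel" unfolding tortoise_def[abs_def] by measurable
        note b = borel_measurable_continuous_onI
        have "(\<lambda>r. mode_pot m (L + k) (tortoise m r)) \<in> borel_measurable borel"
          by (rule measurable_compose[OF t b[OF Cdiff_imp_continuous_on[OF Cdiff_mode_pot[of 0]]]])
        moreover have "(\<lambda>r. e k (on_slice s r)) \<in> borel_measurable borel" "(\<lambda>r. P k (on_slice s r)) \<in> borel_measurable borel"
          "(\<lambda>r. Q k (on_slice s r)) \<in> borel_measurable borel"
          by (rule measurable_compose[OF on_slice_measurable b[OF cont(1)]], rule measurable_compose[OF on_slice_measurable b[OF cont(2)]],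
              rule measurable_compose[OF on_slice_measurable b[OF cont(3)]])
        ultimately show ?thesis unfolding f_def[abs_def] by measurable
      qed
      have pt: "(\<rho> (on_slice s r))\<^sup>2 \<le> 2 * (Ma s)\<^sup>2 + (\<Sum>k\<le>K. c * f k r)" if r: "r \<in> ?I" for r
      proof -
        define q where "q = on_slice s r"
        have sq: "(\<alpha> + \<beta>)\<^sup>2 \<le> 2 * \<alpha>\<^sup>2 + 2 * \<beta>\<^sup>2" for \<alpha> \<beta> :: real
          using zero_le_power2[of "\<alpha> - \<beta>"] by (simp add: power2_eq_square algebra_simps)
        have 1: "(a q)\<^sup>2 \<le> (Ma s)\<^sup>2" using Ma(2)[OF r, of s] a0[of q] by (intro power_mono) (auto simp: q_def)
        have 2: "(\<Sum>k\<le>K. y k q)\<^sup>2 \<le> (\<Sum>k\<le>K. (y k q)\<^sup>2) * real (card {..K})" by (rule sum_squared_le_sum_of_squares)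
        \<comment> \<open>1536 is 3 times 4 times 128: three squared summands, the square of the 2
          in front of l, and the 128 m^2 of \<open>photon_pot_ge\<close>.\<close>
        have 3: "(y k q)\<^sup>2 \<le> (3 + 1536 * m\<^sup>2) * f k r" for k
        proof -
          have s3: "(\<alpha> + \<beta> + \<gamma>)\<^sup>2 \<le> 3 * \<alpha>\<^sup>2 + 3 * \<beta>\<^sup>2 + 3 * \<gamma>\<^sup>2" for \<alpha> \<beta> \<gamma> :: real
            using zero_le_power2[of "\<alpha> - \<beta>"] zero_le_power2[of "\<alpha> - \<gamma>"] zero_le_power2[of "\<beta> - \<gamma>"]
            by (simp add: power2_eq_square algebra_simps)
          define V where "V = mode_pot m (L + k) (tortoise m r)"
          define x where "x = (norm (P k q))\<^sup>2" define x' where "x' = (norm (Q k q))\<^sup>2" define x'' where "x'' = (norm (e k q))\<^sup>2"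
          have x: "x \<ge> 0" "x' \<ge> 0" "x'' \<ge> 0" by (simp_all add: x_def x'_def x''_def)
          have "(real (L + k))\<^sup>2 * 1 \<le> (real (L + k))\<^sup>2 * (128 * m\<^sup>2 * photon_pot m (tortoise m r))"
            by (intro mult_left_mono photon_pot_ge r) simp
          also have "\<dots> = 128 * m\<^sup>2 * (real (L + k) * real (L + k) * photon_pot m (tortoise m r))" by (simp add: power2_eq_square)
          also have "\<dots> \<le> 128 * m\<^sup>2 * V" unfolding V_def by (intro mult_left_mono mode_pot_bounds(3)) simp
          finally have "(real (L + k))\<^sup>2 * x'' \<le> 128 * m\<^sup>2 * V * x''" using x by (intro mult_right_mono) simp_all
          moreover have "(y k q)\<^sup>2 \<le> 3 * x + 3 * x' + 3 * (4 * ((real (L + k))\<^sup>2 * x''))"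
          proof -
            have "(2 * real (L + k) * norm (e k q))\<^sup>2 = 4 * ((real (L + k))\<^sup>2 * (norm (e k q))\<^sup>2)"
              by (simp only: power_mult_distrib) simp
            then show ?thesis using s3[of "norm (P k q)" "norm (Q k q)" "2 * real (L + k) * norm (e k q)"]
              unfolding y_def x_def x'_def x''_def by (simp only:)
          qed
          ultimately have "(y k q)\<^sup>2 \<le> 3 * x + 3 * x' + 1536 * (m\<^sup>2 * (V * x''))" by (simp add: mult.assoc)
          also have "\<dots> \<le> (3 + 1536 * m\<^sup>2) * (x + x' + V * x'')"
          proof -
            have V0: "0 \<le> V * x''" unfolding V_def using mode_pot_bounds(1) x by (intro mult_nonneg_nonneg)
            have "0 \<le> m\<^sup>2 * x" "0 \<le> m\<^sup>2 * x'" using x by simp_all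
            then show ?thesis using V0 by (simp add: algebra_simps)
          qed
          also have "x + x' + V * x'' = f k r" by (simp add: f_def x_def x'_def x''_def V_def q_def)
          finally show ?thesis .
        qed
        have "(\<rho> q)\<^sup>2 \<le> 2 * (a q)\<^sup>2 + 2 * (\<Sum>k\<le>K. y k q)\<^sup>2" unfolding \<rho>_def by (rule sq)
        also have "\<dots> \<le> 2 * (Ma s)\<^sup>2 + 2 * ((\<Sum>k\<le>K. (3 + 1536 * m\<^sup>2) * f k r) * (real K + 1))"
        proof -
          have "(\<Sum>k\<le>K. (y k q)\<^sup>2) * real (card {..K}) \<le> (\<Sum>k\<le>K. (3 + 1536 * m\<^sup>2) * f k r) * (real K + 1)"
            by (intro mult_mono sum_mono 3 sum_nonneg mult_nonneg_nonneg f0) auto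
          then show ?thesis using 1 2 by linarith
        qed
        also have "\<dots> = 2 * (Ma s)\<^sup>2 + (\<Sum>k\<le>K. c * f k r)" by (simp add: c_def sum_distrib_left sum_distrib_right algebra_simps)
        finally show ?thesis by (simp add: q_def)
      qed
      have "(\<integral>\<^sup>+r. ennreal ((\<rho> (on_slice s r))\<^sup>2) * indicator ?I r \<partial>lborel)
        \<le> (\<integral>\<^sup>+r. ennreal (2 * (Ma s)\<^sup>2) * indicator ?I r + (\<Sum>k\<le>K. ennreal c * (ennreal (f k r) * indicator ?I r)) \<partial>lborel)"
      proof (rule nn_integral_mono)
        fix r show "ennreal ((\<rho> (on_slice s r))\<^sup>2) * indicator ?I r \<le> ennreal (2 * (Ma s)\<^sup>2) * indicator ?I r + (\<Sum>k\<le>K. ennreal c * (ennreal (f k r) * indicator ?I r))"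
        proof (cases "r \<in> ?I")
          case True
          have "ennreal ((\<rho> (on_slice s r))\<^sup>2) \<le> ennreal (2 * (Ma s)\<^sup>2 + (\<Sum>k\<le>K. c * f k r))" by (rule ennreal_leI[OF pt[OF True]])
          also have "\<dots> = ennreal (2 * (Ma s)\<^sup>2) + (\<Sum>k\<le>K. ennreal c * ennreal (f k r))"
            using f0 c0 by (simp add: ennreal_plus sum_nonneg sum_ennreal[symmetric] ennreal_mult)
          finally show ?thesis using True by simp
        qed simp
      qed
      also have "\<dots> = ennreal (2 * (Ma s)\<^sup>2) * emeasure lborel ?I + (\<Sum>k\<le>K. ennreal c * (\<integral>\<^sup>+r. ennreal (f k r) * indicator ?I r \<partial>lborel))"
        by (simp add: nn_integral_add nn_integral_sum nn_integral_cmult nn_integral_cmult_indicator)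
      also have "\<dots> \<le> ennreal (2 * (Ma s)\<^sup>2) * ennreal m + (\<Sum>k\<le>K. ennreal c * ennreal \<bar>C s\<bar>)"
      proof (intro add_mono sum_mono mult_left_mono)
        have "7 * m / 2 - 5 * m / 2 = m" by simp
        then show "emeasure lborel ?I \<le> ennreal m" using m by simp
        show "(\<integral>\<^sup>+r. ennreal (f k r) * indicator ?I r \<partial>lborel) \<le> ennreal \<bar>C s\<bar>" for k
          using int[where k=k and s=s] unfolding f_def by (rule order_trans) (simp add: ennreal_leI)
      qed auto
      also have "\<dots> = ennreal (2 * (Ma s)\<^sup>2 * m + (real K + 1) * (c * \<bar>C s\<bar>))"
      proof -
        have "(\<Sum>k\<le>K. ennreal c * ennreal \<bar>C s\<bar>) = ennreal (\<Sum>k\<le>K. c * \<bar>C s\<bar>)"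
          using c0 by (subst sum_ennreal[symmetric]) (auto simp: ennreal_mult)
        also have "(\<Sum>k\<le>K. c * \<bar>C s\<bar>) = (real K + 1) * (c * \<bar>C s\<bar>)" by (simp add: algebra_simps)
        finally show ?thesis using c0 m by (simp add: ennreal_plus ennreal_mult)
      qed
      finally show ?thesis .
    qed
    show "\<exists>u \<rho>. exterior_solution m u \<and>
    (\<forall>p\<in>exterior m. \<bar>tortoise m (radius p)\<bar> \<ge> 2 * x1 + \<bar>fst (null_coords m p)\<bar> \<longrightarrow> u p = 0) \<and>
    (\<forall>p\<in>exterior m. radius p \<in> {5 * m / 2..7 * m / 2} \<longrightarrow>
       (\<forall>q Z D. q = null_coords m p \<longrightarrow> Z = plane_coord p / of_real (radius p) \<longrightarrow> D = (1 + Z * cis (phase q + \<alpha>)) / 2 \<longrightarrow>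
         (\<forall>i. norm (pd i u p) \<le> beam_const * (norm Z ^ (L - 1) * (real L * \<bar>amp \<delta> q\<bar> * norm D ^ K + \<rho> q))) \<and>
         w0 * (real L * \<bar>amp \<delta> q\<bar> * norm Z ^ L * norm D ^ K) \<le> beam_const * (norm (pd 1 u p) + norm Z ^ (L - 1) * \<rho> q))) \<and>
    continuous_on UNIV \<rho> \<and> (\<forall>q. \<rho> q \<ge> 0) \<and>
    (\<forall>s. (\<integral>\<^sup>+r. ennreal ((\<rho> (on_slice s r))\<^sup>2) * indicator {5 * m / 2..7 * m / 2} r \<partial>lborel) \<le> ennreal (2 * (Ma s)\<^sup>2 * m + (real K + 1) * (c * \<bar>C s\<bar>)))"
      by (rule exI[of _ u], rule exI[of _ \<rho>], intro conjI ballI allI[of "\<lambda>q. 0 \<le> \<rho> q"] A1 A4 A5)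
        (use A2 A3 A6 in blast)+
  qed
qed

end

section \<open>Angular integrals on the slices and the profile of the amplitude\<close>

lemma flat_0_bounds:
  "0 \<le> flat 0 x" "flat 0 x \<le> 1" "x \<le> 0 \<Longrightarrow> flat 0 x = 0" "3/4 \<le> x \<Longrightarrow> exp (- 4/3) \<le> flat 0 x"
proof -
  assume x: "3/4 \<le> x"
  then have "inverse x \<le> inverse (3/4)" by (intro le_imp_inverse_le) auto
  then show "exp (- 4/3) \<le> flat 0 x" using x by (simp add: flat_def)
qed (auto simp: flat_def)

text \<open>In polar coordinates each sphere |x| = s is rotated by its own angle \<psi> s, which
  preserves its measure. The phase of a beam winds with r along a slice, and this removes the
  winding from the integrals.\<close>

lemma nn_integral_rotated:
  fixes F :: "real \<Rightarrow> complex \<Rightarrow> ennreal" and \<psi> :: "real \<Rightarrow> real"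
  assumes [measurable]: "(\<lambda>x::real^3. F (norm x) (planar x / of_real (norm x) * cis (\<psi> (norm x)))) \<in> borel_measurable borel"
    and Fm: "\<And>s. F s \<in> borel_measurable borel"
  shows "(\<integral>\<^sup>+x. F (norm x) (planar x / of_real (norm x) * cis (\<psi> (norm x))) \<partial>lborel)
    = (\<integral>\<^sup>+s. (\<integral>\<^sup>+\<omega>. F s (planar \<omega>) \<partial>sphere_measure) * ennreal (3 * s\<^sup>2) * indicator {0<..} s \<partial>lborel)"
  unfolding nn_integral_polar[OF assms(1)]
proof (rule nn_integral_cong)
  fix s :: real
  show "(\<integral>\<^sup>+\<omega>. F (norm (s *\<^sub>R \<omega>)) (planar (s *\<^sub>R \<omega>) / of_real (norm (s *\<^sub>R \<omega>)) * cis (\<psi> (norm (s *\<^sub>R \<omega>)))) \<partial>sphere_measure)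
      * ennreal (3 * s\<^sup>2) * indicator {0<..} s
    = (\<integral>\<^sup>+\<omega>. F s (planar \<omega>) \<partial>sphere_measure) * ennreal (3 * s\<^sup>2) * indicator {0<..} s"
  proof (cases "s > 0")
    case True
    have pl: "planar (s *\<^sub>R \<omega>) = of_real s * planar \<omega>" for \<omega> by (simp add: planar_def complex_eq_iff)
    have "(\<integral>\<^sup>+\<omega>. F (norm (s *\<^sub>R \<omega>)) (planar (s *\<^sub>R \<omega>) / of_real (norm (s *\<^sub>R \<omega>)) * cis (\<psi> (norm (s *\<^sub>R \<omega>)))) \<partial>sphere_measure)
      = (\<integral>\<^sup>+\<omega>. F s (planar (rotz (\<psi> s) \<omega>)) \<partial>sphere_measure)"
    proof (rule nn_integral_cong_AE)
      show "AE \<omega> in sphere_measure. F (norm (s *\<^sub>R \<omega>)) (planar (s *\<^sub>R \<omega>) / of_real (norm (s *\<^sub>R \<omega>)) * cis (\<psi> (norm (s *\<^sub>R \<omega>))))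
          = F s (planar (rotz (\<psi> s) \<omega>))"
        using AE_sphere_measure
      proof eventually_elim
        case (elim \<omega>)
        then show ?case using True by (simp add: pl planar_rotz mult.commute)
      qed
    qed
    also have "\<dots> = (\<integral>\<^sup>+\<omega>. F s (planar \<omega>) \<partial>sphere_measure)"
      by (rule nn_integral_sphere_rotz) (rule measurable_compose[OF measurable_planar Fm])
    finally show ?thesis by simp
  qed simp
qed

lemma integrable_beam_weight: "integrable sphere_measure (\<lambda>\<omega>. beam_weight K n (planar \<omega>))"
  by (rule integrable_sphere_bounded[of _ 1]) (auto intro: beam_weight_le_1)

lemma integrable_beam_weight_indicator:
  "integrable sphere_measure (\<lambda>\<omega>. beam_weight K n (planar \<omega>) * indicator {\<omega>. norm (planar \<omega> - 1) < \<epsilon>} \<omega>)"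
proof (rule integrable_sphere_bounded[of _ 1])
  show "\<bar>beam_weight K n (planar \<omega>) * indicator {\<omega>. norm (planar \<omega> - 1) < \<epsilon>} \<omega>\<bar> \<le> 1" if "norm (planar \<omega>) \<le> 1" for \<omega>
    using beam_weight_le_1[OF that, of K n] by (simp split: split_indicator)
qed measurable

text \<open>f may take negative values; \<open>ennreal\<close> cuts them off, which can only enlarge
  the right hand side.\<close>

lemma ennreal_integral_le_nn_integral:
  fixes f :: "'a \<Rightarrow> real"
  assumes "integrable M f" shows "ennreal (\<integral>x. f x \<partial>M) \<le> (\<integral>\<^sup>+x. ennreal (f x) \<partial>M)"
proof -
  have i: "integrable M (\<lambda>x. max 0 (f x))" using assms by (intro integrable_max) auto
  have "ennreal (\<integral>x. f x \<partial>M) \<le> ennreal (\<integral>x. max 0 (f x) \<partial>M)"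
    using assms i by (intro ennreal_leI integral_mono) auto
  also have "\<dots> = (\<integral>\<^sup>+x. ennreal (max 0 (f x)) \<partial>M)" by (rule nn_integral_eq_integral[symmetric, OF i]) simp
  also have "\<dots> = (\<integral>\<^sup>+x. ennreal (f x) \<partial>M)" by (intro nn_integral_cong) (simp add: max_def ennreal_neg)
  finally show ?thesis .
qed

lemma plane_coord_slice: "plane_coord (slice_chart m \<tau> x) = planar x"
  by (simp add: plane_coord_def slice_chart_def vector_4 planar_def complex_eq_iff)

lemma tstar_slice: "tstar m (slice_chart m \<tau> x) = \<tau>"
  unfolding tstar_def radius_slice_chart by (simp add: slice_chart_def vector_4)

context wkb
begin

lemma null_coords_slice:
  assumes "norm x > 2 * m" shows "null_coords m (slice_chart m \<tau> x) = on_slice \<tau> (norm x)"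
  unfolding null_coords_def radius_slice_chart on_slice_def
  using assms m by (simp add: slice_chart_def vector_4 tortoise_def ln_div algebra_simps)

text \<open>ca and Ca precede \<tau>, \<epsilon> and \<delta>. On \<Sigma>_\<tau> the bump has width
  \<eta> of order \<delta> exp (- \<omega> \<tau>) and squared height of order exp (\<omega>
  \<tau>), with product of order \<delta> for every \<tau>. The constants measure how much B, G and
  the time coordinate vary over 5m/2 \<le> r \<le> 7m/2.\<close>

lemma amplitude_profile:
  assumes G: "continuous_on UNIV G" and zG: "\<And>x. z x = (areal m x - 3 * m) * exp (G x)"
  shows "\<exists>ca Ca. 0 < ca \<and> 0 < Ca \<and> (\<forall>\<tau>\<ge>0. \<forall>\<epsilon>>0. \<exists>\<delta>0>0. \<forall>\<delta>. 0 < \<delta> \<longrightarrow> \<delta> \<le> \<delta>0 \<longrightarrow>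
    (\<exists>\<eta>. 0 < \<eta> \<and> \<eta> \<le> \<epsilon> \<and> \<eta> \<le> m / 2 \<and> (\<forall>r\<in>{3 * m..3 * m + \<eta>}. ca * \<delta> / \<eta> \<le> (amp \<delta> (on_slice \<tau> r))\<^sup>2)) \<and>
    (\<integral>\<^sup>+r. ennreal ((amp \<delta> (on_slice 0 r))\<^sup>2) * indicator {5 * m / 2..7 * m / 2} r \<partial>lborel) \<le> ennreal (Ca * \<delta>))"
proof -
  let ?I = "{5 * m / 2..7 * m / 2}"
  have snd_on: "snd (on_slice s r) = tortoise m r" "fst (on_slice s r) = s + fst (on_slice 0 r)" for s r
    by (simp_all add: on_slice_def)
  have "continuous_on UNIV (\<lambda>p::real \<times> real. G (snd p))"
    by (rule continuous_on_compose2[OF G]) (auto intro!: continuous_intros)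
  from slice_bounded[OF this, of 0] obtain g where g: "g \<ge> 0" "\<And>r. r \<in> ?I \<Longrightarrow> \<bar>G (tortoise m r)\<bar> \<le> g" by (auto simp: snd_on(1))
  have Bc: "continuous_on UNIV (\<lambda>p::real \<times> real. B (snd p))"
    by (rule continuous_on_compose2[OF Cdiff_imp_continuous_on[OF CB[of 0]]]) (auto intro!: continuous_intros)
  from slice_bounded[OF this, of 0] obtain b2 where b2: "b2 \<ge> 0" "\<And>r. r \<in> ?I \<Longrightarrow> \<bar>B (tortoise m r)\<bar> \<le> b2" by (auto simp: snd_on(1))
  have "continuous_on UNIV (\<lambda>p::real \<times> real. inverse (B (snd p)))"
    by (rule continuous_on_inverse[OF Bc]) (use Bpos in \<open>simp add: less_imp_neq[symmetric]\<close>)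
  from slice_bounded[OF this, of 0] obtain b where b: "b \<ge> 0" "\<And>r. r \<in> ?I \<Longrightarrow> \<bar>inverse (B (tortoise m r))\<bar> \<le> b" by (auto simp: snd_on(1))
  define b1 where "b1 = inverse (b + 1)"
  have b1: "b1 > 0" using b by (simp add: b1_def)
  have b1': "b1 \<le> B (tortoise m r)" if "r \<in> ?I" for r
  proof -
    have "inverse (B (tortoise m r)) \<le> b + 1" using b(2)[OF that] by linarith
    from le_imp_inverse_le[OF this] show ?thesis using Bpos[of "tortoise m r"] by (simp add: b1_def)
  qed
  have "continuous_on UNIV (\<lambda>p::real \<times> real. fst p)" by (intro continuous_intros)
  from slice_bounded[OF this, of 0] obtain T0 where T0: "T0 \<ge> 0" "\<And>r. r \<in> ?I \<Longrightarrow> \<bar>fst (on_slice 0 r)\<bar> \<le> T0" by blast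
  \<comment> \<open>Along \<Sigma>_s the time coordinate differs from s by at most T0 in this range;
    E bounds the resulting distortion of exp (\<omega> t).\<close>
  define E where "E = exp (w0 * T0)"
  have E: "E \<ge> 1" using T0 w0_pos by (simp add: E_def)
  have ex: "exp (w0 * s) / E \<le> exp (w0 * fst (on_slice s r))" "exp (w0 * fst (on_slice s r)) \<le> exp (w0 * s) * E" if "r \<in> ?I" for s r
  proof -
    have "\<bar>w0 * fst (on_slice 0 r)\<bar> \<le> w0 * T0" using T0(2)[OF that] w0_pos by (simp add: abs_mult)
    then have "w0 * s - w0 * T0 \<le> w0 * fst (on_slice s r)" "w0 * fst (on_slice s r) \<le> w0 * s + w0 * T0"
      unfolding snd_on(2)[of s] distrib_left by linarith+
    then show "exp (w0 * s) / E \<le> exp (w0 * fst (on_slice s r))" "exp (w0 * fst (on_slice s r)) \<le> exp (w0 * s) * E"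
      unfolding E_def exp_diff[symmetric] exp_add[symmetric] by simp_all
  qed
  have zr: "z (tortoise m r) = (r - 3 * m) * exp (G (tortoise m r))" if "r \<in> ?I" for r
    using that m by (simp add: zG areal_tortoise)
  have eG: "exp (- g) \<le> exp (G (tortoise m r))" "exp (G (tortoise m r)) \<le> exp g" if "r \<in> ?I" for r
    using g(2)[OF that] by (auto simp: abs_le_iff)
  have amp2: "(amp \<delta> (on_slice s r))\<^sup>2 = exp (w0 * fst (on_slice s r)) * (B (tortoise m r))\<^sup>2 *
      (flat 0 (1 - (exp (w0 * fst (on_slice s r)) * z (tortoise m r) / \<delta>)\<^sup>2))\<^sup>2" for \<delta> s r
  proof -
    have "(exp (w0 / 2 * t))\<^sup>2 = exp (w0 * t)" for t
      by (simp add: power2_eq_square exp_add[symmetric])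
    then show ?thesis by (simp add: amp_def snd_on(1) power_mult_distrib)
  qed
  define ca where "ca = b1\<^sup>2 * (exp (- 4/3))\<^sup>2 / (2 * E\<^sup>2 * exp g)"
  define Ca where "Ca = 2 * E\<^sup>2 * b2\<^sup>2 * exp g + 1"
  have ca0: "ca > 0" unfolding ca_def using b1 E by simp
  have Ca0: "Ca > 0" unfolding Ca_def by (intro add_nonneg_pos) auto
  have up: "(\<integral>\<^sup>+r. ennreal ((amp \<delta> (on_slice 0 r))\<^sup>2) * indicator ?I r \<partial>lborel) \<le> ennreal (Ca * \<delta>)" if \<delta>: "\<delta> > 0" for \<delta>
  proof -
    define R where "R = \<delta> * E * exp g"
    have R: "R > 0" using \<delta> E by (simp add: R_def)
    have pt: "(amp \<delta> (on_slice 0 r))\<^sup>2 \<le> E * b2\<^sup>2 * indicator {3 * m - R..3 * m + R} r" if r: "r \<in> ?I" for r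
    proof (cases "\<bar>r - 3 * m\<bar> \<le> R")
      case True
      have f: "(flat 0 x)\<^sup>2 \<le> 1" for x using flat_0_bounds(1,2)[of x] by (simp add: power_le_one)
      have "(amp \<delta> (on_slice 0 r))\<^sup>2 \<le> (E * b2\<^sup>2) * 1"
        unfolding amp2
      proof (intro mult_mono f)
        show "exp (w0 * fst (on_slice 0 r)) \<le> E" using ex(2)[OF r, of 0] by simp
        show "(B (tortoise m r))\<^sup>2 \<le> b2\<^sup>2" using b2(2)[OF r] Bpos[of "tortoise m r"] by (intro power_mono) auto
      qed (use E in auto)
      moreover have "r \<in> {3 * m - R..3 * m + R}" using True by auto
      ultimately show ?thesis by simp
    next
      case False
      define y where "y = exp (w0 * fst (on_slice 0 r)) * z (tortoise m r) / \<delta>"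
      have "1 * \<delta> = (1 / E) * (R * exp (- g))" using E by (simp add: R_def exp_minus)
      also have "\<dots> \<le> exp (w0 * fst (on_slice 0 r)) * (\<bar>r - 3 * m\<bar> * exp (G (tortoise m r)))"
        using False ex(1)[OF r, of 0] eG(1)[OF r] R E by (intro mult_mono) auto
      finally have "1 \<le> \<bar>y\<bar>" using \<delta> by (simp add: y_def zr[OF r] abs_mult le_divide_eq)
      then have "1\<^sup>2 \<le> y\<^sup>2" unfolding abs_le_square_iff[symmetric] by (simp only: abs_one)
      then have "(amp \<delta> (on_slice 0 r))\<^sup>2 = 0" unfolding amp2 y_def[symmetric] by (simp add: flat_0_bounds(3))
      then show ?thesis using E by simp
    qed
    have "(\<integral>\<^sup>+r. ennreal ((amp \<delta> (on_slice 0 r))\<^sup>2) * indicator ?I r \<partial>lborel)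
      \<le> (\<integral>\<^sup>+r. ennreal (E * b2\<^sup>2) * indicator {3 * m - R..3 * m + R} r \<partial>lborel)"
    proof (rule nn_integral_mono)
      fix r show "ennreal ((amp \<delta> (on_slice 0 r))\<^sup>2) * indicator ?I r \<le> ennreal (E * b2\<^sup>2) * indicator {3 * m - R..3 * m + R} r"
        using ennreal_leI[OF pt[of r]] by (cases "r \<in> ?I"; cases "r \<in> {3 * m - R..3 * m + R}") auto
    qed
    also have "\<dots> = ennreal (E * b2\<^sup>2) * ennreal (2 * R)" using R by (simp add: nn_integral_cmult_indicator)
    also have "\<dots> = ennreal (E * b2\<^sup>2 * (2 * R))" using E R by (simp add: ennreal_mult)
    also have "\<dots> \<le> ennreal (Ca * \<delta>)"
    proof (rule ennreal_leI)
      have "E * b2\<^sup>2 * (2 * R) = (2 * E\<^sup>2 * b2\<^sup>2 * exp g) * \<delta>" by (simp add: R_def power2_eq_square)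
      also have "\<dots> \<le> Ca * \<delta>" using \<delta> by (intro mult_right_mono) (auto simp: Ca_def)
      finally show "E * b2\<^sup>2 * (2 * R) \<le> Ca * \<delta>" .
    qed
    finally show ?thesis .
  qed
  have low: "\<exists>\<eta>. 0 < \<eta> \<and> \<eta> \<le> \<epsilon> \<and> \<eta> \<le> m / 2 \<and> (\<forall>r\<in>{3 * m..3 * m + \<eta>}. ca * \<delta> / \<eta> \<le> (amp \<delta> (on_slice \<tau> r))\<^sup>2)"
    if \<tau>: "\<tau> \<ge> 0" and \<epsilon>: "\<epsilon> > 0" and \<delta>: "0 < \<delta>" "\<delta> \<le> min \<epsilon> (m / 2)" for \<tau> \<epsilon> \<delta>
  proof -
    \<comment> \<open>Chosen so that the argument y of the bump is at most 1/2 for 3m \<le> r \<le>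
      3m + \<eta>; then 1 - y^2 \<ge> 3/4 and \<open>flat 0\<close> is at least exp (-4/3).\<close>
    define X where "X = 2 * E * exp g * exp (w0 * \<tau>)"
    have X1: "X \<ge> 1"
    proof -
      have "1 * 1 * 1 * 1 \<le> X" unfolding X_def using E g \<tau> w0_pos by (intro mult_mono) auto
      then show ?thesis by simp
    qed
    define \<eta> where "\<eta> = \<delta> / X"
    have e0: "\<eta> > 0" using \<delta> X1 by (simp add: \<eta>_def)
    have e1: "\<eta> \<le> \<delta>" using \<delta> X1 by (simp add: \<eta>_def divide_le_eq mult_le_cancel_left1)
    have "ca * \<delta> / \<eta> \<le> (amp \<delta> (on_slice \<tau> r))\<^sup>2" if r: "r \<in> {3 * m..3 * m + \<eta>}" for r
    proof -
      have rI: "r \<in> ?I" using r e1 \<delta> m by auto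
      define y where "y = exp (w0 * fst (on_slice \<tau> r)) * z (tortoise m r) / \<delta>"
      have y0: "y \<ge> 0" unfolding y_def zr[OF rI] using r \<delta> by simp
      have "y \<le> (exp (w0 * \<tau>) * E) * (\<eta> * exp g) / \<delta>"
        unfolding y_def zr[OF rI] using r ex(2)[OF rI, of \<tau>] eG(2)[OF rI] \<delta> E by (intro divide_right_mono mult_mono) auto
      also have "\<dots> = 1/2" using \<delta> E by (simp add: \<eta>_def X_def)
      finally have "y\<^sup>2 \<le> (1/2)\<^sup>2" using y0 by (intro power_mono)
      then have "3/4 \<le> 1 - y\<^sup>2" by (simp add: power2_eq_square)
      then have f: "exp (- 4/3) \<le> flat 0 (1 - y\<^sup>2)" by (rule flat_0_bounds(4))
      have "ca * \<delta> / \<eta> = ca * X" using \<delta> X1 by (simp add: \<eta>_def)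
      also have "\<dots> = exp (w0 * \<tau>) / E * b1\<^sup>2 * (exp (- 4/3))\<^sup>2" using E by (simp add: ca_def X_def power2_eq_square)
      also have "\<dots> \<le> (amp \<delta> (on_slice \<tau> r))\<^sup>2"
        unfolding amp2 y_def[symmetric] using ex(1)[OF rI, of \<tau>] b1 b1'[OF rI] f E
        by (intro mult_mono power_mono) auto
      finally show ?thesis .
    qed
    then show ?thesis using e0 e1 \<delta> by (intro exI[of _ \<eta>]) auto
  qed
  show ?thesis
  proof (rule exI[of _ ca], rule exI[of _ Ca], intro conjI ca0 Ca0 allI impI)
    fix \<tau> \<epsilon> :: real assume "\<tau> \<ge> 0" "\<epsilon> > 0"
    then show "\<exists>\<delta>0>0. \<forall>\<delta>. 0 < \<delta> \<longrightarrow> \<delta> \<le> \<delta>0 \<longrightarrow>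
      (\<exists>\<eta>. 0 < \<eta> \<and> \<eta> \<le> \<epsilon> \<and> \<eta> \<le> m / 2 \<and> (\<forall>r\<in>{3 * m..3 * m + \<eta>}. ca * \<delta> / \<eta> \<le> (amp \<delta> (on_slice \<tau> r))\<^sup>2)) \<and>
      (\<integral>\<^sup>+r. ennreal ((amp \<delta> (on_slice 0 r))\<^sup>2) * indicator ?I r \<partial>lborel) \<le> ennreal (Ca * \<delta>)"
      using low up m by (intro exI[of _ "min \<epsilon> (m / 2)"]) auto
  qed
qed

end

section \<open>Energy of beams\<close>

lemma measurable_cis [measurable]: "cis \<in> borel_measurable borel"
  by (intro borel_measurable_continuous_onI continuous_intros)

context wkb
begin

text \<open>Packages the conclusion of \<open>beam_exists\<close> for fixed K, \<alpha>, \<delta>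
  and L, to serve as the hypothesis of the energy bounds.\<close>

definition is_beam :: "nat \<Rightarrow> real \<Rightarrow> real \<Rightarrow> real \<Rightarrow> (real \<Rightarrow> real) \<Rightarrow> nat \<Rightarrow> (real^4 \<Rightarrow> complex) \<Rightarrow> (real \<times> real \<Rightarrow> real) \<Rightarrow> bool" where
  "is_beam K \<alpha> \<delta> x1 CR L u \<rho> \<longleftrightarrow> exterior_solution m u \<and>
    (\<forall>p\<in>exterior m. \<bar>tortoise m (radius p)\<bar> \<ge> 2 * x1 + \<bar>fst (null_coords m p)\<bar> \<longrightarrow> u p = 0) \<and>
    (\<forall>p\<in>exterior m. radius p \<in> {5 * m / 2..7 * m / 2} \<longrightarrow>
       (\<forall>q Z D. q = null_coords m p \<longrightarrow> Z = plane_coord p / of_real (radius p) \<longrightarrow> D = (1 + Z * cis (phase q + \<alpha>)) / 2 \<longrightarrow>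
         (\<forall>i. norm (pd i u p) \<le> beam_const * (norm Z ^ (L - 1) * (real L * \<bar>amp \<delta> q\<bar> * norm D ^ K + \<rho> q))) \<and>
         w0 * (real L * \<bar>amp \<delta> q\<bar> * norm Z ^ L * norm D ^ K) \<le> beam_const * (norm (pd 1 u p) + norm Z ^ (L - 1) * \<rho> q))) \<and>
    continuous_on UNIV \<rho> \<and> (\<forall>q. \<rho> q \<ge> 0) \<and>
    (\<forall>s. (\<integral>\<^sup>+r. ennreal ((\<rho> (on_slice s r))\<^sup>2) * indicator {5 * m / 2..7 * m / 2} r \<partial>lborel) \<le> ennreal (CR s))"

abbreviation beam_mass :: "nat \<Rightarrow> nat \<Rightarrow> real" where
  "beam_mass K n \<equiv> (\<integral>\<omega>. beam_weight K n (planar \<omega>) \<partial>sphere_measure)"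

text \<open>On the sphere of radius r in \<Sigma>_s the beam is centred at longitude -
  \<open>twist\<close>; rotating by \<open>twist\<close> moves its centre to Z = 1.\<close>

definition twist :: "real \<Rightarrow> real \<Rightarrow> real \<Rightarrow> real" where
  "twist \<alpha> s r = phase (on_slice s r) + \<alpha>"

lemma measurable_phase [measurable]: "phase \<in> borel_measurable borel"
  unfolding phase_def[abs_def]
  by (intro borel_measurable_continuous_onI continuous_intros continuous_on_compose2[OF Cdiff_imp_continuous_on[OF CS0[of 0]]]) auto

lemma measurable_twist [measurable]: "twist \<alpha> s \<in> borel_measurable borel"
  unfolding twist_def[abs_def] by measurable

lemma measurable_amp [measurable]: "amp \<delta> \<in> borel_measurable borel"
  by (rule borel_measurable_continuous_onI[OF Cdiff_imp_continuous_on[OF Cdiff_amp[of 0]]])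

context
  fixes K L n :: nat and \<alpha> \<delta> x1 :: real and CR :: "real \<Rightarrow> real" and u :: "real^4 \<Rightarrow> complex" and \<rho> :: "real \<times> real \<Rightarrow> real"
  assumes beam: "is_beam K \<alpha> \<delta> x1 CR L u \<rho>" and L: "L = Suc n" and x1: "0 < x1" "x1 \<le> m / 4"
begin

lemma rho_measurable [measurable]: "\<rho> \<in> borel_measurable borel"
  using beam unfolding is_beam_def by (intro borel_measurable_continuous_onI) blast

lemma rho_integral: "(\<integral>\<^sup>+r. ennreal ((\<rho> (on_slice s r))\<^sup>2) * indicator {5 * m / 2..7 * m / 2} r \<partial>lborel) \<le> ennreal (CR s)"
  using beam unfolding is_beam_def by blast

lemma beam_differentiable: "p \<in> exterior m \<Longrightarrow> u differentiable (at p)"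
  using beam unfolding is_beam_def exterior_solution_def by (intro Cdiff_differentiable) blast+

definition slice_stress :: "real \<Rightarrow> real^3 \<Rightarrow> real" where
  "slice_stress \<tau> x = stress_energy (schwarzschild m) u (slice_chart m \<tau> x) (N_field m (slice_chart m \<tau> x)) (N_field m (slice_chart m \<tau> x))"

lemma energy_eq: "energy m \<tau> A u = (\<integral>\<^sup>+x. ennreal (slice_stress \<tau> x) * indicator {x. norm x > 2 * m \<and> slice_chart m \<tau> x \<in> A} x \<partial>lborel)"
  unfolding energy_def
proof (rule nn_integral_cong)
  fix x :: "real^3"
  show "ennreal (let p = slice_chart m \<tau> x in
          ip (schwarzschild m) p (current (schwarzschild m) (N_field m) u p)
             (unit_normal (schwarzschild m) (N_field m) (tstar m) p)
          * sqrt (det (induced_metric (schwarzschild m) (slice_chart m \<tau>) x))) * indicator {x. norm x > 2 * m \<and> slice_chart m \<tau> x \<in> A} x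
     = ennreal (slice_stress \<tau> x) * indicator {x. norm x > 2 * m \<and> slice_chart m \<tau> x \<in> A} x"
  proof (cases "norm x > 2 * m")
    case True
    show ?thesis
      unfolding energy_integrand[OF m True beam_differentiable[OF slice_chart_exterior[OF True]]] slice_stress_def ..
  qed simp
qed

text \<open>With L = n + 1 the errors carry |Z|^n, the power measured by
  \<open>equatorial n\<close>. The lower bound of \<open>beam_exists\<close> has |Z|^L instead; |Z|
  \<ge> 1/2 restores the missing factor and contributes 4 to the constant 16.\<close>

lemma beam_bounds:
  fixes x :: "real^3" and \<tau> :: real
  assumes x: "norm x \<in> {5 * m / 2..7 * m / 2}"
  defines "r \<equiv> norm x"
  defines "Z \<equiv> planar x / of_real r * cis (twist \<alpha> \<tau> r)"
  shows "slice_stress \<tau> x \<le> 400 * beam_const\<^sup>2 * ((real L)\<^sup>2 * (amp \<delta> (on_slice \<tau> r))\<^sup>2 * beam_weight K n Z + (\<rho> (on_slice \<tau> r))\<^sup>2 * norm Z ^ (2 * n))"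
    "norm Z \<ge> 1/2 \<Longrightarrow> w0\<^sup>2 / (16 * beam_const\<^sup>2) * ((real L)\<^sup>2 * (amp \<delta> (on_slice \<tau> r))\<^sup>2 * beam_weight K n Z)
       - (\<rho> (on_slice \<tau> r))\<^sup>2 / 2 * norm Z ^ (2 * n) \<le> slice_stress \<tau> x"
proof -
  define p where "p = slice_chart m \<tau> x"
  define q where "q = on_slice \<tau> r"
  define Z0 where "Z0 = planar x / complex_of_real r"
  define D where "D = (1 + Z) / 2"
  have nx: "norm x > 2 * m" using x m by auto
  have p: "p \<in> exterior m" unfolding p_def by (rule slice_chart_exterior[OF nx])
  have rp: "radius p = r" by (simp add: p_def radius_slice_chart r_def)
  have qp: "q = null_coords m p" unfolding p_def null_coords_slice[OF nx] q_def r_def ..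
  have pc: "plane_coord p = planar x" unfolding p_def by (rule plane_coord_slice)
  have Zp: "Z0 = plane_coord p / of_real (radius p)" by (simp only: rp pc Z0_def)
  have Dp: "D = (1 + Z0 * cis (phase q + \<alpha>)) / 2" by (simp add: D_def Z_def Z0_def twist_def q_def)
  have nZ: "norm Z0 = norm Z" by (simp add: Z_def Z0_def norm_mult norm_divide)
  have "(\<forall>i. norm (pd i u p) \<le> beam_const * (norm Z0 ^ (L - 1) * (real L * \<bar>amp \<delta> q\<bar> * norm D ^ K + \<rho> q))) \<and>
         w0 * (real L * \<bar>amp \<delta> q\<bar> * norm Z0 ^ L * norm D ^ K) \<le> beam_const * (norm (pd 1 u p) + norm Z0 ^ (L - 1) * \<rho> q)"
    using beam p x qp Zp Dp unfolding is_beam_def rp[unfolded r_def, symmetric] by blast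
  then have b1: "norm (pd i u p) \<le> beam_const * (norm Z ^ n * (real L * \<bar>amp \<delta> q\<bar> * norm D ^ K + \<rho> q))"
    and b2: "w0 * (real L * \<bar>amp \<delta> q\<bar> * norm Z ^ L * norm D ^ K) \<le> beam_const * (norm (pd 1 u p) + norm Z ^ n * \<rho> q)" for i
    unfolding nZ by (simp_all add: L)
  define W where "W = (real L)\<^sup>2 * (amp \<delta> q)\<^sup>2 * beam_weight K n Z"
  define V where "V = (\<rho> q)\<^sup>2 * norm Z ^ (2 * n)"
  define Y where "Y = real L * \<bar>amp \<delta> q\<bar> * norm D ^ K"
  have WY: "(norm Z ^ n * Y)\<^sup>2 = W"
    unfolding W_def Y_def beam_weight_def D_def power_mult_distrib by (simp add: power_mult[symmetric] mult_ac)
  have VY: "(norm Z ^ n * \<rho> q)\<^sup>2 = V"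
    unfolding V_def power_mult_distrib by (simp add: power_mult[symmetric] mult_ac)
  have sq: "(x + y)\<^sup>2 \<le> 2 * x\<^sup>2 + 2 * y\<^sup>2" for x y :: real
    using zero_le_power2[of "x - y"] by (simp add: power2_eq_square algebra_simps)
  have sp: "(norm (pd i u p))\<^sup>2 \<le> beam_const\<^sup>2 * (2 * W + 2 * V)" for i
  proof -
    have "(norm (pd i u p))\<^sup>2 \<le> (beam_const * (norm Z ^ n * (Y + \<rho> q)))\<^sup>2" using b1[of i] unfolding Y_def by (intro power_mono) auto
    also have "\<dots> = beam_const\<^sup>2 * (norm Z ^ n * Y + norm Z ^ n * \<rho> q)\<^sup>2" by (simp only: power_mult_distrib distrib_left[symmetric])
    also have "\<dots> \<le> beam_const\<^sup>2 * (2 * W + 2 * V)" using sq[of "norm Z ^ n * Y" "norm Z ^ n * \<rho> q"] unfolding WY VY by (intro mult_left_mono) auto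
    finally show ?thesis .
  qed
  have four: "50 * (a1 + a2 + a3 + a4) \<le> 50 * (4 * b)" if "a1 \<le> b" "a2 \<le> b" "a3 \<le> b" "a4 \<le> b" for a1 a2 a3 a4 b :: real
    using that by simp
  note st = stress_energy_N_N_bounds[OF m p beam_differentiable[OF p]]
  have "slice_stress \<tau> x \<le> 50 * (\<Sum>i\<in>UNIV. (norm (pd i u p))\<^sup>2)"
    unfolding slice_stress_def p_def[symmetric] using x by (intro st(2)) (simp add: rp r_def)
  also have "\<dots> \<le> 50 * (4 * (beam_const\<^sup>2 * (2 * W + 2 * V)))"
    unfolding sum_4 by (rule four[OF sp sp sp sp])
  also have "\<dots> = 400 * beam_const\<^sup>2 * (W + V)" by (simp add: algebra_simps)
  finally show "slice_stress \<tau> x \<le> 400 * beam_const\<^sup>2 * ((real L)\<^sup>2 * (amp \<delta> (on_slice \<tau> r))\<^sup>2 * beam_weight K n Z + (\<rho> (on_slice \<tau> r))\<^sup>2 * norm Z ^ (2 * n))"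
    unfolding W_def V_def q_def .
  assume h: "norm Z \<ge> 1/2"
  define T where "T = slice_stress \<tau> x"
  have T: "(norm (pd 1 u p))\<^sup>2 \<le> 2 * T"
    using st(1) unfolding T_def slice_stress_def p_def[symmetric] by simp
  have bc: "beam_const\<^sup>2 > 0" using beam_const_pos by simp
  have "w0 * (norm Z ^ n * Y) / 2 \<le> w0 * (real L * \<bar>amp \<delta> q\<bar> * norm Z ^ L * norm D ^ K)"
  proof -
    have "(norm Z ^ n * Y) * (1/2) \<le> (norm Z ^ n * Y) * norm Z" by (intro mult_left_mono h) (simp add: Y_def)
    also have "\<dots> = real L * \<bar>amp \<delta> q\<bar> * norm Z ^ L * norm D ^ K" by (simp add: Y_def L mult_ac)
    finally have "w0 * ((norm Z ^ n * Y) * (1/2)) \<le> w0 * (real L * \<bar>amp \<delta> q\<bar> * norm Z ^ L * norm D ^ K)" using w0_pos by (intro mult_left_mono) auto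
    then show ?thesis by simp
  qed
  from order_trans[OF this b2] have "(w0 * (norm Z ^ n * Y) / 2)\<^sup>2 \<le> (beam_const * (norm (pd 1 u p) + norm Z ^ n * \<rho> q))\<^sup>2"
    using w0_pos by (intro power_mono) (auto simp: Y_def)
  also have "\<dots> \<le> beam_const\<^sup>2 * (2 * (norm (pd 1 u p))\<^sup>2 + 2 * V)"
    unfolding power_mult_distrib[of beam_const] using sq[of "norm (pd 1 u p)" "norm Z ^ n * \<rho> q"] unfolding VY by (intro mult_left_mono) auto
  also have "\<dots> \<le> beam_const\<^sup>2 * (4 * T + 2 * V)" using T bc by (intro mult_left_mono) auto
  finally have "w0\<^sup>2 * W / 4 \<le> beam_const\<^sup>2 * (4 * T + 2 * V)" unfolding power_divide power_mult_distrib[of w0] WY by simp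
  then have "w0\<^sup>2 / (16 * beam_const\<^sup>2) * W \<le> T + V / 2" using bc by (simp add: field_simps)
  then show "w0\<^sup>2 / (16 * beam_const\<^sup>2) * ((real L)\<^sup>2 * (amp \<delta> (on_slice \<tau> r))\<^sup>2 * beam_weight K n Z)
       - (\<rho> (on_slice \<tau> r))\<^sup>2 / 2 * norm Z ^ (2 * n) \<le> slice_stress \<tau> x"
    unfolding W_def V_def q_def T_def by simp
qed

text \<open>On \<Sigma>_0 the coordinates are - l and r - 3m + l, where the logarithmic term l has
  the sign of r - 3m; so |x| - |t| = |r - 3m|. Because 2 x1 \<le> m/2, the points in question lie in
  an open set on which u vanishes, and the derivatives vanish with it.\<close>

lemma initial_stress_outside:
  assumes x: "norm x > 2 * m" "norm x \<notin> {5 * m / 2..7 * m / 2}"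
  shows "slice_stress 0 x = 0"
proof -
  define p where "p = slice_chart m 0 x"
  have p: "p \<in> exterior m" unfolding p_def by (rule slice_chart_exterior[OF x(1)])
  define f where "f p = \<bar>snd (null_coords m p)\<bar> - \<bar>fst (null_coords m p)\<bar>" for p
  let ?S = "exterior m \<inter> f -` {2 * x1<..}"
  have "continuous_on (exterior m) f"
    unfolding f_def[abs_def] by (intro continuous_intros Cdiff_imp_continuous_on[OF Cdiff_null_coords[OF m, of 0]])
  then have S: "open ?S" by (rule continuous_open_preimage[OF _ open_exterior open_greaterThan])
  have "f p = \<bar>norm x - 3 * m\<bar>"
  proof -
    define r where "r = norm x"
    define l where "l = 2 * m * ln ((r - 2 * m) / m)"
    have r: "r > 2 * m" using x by (simp add: r_def)
    have nc: "null_coords m p = (- l, r - 3 * m + l)"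
      unfolding p_def null_coords_slice[OF x(1)] by (simp add: on_slice_def tortoise_def l_def r_def)
    consider "r \<ge> 3 * m" | "r < 3 * m" by linarith
    then show ?thesis
    proof cases
      case 1
      then have "l \<ge> 0" unfolding l_def using m by (intro mult_nonneg_nonneg ln_ge_zero) (auto simp: le_divide_eq)
      then show ?thesis using 1 by (simp add: f_def nc r_def[symmetric])
    next
      case 2
      then have "(r - 2 * m) / m \<le> 1" using m by (simp add: divide_le_eq)
      then have "ln ((r - 2 * m) / m) \<le> 0" using r m by simp
      then have "l \<le> 0" unfolding l_def using m by (simp add: mult_nonneg_nonpos)
      then show ?thesis using 2 by (simp add: f_def nc r_def[symmetric])
    qed
  qed
  moreover have "\<bar>norm x - 3 * m\<bar> > m / 2"
  proof -
    have "norm x < 5 * m / 2 \<or> 7 * m / 2 < norm x" using x(2) by auto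
    then show ?thesis by (elim disjE; linarith)
  qed
  ultimately have pS: "p \<in> ?S" using p x1 by simp
  have z: "(0::complex) = u q" if "q \<in> ?S" for q
    using that beam unfolding is_beam_def f_def by (auto simp: null_coords_def)
  have "pd i u p = 0" for i
  proof -
    have "pd i u p = pd i (\<lambda>_. 0::complex) p" by (rule pd_cong_open[OF S pS _ differentiable_const]) (rule z)
    then show ?thesis by (simp add: pd_eq[OF has_derivative_const])
  qed
  then show ?thesis unfolding slice_stress_def p_def[symmetric]
    by (rule stress_energy_N_N_bounds(3)[OF m p beam_differentiable[OF p]])
qed

text \<open>The pointwise bound is a function of r and of Z rotated by \<open>twist\<close>, so
  polar coordinates split the integral into angular masses and radial integrals. The density 3 s^2
  is at most 48 m^2 for s \<le> 4m.\<close>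

lemma initial_energy_le:
  assumes amp: "(\<integral>\<^sup>+r. ennreal ((amp \<delta> (on_slice 0 r))\<^sup>2) * indicator {5 * m / 2..7 * m / 2} r \<partial>lborel) \<le> ennreal Q" and Q: "Q \<ge> 0" "CR 0 \<ge> 0"
  shows "energy m 0 A u \<le> ennreal (48 * m\<^sup>2 * (400 * beam_const\<^sup>2) * ((real L)\<^sup>2 * beam_mass K n * Q + equatorial n * CR 0))"
proof -
  let ?I = "{5 * m / 2..7 * m / 2}" and ?c = "400 * beam_const\<^sup>2"
  let ?A = "\<lambda>s. (amp \<delta> (on_slice 0 s))\<^sup>2" and ?R = "\<lambda>s. (\<rho> (on_slice 0 s))\<^sup>2"
  define F where "F s Z = ennreal (?c * ((real L)\<^sup>2 * ?A s * beam_weight K n Z + ?R s * norm Z ^ (2 * n))) * indicator ?I s" for s :: real and Z :: complex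
  have J: "beam_mass K n \<ge> 0" by (intro integral_nonneg_AE AE_I2 beam_weight_nonneg)
  have a: "equatorial n \<ge> 0" using equatorial_pos[of n] by simp
  have "energy m 0 A u \<le> (\<integral>\<^sup>+x. F (norm x) (planar x / of_real (norm x) * cis (twist \<alpha> 0 (norm x))) \<partial>lborel)"
    unfolding energy_eq
  proof (rule nn_integral_mono)
    fix x :: "real^3"
    show "ennreal (slice_stress 0 x) * indicator {x. norm x > 2 * m \<and> slice_chart m 0 x \<in> A} x \<le> F (norm x) (planar x / of_real (norm x) * cis (twist \<alpha> 0 (norm x)))"
    proof (cases "norm x \<in> ?I")
      case True
      have "ennreal (slice_stress 0 x) * indicator {x. norm x > 2 * m \<and> slice_chart m 0 x \<in> A} x \<le> ennreal (slice_stress 0 x)"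
        by (simp split: split_indicator)
      also have "\<dots> \<le> F (norm x) (planar x / of_real (norm x) * cis (twist \<alpha> 0 (norm x)))"
        unfolding F_def using ennreal_leI[OF beam_bounds(1)[OF True, of 0]] True by simp
      finally show ?thesis .
    next
      case False
      then show ?thesis using initial_stress_outside[of x] by (simp split: split_indicator)
    qed
  qed
  also have "\<dots> = (\<integral>\<^sup>+s. (\<integral>\<^sup>+\<omega>. F s (planar \<omega>) \<partial>sphere_measure) * ennreal (3 * s\<^sup>2) * indicator {0<..} s \<partial>lborel)"
  proof (rule nn_integral_rotated)
    show "(\<lambda>x::real^3. F (norm x) (planar x / of_real (norm x) * cis (twist \<alpha> 0 (norm x)))) \<in> borel_measurable borel"
      unfolding F_def by measurable
    show "F s \<in> borel_measurable borel" for s unfolding F_def[abs_def] by measurable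
  qed
  also have "\<dots> \<le> (\<integral>\<^sup>+s. ennreal (48 * m\<^sup>2 * ?c) * (ennreal ((real L)\<^sup>2 * beam_mass K n) * (ennreal (?A s) * indicator ?I s)
       + ennreal (equatorial n) * (ennreal (?R s) * indicator ?I s)) \<partial>lborel)"
  proof (rule nn_integral_mono)
    fix s :: real
    show "(\<integral>\<^sup>+\<omega>. F s (planar \<omega>) \<partial>sphere_measure) * ennreal (3 * s\<^sup>2) * indicator {0<..} s
      \<le> ennreal (48 * m\<^sup>2 * ?c) * (ennreal ((real L)\<^sup>2 * beam_mass K n) * (ennreal (?A s) * indicator ?I s)
       + ennreal (equatorial n) * (ennreal (?R s) * indicator ?I s))"
    proof (cases "s \<in> ?I")
      case True
      have "(\<integral>\<^sup>+\<omega>. F s (planar \<omega>) \<partial>sphere_measure) = ennreal (\<integral>\<omega>. ?c * ((real L)\<^sup>2 * ?A s * beam_weight K n (planar \<omega>) + ?R s * norm (planar \<omega>) ^ (2 * n)) \<partial>sphere_measure)"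
        unfolding F_def using True
        by (subst nn_integral_eq_integral[symmetric]) (auto intro!: integrable_beam_weight integrable_equatorial AE_I2 mult_nonneg_nonneg add_nonneg_nonneg beam_weight_nonneg)
      also have "(\<integral>\<omega>. ?c * ((real L)\<^sup>2 * ?A s * beam_weight K n (planar \<omega>) + ?R s * norm (planar \<omega>) ^ (2 * n)) \<partial>sphere_measure)
        = ?c * ((real L)\<^sup>2 * ?A s * beam_mass K n + ?R s * equatorial n)"
        by (simp add: Bochner_Integration.integral_add integrable_beam_weight integrable_equatorial equatorial_def)
      finally have 1: "(\<integral>\<^sup>+\<omega>. F s (planar \<omega>) \<partial>sphere_measure) = ennreal (?c * ((real L)\<^sup>2 * ?A s * beam_mass K n + ?R s * equatorial n))" .
      have "s\<^sup>2 \<le> (4 * m)\<^sup>2" using True m by (intro power_mono) auto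
      then have 2: "3 * s\<^sup>2 \<le> 48 * m\<^sup>2" by (simp add: power_mult_distrib)
      have "(\<integral>\<^sup>+\<omega>. F s (planar \<omega>) \<partial>sphere_measure) * ennreal (3 * s\<^sup>2) * indicator {0<..} s
        \<le> ennreal (?c * ((real L)\<^sup>2 * ?A s * beam_mass K n + ?R s * equatorial n)) * ennreal (48 * m\<^sup>2)"
        unfolding 1 using ennreal_leI[OF 2] by (auto split: split_indicator intro!: mult_left_mono)
      also have "\<dots> = ennreal (48 * m\<^sup>2 * ?c * ((real L)\<^sup>2 * beam_mass K n * ?A s + equatorial n * ?R s))"
        using J a by (subst ennreal_mult[symmetric]) (auto intro!: mult_nonneg_nonneg add_nonneg_nonneg simp: algebra_simps)
      also have "\<dots> = ennreal (48 * m\<^sup>2 * ?c) * (ennreal ((real L)\<^sup>2 * beam_mass K n) * ennreal (?A s) + ennreal (equatorial n) * ennreal (?R s))"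
        using J a by (simp add: ennreal_mult ennreal_plus add_nonneg_nonneg mult_nonneg_nonneg)
      finally show ?thesis using True by simp
    next
      case False
      then show ?thesis by (simp add: F_def)
    qed
  qed
  also have "\<dots> = ennreal (48 * m\<^sup>2 * ?c) * (ennreal ((real L)\<^sup>2 * beam_mass K n) * (\<integral>\<^sup>+s. ennreal (?A s) * indicator ?I s \<partial>lborel)
      + ennreal (equatorial n) * (\<integral>\<^sup>+s. ennreal (?R s) * indicator ?I s \<partial>lborel))"
    by (simp add: nn_integral_cmult nn_integral_add)
  also have "\<dots> \<le> ennreal (48 * m\<^sup>2 * ?c) * (ennreal ((real L)\<^sup>2 * beam_mass K n) * ennreal Q + ennreal (equatorial n) * ennreal (CR 0))"
    by (intro mult_left_mono add_mono amp rho_integral) auto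
  also have "\<dots> = ennreal (48 * m\<^sup>2 * ?c * ((real L)\<^sup>2 * beam_mass K n * Q + equatorial n * CR 0))"
    using J a Q by (simp add: ennreal_mult ennreal_plus add_nonneg_nonneg mult_nonneg_nonneg)
  finally show ?thesis .
qed

text \<open>The error term stands on the right to avoid a subtraction of extended reals. The
  pointwise lower bound, restricted to the shell 3m \<le> r \<le> 3m + \<eta> and to Z near 1, may
  be negative; cutting it off at 0 is harmless in this direction. 27 m^2 is the least value of 3 s^2
  on the shell.\<close>

lemma late_energy_ge:
  assumes \<eta>: "0 < \<eta>" "\<eta> \<le> m / 2" and amp: "\<And>r. r \<in> {3 * m..3 * m + \<eta>} \<Longrightarrow> q \<le> (amp \<delta> (on_slice \<tau> r))\<^sup>2"
    and q: "q \<ge> 0" and \<epsilon>: "\<epsilon> \<le> 1/2"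
    and near: "\<And>x. norm x \<in> {3 * m..3 * m + \<eta>} \<Longrightarrow> norm (planar x / of_real (norm x) * cis (twist \<alpha> \<tau> (norm x)) - 1) < \<epsilon> \<Longrightarrow> slice_chart m \<tau> x \<in> A"
    and conc: "beam_mass K n \<le> 2 * (\<integral>\<omega>. beam_weight K n (planar \<omega>) * indicator {\<omega>. norm (planar \<omega> - 1) < \<epsilon>} \<omega> \<partial>sphere_measure)"
    and R: "CR \<tau> \<ge> 0"
  defines "c1 \<equiv> w0\<^sup>2 / (16 * beam_const\<^sup>2)"
  shows "ennreal (27 * m\<^sup>2 * (c1 * (real L)\<^sup>2 * q * beam_mass K n / 2) * \<eta>) \<le> energy m \<tau> A u + ennreal (27 * m\<^sup>2 * (equatorial n / 2 * CR \<tau>))"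
proof -
  let ?I = "{5 * m / 2..7 * m / 2}" and ?J = "{3 * m..3 * m + \<eta>}"
  let ?A = "\<lambda>s. (amp \<delta> (on_slice \<tau> s))\<^sup>2" and ?R = "\<lambda>s. (\<rho> (on_slice \<tau> s))\<^sup>2"
  have c1: "c1 \<ge> 0" by (simp add: c1_def)
  have JI: "?J \<subseteq> ?I" using \<eta> m by auto
  have a: "equatorial n \<ge> 0" using equatorial_pos[of n] by simp
  have J: "beam_mass K n \<ge> 0" by (intro integral_nonneg_AE AE_I2 beam_weight_nonneg)
  define \<kappa> where "\<kappa> = c1 * (real L)\<^sup>2 * q"
  have k0: "\<kappa> \<ge> 0" using c1 q by (simp add: \<kappa>_def)
  let ?B = "{Z::complex. norm (Z - 1) < \<epsilon>}"
  have B [measurable]: "?B \<in> sets borel" by measurable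
  define f where "f s Z = \<kappa> * (beam_weight K n Z * indicator ?B Z) - ?R s / 2 * norm Z ^ (2 * n)" for s Z
  define F where "F s Z = ennreal (f s Z) * indicator ?J s" for s :: real and Z :: complex
  define M where "M s = \<kappa> * beam_mass K n / 2 - ?R s / 2 * equatorial n" for s
  have Mm [measurable]: "M \<in> borel_measurable borel" unfolding M_def[abs_def] by measurable
  have "(\<integral>\<^sup>+s. ennreal (27 * m\<^sup>2) * (ennreal (M s) * indicator ?J s) \<partial>lborel)
     \<le> (\<integral>\<^sup>+s. (\<integral>\<^sup>+\<omega>. F s (planar \<omega>) \<partial>sphere_measure) * ennreal (3 * s\<^sup>2) * indicator {0<..} s \<partial>lborel)"
  proof (rule nn_integral_mono)
    fix s :: real
    show "ennreal (27 * m\<^sup>2) * (ennreal (M s) * indicator ?J s) \<le> (\<integral>\<^sup>+\<omega>. F s (planar \<omega>) \<partial>sphere_measure) * ennreal (3 * s\<^sup>2) * indicator {0<..} s"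
    proof (cases "s \<in> ?J")
      case True
      have int: "integrable sphere_measure (\<lambda>\<omega>. f s (planar \<omega>))"
        unfolding f_def using integrable_beam_weight_indicator[of K n \<epsilon>] integrable_equatorial[of n]
        by (intro Bochner_Integration.integrable_diff integrable_mult_right) (auto simp: indicator_def)
      have "(\<integral>\<omega>. f s (planar \<omega>) \<partial>sphere_measure) = \<kappa> * (\<integral>\<omega>. beam_weight K n (planar \<omega>) * indicator {\<omega>. norm (planar \<omega> - 1) < \<epsilon>} \<omega> \<partial>sphere_measure) - ?R s / 2 * equatorial n"
      proof -
        have "(\<lambda>\<omega>. f s (planar \<omega>)) = (\<lambda>\<omega>. \<kappa> * (beam_weight K n (planar \<omega>) * indicator {\<omega>. norm (planar \<omega> - 1) < \<epsilon>} \<omega>) - ?R s / 2 * norm (planar \<omega>) ^ (2 * n))"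
          by (auto simp: f_def fun_eq_iff indicator_def)
        then show ?thesis
          by (simp add: Bochner_Integration.integral_diff integrable_beam_weight_indicator integrable_equatorial equatorial_def)
      qed
      moreover have "\<kappa> * (beam_mass K n / 2) \<le> \<kappa> * (\<integral>\<omega>. beam_weight K n (planar \<omega>) * indicator {\<omega>. norm (planar \<omega> - 1) < \<epsilon>} \<omega> \<partial>sphere_measure)"
        using conc by (intro mult_left_mono k0) simp
      ultimately have "M s \<le> (\<integral>\<omega>. f s (planar \<omega>) \<partial>sphere_measure)" by (simp add: M_def)
      then have lo: "ennreal (M s) \<le> (\<integral>\<^sup>+\<omega>. ennreal (f s (planar \<omega>)) \<partial>sphere_measure)"
        using ennreal_integral_le_nn_integral[OF int] order_trans[OF ennreal_leI] by blast
      have sm: "27 * m\<^sup>2 \<le> 3 * s\<^sup>2"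
      proof -
        have "(3 * m)\<^sup>2 \<le> s\<^sup>2" using True m by (intro power_mono) auto
        then show ?thesis by (simp add: power_mult_distrib)
      qed
      have "ennreal (M s) * ennreal (27 * m\<^sup>2) \<le> (\<integral>\<^sup>+\<omega>. ennreal (f s (planar \<omega>)) \<partial>sphere_measure) * ennreal (3 * s\<^sup>2)"
        by (rule mult_mono[OF lo ennreal_leI[OF sm]]) auto
      moreover have "s > 0" using True m by auto
      ultimately show ?thesis using True by (simp add: F_def mult.commute)
    qed simp
  qed
  also have "\<dots> = (\<integral>\<^sup>+x. F (norm x) (planar x / of_real (norm x) * cis (twist \<alpha> \<tau> (norm x))) \<partial>lborel)"
  proof (rule nn_integral_rotated[symmetric])
    show "(\<lambda>x::real^3. F (norm x) (planar x / of_real (norm x) * cis (twist \<alpha> \<tau> (norm x)))) \<in> borel_measurable borel"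
      unfolding F_def f_def by measurable
    show "F s \<in> borel_measurable borel" for s unfolding F_def[abs_def] f_def[abs_def] by measurable
  qed
  also have "\<dots> \<le> energy m \<tau> A u"
    unfolding energy_eq
  proof (rule nn_integral_mono)
    fix x :: "real^3"
    define Z where "Z = planar x / of_real (norm x) * cis (twist \<alpha> \<tau> (norm x))"
    show "F (norm x) (planar x / of_real (norm x) * cis (twist \<alpha> \<tau> (norm x))) \<le> ennreal (slice_stress \<tau> x) * indicator {x. norm x > 2 * m \<and> slice_chart m \<tau> x \<in> A} x"
      unfolding Z_def[symmetric]
    proof (cases "norm x \<in> ?J \<and> norm (Z - 1) < \<epsilon>")
      case True
      then have xI: "norm x \<in> ?I" and xA: "norm x > 2 * m" "slice_chart m \<tau> x \<in> A"
        using JI near[of x] m unfolding Z_def by auto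
      have h: "norm Z \<ge> 1/2" using True \<epsilon> norm_triangle_ineq3[of Z 1] by (auto simp: norm_minus_commute abs_le_iff)
      have "f (norm x) Z \<le> slice_stress \<tau> x"
      proof -
        have "\<kappa> * beam_weight K n Z \<le> c1 * ((real L)\<^sup>2 * ?A (norm x) * beam_weight K n Z)"
        proof -
          have "(c1 * (real L)\<^sup>2 * beam_weight K n Z) * q \<le> (c1 * (real L)\<^sup>2 * beam_weight K n Z) * ?A (norm x)"
            using amp[of "norm x"] True c1 beam_weight_nonneg[of K n Z] by (intro mult_left_mono) auto
          then show ?thesis by (simp add: \<kappa>_def mult_ac)
        qed
        then show ?thesis using beam_bounds(2)[OF xI, of \<tau>, folded Z_def, OF h] True unfolding f_def c1_def by simp
      qed
      then show "F (norm x) Z \<le> ennreal (slice_stress \<tau> x) * indicator {x. norm x > 2 * m \<and> slice_chart m \<tau> x \<in> A} x"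
        using True xA by (simp add: F_def ennreal_leI)
    next
      case False
      have "F (norm x) Z = 0"
      proof (cases "norm x \<in> ?J")
        case True
        then have "f (norm x) Z \<le> 0" using False by (auto simp: f_def)
        then show ?thesis by (simp add: F_def ennreal_neg)
      qed (simp add: F_def)
      then show "F (norm x) Z \<le> ennreal (slice_stress \<tau> x) * indicator {x. norm x > 2 * m \<and> slice_chart m \<tau> x \<in> A} x" by simp
    qed
  qed
  finally have E: "(\<integral>\<^sup>+s. ennreal (27 * m\<^sup>2) * (ennreal (M s) * indicator ?J s) \<partial>lborel) \<le> energy m \<tau> A u" .
  have "ennreal (27 * m\<^sup>2 * (\<kappa> * beam_mass K n / 2) * \<eta>) = (\<integral>\<^sup>+s. ennreal (27 * m\<^sup>2 * (\<kappa> * beam_mass K n / 2)) * indicator ?J s \<partial>lborel)"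
  proof -
    have X0: "0 \<le> 27 * m\<^sup>2 * (\<kappa> * beam_mass K n / 2)" using k0 J by simp
    show ?thesis unfolding ennreal_mult[OF X0 less_imp_le[OF \<eta>(1)]] using \<eta> by (simp add: nn_integral_cmult_indicator)
  qed
  also have "\<dots> \<le> (\<integral>\<^sup>+s. ennreal (27 * m\<^sup>2) * (ennreal (M s) * indicator ?J s) + ennreal (27 * m\<^sup>2 * (equatorial n / 2)) * (ennreal (?R s) * indicator ?I s) \<partial>lborel)"
  proof (rule nn_integral_mono)
    fix s :: real
    show "ennreal (27 * m\<^sup>2 * (\<kappa> * beam_mass K n / 2)) * indicator ?J s
      \<le> ennreal (27 * m\<^sup>2) * (ennreal (M s) * indicator ?J s) + ennreal (27 * m\<^sup>2 * (equatorial n / 2)) * (ennreal (?R s) * indicator ?I s)"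
    proof (cases "s \<in> ?J")
      case True
      have le: "27 * m\<^sup>2 * (\<kappa> * beam_mass K n / 2) \<le> 27 * m\<^sup>2 * max 0 (M s) + 27 * m\<^sup>2 * (equatorial n / 2) * ?R s"
      proof -
        have "27 * m\<^sup>2 * (\<kappa> * beam_mass K n / 2) = 27 * m\<^sup>2 * M s + 27 * m\<^sup>2 * (equatorial n / 2) * ?R s" by (simp add: M_def algebra_simps)
        moreover have "27 * m\<^sup>2 * M s \<le> 27 * m\<^sup>2 * max 0 (M s)" by (intro mult_left_mono) auto
        ultimately show ?thesis by linarith
      qed
      have "ennreal (27 * m\<^sup>2 * (\<kappa> * beam_mass K n / 2)) \<le> ennreal (27 * m\<^sup>2 * max 0 (M s) + 27 * m\<^sup>2 * (equatorial n / 2) * ?R s)"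
        by (rule ennreal_leI[OF le])
      also have "\<dots> = ennreal (27 * m\<^sup>2) * ennreal (max 0 (M s)) + ennreal (27 * m\<^sup>2 * (equatorial n / 2)) * ennreal (?R s)"
      proof -
        have "0 \<le> 27 * m\<^sup>2" "0 \<le> max 0 (M s)" "0 \<le> 27 * m\<^sup>2 * (equatorial n / 2)" "0 \<le> ?R s" using a by auto
        then show ?thesis by (simp only: ennreal_plus ennreal_mult mult_nonneg_nonneg)
      qed
      also have "ennreal (max 0 (M s)) = ennreal (M s)" by (simp add: max_def ennreal_neg)
      finally show ?thesis using True JI by auto
    qed simp
  qed
  also have "\<dots> = (\<integral>\<^sup>+s. ennreal (27 * m\<^sup>2) * (ennreal (M s) * indicator ?J s) \<partial>lborel) + ennreal (27 * m\<^sup>2 * (equatorial n / 2)) * (\<integral>\<^sup>+s. ennreal (?R s) * indicator ?I s \<partial>lborel)"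
    by (simp add: nn_integral_add nn_integral_cmult)
  also have "\<dots> \<le> energy m \<tau> A u + ennreal (27 * m\<^sup>2 * (equatorial n / 2)) * ennreal (CR \<tau>)"
    by (intro add_mono mult_left_mono E rho_integral) auto
  also have "ennreal (27 * m\<^sup>2 * (equatorial n / 2)) * ennreal (CR \<tau>) = ennreal (27 * m\<^sup>2 * (equatorial n / 2 * CR \<tau>))"
    using a R by (simp add: ennreal_mult[symmetric] mult_ac)
  finally show ?thesis unfolding \<kappa>_def .
qed

end

end

section \<open>Localisation at the geodesic and persistence of the energy\<close>

context wkb
begin

text \<open>The height over the equatorial plane is governed by |Z|, since (x $ 3)^2 = r^2 (1 -
  |Z|^2). Longitude and radius follow by continuity at r = 3m, where the choice of \<alpha>
  compensates the time shift 2m ln m between the phase and the geodesic.\<close>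

lemma near_geodesic:
  assumes \<epsilon>0: "\<epsilon>0 > 0" and \<alpha>: "\<alpha> = w0 * (2 * m * ln m)"
  shows "\<exists>\<epsilon> \<eta>0. 0 < \<epsilon> \<and> \<epsilon> \<le> 1/2 \<and> 0 < \<eta>0 \<and> (\<forall>x. norm x \<in> {3 * m..3 * m + \<eta>0} \<longrightarrow>
     norm (planar x / of_real (norm x) * cis (twist \<alpha> \<tau> (norm x)) - 1) < \<epsilon> \<longrightarrow> dist (slice_chart m \<tau> x) (photon_geodesic m \<tau>) < \<epsilon>0)"
proof -
  define \<theta> where "\<theta> = w0 * (\<tau> - 2 * m * ln m)"
  have "(27 * m\<^sup>2) powr (-1/2) = w0"
  proof -
    have "(27 * m\<^sup>2) powr (-1/2) = inverse (sqrt (27 * m\<^sup>2))" using m by (simp add: powr_minus powr_half_sqrt)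
    also have "\<dots> = w0" using m by (simp add: real_sqrt_mult orbit_freq_def divide_inverse)
    finally show ?thesis .
  qed
  then have gam: "photon_geodesic m \<tau> = vector [\<tau> - 2 * m * ln m, 3 * m * cos \<theta>, 3 * m * sin \<theta>, 0]"
    by (simp add: photon_geodesic_def spherical_def \<theta>_def)
  define f1 where "f1 r = 2 * m * ln (r - 2 * m)" for r
  define f2 where "f2 r = complex_of_real r * cis (- twist \<alpha> \<tau> r)" for r
  define e where "e = \<epsilon>0 / 12"
  have e0: "e > 0" using \<epsilon>0 by (simp add: e_def)
  have ct: "isCont (tortoise m) (3 * m)" using m by (intro DERIV_isCont[OF tortoise_derivative]) auto
  have t0: "tortoise m (3 * m) = 0" using m by (simp add: tortoise_def)
  have cS: "isCont (\<lambda>r. S0 (tortoise m r)) (3 * m)" by (rule isCont_o2[OF ct DERIV_isCont[OF dS0]])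
  have "isCont f1 (3 * m)" unfolding f1_def[abs_def] using m by (intro continuous_intros) auto
  then obtain d1 where d1: "d1 > 0" "\<And>r. dist r (3 * m) < d1 \<Longrightarrow> dist (f1 r) (f1 (3 * m)) < e"
    unfolding continuous_at_eps_delta using e0 by blast
  have "isCont (\<lambda>r. cis (- twist \<alpha> \<tau> r)) (3 * m)"
  proof (rule isCont_o2[where g=cis])
    show "isCont (\<lambda>r. - twist \<alpha> \<tau> r) (3 * m)"
      unfolding twist_def phase_def on_slice_def fst_conv snd_conv by (intro continuous_intros ct cS)
    show "isCont cis (- twist \<alpha> \<tau> (3 * m))" by (rule has_derivative_continuous[OF has_derivative_cis])
  qed
  then have "isCont f2 (3 * m)" unfolding f2_def[abs_def] by (intro continuous_intros)
  then obtain d2 where d2: "d2 > 0" "\<And>r. dist r (3 * m) < d2 \<Longrightarrow> dist (f2 r) (f2 (3 * m)) < e"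
    unfolding continuous_at_eps_delta using e0 by blast
  have f13: "f1 (3 * m) = 2 * m * ln m" by (simp add: f1_def)
  have "- twist \<alpha> \<tau> (3 * m) = \<theta>"
    unfolding twist_def phase_def on_slice_def t0 fst_conv snd_conv S00 \<alpha> \<theta>_def by (simp add: algebra_simps)
  then have f23: "f2 (3 * m) = of_real (3 * m) * cis \<theta>" by (simp add: f2_def)
  \<comment> \<open>The angular tolerance. As 1 - |Z|^2 is at most 2 \<epsilon>, the height is of
    the order of the root of \<epsilon>, which is why \<epsilon> is set to s^2/2 below.\<close>
  define s where "s = min 1 (\<epsilon>0 / (32 * m))"
  have s: "0 < s" "s \<le> 1" "8 * m * s \<le> \<epsilon>0 / 4"
  proof -
    show "0 < s" "s \<le> 1" using \<epsilon>0 m by (auto simp: s_def)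
    have "s \<le> \<epsilon>0 / (32 * m)" by (simp add: s_def)
    then show "8 * m * s \<le> \<epsilon>0 / 4" using m by (simp add: field_simps)
  qed
  have ss: "s\<^sup>2 \<le> s" using s mult_left_mono[of s 1 s] by (simp add: power2_eq_square)
  define \<epsilon> where "\<epsilon> = s\<^sup>2 / 2"
  define \<eta>0 where "\<eta>0 = min (min d1 d2 / 2) m"
  have eta: "\<eta>0 > 0" "\<eta>0 < d1" "\<eta>0 < d2" "\<eta>0 \<le> m" using d1 d2 m by (auto simp: \<eta>0_def)
  have main: "dist (slice_chart m \<tau> x) (photon_geodesic m \<tau>) < \<epsilon>0"
    if x: "norm x \<in> {3 * m..3 * m + \<eta>0}" and Zn: "norm (planar x / of_real (norm x) * cis (twist \<alpha> \<tau> (norm x)) - 1) < \<epsilon>" for x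
  proof -
    define r where "r = norm x"
    define \<psi> where "\<psi> = twist \<alpha> \<tau> r"
    define Z where "Z = planar x / of_real r"
    have r: "0 < r" "r \<le> 4 * m" "dist r (3 * m) < d1" "dist r (3 * m) < d2" using x eta m by (auto simp: r_def dist_real_def)
    have Zn': "norm (Z * cis \<psi> - 1) < \<epsilon>" using Zn by (simp add: Z_def \<psi>_def r_def)
    have px: "planar x = of_real r * Z" using r by (simp add: Z_def)
    have "norm (planar x - f2 r) = r * norm (Z - cis (- \<psi>))"
      unfolding px f2_def \<psi>_def[symmetric] right_diff_distrib[symmetric] using r by (simp add: norm_mult)
    also have "norm (Z - cis (- \<psi>)) = norm ((Z - cis (- \<psi>)) * cis \<psi>)" by (simp add: norm_mult)
    also have "(Z - cis (- \<psi>)) * cis \<psi> = Z * cis \<psi> - 1" by (simp add: left_diff_distrib cis_mult)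
    also have "r * norm (Z * cis \<psi> - 1) \<le> 4 * m * \<epsilon>" using r Zn' by (intro mult_mono) auto
    finally have 1: "norm (planar x - f2 r) \<le> 4 * m * \<epsilon>" .
    have 2: "norm (f2 r - f2 (3 * m)) < e" using d2(2)[OF r(4)] by (simp add: dist_norm)
    have 3: "norm (planar x - f2 (3 * m)) < 4 * m * \<epsilon> + e"
      using norm_triangle_ineq[of "planar x - f2 r" "f2 r - f2 (3 * m)"] 1 2 by simp
    have re: "\<bar>x $ 1 - 3 * m * cos \<theta>\<bar> < 4 * m * \<epsilon> + e" "\<bar>x $ 2 - 3 * m * sin \<theta>\<bar> < 4 * m * \<epsilon> + e"
      using le_less_trans[OF abs_Re_le_cmod 3] le_less_trans[OF abs_Im_le_cmod 3] unfolding f23 by (simp_all add: planar_def)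
    have 4: "\<bar>x $ 3\<bar> \<le> 4 * m * s"
    proof -
      have "norm Z \<ge> 1 - \<epsilon>"
        using norm_triangle_ineq2[of 1 "1 - Z * cis \<psi>"] Zn' by (simp add: norm_minus_commute norm_mult)
      moreover have "1 - \<epsilon> \<ge> 0" using ss s by (simp add: \<epsilon>_def)
      ultimately have "(1 - \<epsilon>)\<^sup>2 \<le> (norm Z)\<^sup>2" by (intro power_mono)
      then have z2: "1 - (norm Z)\<^sup>2 \<le> s\<^sup>2" by (simp add: power2_eq_square \<epsilon>_def algebra_simps) (use zero_le_square[of "s * s"] in linarith)
      have "r\<^sup>2 = (x $ 1)\<^sup>2 + (x $ 2)\<^sup>2 + (x $ 3)\<^sup>2"
        unfolding r_def norm_vec_def L2_set_def by (simp add: sum_3)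
      moreover have "(norm (planar x))\<^sup>2 = (x $ 1)\<^sup>2 + (x $ 2)\<^sup>2" by (simp add: planar_def cmod_power2)
      moreover have "(norm (planar x))\<^sup>2 = r\<^sup>2 * (norm Z)\<^sup>2" unfolding px by (simp add: norm_mult power_mult_distrib)
      ultimately have "(x $ 3)\<^sup>2 = r\<^sup>2 * (1 - (norm Z)\<^sup>2)" by (simp add: algebra_simps)
      also have "\<dots> \<le> r\<^sup>2 * s\<^sup>2" by (intro mult_left_mono z2) simp
      finally have "(x $ 3)\<^sup>2 \<le> (r * s)\<^sup>2" by (simp only: power_mult_distrib)
      then have "\<bar>x $ 3\<bar> \<le> \<bar>r * s\<bar>" by (simp only: abs_le_square_iff)
      also have "\<bar>r * s\<bar> = r * s" using r s by simp
      also have "\<dots> \<le> 4 * m * s" using r s by (intro mult_right_mono) auto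
      finally show ?thesis .
    qed
    have 5: "\<bar>2 * m * ln (r - 2 * m) - 2 * m * ln m\<bar> < e" using d1(2)[OF r(3)] unfolding f13 by (simp add: f1_def dist_real_def)
    have "dist (slice_chart m \<tau> x) (photon_geodesic m \<tau>) \<le> (\<Sum>i\<in>UNIV. \<bar>(slice_chart m \<tau> x - photon_geodesic m \<tau>) $ i\<bar>)"
      unfolding dist_norm by (rule norm_le_l1_cart)
    also have "\<dots> = \<bar>2 * m * ln (r - 2 * m) - 2 * m * ln m\<bar> + \<bar>x $ 1 - 3 * m * cos \<theta>\<bar> + \<bar>x $ 2 - 3 * m * sin \<theta>\<bar> + \<bar>x $ 3\<bar>"
      unfolding sum_4 gam slice_chart_def by (simp add: vector_4 r_def abs_minus_commute)
    also have "\<dots> < e + (4 * m * \<epsilon> + e) + (4 * m * \<epsilon> + e) + 4 * m * s"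
      using 4 5 re by linarith
    also have "\<dots> \<le> \<epsilon>0"
    proof -
      have "4 * m * \<epsilon> + 4 * m * \<epsilon> = 4 * m * s\<^sup>2" by (simp add: \<epsilon>_def)
      also have "\<dots> \<le> 4 * m * s" using ss m by (intro mult_left_mono) auto
      finally show ?thesis using s(3) \<epsilon>0 unfolding e_def by linarith
    qed
    finally show ?thesis .
  qed
  show ?thesis
    by (rule exI[of _ \<epsilon>], rule exI[of _ \<eta>0]) (use main eta s ss in \<open>auto simp: \<epsilon>_def\<close>)
qed

text \<open>The order of choices: \<kappa> comes from the constants of the amplitude profile, hence
  before \<tau>; \<epsilon> and \<eta>0 come from the neighbourhood at time \<tau>, K from
  \<epsilon>, \<delta> from \<eta>0, and n is last. The main terms are of the form L^2 J \<delta>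
  and the errors multiples of \<open>equatorial n\<close> \<le> C J, so a large L makes the errors
  negligible.\<close>

theorem energy_persists:
  assumes G: "continuous_on UNIV G" and zG: "\<And>x. z x = (areal m x - 3 * m) * exp (G x)"
    and T: "openin (top_of_set (DoD m)) \<T>" "photon_geodesic m ` {0..} \<subseteq> \<T>"
  shows "\<exists>\<kappa>>0. \<forall>\<tau>\<ge>0. \<exists>u. wave_solution m u \<and>
     \<not> energy m \<tau> (\<T> \<inter> Sigma_slice m \<tau>) u \<le> ennreal \<kappa> * energy m 0 (Sigma_slice m 0) u"
proof -
  obtain ca Ca where ca: "0 < ca" "0 < Ca" and prof: "\<forall>\<tau>\<ge>0. \<forall>\<epsilon>>0. \<exists>\<delta>0>0. \<forall>\<delta>. 0 < \<delta> \<longrightarrow> \<delta> \<le> \<delta>0 \<longrightarrow>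
    (\<exists>\<eta>. 0 < \<eta> \<and> \<eta> \<le> \<epsilon> \<and> \<eta> \<le> m / 2 \<and> (\<forall>r\<in>{3 * m..3 * m + \<eta>}. ca * \<delta> / \<eta> \<le> (amp \<delta> (on_slice \<tau> r))\<^sup>2)) \<and>
    (\<integral>\<^sup>+r. ennreal ((amp \<delta> (on_slice 0 r))\<^sup>2) * indicator {5 * m / 2..7 * m / 2} r \<partial>lborel) \<le> ennreal (Ca * \<delta>)"
    using amplitude_profile[OF G zG] by (elim exE conjE) (rule that; assumption)
  define c1 where "c1 = w0\<^sup>2 / (16 * beam_const\<^sup>2)"
  define N0 where "N0 = 48 * m\<^sup>2 * (400 * beam_const\<^sup>2)"
  have pos: "c1 > 0" "N0 > 0" using w0_pos beam_const_pos m by (simp_all add: c1_def N0_def)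
  \<comment> \<open>A quarter of the ratio of the lower to the upper constant. As the lower bound
    carries a factor 1/2, the main term at time \<tau> is twice \<kappa> times the initial main
    term.\<close>
  define \<kappa> where "\<kappa> = 27 * m\<^sup>2 * c1 * ca / (4 * N0 * Ca)"
  have k0: "\<kappa> > 0" using pos ca m by (simp add: \<kappa>_def)
  have kN: "\<kappa> * N0 * Ca = 27 * m\<^sup>2 * c1 * ca / 4" using pos ca by (simp add: \<kappa>_def)
  show ?thesis
  proof (rule exI[of _ \<kappa>], intro conjI k0 allI impI)
    fix \<tau> :: real assume \<tau>: "\<tau> \<ge> 0"
    define \<alpha> where "\<alpha> = w0 * (2 * m * ln m)"
    have "photon_geodesic m \<tau> \<in> \<T>" using T(2) \<tau> by auto
    then obtain \<epsilon>0 where e0: "\<epsilon>0 > 0" and inT: "\<And>p. p \<in> DoD m \<Longrightarrow> dist p (photon_geodesic m \<tau>) < \<epsilon>0 \<Longrightarrow> p \<in> \<T>"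
      using T(1) unfolding openin_euclidean_subtopology_iff by blast
    obtain \<epsilon> \<eta>0 where eps: "0 < \<epsilon>" "\<epsilon> \<le> 1/2" and eta0: "0 < \<eta>0" and near: "\<And>x. norm x \<in> {3 * m..3 * m + \<eta>0} \<Longrightarrow>
       norm (planar x / of_real (norm x) * cis (twist \<alpha> \<tau> (norm x)) - 1) < \<epsilon> \<Longrightarrow> dist (slice_chart m \<tau> x) (photon_geodesic m \<tau>) < \<epsilon>0"
      using near_geodesic[OF e0 \<alpha>_def, of \<tau>] by (elim exE conjE) (rule that; blast)
    have e1: "\<epsilon> \<le> 1" using eps by simp
    obtain K C where C: "C > 0" and conc: "\<forall>\<^sub>F n in sequentially.
        beam_mass K n \<le> 2 * (\<integral>\<omega>. beam_weight K n (planar \<omega>) * indicator {\<omega>. norm (planar \<omega> - 1) < \<epsilon>} \<omega> \<partial>sphere_measure) \<and>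
        equatorial n \<le> C * beam_mass K n"
      using angular_concentration[OF eps(1) e1] by blast
    have "\<exists>\<delta>0>0. \<forall>\<delta>. 0 < \<delta> \<longrightarrow> \<delta> \<le> \<delta>0 \<longrightarrow>
      (\<exists>\<eta>. 0 < \<eta> \<and> \<eta> \<le> \<eta>0 \<and> \<eta> \<le> m / 2 \<and> (\<forall>r\<in>{3 * m..3 * m + \<eta>}. ca * \<delta> / \<eta> \<le> (amp \<delta> (on_slice \<tau> r))\<^sup>2)) \<and>
      (\<integral>\<^sup>+r. ennreal ((amp \<delta> (on_slice 0 r))\<^sup>2) * indicator {5 * m / 2..7 * m / 2} r \<partial>lborel) \<le> ennreal (Ca * \<delta>)"
      by (rule prof[THEN spec, THEN mp, OF \<tau>, THEN spec, THEN mp, OF eta0])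
    then obtain \<delta>0 where d0: "\<delta>0 > 0" and prof': "\<forall>\<delta>. 0 < \<delta> \<longrightarrow> \<delta> \<le> \<delta>0 \<longrightarrow>
      (\<exists>\<eta>. 0 < \<eta> \<and> \<eta> \<le> \<eta>0 \<and> \<eta> \<le> m / 2 \<and> (\<forall>r\<in>{3 * m..3 * m + \<eta>}. ca * \<delta> / \<eta> \<le> (amp \<delta> (on_slice \<tau> r))\<^sup>2)) \<and>
      (\<integral>\<^sup>+r. ennreal ((amp \<delta> (on_slice 0 r))\<^sup>2) * indicator {5 * m / 2..7 * m / 2} r \<partial>lborel) \<le> ennreal (Ca * \<delta>)"
      by (elim exE conjE) (rule that; assumption)
    define x1 where "x1 = m / 4"
    have x1: "0 < x1" "x1 \<le> m / 4" using m by (simp_all add: x1_def)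
    have zinc: "z a < z b" if "a < b" for a b
    proof (rule DERIV_pos_imp_increasing[OF that])
      fix x show "\<exists>y. (z has_real_derivative y) (at x) \<and> 0 < y"
        using dz[of x] Bpos[of x] by (intro exI[of _ "(B x)\<^sup>2"]) simp
    qed
    define \<delta> where "\<delta> = min \<delta>0 (min (z x1) (- z (- x1)))"
    have d: "0 < \<delta>" "\<delta> \<le> min (z x1) (- z (- x1))" "\<delta> \<le> \<delta>0"
      using d0 zinc[of 0 x1] zinc[of "- x1" 0] x1 z0 by (auto simp: \<delta>_def)
    obtain \<eta> where eta: "0 < \<eta>" "\<eta> \<le> \<eta>0" "\<eta> \<le> m / 2" and lowamp: "\<And>r. r \<in> {3 * m..3 * m + \<eta>} \<Longrightarrow> ca * \<delta> / \<eta> \<le> (amp \<delta> (on_slice \<tau> r))\<^sup>2"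
      and upamp: "(\<integral>\<^sup>+r. ennreal ((amp \<delta> (on_slice 0 r))\<^sup>2) * indicator {5 * m / 2..7 * m / 2} r \<partial>lborel) \<le> ennreal (Ca * \<delta>)"
      using prof'[THEN spec, THEN mp, OF d(1), THEN mp, OF d(3)] by (elim exE conjE) (rule that; blast)
    obtain CR0 where CR0: "\<And>L. L \<ge> 1 \<Longrightarrow> \<exists>u \<rho>. is_beam K \<alpha> \<delta> x1 CR0 L u \<rho>"
    proof -
      have "\<exists>CR. \<forall>L\<ge>1. \<exists>u \<rho>. is_beam K \<alpha> \<delta> x1 CR L u \<rho>"
        unfolding is_beam_def by (rule beam_exists[OF x1(1) d(1,2)])
      then show ?thesis using that by blast
    qed
    define CR where "CR s = \<bar>CR0 s\<bar>" for s
    have CR: "\<exists>u \<rho>. is_beam K \<alpha> \<delta> x1 CR L u \<rho>" if L1: "L \<ge> 1" for L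
    proof -
      have le: "ennreal (CR0 s) \<le> ennreal (CR s)" for s unfolding CR_def by (rule ennreal_leI[OF abs_ge_self])
      obtain u \<rho> where "is_beam K \<alpha> \<delta> x1 CR0 L u \<rho>" using CR0[OF L1] by blast
      then have "is_beam K \<alpha> \<delta> x1 CR L u \<rho>" unfolding is_beam_def
        by (elim conjE, intro conjI) (assumption | (intro allI, rule order_trans[OF _ le], erule spec))+
      then show ?thesis by blast
    qed
    define X where "X = \<kappa> * N0 * CR 0 + 27 * m\<^sup>2 * (CR \<tau> / 2)"
    define h where "h = 27 * m\<^sup>2 * c1 * ca * \<delta> / 4"
    have h0: "h > 0" using m pos ca d by (simp add: h_def)
    have X0: "X \<ge> 0" using k0 pos by (simp add: X_def CR_def)
    \<comment> \<open>Since L^2 \<ge> n and \<open>equatorial n\<close> \<le> C J, this size of n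
      makes the surplus h L^2 J exceed the total error X times \<open>equatorial n\<close>.\<close>
    obtain n where big: "X * C / h < real n" and cn: "beam_mass K n \<le> 2 * (\<integral>\<omega>. beam_weight K n (planar \<omega>) * indicator {\<omega>. norm (planar \<omega> - 1) < \<epsilon>} \<omega> \<partial>sphere_measure)"
      and an: "equatorial n \<le> C * beam_mass K n"
    proof -
      have "\<forall>\<^sub>F n in sequentially. X * C / h < real n"
        using filterlim_real_sequentially unfolding filterlim_at_top_dense by blast
      from eventually_happens'[OF sequentially_bot eventually_conj[OF this conc]] show ?thesis using that by blast
    qed
    define L where "L = Suc n"
    obtain u \<rho> where beam: "is_beam K \<alpha> \<delta> x1 CR L u \<rho>" using CR[of L] by (auto simp: L_def)
    define J where "J = beam_mass K n"
    define a where "a = equatorial n"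
    have a0: "a > 0" unfolding a_def by (rule equatorial_pos)
    have J0: "J > 0" using a0 an C unfolding a_def J_def[symmetric] by (meson less_le_trans zero_less_mult_pos)
    have up: "energy m 0 (Sigma_slice m 0) u \<le> ennreal (N0 * ((real L)\<^sup>2 * J * (Ca * \<delta>) + a * CR 0))"
      unfolding N0_def J_def a_def
      by (rule initial_energy_le[OF beam L_def x1 upamp]) (use ca d in \<open>auto simp: CR_def\<close>)
    have low: "ennreal (27 * m\<^sup>2 * (c1 * (real L)\<^sup>2 * (ca * \<delta> / \<eta>) * J / 2) * \<eta>)
       \<le> energy m \<tau> (\<T> \<inter> Sigma_slice m \<tau>) u + ennreal (27 * m\<^sup>2 * (a / 2 * CR \<tau>))"
      unfolding c1_def J_def a_def
    proof (rule late_energy_ge[OF beam L_def x1 eta(1,3) lowamp _ eps(2) _ cn])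
      fix x assume x: "norm x \<in> {3 * m..3 * m + \<eta>}" "norm (planar x / of_real (norm x) * cis (twist \<alpha> \<tau> (norm x)) - 1) < \<epsilon>"
      have ext: "slice_chart m \<tau> x \<in> exterior m" using x(1) m by (intro slice_chart_exterior) auto
      have "slice_chart m \<tau> x \<in> DoD m" by (rule DoD_contains_future[OF m ext]) (simp add: tstar_slice \<tau>)
      moreover have "norm x \<in> {3 * m..3 * m + \<eta>0}" using x(1) eta(2) by auto
      ultimately have "slice_chart m \<tau> x \<in> \<T>" using near[OF _ x(2)] inT by blast
      then show "slice_chart m \<tau> x \<in> \<T> \<inter> Sigma_slice m \<tau>" using ext by (simp add: Sigma_slice_def tstar_slice)
    qed (use ca d eta in \<open>auto simp: CR_def\<close>)
    have "\<not> energy m \<tau> (\<T> \<inter> Sigma_slice m \<tau>) u \<le> ennreal \<kappa> * energy m 0 (Sigma_slice m 0) u"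
    proof
      assume hyp: "energy m \<tau> (\<T> \<inter> Sigma_slice m \<tau>) u \<le> ennreal \<kappa> * energy m 0 (Sigma_slice m 0) u"
      define UA where "UA = \<kappa> * (N0 * ((real L)\<^sup>2 * J * (Ca * \<delta>) + a * CR 0))"
      define UB where "UB = 27 * m\<^sup>2 * (a / 2 * CR \<tau>)"
      have U0: "UA \<ge> 0" "UB \<ge> 0"
      proof -
        have "0 \<le> (real L)\<^sup>2 * J * (Ca * \<delta>) + a * CR 0"
          using J0 ca d a0 by (intro add_nonneg_nonneg mult_nonneg_nonneg) (auto simp: CR_def)
        then show "UA \<ge> 0" unfolding UA_def using k0 pos by (intro mult_nonneg_nonneg) auto
        show "UB \<ge> 0" unfolding UB_def CR_def using a0 by (intro mult_nonneg_nonneg) auto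
      qed
      have "ennreal \<kappa> * energy m 0 (Sigma_slice m 0) u \<le> ennreal \<kappa> * ennreal (N0 * ((real L)\<^sup>2 * J * (Ca * \<delta>) + a * CR 0))"
        by (rule mult_left_mono[OF up]) simp
      also have "\<dots> = ennreal UA" unfolding UA_def by (rule ennreal_mult'[symmetric]) (use k0 in simp)
      finally have E: "energy m \<tau> (\<T> \<inter> Sigma_slice m \<tau>) u \<le> ennreal UA" using hyp by (rule order_trans[rotated])
      have "ennreal (27 * m\<^sup>2 * (c1 * (real L)\<^sup>2 * (ca * \<delta> / \<eta>) * J / 2) * \<eta>) \<le> ennreal UA + ennreal UB"
        using order_trans[OF low add_right_mono[OF E]] unfolding UB_def .
      also have "\<dots> = ennreal (UA + UB)" by (rule ennreal_plus[symmetric, OF U0])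
      finally have "27 * m\<^sup>2 * (c1 * (real L)\<^sup>2 * (ca * \<delta> / \<eta>) * J / 2) * \<eta> \<le> UA + UB"
        using ennreal_le_iff[OF add_nonneg_nonneg[OF U0]] by blast
      moreover have "27 * m\<^sup>2 * (c1 * (real L)\<^sup>2 * (ca * \<delta> / \<eta>) * J / 2) * \<eta> = 2 * (h * (real L)\<^sup>2 * J)"
        using eta by (simp add: h_def)
      moreover have "UA + UB = h * (real L)\<^sup>2 * J + X * a"
      proof -
        have "UA + UB
          = (\<kappa> * N0 * Ca) * \<delta> * ((real L)\<^sup>2 * J) + X * a" by (simp add: UA_def UB_def X_def algebra_simps)
        then show ?thesis unfolding kN by (simp add: h_def)
      qed
      ultimately have "h * (real L)\<^sup>2 * J \<le> X * a" by linarith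
      also have "\<dots> \<le> X * (C * J)" using an X0 unfolding a_def J_def by (intro mult_left_mono)
      finally have "(h * (real L)\<^sup>2) * J \<le> (X * C) * J" by (simp add: mult_ac)
      then have "h * (real L)\<^sup>2 \<le> X * C" using J0 by (simp only: mult_le_cancel_right_pos)
      moreover have "real n \<le> (real L)\<^sup>2" unfolding L_def by (simp add: power2_eq_square algebra_simps)
      then have "h * real n \<le> h * (real L)\<^sup>2" using h0 by (intro mult_left_mono) auto
      moreover have "X * C < h * real n" using big h0 by (simp add: divide_less_eq mult.commute)
      ultimately show False by linarith
    qed
    moreover have "wave_solution m u"
      by (rule exterior_solution_wave_solution[OF beam[unfolded is_beam_def, THEN conjunct1]])
    ultimately show "\<exists>u. wave_solution m u \<and> \<not> energy m \<tau> (\<T> \<inter> Sigma_slice m \<tau>) u \<le> ennreal \<kappa> * energy m 0 (Sigma_slice m 0) u"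
      by blast
  qed
qed

end

text \<open>A rate tending to 0 drops below the persistent fraction \<kappa> at some \<tau> \<ge> 0,
  and the solution whose energy persists until that \<tau> violates the bound.\<close>

theorem mainTheorem9:
  fixes m :: real and \<T> :: "(real^4) set"
  assumes "m > 0"
    and "openin (top_of_set (DoD m)) \<T>"
    and "photon_geodesic m ` {0..} \<subseteq> \<T>"
  shows "\<not> (\<exists>P :: real \<Rightarrow> real.
            (\<forall>\<tau>\<ge>0. P \<tau> > 0) \<and> (P \<longlongrightarrow> 0) at_top \<and>
            (\<forall>u. wave_solution m u \<longrightarrow>
               (\<forall>\<tau>\<ge>0. energy m \<tau> (\<T> \<inter> Sigma_slice m \<tau>) u
                        \<le> ennreal (P \<tau>) * energy m 0 (Sigma_slice m 0) u)))"
proof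
  assume "\<exists>P :: real \<Rightarrow> real.
            (\<forall>\<tau>\<ge>0. P \<tau> > 0) \<and> (P \<longlongrightarrow> 0) at_top \<and>
            (\<forall>u. wave_solution m u \<longrightarrow>
               (\<forall>\<tau>\<ge>0. energy m \<tau> (\<T> \<inter> Sigma_slice m \<tau>) u
                        \<le> ennreal (P \<tau>) * energy m 0 (Sigma_slice m 0) u))"
  then obtain P :: "real \<Rightarrow> real" where P: "(P \<longlongrightarrow> 0) at_top"
    and decay: "\<And>u \<tau>. wave_solution m u \<Longrightarrow> \<tau> \<ge> 0 \<Longrightarrow>
       energy m \<tau> (\<T> \<inter> Sigma_slice m \<tau>) u \<le> ennreal (P \<tau>) * energy m 0 (Sigma_slice m 0) u"
    by blast
  obtain z B where H: "(\<forall>k. Cdiff k UNIV z) \<and> (\<forall>k. Cdiff k UNIV B) \<and> z 0 = 0 \<and> (\<forall>x. B x > 0) \<and>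
     (\<forall>x. (z has_real_derivative (B x)\<^sup>2) (at x)) \<and> (\<forall>x. ray_speed m x * (B x)\<^sup>2 = orbit_freq m * z x) \<and>
     (\<exists>G. continuous_on UNIV G \<and> (\<forall>x. z x = (areal m x - 3 * m) * exp (G x)))"
    using linearising_coordinate_exists[OF assms(1)] by (elim exE) (rule that)
  note H2 = H[THEN conjunct2] note H3 = H2[THEN conjunct2] note H4 = H3[THEN conjunct2]
  note H5 = H4[THEN conjunct2] note H6 = H5[THEN conjunct2]
  note z = H[THEN conjunct1, THEN spec] H2[THEN conjunct1, THEN spec] H3[THEN conjunct1] H4[THEN conjunct1, THEN spec]
    H5[THEN conjunct1, THEN spec] H6[THEN conjunct1, THEN spec]
  obtain G where G0: "continuous_on UNIV G \<and> (\<forall>x. z x = (areal m x - 3 * m) * exp (G x))"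
    using H6[THEN conjunct2] by (elim exE) (rule that)
  note G = G0[THEN conjunct1] G0[THEN conjunct2, THEN spec]
  have Cr: "Cdiff k UNIV (\<lambda>x. - orbit_freq m * ray_speed m x)" for k
    by (rule Cdiff_mult[OF open_UNIV Cdiff_const Cdiff_ray_speed[OF assms(1)]])
  \<comment> \<open>The radial part of the critical phase, normalised to vanish on the photon
    sphere; its smoothness follows from that of \<open>ray_speed\<close>.\<close>
  obtain S0 where S0: "S0 0 = 0" "\<And>x. (S0 has_real_derivative - orbit_freq m * ray_speed m x) (at x)"
    using Cdiff_antiderivative[OF Cr[of 0]] by (elim exE conjE) (rule that; blast)
  have CS0: "Cdiff k UNIV S0" for k
    by (rule Cdiff_SucD[OF Cdiff_real_derivative[OF open_UNIV S0(2) Cr]])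
  interpret wkb m z B S0
    by (rule wkb.intro[OF assms(1) z(1,2) CS0 z(3-6) S0(2,1)])
  obtain \<kappa> where \<kappa>: "\<kappa> > 0" and persist: "\<And>\<tau>. \<tau> \<ge> 0 \<Longrightarrow> \<exists>u. wave_solution m u \<and>
     \<not> energy m \<tau> (\<T> \<inter> Sigma_slice m \<tau>) u \<le> ennreal \<kappa> * energy m 0 (Sigma_slice m 0) u"
    using energy_persists[OF G assms(2,3)] by blast
  have "\<forall>\<^sub>F \<tau> in at_top. P \<tau> < \<kappa> \<and> \<tau> \<ge> 0"
    using order_tendstoD(2)[OF P \<kappa>] eventually_ge_at_top[of 0] by eventually_elim simp
  from eventually_happens'[OF trivial_limit_at_top_linorder this]
  obtain \<tau> where \<tau>: "P \<tau> < \<kappa>" "\<tau> \<ge> 0" by blast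
  obtain u where u: "wave_solution m u"
    "\<not> energy m \<tau> (\<T> \<inter> Sigma_slice m \<tau>) u \<le> ennreal \<kappa> * energy m 0 (Sigma_slice m 0) u"
    using persist[OF \<tau>(2)] by blast
  have "ennreal (P \<tau>) * energy m 0 (Sigma_slice m 0) u \<le> ennreal \<kappa> * energy m 0 (Sigma_slice m 0) u"
    using \<tau> by (intro mult_right_mono ennreal_leI) auto
  from order_trans[OF decay[OF u(1) \<tau>(2)] this] u(2) show False by blast
qed

end
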